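(* Let $\Omega\subset\mathbb{R}^n$ be open, bounded and convex, and let $T\in(0,\infty]$. Let $f\colon[0,T]\times\mathbb{R}^n\to\mathbb{R}$ be such that $\xi\mapsto f(t,\xi)$ is convex for a.e. $t\in[0,T]$ and $t\mapsto f(t,\xi)$ belongs to $L^1(0,\tau)$ for all $\xi\in\mathbb{R}^n$ and all $\tau\in(0,T]\cap\mathbb{R}$. Let $u_o\in W^{1,\infty}(\Omega)$ be such that $u_o|_{\partial\Omega}$ satisfies the bounded slope condition with some constant $Q>0$. Assume moreover that $\xi\mapsto f(t,\xi)$ is in $C^1(\mathbb{R}^n)$ for almost all $t\in(0,T)$ and that for each $L>0$ there exists a constant $M_L>0$ such that $$\sup_{t\in(0,T)}|D_\xi f(t,\xi)|<M_L\quad\text{for all }\xi\in B_L(0),$$ where the supremum is over those $t$ (almost all) for which $f(t,\cdot)\in C^1(\mathbb{R}^n)$. Then the unique variational solution $u$ to the Cauchy-Dirichlet problem associated with $\partial_t u-\operatorname{div}(D_\xi f(t,Du))=0$ and $u_o$ in $\Omega_T$ is a weak solution of this equation in $\Omega_T$. Further, $u\in C^{0;1,1/2}(\overline{\Omega}_T)$.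
   Context: Notation: $\Omega_T:=\Omega\times(0,T)$; $D$ denotes the (weak) gradient in the space variable $x$; $v(t)$ denotes the map $x\mapsto v(x,t)$; $B_L(0)$ is the ball of radius $L$ in $\mathbb{R}^n$. If $T=\infty$, the interval $[0,T]$ is read as $[0,\infty)$. Since $\Omega$ is bounded and convex, $W^{1,\infty}(\Omega)$ is identified with the Lipschitz functions on $\overline\Omega$, so boundary values are well defined. Bounded slope condition: a function $U\colon\partial\Omega\to\mathbb{R}$ satisfies the bounded slope condition with constant $Q>0$ if for every $x_o\in\partial\Omega$ there exist two affine functions $w_{x_o}^\pm\colon\mathbb{R}^n\to\mathbb{R}$ with Lipschitz constants at most $Q$ such that $w_{x_o}^-(x)\le U(x)\le w_{x_o}^+(x)$ for all $x\in\partial\Omega$ and $w_{x_o}^-(x_o)=U(x_o)=w_{x_o}^+(x_o)$. Function classes: $K^\infty(\Omega_T):=\{v\in L^\infty(\Omega_T)\cap C^0([0,T];L^2(\Omega)) : Dv\in L^\infty(\Omega_T,\mathbb{R}^n)\}$ and $K^\infty_{u_o}(\Omega_T):=\{v\in K^\infty(\Omega_T): v=u_o \text{ on } \partial\Omega\times(0,T)\}$ (i.e. $v(t)=u_o$ on $\partial\Omega$ for a.e. $t$). Variational solution: if $T<\infty$, a map $u\in K^\infty_{u_o}(\Omega_T)$ is a variational solution to the Cauchy-Dirichlet problem associated with the equation and $u_o$ in $\Omega_T$ if $$\iint_{\Omega_T} f(t,Du)\,dx\,dt\le\iint_{\Omega_T}\big[\partial_t v\,(v-u)+f(t,Dv)\big]\,dx\,dt+\tfrac12\|v(0)-u_o\|_{L^2(\Omega)}^2-\tfrac12\|(v-u)(T)\|_{L^2(\Omega)}^2$$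 for every $v\in K^\infty_{u_o}(\Omega_T)$ with (weak derivative) $\partial_t v\in L^2(\Omega_T)$. If $T=\infty$, $u\in K^\infty_{u_o}(\Omega_\infty)$ is a variational solution in $\Omega_\infty$ if its restriction to $\Omega_\tau$ is a variational solution in $\Omega_\tau$ for every $\tau\in(0,\infty)$. Under the first set of hypotheses above (before those on $D_\xi f$) a variational solution exists, is unique, and satisfies $\|Du\|_{L^\infty(\Omega_T,\mathbb{R}^n)}\le\max\{Q,\|Du_o\|_{L^\infty(\Omega,\mathbb{R}^n)}\}$. Weak solution: $u$ is a weak solution in $\Omega_T$ if $\iint_{\Omega_T}\big[u\,\partial_t\varphi-D_\xi f(t,Du)\cdot D\varphi\big]\,dx\,dt=0$ for all $\varphi\in C_0^\infty(\Omega_T)$. $C^{0;1,1/2}(\overline{\Omega}_T)$ is the space of functions that are Lipschitz continuous in space and $1/2$-Hölder continuous in time, i.e. (after choosing the continuous representative) there is a constant $C$ with $|u(x,t)-u(y,s)|\le C(|x-y|+|t-s|^{1/2})$ for all $(x,t),(y,s)\in\overline{\Omega_T}$. *)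

theory Defs
  imports "HOL-Analysis.Analysis"
begin

text \<open>
  Elements of Lebesgue and Sobolev spaces are represented by functions; values outside the
  set in question are irrelevant. A space-time function has type \<open>'a \<times> real \<Rightarrow> real\<close>,
  and \<open>v(t)\<close> is \<open>\<lambda>x. v (x, t)\<close>. The end time \<open>T\<close> is an extended real.
\<close>

subsection \<open>Space-time cylinders and Lebesgue spaces\<close>

definition open_time :: "ereal \<Rightarrow> real set" where
  "open_time T = {t. 0 < t \<and> ereal t < T}"

text \<open>For \<open>T = \<infinity>\<close> this is \<open>[0, \<infinity>)\<close>.\<close>

definition closed_time :: "ereal \<Rightarrow> real set" where
  "closed_time T = {t. 0 \<le> t \<and> ereal t \<le> T}"

definition cylinder :: "'a set \<Rightarrow> ereal \<Rightarrow> ('a \<times> real) set" where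
  "cylinder \<Omega> T = \<Omega> \<times> open_time T"

definition Linf :: "'a::euclidean_space set \<Rightarrow> ('a \<Rightarrow> 'b::euclidean_space) set" where
  "Linf S = {g \<in> borel_measurable (lebesgue_on S). \<exists>C. AE x in lebesgue_on S. norm (g x) \<le> C}"

definition L2 :: "'a::euclidean_space set \<Rightarrow> ('a \<Rightarrow> real) set" where
  "L2 S = {g \<in> borel_measurable (lebesgue_on S). integrable (lebesgue_on S) (\<lambda>x. (g x)\<^sup>2)}"

definition norm_L2 :: "'a::euclidean_space set \<Rightarrow> ('a \<Rightarrow> real) \<Rightarrow> real" where
  "norm_L2 S g = sqrt (LINT x|lebesgue_on S. (g x)\<^sup>2)"

definition locally_integrable ::
    "'a::euclidean_space set \<Rightarrow> ('a \<Rightarrow> 'b::euclidean_space) \<Rightarrow> bool" where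
  "locally_integrable U g \<longleftrightarrow> (\<forall>K. compact K \<and> K \<subseteq> U \<longrightarrow> integrable (lebesgue_on K) g)"

text \<open>The space \<open>C\<^sup>0([0,T]; L\<^sup>2(\<Omega>))\<close>, for a representative whose slice at every time is
  the value of the continuous curve; in particular \<open>v(0)\<close> and \<open>v(T)\<close> are meaningful.\<close>

definition C0_L2 :: "'a::euclidean_space set \<Rightarrow> ereal \<Rightarrow> ('a \<times> real \<Rightarrow> real) set" where
  "C0_L2 \<Omega> T = {v. \<forall>t\<in>closed_time T.
      (\<lambda>x. v (x, t)) \<in> L2 \<Omega> \<and>
      ((\<lambda>s. norm_L2 \<Omega> (\<lambda>x. v (x, s) - v (x, t))) \<longlongrightarrow> 0) (at t within closed_time T)}"

subsection \<open>Classical and weak derivatives\<close>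

definition grad :: "('a::euclidean_space \<Rightarrow> real) \<Rightarrow> 'a \<Rightarrow> 'a" where
  "grad g x = (THE d. GDERIV g x :> d)"

definition C1 :: "('a::euclidean_space \<Rightarrow> real) \<Rightarrow> bool" where
  "C1 g \<longleftrightarrow> (\<exists>G. continuous_on UNIV G \<and> (\<forall>x. GDERIV g x :> G x))"

definition space_grad :: "('a::euclidean_space \<times> real \<Rightarrow> real) \<Rightarrow> 'a \<times> real \<Rightarrow> 'a" where
  "space_grad \<phi> = (\<lambda>(x, t). grad (\<lambda>y. \<phi> (y, t)) x)"

definition time_deriv :: "('a::euclidean_space \<times> real \<Rightarrow> real) \<Rightarrow> 'a \<times> real \<Rightarrow> real" where
  "time_deriv \<phi> = (\<lambda>(x, t). deriv (\<lambda>s. \<phi> (x, s)) t)"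

primrec Ck :: "nat \<Rightarrow> ('a::euclidean_space \<Rightarrow> real) \<Rightarrow> bool" where
  "Ck 0 g \<longleftrightarrow> continuous_on UNIV g"
| "Ck (Suc k) g \<longleftrightarrow> (\<forall>x. g differentiable (at x)) \<and>
     (\<forall>h. Ck k (\<lambda>x. frechet_derivative g (at x) h))"

text \<open>Test functions \<open>C\<^sub>0\<^sup>\<infinity>(U)\<close>, extended by zero to the whole space.\<close>

definition test_functions :: "'a::euclidean_space set \<Rightarrow> ('a \<Rightarrow> real) set" where
  "test_functions U = {\<phi>. (\<forall>k. Ck k \<phi>) \<and>
     compact (closure {x. \<phi> x \<noteq> 0}) \<and> closure {x. \<phi> x \<noteq> 0} \<subseteq> U}"

definition has_weak_grad ::
    "('a::euclidean_space \<times> real) set \<Rightarrow> ('a \<times> real \<Rightarrow> real) \<Rightarrow> ('a \<times> real \<Rightarrow> 'a) \<Rightarrow> bool" where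
  "has_weak_grad U v g \<longleftrightarrow> locally_integrable U v \<and> locally_integrable U g \<and>
     (\<forall>\<phi>\<in>test_functions U.
        (LINT p|lebesgue_on U. v p *\<^sub>R space_grad \<phi> p) = - (LINT p|lebesgue_on U. \<phi> p *\<^sub>R g p))"

definition has_weak_dt ::
    "('a::euclidean_space \<times> real) set \<Rightarrow> ('a \<times> real \<Rightarrow> real) \<Rightarrow> ('a \<times> real \<Rightarrow> real) \<Rightarrow> bool" where
  "has_weak_dt U v w \<longleftrightarrow> locally_integrable U v \<and> locally_integrable U w \<and>
     (\<forall>\<phi>\<in>test_functions U.
        (LINT p|lebesgue_on U. v p * time_deriv \<phi> p) = - (LINT p|lebesgue_on U. \<phi> p * w p))"

text \<open>Weak derivatives are unique up to null sets. The following pick one representative, which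
  is meaningful only if a weak derivative exists.\<close>

definition weak_grad ::
    "('a::euclidean_space \<times> real) set \<Rightarrow> ('a \<times> real \<Rightarrow> real) \<Rightarrow> 'a \<times> real \<Rightarrow> 'a" where
  "weak_grad U v = (SOME g. has_weak_grad U v g)"

definition weak_dt ::
    "('a::euclidean_space \<times> real) set \<Rightarrow> ('a \<times> real \<Rightarrow> real) \<Rightarrow> 'a \<times> real \<Rightarrow> real" where
  "weak_dt U v = (SOME w. has_weak_dt U v w)"

subsection \<open>Boundary data and function classes\<close>

text \<open>\<open>W\<^sup>1\<^sup>,\<^sup>\<infinity>(\<Omega>)\<close> for bounded convex \<open>\<Omega>\<close>, identified with the Lipschitz functions on the
  closure of \<open>\<Omega>\<close>.\<close>

definition W1inf :: "'a::euclidean_space set \<Rightarrow> ('a \<Rightarrow> real) set" where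
  "W1inf \<Omega> = {w. \<exists>L. L-lipschitz_on (closure \<Omega>) w}"

definition affine_fun :: "('a::euclidean_space \<Rightarrow> real) \<Rightarrow> bool" where
  "affine_fun w \<longleftrightarrow> (\<exists>a b. \<forall>x. w x = a \<bullet> x + b)"

definition bounded_slope ::
    "'a::euclidean_space set \<Rightarrow> ('a \<Rightarrow> real) \<Rightarrow> real \<Rightarrow> bool" where
  "bounded_slope \<Omega> U Q \<longleftrightarrow> (\<forall>x0\<in>frontier \<Omega>. \<exists>wm wp.
     affine_fun wm \<and> affine_fun wp \<and> Q-lipschitz_on UNIV wm \<and> Q-lipschitz_on UNIV wp \<and>
     (\<forall>x\<in>frontier \<Omega>. wm x \<le> U x \<and> U x \<le> wp x) \<and> wm x0 = U x0 \<and> wp x0 = U x0)"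

definition Kinf :: "'a::euclidean_space set \<Rightarrow> ereal \<Rightarrow> ('a \<times> real \<Rightarrow> real) set" where
  "Kinf \<Omega> T = {v. v \<in> Linf (cylinder \<Omega> T) \<and> v \<in> C0_L2 \<Omega> T \<and>
     (\<exists>g. has_weak_grad (cylinder \<Omega> T) v g \<and> g \<in> Linf (cylinder \<Omega> T))}"

text \<open>The boundary values of \<open>v(t)\<close> are those of its Lipschitz representative.\<close>

definition Kinf_bd ::
    "'a::euclidean_space set \<Rightarrow> ereal \<Rightarrow> ('a \<Rightarrow> real) \<Rightarrow> ('a \<times> real \<Rightarrow> real) set" where
  "Kinf_bd \<Omega> T u0 = {v \<in> Kinf \<Omega> T. AE t in lebesgue_on (open_time T).
     \<exists>w\<in>W1inf \<Omega>. (AE x in lebesgue_on \<Omega>. v (x, t) = w x) \<and> (\<forall>x\<in>frontier \<Omega>. w x = u0 x)}"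

subsection \<open>Notions of solution\<close>

definition variational_solution_finite ::
    "(real \<Rightarrow> 'a::euclidean_space \<Rightarrow> real) \<Rightarrow> 'a set \<Rightarrow> real \<Rightarrow> ('a \<Rightarrow> real)
      \<Rightarrow> ('a \<times> real \<Rightarrow> real) \<Rightarrow> bool" where
  "variational_solution_finite f \<Omega> \<tau> u0 u \<longleftrightarrow>
    (let Q = cylinder \<Omega> (ereal \<tau>) in
     u \<in> Kinf_bd \<Omega> (ereal \<tau>) u0 \<and>
     (\<forall>v\<in>Kinf_bd \<Omega> (ereal \<tau>) u0. (\<exists>w. has_weak_dt Q v w \<and> w \<in> L2 Q) \<longrightarrow>
        (LINT p|lebesgue_on Q. f (snd p) (weak_grad Q u p))
        \<le> (LINT p|lebesgue_on Q. weak_dt Q v p * (v p - u p) + f (snd p) (weak_grad Q v p))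
          + 1/2 * (norm_L2 \<Omega> (\<lambda>x. v (x, 0) - u0 x))\<^sup>2
          - 1/2 * (norm_L2 \<Omega> (\<lambda>x. v (x, \<tau>) - u (x, \<tau>)))\<^sup>2))"

definition variational_solution ::
    "(real \<Rightarrow> 'a::euclidean_space \<Rightarrow> real) \<Rightarrow> 'a set \<Rightarrow> ereal \<Rightarrow> ('a \<Rightarrow> real)
      \<Rightarrow> ('a \<times> real \<Rightarrow> real) \<Rightarrow> bool" where
  "variational_solution f \<Omega> T u0 u \<longleftrightarrow>
    (if T = \<infinity>
     then u \<in> Kinf_bd \<Omega> \<infinity> u0 \<and> (\<forall>\<tau>>0. variational_solution_finite f \<Omega> \<tau> u0 u)
     else variational_solution_finite f \<Omega> (real_of_ereal T) u0 u)"

definition weak_solution ::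
    "(real \<Rightarrow> 'a::euclidean_space \<Rightarrow> real) \<Rightarrow> 'a set \<Rightarrow> ereal \<Rightarrow> ('a \<times> real \<Rightarrow> real) \<Rightarrow> bool" where
  "weak_solution f \<Omega> T u \<longleftrightarrow>
    (let Q = cylinder \<Omega> T in
     \<forall>\<phi>\<in>test_functions Q.
       (LINT p|lebesgue_on Q.
          u p * time_deriv \<phi> p - grad (f (snd p)) (weak_grad Q u p) \<bullet> space_grad \<phi> p) = 0)"

text \<open>Lipschitz in space and \<open>1/2\<close>-Hoelder in time up to the boundary, after modification on a
  null set.\<close>

definition C_0_1_half :: "'a::euclidean_space set \<Rightarrow> ereal \<Rightarrow> ('a \<times> real \<Rightarrow> real) set" where
  "C_0_1_half \<Omega> T = {u. \<exists>w. (AE p in lebesgue_on (cylinder \<Omega> T). u p = w p) \<and>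
     (\<exists>C. \<forall>(x, t)\<in>closure (cylinder \<Omega> T). \<forall>(y, s)\<in>closure (cylinder \<Omega> T).
        \<bar>w (x, t) - w (y, s)\<bar> \<le> C * (norm (x - y) + sqrt \<bar>t - s\<bar>))}"

end

theory Submission imports Defs begin

text \<open>
  The solution \<open>u\<close> has a bounded representative \<open>U\<close> that is continuous in space-time, Lipschitz in
  space and equal to \<open>u0\<close> on the lateral boundary. If \<open>V\<close> solves \<open>h \<partial>\<^sub>t V = U - V\<close> and \<open>\<psi>\<close> is smooth,
  compactly supported in \<open>\<Omega>\<close> and zero near the end time, then \<open>V + \<psi>\<close> is an admissible competitor,
  because \<open>V\<close> inherits the bounds and the boundary values of \<open>U\<close>. As \<open>\<partial>\<^sub>t V (V - U) \<le> 0\<close>, the limit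
  \<open>h \<rightarrow> 0\<close> of the variational inequality bounds \<open>\<integral>\<integral> f(t, Du)\<close> by
  \<open>\<integral>\<integral> f(t, Du + D\<psi>) - \<integral>\<integral> U \<partial>\<^sub>t \<psi> + \<integral> (U(0) - u0)\<^sup>2 / 2 - \<integral> u0 \<psi>(0)\<close>. Functions \<open>\<psi>\<close> concentrated
  near the initial time show \<open>U(0) = u0\<close>. With \<open>\<psi> = s \<phi>\<close>, division by \<open>s\<close> and \<open>s \<rightarrow> 0\<close> from both sides,
  the inequality becomes the weak equation.

  Tested with \<open>\<zeta>(x) \<eta>(t)\<close>, the weak equation says that \<open>\<integral> \<zeta> U(t)\<close> is Lipschitz in time with constant
  \<open>M \<integral> |D\<zeta>|\<close>. If \<open>\<zeta>\<close> is a bump of radius \<open>r\<close> around \<open>x\<close>, this and the Lipschitz bound in space give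
  \<open>|U(x, t) - U(x, s)| \<le> 2 L r + K |t - s| / r\<close>, and \<open>r = |t - s|\<^sup>1\<^sup>/\<^sup>2\<close> is the claim. Where the ball
  leaves \<open>\<Omega>\<close>, a boundary point at distance at most \<open>r\<close>, at which \<open>U\<close> is constant in time, replaces the bump.
\<close>

subsection \<open>Smooth functions and test functions\<close>

text \<open>The obstacle is that \<open>u\<close> cannot be inserted into its own inequality: it is
  not known to have a time derivative in L2. Smoothing in space would spoil the boundary values;
  averaging in time alone keeps them. Since \<open>V\<close> starts from a mean of \<open>U\<close>
  and not from \<open>u0\<close>, it is a plain weighted mean of \<open>U\<close>, with nonnegative
  weights of mass one, so its bounds, boundary values and gradient come from \<open>U\<close> alone.
  The price is the term with \<open>U(0) - u0\<close>, which is why the initial values need an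
  argument of their own. Averaging does not commute with \<open>f\<close>; the limit in the gradient
  term rests on L1 convergence of the averaged gradients and on a Lipschitz bound for
  \<open>f(t, .)\<close> on balls, uniform in \<open>t\<close>.

  Weak derivatives are picked by choice, and the boundary condition holds only at almost every time.
  The fundamental lemma and the passage from almost every time to every time therefore precede the
  variational argument. The estimates are made on finite time intervals, and the constant of the
  final Hoelder bound does not depend on their length.\<close>

definition smooth :: "('a::euclidean_space \<Rightarrow> real) \<Rightarrow> bool" where
  "smooth g \<longleftrightarrow> (\<forall>k. Ck k g)"

lemma Ck_SucI:
  assumes "\<And>x. (g has_derivative g' x) (at x)" and "\<And>h. Ck k (\<lambda>x. g' x h)"
  shows "Ck (Suc k) g"
proof -
  have "frechet_derivative g (at x) = g' x" for x
    using frechet_derivative_at[OF assms(1)] by simp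
  then show ?thesis using assms by (auto simp: differentiable_def)
qed

lemma Ck_continuous: "Ck k g \<Longrightarrow> continuous_on UNIV g"
  by (cases k) (auto intro!: differentiable_imp_continuous_on
      simp: differentiable_on_def differentiable_at_withinI)

lemma Ck_SucD: "Ck (Suc k) g \<Longrightarrow> Ck k g"
proof (induction k arbitrary: g)
  case 0
  then show ?case using Ck_continuous by fastforce
qed auto

lemma Ck_const: "Ck k (\<lambda>x. c)"
proof (induction k arbitrary: c)
  case (Suc k)
  show ?case by (rule Ck_SucI[where g'="\<lambda>_ _. 0", OF has_derivative_const Suc])
qed simp

lemma Ck_bounded_linear: "bounded_linear g \<Longrightarrow> Ck k g"
proof (cases k)
  case 0
  then show "bounded_linear g \<Longrightarrow> Ck k g"
    by (simp add: linear_continuous_on)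
next
  case (Suc n)
  then show "bounded_linear g \<Longrightarrow> Ck k g"
    using Ck_SucI[of g "\<lambda>_. g" n] by (metis Ck_const bounded_linear_imp_has_derivative)
qed

lemma Ck_add: "Ck k f \<Longrightarrow> Ck k g \<Longrightarrow> Ck k (\<lambda>x. f x + g x)"
proof (induction k arbitrary: f g)
  case 0
  then show ?case by (simp add: continuous_on_add continuous_on_mult)
next
  case (Suc k)
  show ?case
  proof (rule Ck_SucI)
    show "((\<lambda>x. f x + g x) has_derivative
       (\<lambda>h. frechet_derivative f (at x) h + frechet_derivative g (at x) h)) (at x)" for x
      using Suc.prems by (intro has_derivative_add) (auto simp: frechet_derivative_works)
    show "Ck k (\<lambda>x. frechet_derivative f (at x) h + frechet_derivative g (at x) h)" for h
      using Suc.prems by (intro Suc.IH) auto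
  qed
qed

lemma Ck_mult: "Ck k f \<Longrightarrow> Ck k g \<Longrightarrow> Ck k (\<lambda>x. f x * g x)"
proof (induction k arbitrary: f g)
  case 0
  then show ?case by (simp add: continuous_on_add continuous_on_mult)
next
  case (Suc k)
  show ?case
  proof (rule Ck_SucI)
    show "((\<lambda>x. f x * g x) has_derivative
       (\<lambda>h. f x * frechet_derivative g (at x) h + frechet_derivative f (at x) h * g x)) (at x)" for x
      using Suc.prems by (intro has_derivative_mult) (auto simp: frechet_derivative_works)
    show "Ck k (\<lambda>x. f x * frechet_derivative g (at x) h + frechet_derivative f (at x) h * g x)" for h
      using Suc.prems Ck_SucD[OF Suc.prems(1)] Ck_SucD[OF Suc.prems(2)] by (intro Ck_add Suc.IH) auto
  qed
qed

lemma Ck_affine: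
  assumes "bounded_linear A"
  shows "Ck k g \<Longrightarrow> Ck k (\<lambda>x. g (A x + b))"
proof (induction k arbitrary: g)
  case 0
  then show ?case
    using continuous_on_compose2[of UNIV g UNIV "\<lambda>x. A x + b"] linear_continuous_on[OF assms]
    by (simp add: continuous_on_add)
next
  case (Suc k)
  show ?case
  proof (rule Ck_SucI)
    show "((\<lambda>x. g (A x + b)) has_derivative (\<lambda>h. frechet_derivative g (at (A x + b)) (A h))) (at x)" for x
    proof (rule has_derivative_compose[of "\<lambda>x. A x + b" A _ _ g])
      show "((\<lambda>x. A x + b) has_derivative A) (at x)"
        using assms by (auto intro!: derivative_eq_intros bounded_linear_imp_has_derivative)
      show "(g has_derivative frechet_derivative g (at (A x + b))) (at (A x + b))"
        using Suc.prems by (auto simp: frechet_derivative_works)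
    qed
    show "Ck k (\<lambda>x. frechet_derivative g (at (A x + b)) (A h))" for h
      using Suc.IH[of "\<lambda>x. frechet_derivative g (at x) (A h)"] Suc.prems by auto
  qed
qed

text \<open>The powers of \<open>1 / t\<close> make the family closed under differentiation up to linear
  combinations, so that smoothness follows by induction on the order.\<close>

definition exp_bump :: "nat \<Rightarrow> real \<Rightarrow> real" where
  "exp_bump j t = (if t > 0 then (1 / t) ^ j * exp (- (1 / t)) else 0)"

lemma exp_ge_power_fact: "0 \<le> (y::real) \<Longrightarrow> y ^ n / fact n \<le> exp y"
proof -
  assume y: "0 \<le> y"
  have "(\<Sum>i\<in>{n}. y ^ i /\<^sub>R fact i) \<le> (\<Sum>i. y ^ i /\<^sub>R fact i)"
    by (rule sum_le_suminf) (use y in \<open>auto simp: summable_exp_generic intro!: scaleR_nonneg_nonneg simp del: real_scaleR_def\<close>)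
  then show ?thesis by (simp add: exp_def divide_inverse mult.commute)
qed

text \<open>Comparing exp(1/t) with the term of order \<open>j + 2\<close> of its series leaves a
  factor \<open>t^2\<close>. This quadratic decay makes the derivative at the origin vanish.\<close>

lemma exp_bump_le: "\<bar>exp_bump j t\<bar> \<le> fact (j + 2) * t\<^sup>2"
proof (cases "t > 0")
  case True
  define y where "y = 1 / t"
  have y: "y > 0" using True by (simp add: y_def)
  have "y ^ (j + 2) / fact (j + 2) \<le> exp y" by (rule exp_ge_power_fact) (use y in simp)
  then have "y ^ (j + 2) \<le> fact (j + 2) * exp y" by (simp only: pos_divide_le_eq fact_gt_zero mult.commute)
  then have "y ^ (j + 2) * exp (- y) \<le> fact (j + 2) * exp y * exp (- y)"
    by (rule mult_right_mono) simp
  then have "y ^ j * y ^ 2 * exp (- y) \<le> fact (j + 2)"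
    by (simp only: power_add mult.assoc exp_minus_inverse mult_1_right)
  then have "y ^ j * exp (- y) \<le> fact (j + 2) / y ^ 2"
    using y by (simp add: pos_le_divide_eq mult_ac del: fact_Suc)
  then show ?thesis using True by (simp add: exp_bump_def y_def power_divide abs_mult)
qed (simp add: exp_bump_def)

text \<open>With y = 1/t one has y' = -y^2, so differentiating y^j exp(-y) raises the power by two
  or by one. The formula persists at t = 0, where all members of the family vanish.\<close>

lemma exp_bump_deriv:
  "(exp_bump j has_real_derivative (exp_bump (j + 2) t - real j * exp_bump (j + 1) t)) (at t)"
proof -
  consider "t > 0" | "t < 0" | "t = 0" by linarith
  then show ?thesis
  proof cases
    case 1
    have "((\<lambda>t. (1 / t) ^ j * exp (- (1 / t))) has_real_derivative
            (exp_bump (j + 2) t - real j * exp_bump (j + 1) t)) (at t)"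
    proof -
      define y where "y = 1 / t"
      have "((\<lambda>t. 1 / t) has_real_derivative - (y ^ 2)) (at t)"
        using 1 by (auto intro!: derivative_eq_intros simp: y_def power2_eq_square)
      moreover have "((\<lambda>y. y ^ j * exp (- y)) has_real_derivative
          real j * y ^ (j - 1) * exp (- y) - y ^ j * exp (- y)) (at (1 / t))"
        unfolding y_def[symmetric] by (auto intro!: derivative_eq_intros)
      ultimately have "((\<lambda>t. (1 / t) ^ j * exp (- (1 / t))) has_real_derivative
          (real j * y ^ (j - 1) * exp (- y) - y ^ j * exp (- y)) * - (y ^ 2)) (at t)"
        by (rule DERIV_chain2[rotated])
      moreover have "(real j * y ^ (j - 1) * exp (- y) - y ^ j * exp (- y)) * - (y ^ 2)
          = exp_bump (j + 2) t - real j * exp_bump (j + 1) t"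
        using 1 by (cases j) (simp_all add: exp_bump_def y_def[symmetric] algebra_simps power2_eq_square)
      ultimately show ?thesis by simp
    qed
    moreover have "\<forall>\<^sub>F s in nhds t. exp_bump j s = (1 / s) ^ j * exp (- (1 / s))"
      using eventually_nhds_in_open[of "{0<..}" t] 1
      by (auto elim!: eventually_mono simp: exp_bump_def)
    ultimately show ?thesis
      using DERIV_cong_ev[of t t "exp_bump j" "\<lambda>s. (1 / s) ^ j * exp (- (1 / s))", OF refl _ refl] by simp
  next
    case 2
    have "\<forall>\<^sub>F s in nhds t. exp_bump j s = 0"
      using eventually_nhds_in_open[of "{..<0}" t] 2
      by (auto elim!: eventually_mono simp: exp_bump_def)
    then have "(exp_bump j has_real_derivative 0) (at t)"
      using DERIV_cong_ev[of t t "exp_bump j" "\<lambda>_. 0" 0 0] by simp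
    moreover have "exp_bump (j + 2) t - real j * exp_bump (j + 1) t = 0"
      using 2 by (simp add: exp_bump_def)
    ultimately show ?thesis by (simp only:)
  next
    case 3
    have "((\<lambda>h. exp_bump j h / h) \<longlongrightarrow> 0) (at 0)"
    proof (rule tendsto_rabs_zero_cancel, rule tendsto_sandwich[where f="\<lambda>_. 0" and h="\<lambda>h. fact (j + 2) * \<bar>h\<bar>"])
      have "\<bar>exp_bump j h / h\<bar> \<le> fact (j + 2) * \<bar>h\<bar>" if "h \<noteq> 0" for h
      proof -
        have gen: "a \<noteq> 0 \<Longrightarrow> c * (a * a) / a = c * a" for a c :: real by simp
        have "\<bar>exp_bump j h / h\<bar> = \<bar>exp_bump j h\<bar> / \<bar>h\<bar>" by (rule abs_divide)
        also have "\<dots> \<le> fact (j + 2) * h\<^sup>2 / \<bar>h\<bar>" by (intro divide_right_mono exp_bump_le) simp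
        also have "h\<^sup>2 = \<bar>h\<bar> * \<bar>h\<bar>" by (simp add: power2_eq_square)
        also have "fact (j + 2) * (\<bar>h\<bar> * \<bar>h\<bar>) / \<bar>h\<bar> = fact (j + 2) * \<bar>h\<bar>"
          by (rule gen) (use that in simp)
        finally show ?thesis .
      qed
      then show "\<forall>\<^sub>F h in at 0. \<bar>exp_bump j h / h\<bar> \<le> fact (j + 2) * \<bar>h\<bar>"
        by (auto simp: eventually_at intro: exI[of _ 1])
      show "((\<lambda>h::real. fact (j + 2) * \<bar>h\<bar>) \<longlongrightarrow> 0) (at 0)"
        by (auto intro!: tendsto_eq_intros)
    qed auto
    then show ?thesis using 3 by (simp add: DERIV_def exp_bump_def)
  qed
qed

text \<open>The induction on the order runs over all \<open>j\<close> at once, since a derivative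
  shifts \<open>j\<close>. The derivative of \<open>q\<close> enters as a factor, so
  \<open>q\<close> is needed at every order.\<close>

lemma Ck_exp_bump:
  assumes "\<And>k. Ck k q"
  shows "Ck k (\<lambda>x. exp_bump j (q x))"
proof (induction k arbitrary: j)
  case 0
  have "continuous_on UNIV (exp_bump j)"
    using exp_bump_deriv by (auto intro!: continuous_at_imp_continuous_on DERIV_isCont)
  then show ?case using assms[of 0] by (auto intro: continuous_on_compose2)
next
  case (Suc k)
  show ?case
  proof (rule Ck_SucI)
    show "((\<lambda>x. exp_bump j (q x)) has_derivative (\<lambda>h. (exp_bump (j + 2) (q x) + (- real j) * exp_bump (j + 1) (q x))
        * frechet_derivative q (at x) h)) (at x)" for x
    proof (rule has_derivative_compose[of q _ _ _ "exp_bump j", THEN has_derivative_eq_rhs])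
      show "(q has_derivative frechet_derivative q (at x)) (at x)"
        using assms[of "Suc 0"] by (auto simp: frechet_derivative_works)
      show "(exp_bump j has_derivative (\<lambda>h. h * (exp_bump (j + 2) (q x) - real j * exp_bump (j + 1) (q x)))) (at (q x))"
        using exp_bump_deriv[of j "q x"] by (simp add: has_field_derivative_def mult_commute_abs)
    qed (auto simp: algebra_simps)
    show "Ck k (\<lambda>x. (exp_bump (j + 2) (q x) + (- real j) * exp_bump (j + 1) (q x)) * frechet_derivative q (at x) h)" for h
      using assms[of "Suc k"] by (intro Ck_mult Ck_add Ck_const Suc) auto
  qed
qed

lemma smooth_const: "smooth (\<lambda>x. c)"
  and smooth_bounded_linear: "bounded_linear g \<Longrightarrow> smooth g"
  and smooth_add: "smooth g1 \<Longrightarrow> smooth g2 \<Longrightarrow> smooth (\<lambda>x. g1 x + g2 x)"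
  and smooth_mult: "smooth g1 \<Longrightarrow> smooth g2 \<Longrightarrow> smooth (\<lambda>x. g1 x * g2 x)"
  by (auto simp: smooth_def Ck_const Ck_bounded_linear Ck_add Ck_mult)

lemma smooth_diff: "smooth g1 \<Longrightarrow> smooth g2 \<Longrightarrow> smooth (\<lambda>x. g1 x - g2 x)"
  using smooth_add[of g1 "\<lambda>x. (-1) * g2 x"] smooth_mult[OF smooth_const[of "-1"], of g2] by simp

lemma smooth_power: "smooth g \<Longrightarrow> smooth (\<lambda>x. g x ^ n)"
  by (induction n) (auto intro: smooth_const smooth_mult)

lemma smooth_sum: "(\<And>i. i \<in> I \<Longrightarrow> smooth (g i)) \<Longrightarrow> smooth (\<lambda>x. \<Sum>i\<in>I. g i x)"
  by (induction I rule: infinite_finite_induct) (auto intro: smooth_const smooth_add)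

lemma smooth_affine: "smooth g \<Longrightarrow> bounded_linear A \<Longrightarrow> smooth (\<lambda>x. g (A x + b))"
  by (auto simp: smooth_def Ck_affine)

lemma smooth_exp_bump: "smooth q \<Longrightarrow> smooth (\<lambda>x. exp_bump j (q x))"
  by (auto simp: smooth_def Ck_exp_bump)

lemma smooth_continuous: "smooth g \<Longrightarrow> continuous_on S g"
  using Ck_continuous continuous_on_subset unfolding smooth_def by blast

lemma smooth_deriv:
  assumes "smooth g"
  shows "(g has_derivative frechet_derivative g (at x)) (at x)"
    and "smooth (\<lambda>x. frechet_derivative g (at x) h)"
proof -
  have "Ck (Suc k) g" for k using assms by (auto simp: smooth_def simp del: Ck.simps)
  then show "(g has_derivative frechet_derivative g (at x)) (at x)"
    and "smooth (\<lambda>x. frechet_derivative g (at x) h)"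
    by (auto simp: smooth_def frechet_derivative_works)
qed

lemma smooth_norm_sq: "smooth (\<lambda>x::'a::euclidean_space. (norm (x - c))\<^sup>2)"
proof -
  have eq: "(norm (x - c))\<^sup>2 = (\<Sum>b\<in>Basis. ((x \<bullet> b - c \<bullet> b))^2)" for x
    by (subst power2_norm_eq_inner, subst euclidean_inner) (simp add: power2_eq_square inner_diff_left)
  show ?thesis unfolding eq
    by (intro smooth_sum smooth_power smooth_diff smooth_const smooth_bounded_linear bounded_linear_inner_left)
qed

section \<open>Bump functions and test functions\<close>

text \<open>The standard mollifier exp(-1/(r^2 - |x - c|^2)), not normalised. The squared distance
  is a polynomial in the coordinates, so the centre needs no separate argument.\<close>

definition bump :: "'a::euclidean_space \<Rightarrow> real \<Rightarrow> 'a \<Rightarrow> real" where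
  "bump c r x = exp_bump 0 (r\<^sup>2 - (norm (x - c))\<^sup>2)"

lemma smooth_bump: "smooth (bump c r)"
  unfolding bump_def[abs_def] by (intro smooth_exp_bump smooth_diff smooth_const smooth_norm_sq)

lemma abs_less_square_iff: "0 \<le> a \<Longrightarrow> 0 < r \<Longrightarrow> a\<^sup>2 < r\<^sup>2 \<longleftrightarrow> a < (r::real)"
  by (meson linorder_not_less order_less_imp_le power_less_imp_less_base power_mono power_strict_mono zero_less_numeral)

lemma bump_nonneg: "0 \<le> bump c r x" and bump_le_1: "bump c r x \<le> 1"
  by (auto simp: bump_def exp_bump_def)

lemma bump_pos_iff: "0 < r \<Longrightarrow> 0 < bump c r x \<longleftrightarrow> x \<in> ball c r"
  using abs_less_square_iff[of "norm (x - c)" r]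
  by (simp add: bump_def exp_bump_def dist_norm norm_minus_commute)

lemma bump_eq_0_iff: "0 < r \<Longrightarrow> bump c r x = 0 \<longleftrightarrow> x \<notin> ball c r"
  using bump_pos_iff[of r c x] bump_nonneg[of c r x] by auto

text \<open>Any compact set off which the function vanishes will do, so the closure of the support
  never has to be computed.\<close>

lemma test_functionsI:
  assumes "smooth \<phi>" "compact K" "K \<subseteq> U" "\<And>x. x \<notin> K \<Longrightarrow> \<phi> x = 0"
  shows "\<phi> \<in> test_functions U"
proof -
  have "closure {x. \<phi> x \<noteq> 0} \<subseteq> K"
    using assms by (intro closure_minimal compact_imp_closed) auto
  then show ?thesis
    using assms compact_Int_closed[of K "closure {x. \<phi> x \<noteq> 0}"]
    by (auto simp: test_functions_def smooth_def inf.absorb2)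
qed

lemma test_functionsE:
  assumes "\<phi> \<in> test_functions U"
  obtains K where "smooth \<phi>" "compact K" "K \<subseteq> U" "\<And>x. x \<notin> K \<Longrightarrow> \<phi> x = 0"
proof
  show "smooth \<phi>" "compact (closure {x. \<phi> x \<noteq> 0})" "closure {x. \<phi> x \<noteq> 0} \<subseteq> U"
    using assms by (auto simp: test_functions_def smooth_def)
  show "\<phi> x = 0" if "x \<notin> closure {x. \<phi> x \<noteq> 0}" for x
    using that closure_subset[of "{x. \<phi> x \<noteq> 0}"] by auto
qed

lemma test_functions_smooth: "\<phi> \<in> test_functions U \<Longrightarrow> smooth \<phi>"
  by (auto simp: test_functions_def smooth_def)

lemma test_functions_outside: "\<phi> \<in> test_functions U \<Longrightarrow> x \<notin> U \<Longrightarrow> \<phi> x = 0"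
  by (metis subsetD test_functionsE)

lemma test_functions_mono: "\<phi> \<in> test_functions U \<Longrightarrow> U \<subseteq> V \<Longrightarrow> \<phi> \<in> test_functions V"
  by (auto simp: test_functions_def)

lemma test_functions_mult:
  assumes "\<phi> \<in> test_functions U" "smooth g"
  shows "(\<lambda>x. g x * \<phi> x) \<in> test_functions U"
  using assms(1)
proof (rule test_functionsE)
  fix K assume "smooth \<phi>" "compact K" "K \<subseteq> U" "\<And>x. x \<notin> K \<Longrightarrow> \<phi> x = 0"
  then show ?thesis using assms(2) by (intro test_functionsI[of _ K] smooth_mult) auto
qed

lemma bump_test:
  assumes "0 < r" "cball c r \<subseteq> U"
  shows "bump c r \<in> test_functions U"
  using assms by (intro test_functionsI[of _ "cball c r"]) (auto simp: smooth_bump bump_eq_0_iff)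

lemma zero_off_closed_deriv:
  assumes "closed K" "\<And>x. x \<notin> K \<Longrightarrow> \<phi> x = 0" "x \<notin> K"
  shows "(\<phi> has_derivative (\<lambda>_. 0)) (at x)"
  by (rule has_derivative_transform_within_open[of "\<lambda>_. 0" _ _ UNIV "- K"]) (use assms in \<open>auto simp: open_Compl\<close>)

lemma test_functions_deriv:
  assumes "\<phi> \<in> test_functions U"
  shows "(\<lambda>x. frechet_derivative \<phi> (at x) h) \<in> test_functions U"
  using assms
proof (rule test_functionsE)
  fix K assume K: "smooth \<phi>" "compact K" "K \<subseteq> U" "\<And>x. x \<notin> K \<Longrightarrow> \<phi> x = 0"
  have "frechet_derivative \<phi> (at x) h = 0" if "x \<notin> K" for x
    using frechet_derivative_at[OF zero_off_closed_deriv[OF compact_imp_closed[OF K(2)] K(4) that], symmetric]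
    by (simp add: fun_eq_iff)
  then show ?thesis using K smooth_deriv(2) by (intro test_functionsI[of _ K]) auto
qed

lemma test_functions_bounded:
  assumes "\<phi> \<in> test_functions U"
  obtains B where "0 < B" "\<And>x. \<bar>\<phi> x\<bar> \<le> B"
  using assms
proof (rule test_functionsE)
  fix K assume K: "smooth \<phi>" "compact K" "K \<subseteq> U" "\<And>x. x \<notin> K \<Longrightarrow> \<phi> x = 0"
  have "compact (\<phi> ` K)"
    using K smooth_continuous by (intro compact_continuous_image) auto
  then obtain B where "0 < B" "\<And>x. x \<in> K \<Longrightarrow> \<bar>\<phi> x\<bar> \<le> B"
    by (auto dest!: compact_imp_bounded simp: bounded_pos)
  then have "\<bar>\<phi> x\<bar> \<le> B" for x using K(4) by (cases "x \<in> K") auto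
  with \<open>0 < B\<close> show ?thesis using that by blast
qed

section \<open>Classical derivatives in space and time\<close>

lemma GDERIV_unique: "GDERIV g x :> d \<Longrightarrow> GDERIV g x :> d' \<Longrightarrow> d = d'"
proof -
  assume "GDERIV g x :> d" "GDERIV g x :> d'"
  then have "(\<lambda>h. h \<bullet> d) = (\<lambda>h. h \<bullet> d')"
    unfolding gderiv_def by (rule has_derivative_unique)
  then have "h \<bullet> d = h \<bullet> d'" for h by (rule fun_cong)
  then show ?thesis using vector_eq_ldot by blast
qed

lemma grad_eqI: "GDERIV g x :> d \<Longrightarrow> grad g x = d"
  unfolding grad_def using GDERIV_unique by blast

lemma has_derivative_GDERIV:
  fixes g :: "'a::euclidean_space \<Rightarrow> real"
  assumes "(g has_derivative g') (at x)"
  shows "GDERIV g x :> (\<Sum>b\<in>Basis. g' b *\<^sub>R b)"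
proof -
  have lin: "linear g'" using assms has_derivative_linear by blast
  have "g' h = h \<bullet> (\<Sum>b\<in>Basis. g' b *\<^sub>R b)" for h
    by (subst euclidean_representation[symmetric, of h], subst linear_sum[OF lin])
       (simp add: linear_scale[OF lin] inner_sum_right mult.commute)
  then have "g' = (\<lambda>h. h \<bullet> (\<Sum>b\<in>Basis. g' b *\<^sub>R b))" by (rule ext)
  then show ?thesis using assms unfolding gderiv_def by simp
qed

text \<open>The gradient, defined by a description operator, is traded for the Frechet derivative in
  direction \<open>(h, 0)\<close>, from which smoothness, supports, bounds and product rules are
  then taken.\<close>

lemma space_grad_inner:
  fixes \<phi> :: "'a::euclidean_space \<times> real \<Rightarrow> real"
  assumes "smooth \<phi>"
  shows "space_grad \<phi> p \<bullet> h = frechet_derivative \<phi> (at p) (h, 0)"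
proof -
  obtain x t where p: "p = (x, t)" by force
  have d: "((\<lambda>y. \<phi> (y, t)) has_derivative (\<lambda>h. frechet_derivative \<phi> (at (x, t)) (h, 0))) (at x)"
  proof (rule has_derivative_compose[OF _ smooth_deriv(1)[OF assms]])
    show "((\<lambda>y. (y, t)) has_derivative (\<lambda>h. (h, 0))) (at x)"
      by (intro has_derivative_Pair has_derivative_ident has_derivative_const)
  qed
  from has_derivative_GDERIV[OF this]
  have "GDERIV (\<lambda>y. \<phi> (y, t)) x :> space_grad \<phi> p"
    using grad_eqI by (simp add: space_grad_def p grad_eqI)
  then have "(\<lambda>h. h \<bullet> space_grad \<phi> p) = (\<lambda>h. frechet_derivative \<phi> (at (x, t)) (h, 0))"
    unfolding gderiv_def using d by (rule has_derivative_unique)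
  then have "h \<bullet> space_grad \<phi> p = frechet_derivative \<phi> (at (x, t)) (h, 0)" by (rule fun_cong)
  then show ?thesis by (simp add: p inner_commute)
qed

lemma time_deriv_eq:
  fixes \<phi> :: "'a::euclidean_space \<times> real \<Rightarrow> real"
  assumes "smooth \<phi>"
  shows "((\<lambda>s. \<phi> (x, s)) has_real_derivative time_deriv \<phi> (x, t)) (at t)"
    and "time_deriv \<phi> p = frechet_derivative \<phi> (at p) (0, 1)"
proof -
  have d: "((\<lambda>s. \<phi> (x, s)) has_real_derivative frechet_derivative \<phi> (at (x, t)) (0, 1)) (at t)" for x t
  proof -
    have "((\<lambda>s. \<phi> (x, s)) has_derivative (\<lambda>h. frechet_derivative \<phi> (at (x, t)) (0, h))) (at t)"
    proof (rule has_derivative_compose[OF _ smooth_deriv(1)[OF assms]])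
      show "((\<lambda>s. (x, s)) has_derivative (\<lambda>h. (0, h))) (at t)"
        by (intro has_derivative_Pair has_derivative_ident has_derivative_const)
    qed
    moreover have "h * frechet_derivative \<phi> (at (x, t)) (0, 1) = frechet_derivative \<phi> (at (x, t)) (0, h)" for h
      using linear_scale[OF has_derivative_linear[OF smooth_deriv(1)[OF assms, of "(x, t)"]], of h "(0, 1)"] by simp
    ultimately show ?thesis
      by (rule has_derivative_imp_has_field_derivative)
  qed
  show "time_deriv \<phi> p = frechet_derivative \<phi> (at p) (0, 1)"
    using DERIV_imp_deriv[OF d] by (cases p) (simp add: time_deriv_def)
  with d show "((\<lambda>s. \<phi> (x, s)) has_real_derivative time_deriv \<phi> (x, t)) (at t)"
    by (simp add: time_deriv_def DERIV_imp_deriv[OF d])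
qed

lemma time_deriv_eq': "smooth \<phi> \<Longrightarrow> time_deriv \<phi> = (\<lambda>p. frechet_derivative \<phi> (at p) (0, 1))"
  by (rule ext) (rule time_deriv_eq(2))

lemma smooth_time_deriv: "smooth \<phi> \<Longrightarrow> smooth (time_deriv \<phi>)"
  using smooth_deriv(2)[of \<phi> "(0, 1)"] time_deriv_eq'[of \<phi>] by simp

lemma smooth_space_grad_inner: "smooth \<phi> \<Longrightarrow> smooth (\<lambda>p. space_grad \<phi> p \<bullet> h)"
  using smooth_deriv(2) by (simp add: space_grad_inner)

lemma time_deriv_test: "\<phi> \<in> test_functions U \<Longrightarrow> time_deriv \<phi> \<in> test_functions U"
  using test_functions_deriv[of \<phi> U "(0, 1)"] test_functions_smooth[of \<phi> U]
  by (simp add: time_deriv_eq')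

lemma space_grad_test: "\<phi> \<in> test_functions U \<Longrightarrow> (\<lambda>p. space_grad \<phi> p \<bullet> h) \<in> test_functions U"
  using test_functions_deriv[of \<phi> U "(h, 0)"] test_functions_smooth[of \<phi> U]
  by (simp add: space_grad_inner)

lemma continuous_space_grad:
  fixes \<phi> :: "'a::euclidean_space \<times> real \<Rightarrow> real"
  assumes "smooth \<phi>"
  shows "continuous_on S (space_grad \<phi>)"
  using smooth_continuous[OF smooth_space_grad_inner[OF assms]]
  by (subst continuous_on_componentwise) auto

lemma space_grad_bounded:
  fixes \<phi> :: "'a::euclidean_space \<times> real \<Rightarrow> real"
  assumes "\<phi> \<in> test_functions U"
  obtains B where "0 < B" "\<And>p. norm (space_grad \<phi> p) \<le> B"
proof -
  have "\<forall>b\<in>Basis. \<exists>B>0. \<forall>p. \<bar>space_grad \<phi> p \<bullet> b\<bar> \<le> B"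
    using space_grad_test[OF assms] test_functions_bounded by metis
  then obtain B where B: "\<And>b p. b \<in> Basis \<Longrightarrow> 0 < B b \<and> \<bar>space_grad \<phi> p \<bullet> b\<bar> \<le> B b" by metis
  show ?thesis
  proof (rule that[of "1 + sum B Basis"])
    show "0 < 1 + sum B Basis" using B by (intro add_pos_nonneg sum_nonneg) (auto intro: less_imp_le)
    show "norm (space_grad \<phi> p) \<le> 1 + sum B Basis" for p
      using norm_le_l1[of "space_grad \<phi> p"] B sum_mono[of Basis "\<lambda>b. \<bar>space_grad \<phi> p \<bullet> b\<bar>" B] by fastforce
  qed
qed

lemma space_grad_outside:
  fixes \<phi> :: "'a::euclidean_space \<times> real \<Rightarrow> real"
  assumes "\<phi> \<in> test_functions U" "p \<notin> U"
  shows "space_grad \<phi> p = 0"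
  using test_functions_outside[OF space_grad_test[OF assms(1)] assms(2), of "space_grad \<phi> p"] by simp

subsection \<open>Uniqueness of weak derivatives\<close>

lemma LINT_lebesgue_on:
  fixes f :: "'a::euclidean_space \<Rightarrow> 'b::{banach, second_countable_topology}"
  assumes "U \<in> sets lebesgue"
  shows "(LINT x|lebesgue_on U. f x) = (LINT x|lebesgue. indicator U x *\<^sub>R f x)"
  using assms by (intro integral_restrict_space) auto

lemma integrable_lebesgue_on_iff:
  fixes f :: "'a::euclidean_space \<Rightarrow> 'b::{banach, second_countable_topology}"
  assumes "U \<in> sets lebesgue"
  shows "integrable (lebesgue_on U) f \<longleftrightarrow> integrable lebesgue (\<lambda>x. indicator U x *\<^sub>R f x)"
  using assms by (intro integrable_restrict_space) auto

lemma AE_lebesgue_on_iff: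
  assumes "U \<in> sets lebesgue"
  shows "(AE x in lebesgue_on U. P x) \<longleftrightarrow> (AE x in lborel. x \<in> U \<longrightarrow> P x)"
  using assms by (subst AE_restrict_space_iff) (auto simp: AE_completion_iff)

lemma borel_measurable_imp_lebesgue:
  "f \<in> borel_measurable borel \<Longrightarrow> f \<in> borel_measurable (lebesgue_on U)"
  by (intro measurable_restrict_space1 measurable_completion) simp

lemma euclidean_borel_representative:
  fixes f :: "'a::euclidean_space \<Rightarrow> 'b::euclidean_space"
  assumes f: "f \<in> borel_measurable lebesgue"
  obtains g where "g \<in> borel_measurable borel" "AE x in lborel. f x = g x"
proof -
  have "\<exists>g\<in>borel_measurable lborel. AE x in lborel. f x \<bullet> b = g x" for b
    by (intro completion_ex_borel_measurable_real borel_measurable_inner f borel_measurable_const)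
  then obtain g where g: "\<And>b. g b \<in> borel_measurable borel" "\<And>b. AE x in lborel. f x \<bullet> b = g b x"
    by (auto simp: Bex_def) metis
  show ?thesis
  proof (rule that[of "\<lambda>x. \<Sum>b\<in>Basis. g b x *\<^sub>R b"])
    show "(\<lambda>x. \<Sum>b\<in>Basis. g b x *\<^sub>R b) \<in> borel_measurable borel"
      using g(1) by measurable
    have "AE x in lborel. \<forall>b\<in>Basis. f x \<bullet> b = g b x"
      using g(2) by (subst AE_ball_countable) (auto simp: countable_finite)
    then show "AE x in lborel. f x = (\<Sum>b\<in>Basis. g b x *\<^sub>R b)"
    proof eventually_elim
      case (elim x)
      then have "(\<Sum>b\<in>Basis. g b x *\<^sub>R b) = (\<Sum>b\<in>Basis. (f x \<bullet> b) *\<^sub>R b)" by simp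
      then show ?case by (simp add: euclidean_representation)
    qed
  qed
qed

text \<open>Setting the function to zero off \<open>U\<close> and where the bound fails turns a
  bound almost everywhere into one at every point. This spares null set arguments whenever slices in
  time are taken later.\<close>

lemma bounded_borel_representative:
  fixes f :: "'a::euclidean_space \<Rightarrow> 'b::euclidean_space"
  assumes U: "U \<in> sets borel" and f: "f \<in> borel_measurable (lebesgue_on U)"
    and bd: "AE x in lebesgue_on U. norm (f x) \<le> C" and C: "0 \<le> C"
  obtains g where "g \<in> borel_measurable borel" "AE x in lebesgue_on U. f x = g x"
    "\<And>x. norm (g x) \<le> C" "\<And>x. x \<notin> U \<Longrightarrow> g x = 0"
proof -
  have Ul: "U \<in> sets lebesgue" using U by auto
  have "(\<lambda>x. indicator U x *\<^sub>R f x) \<in> borel_measurable lebesgue"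
    using f Ul by (subst (asm) borel_measurable_restrict_space_iff) auto
  then obtain g where g: "g \<in> borel_measurable borel" "AE x in lborel. indicator U x *\<^sub>R f x = g x"
    by (rule euclidean_borel_representative)
  let ?g = "\<lambda>x. if x \<in> U \<and> norm (g x) \<le> C then g x else 0"
  show ?thesis
  proof (rule that[of ?g])
    have [measurable]: "U \<in> sets borel" "g \<in> borel_measurable borel" by fact+
    show "?g \<in> borel_measurable borel" by measurable
    show "AE x in lebesgue_on U. f x = ?g x"
      using g(2) bd unfolding AE_lebesgue_on_iff[OF Ul] by eventually_elim auto
  qed (use C in auto)
qed

section \<open>The fundamental lemma of the calculus of variations\<close>

text \<open>The positive and negative parts are densities of two measures that agree on all boxes.
  Boxes form a generator stable under intersection, so the measures coincide, and densities of equal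
  measures agree almost everywhere.\<close>

lemma AE_zero_if_box_integrals_zero:
  fixes g :: "'a::euclidean_space \<Rightarrow> real"
  assumes g: "integrable lborel g"
    and zero: "\<And>a b. (LINT x|lborel. indicator (box a b) x * g x) = 0"
  shows "AE x in lborel. g x = 0"
proof -
  have gm[measurable]: "g \<in> borel_measurable borel" using g by auto
  let ?p = "\<lambda>x. max 0 (g x)" and ?n = "\<lambda>x. max 0 (- g x)"
  let ?N = "density lborel (\<lambda>x. ennreal (?p x))" and ?M = "density lborel (\<lambda>x. ennreal (?n x))"
  have int: "integrable lborel ?p" "integrable lborel ?n"
    using g by (auto intro: Bochner_Integration.integrable_max)
  have eb: "emeasure (density lborel (\<lambda>x. ennreal (q x))) (box a b) = ennreal (LINT x|lborel. indicator (box a b) x * q x)"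
    if q: "integrable lborel q" "\<And>x. 0 \<le> q x" for q :: "'a \<Rightarrow> real" and a b
  proof -
    have [measurable]: "q \<in> borel_measurable borel" using q by auto
    have "emeasure (density lborel (\<lambda>x. ennreal (q x))) (box a b)
      = (\<integral>\<^sup>+x. ennreal (q x) * indicator (box a b) x \<partial>lborel)"
      by (subst emeasure_density) auto
    also have "\<dots> = (\<integral>\<^sup>+x. ennreal (indicator (box a b) x * q x) \<partial>lborel)"
      by (intro nn_integral_cong) (auto split: split_indicator)
    also have "\<dots> = ennreal (LINT x|lborel. indicator (box a b) x * q x)"
      using q integrable_mult_indicator[of "box a b" lborel q]
      by (intro nn_integral_eq_integral) (auto split: split_indicator)
    finally show ?thesis .
  qed
  have "?N = ?M"
  proof (rule measure_eqI_generator_eq)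
    let ?E = "range (\<lambda>(a, b). box a b::'a set)"
    show "Int_stable ?E" by (auto simp: Int_stable_def box_Int_box)
    show "?E \<subseteq> Pow UNIV" "sets ?N = sigma_sets UNIV ?E" "sets ?M = sigma_sets UNIV ?E"
      by (simp_all add: borel_eq_box)
    let ?A = "\<lambda>n::nat. box (- (real n *\<^sub>R One)) (real n *\<^sub>R One) :: 'a set"
    show "range ?A \<subseteq> ?E" "(\<Union>i. ?A i) = UNIV"
      unfolding UN_box_eq_UNIV by auto
    show "emeasure ?N (?A i) \<noteq> \<infinity>" for i using eb[OF int(1)] by simp
    fix X assume "X \<in> ?E"
    then obtain a b where X: "X = box a b" by auto
    have "(LINT x|lborel. indicator (box a b) x * ?p x) - (LINT x|lborel. indicator (box a b) x * ?n x)
        = (LINT x|lborel. indicator (box a b) x * ?p x - indicator (box a b) x * ?n x)"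
      using integrable_mult_indicator[of "box a b" lborel, OF _ int(1)] integrable_mult_indicator[of "box a b" lborel, OF _ int(2)]
      by (intro Bochner_Integration.integral_diff[symmetric]) auto
    also have "\<dots> = (LINT x|lborel. indicator (box a b) x * g x)"
      by (intro Bochner_Integration.integral_cong) (auto split: split_indicator)
    finally have "(LINT x|lborel. indicator (box a b) x * ?p x) = (LINT x|lborel. indicator (box a b) x * ?n x)"
      by (simp add: zero)
    then show "emeasure ?N X = emeasure ?M X"
      unfolding X using eb[OF int(1)] eb[OF int(2)] by simp
  qed
  then have "AE x in lborel. ennreal (?p x) = ennreal (?n x)"
    by (intro sigma_finite_measure.density_unique[OF sigma_finite_lborel]) auto
  then show ?thesis
    by eventually_elim (auto simp: max_def split: if_splits)
qed

text \<open>Unlike a radial bump, this product is positive exactly on an open box, and boxes are the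
  generator used for the measures above.\<close>

definition box_bump :: "'a::euclidean_space \<Rightarrow> 'a \<Rightarrow> 'a \<Rightarrow> real" where
  "box_bump a b x = (\<Prod>i\<in>Basis. exp_bump 0 (x \<bullet> i - a \<bullet> i) * exp_bump 0 (b \<bullet> i - x \<bullet> i))"

lemma smooth_prod: "(\<And>i. i \<in> I \<Longrightarrow> smooth (g i)) \<Longrightarrow> smooth (\<lambda>x. \<Prod>i\<in>I. g i x)"
  by (induction I rule: infinite_finite_induct) (auto intro: smooth_const smooth_mult)

lemma smooth_box_bump: "smooth (box_bump a b)"
  unfolding box_bump_def[abs_def]
  by (intro smooth_prod smooth_mult smooth_exp_bump smooth_diff smooth_const smooth_bounded_linear
      bounded_linear_inner_left)

lemma box_bump_range: "0 \<le> box_bump a b x" "box_bump a b x \<le> 1"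
proof -
  have "0 \<le> exp_bump 0 (x \<bullet> i - a \<bullet> i) * exp_bump 0 (b \<bullet> i - x \<bullet> i)
      \<and> exp_bump 0 (x \<bullet> i - a \<bullet> i) * exp_bump 0 (b \<bullet> i - x \<bullet> i) \<le> 1" for i
    by (auto simp: exp_bump_def intro!: mult_le_one)
  then show "0 \<le> box_bump a b x" "box_bump a b x \<le> 1"
    unfolding box_bump_def by (intro prod_nonneg prod_le_1; blast)+
qed

lemma box_bump_eq_0_iff: "box_bump a b x = 0 \<longleftrightarrow> x \<notin> box a b"
  unfolding box_bump_def mem_box by (auto simp: exp_bump_def prod_zero_iff split: if_splits)

lemma integrable_test_scaleR:
  fixes g :: "'a::euclidean_space \<Rightarrow> 'b::euclidean_space"
  assumes U: "U \<in> sets lebesgue" and g: "locally_integrable U g" and \<phi>: "\<phi> \<in> test_functions U"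
  shows "integrable (lebesgue_on U) (\<lambda>x. \<phi> x *\<^sub>R g x)"
proof -
  from \<phi> obtain K where K: "smooth \<phi>" "compact K" "K \<subseteq> U" "\<And>x. x \<notin> K \<Longrightarrow> \<phi> x = 0"
    by (rule test_functionsE) blast
  from \<phi> obtain B where B: "0 < B" "\<And>x. \<bar>\<phi> x\<bar> \<le> B" by (rule test_functions_bounded) blast
  have Kl: "K \<in> sets lebesgue" using K(2) by (simp add: compact_imp_closed lmeasurable_compact fmeasurableD)
  have gK: "integrable (lebesgue_on K) g" using g K by (auto simp: locally_integrable_def)
  have [measurable]: "\<phi> \<in> borel_measurable (lebesgue_on K)"
    by (intro borel_measurable_imp_lebesgue borel_measurable_continuous_onI smooth_continuous K)
  have [measurable]: "g \<in> borel_measurable (lebesgue_on K)" using gK by auto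
  have "integrable (lebesgue_on K) (\<lambda>x. \<phi> x *\<^sub>R g x)"
  proof (rule Bochner_Integration.integrable_bound)
    show "integrable (lebesgue_on K) (\<lambda>x. B * norm (g x))" using gK by auto
    show "AE x in lebesgue_on K. norm (\<phi> x *\<^sub>R g x) \<le> norm (B * norm (g x))"
      using B by (auto simp: abs_mult intro!: mult_right_mono)
  qed measurable
  then have "integrable lebesgue (\<lambda>x. indicator K x *\<^sub>R (\<phi> x *\<^sub>R g x))"
    by (simp only: integrable_lebesgue_on_iff[OF Kl])
  also have "(\<lambda>x. indicator K x *\<^sub>R (\<phi> x *\<^sub>R g x)) = (\<lambda>x. indicator U x *\<^sub>R (\<phi> x *\<^sub>R g x))"
    using K by (auto simp: fun_eq_iff split: split_indicator)
  finally show ?thesis by (simp only: integrable_lebesgue_on_iff[OF U])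
qed

lemma LINT_lebesgue_on_support:
  fixes g :: "'a::euclidean_space \<Rightarrow> 'b::{banach, second_countable_topology}"
  assumes "U \<in> sets lebesgue" "V \<in> sets lebesgue" "V \<subseteq> U" "\<And>x. x \<in> U \<Longrightarrow> x \<notin> V \<Longrightarrow> g x = 0"
  shows "(LINT x|lebesgue_on V. g x) = (LINT x|lebesgue_on U. g x)"
  unfolding LINT_lebesgue_on[OF assms(1)] LINT_lebesgue_on[OF assms(2)]
  using assms by (intro Bochner_Integration.integral_cong) (auto split: split_indicator)

text \<open>Test functions increasing to the indicator of a smaller box show, by dominated
  convergence, that \<open>g\<close> has integral zero over every box inside \<open>box a b\<close>.
  As \<open>cbox a b\<close> is a compact subset of \<open>U\<close>, cutting \<open>g\<close> off
  to \<open>box a b\<close> makes it integrable.\<close>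

lemma fundamental_lemma_box:
  fixes g :: "'a::euclidean_space \<Rightarrow> real"
  assumes U: "open U" and g: "locally_integrable U g"
    and zero: "\<And>\<phi>. \<phi> \<in> test_functions U \<Longrightarrow> (LINT x|lebesgue_on U. \<phi> x * g x) = 0"
    and ab: "cbox a b \<subseteq> U"
  shows "AE x in lborel. x \<in> box a b \<longrightarrow> g x = 0"
proof -
  have Ul: "U \<in> sets lebesgue" using U by (simp add: borel_open)
  let ?G = "\<lambda>x. indicator (box a b) x * g x"
  have "integrable (lebesgue_on (cbox a b)) g" using g ab by (auto simp: locally_integrable_def)
  then have "integrable lebesgue (\<lambda>x. indicator (cbox a b) x *\<^sub>R g x)"
    by (subst (asm) integrable_lebesgue_on_iff) auto
  then have "integrable lebesgue (\<lambda>x. indicator (box a b) x *\<^sub>R (indicator (cbox a b) x *\<^sub>R g x))"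
    by (rule integrable_mult_indicator[rotated]) simp
  also have "(\<lambda>x. indicator (box a b) x *\<^sub>R (indicator (cbox a b) x *\<^sub>R g x)) = ?G"
    using box_subset_cbox[of a b] by (auto simp: fun_eq_iff split: split_indicator)
  finally have G: "integrable lebesgue ?G" .
  have *: "(LINT x|lebesgue. indicator (box c d) x * ?G x) = 0" for c d
  proof -
    obtain p q where pq: "box c d \<inter> box a b = box p q" by (auto simp: box_Int_box)
    show ?thesis
    proof (cases "box p q = {}")
      case True
      then have "(\<lambda>x. indicator (box c d) x * ?G x) = (\<lambda>_. 0)"
        using pq by (intro ext) (auto split: split_indicator)
      then show ?thesis by (simp only: Bochner_Integration.integral_zero)
    next
      case False
      have "box p q \<subseteq> box a b" using pq by blast
      moreover from this have "box a b \<noteq> {}" using False by blast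
      ultimately have sub: "cbox p q \<subseteq> cbox a b"
        using closure_mono[of "box p q" "box a b"] False by (simp add: closure_box)
      \<comment> \<open>The bump is positive and at most one on the box and zero elsewhere. Hence
        this expression is smooth, has values in [0, 1] and tends to the indicator as
        \<open>m\<close> grows.\<close>
      define \<phi> where "\<phi> m x = 1 - (1 - box_bump p q x) ^ m" for m :: nat and x
      have sm: "smooth (\<phi> m)" for m
        unfolding \<phi>_def[abs_def] by (intro smooth_diff smooth_const smooth_power smooth_box_bump)
      have off: "\<phi> m x = 0" if "x \<notin> box p q" for m x
        using that box_bump_eq_0_iff[of p q x] by (simp add: \<phi>_def)
      have test: "\<phi> m \<in> test_functions U" for m
        using sub ab by (intro test_functionsI[OF sm, of "cbox p q"]) (auto intro: off dest: subsetD[OF box_subset_cbox])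
      have rng: "\<bar>\<phi> m x\<bar> \<le> 1" for m x
      proof -
        have "0 \<le> 1 - box_bump p q x" "1 - box_bump p q x \<le> 1" using box_bump_range[of p q x] by auto
        then have "0 \<le> (1 - box_bump p q x) ^ m" "(1 - box_bump p q x) ^ m \<le> 1"
          by (auto intro: power_le_one)
        then show ?thesis by (simp add: \<phi>_def)
      qed
      have lim: "(\<lambda>m. \<phi> m x) \<longlonglongrightarrow> indicator (box p q) x" for x
      proof (cases "x \<in> box p q")
        case True
        then have "0 < box_bump p q x"
          using box_bump_eq_0_iff[of p q x] box_bump_range[of p q x] by linarith
        then have "(\<lambda>m. (1 - box_bump p q x) ^ m) \<longlonglongrightarrow> 0"
          using box_bump_range[of p q x] by (intro LIMSEQ_power_zero) auto
        from tendsto_diff[OF tendsto_const this, of 1] show ?thesis using True by (simp add: \<phi>_def)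
      next
        case False
        then show ?thesis using off by simp
      qed
      have "(\<lambda>m. LINT x|lebesgue. \<phi> m x * ?G x) \<longlonglongrightarrow> (LINT x|lebesgue. indicator (box p q) x * ?G x)"
      proof (rule integral_dominated_convergence[where w="\<lambda>x. \<bar>?G x\<bar>"])
        have [measurable]: "?G \<in> borel_measurable lebesgue" using G by auto
        show "(\<lambda>x. indicator (box p q) x * ?G x) \<in> borel_measurable lebesgue"
          by (rule borel_measurable_times[OF borel_measurable_indicator borel_measurable_integrable[OF G]]) simp
        show "(\<lambda>x. \<phi> m x * ?G x) \<in> borel_measurable lebesgue" for m
          using borel_measurable_imp_lebesgue[OF borel_measurable_continuous_onI[OF smooth_continuous[OF sm[of m]]], of UNIV]
          by (intro borel_measurable_times[OF _ borel_measurable_integrable[OF G]]) (simp add: lebesgue_on_UNIV_eq)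
        show "AE x in lebesgue. (\<lambda>m. \<phi> m x * ?G x) \<longlonglongrightarrow> indicator (box p q) x * ?G x"
          by (intro AE_I2 tendsto_mult lim tendsto_const)
        show "AE x in lebesgue. norm (\<phi> m x * ?G x) \<le> \<bar>?G x\<bar>" for m
          using rng by (auto simp: abs_mult intro!: AE_I2 mult_left_le_one_le)
      qed (use G in auto)
      moreover have "(LINT x|lebesgue. \<phi> m x * ?G x) = 0" for m
      proof -
        have "(LINT x|lebesgue. \<phi> m x * ?G x) = (LINT x|lebesgue. indicator U x *\<^sub>R (\<phi> m x * g x))"
        proof (intro Bochner_Integration.integral_cong refl)
          fix x show "\<phi> m x * ?G x = indicator U x *\<^sub>R (\<phi> m x * g x)"
          proof (cases "x \<in> box p q")
            case True
            then have "x \<in> box a b" "x \<in> U" using pq sub ab box_subset_cbox[of a b] by auto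
            then show ?thesis by simp
          qed (simp add: off)
        qed
        then show ?thesis using zero[OF test] by (simp add: LINT_lebesgue_on[OF Ul])
      qed
      ultimately have "(LINT x|lebesgue. indicator (box p q) x * ?G x) = 0"
        by (simp add: LIMSEQ_const_iff)
      moreover have "(\<lambda>x. indicator (box p q) x * ?G x) = (\<lambda>x. indicator (box c d) x * ?G x)"
        by (intro ext) (auto simp: pq[symmetric] split: split_indicator)
      ultimately show ?thesis by (simp only:)
    qed
  qed
  obtain g' where g': "g' \<in> borel_measurable borel" "AE x in lborel. ?G x = g' x"
    using euclidean_borel_representative[of ?G] G by blast
  have g'c: "g' \<in> borel_measurable lebesgue" using g'(1) by (intro measurable_completion) simp
  have ae: "AE x in lebesgue. ?G x = g' x" using g'(2) by (simp add: AE_completion_iff)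
  have "integrable lebesgue g'"
    by (rule integrable_cong_AE_imp[OF G]) (use g'c ae in auto)
  then have "integrable lborel g'" using g'(1) by (simp add: integrable_completion)
  then have "AE x in lborel. g' x = 0"
  proof (rule AE_zero_if_box_integrals_zero)
    fix c d
    have "(LINT x|lborel. indicator (box c d) x * g' x) = (LINT x|lebesgue. indicator (box c d) x * g' x)"
      using g'(1) by (subst integral_completion) auto
    also have "\<dots> = (LINT x|lebesgue. indicator (box c d) x * ?G x)"
    proof (rule integral_cong_AE)
      show "(\<lambda>x. indicator (box c d) x * g' x) \<in> borel_measurable lebesgue"
        by (intro borel_measurable_times borel_measurable_indicator g'c) simp
      show "(\<lambda>x. indicator (box c d) x * ?G x) \<in> borel_measurable lebesgue"
        by (rule borel_measurable_times[OF borel_measurable_indicator borel_measurable_integrable[OF G]]) simp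
      show "AE x in lebesgue. indicator (box c d) x * g' x = indicator (box c d) x * ?G x"
        using ae by eventually_elim simp
    qed
    finally show "(LINT x|lborel. indicator (box c d) x * g' x) = 0" by (simp add: *)
  qed
  with g'(2) show ?thesis by eventually_elim auto
qed

text \<open>An open set is a countable union of closed boxes, and the boundaries of these boxes, on
  which the local statement is silent, are null sets.\<close>

lemma fundamental_lemma:
  fixes g :: "'a::euclidean_space \<Rightarrow> real"
  assumes U: "open U" and g: "locally_integrable U g"
    and zero: "\<And>\<phi>. \<phi> \<in> test_functions U \<Longrightarrow> (LINT x|lebesgue_on U. \<phi> x * g x) = 0"
  shows "AE x in lebesgue_on U. g x = 0"
proof -
  obtain \<D> where D: "countable \<D>" "\<And>X. X \<in> \<D> \<Longrightarrow> X \<subseteq> U \<and> (\<exists>a b. X = cbox a b)" "\<Union>\<D> = U"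
    using open_countable_Union_open_cbox[OF U] by (smt (verit, del_insts) Pow_iff subsetD)
  have "AE x in lborel. x \<in> X \<longrightarrow> g x = 0" if XD: "X \<in> \<D>" for X
  proof -
    obtain a b where X: "X = cbox a b" "cbox a b \<subseteq> U" using D(2)[OF XD] by blast
    have "AE x in lborel. x \<notin> cbox a b - box a b"
      using negligible_frontier_interval[of a b]
      by (subst AE_completion_iff[symmetric]) (simp only: negligible_iff_null_sets AE_not_in)
    moreover have "AE x in lborel. x \<in> box a b \<longrightarrow> g x = 0"
      by (rule fundamental_lemma_box[OF U g _ X(2)]) (rule zero)
    ultimately show ?thesis
      unfolding X(1) by eventually_elim auto
  qed
  then have "AE x in lborel. \<forall>X\<in>\<D>. x \<in> X \<longrightarrow> g x = 0"
    using D(1) by (subst AE_ball_countable) auto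
  then have "AE x in lborel. x \<in> U \<longrightarrow> g x = 0"
    by eventually_elim (use D(3) in auto)
  then show ?thesis using U by (subst AE_lebesgue_on_iff) (auto simp: borel_open)
qed

lemma locally_integrable_diff:
  "locally_integrable U g1 \<Longrightarrow> locally_integrable U g2 \<Longrightarrow> locally_integrable U (\<lambda>x. g1 x - g2 x)"
  by (auto simp: locally_integrable_def)

lemma locally_integrable_inner:
  "locally_integrable U g \<Longrightarrow> locally_integrable U (\<lambda>x. g x \<bullet> b)"
  by (auto simp: locally_integrable_def)

lemma locally_integrable_subset:
  "locally_integrable U g \<Longrightarrow> V \<subseteq> U \<Longrightarrow> locally_integrable V g"
  by (auto simp: locally_integrable_def)

lemma fundamental_lemma_eq:
  fixes g1 g2 :: "'a::euclidean_space \<Rightarrow> 'b::euclidean_space"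
  assumes U: "open U" and g: "locally_integrable U g1" "locally_integrable U g2"
    and eq: "\<And>\<phi>. \<phi> \<in> test_functions U \<Longrightarrow>
      (LINT x|lebesgue_on U. \<phi> x *\<^sub>R g1 x) = (LINT x|lebesgue_on U. \<phi> x *\<^sub>R g2 x)"
  shows "AE x in lebesgue_on U. g1 x = g2 x"
proof -
  have Ul: "U \<in> sets lebesgue" using U by (simp add: borel_open)
  have "AE x in lebesgue_on U. g1 x \<bullet> b - g2 x \<bullet> b = 0" for b
  proof (rule fundamental_lemma[OF U])
    show "locally_integrable U (\<lambda>x. g1 x \<bullet> b - g2 x \<bullet> b)"
      by (intro locally_integrable_diff locally_integrable_inner g)
    fix \<phi> assume \<phi>: "\<phi> \<in> test_functions U"
    have i: "integrable (lebesgue_on U) (\<lambda>x. \<phi> x *\<^sub>R g1 x)" "integrable (lebesgue_on U) (\<lambda>x. \<phi> x *\<^sub>R g2 x)"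
      by (intro integrable_test_scaleR Ul g \<phi>)+
    have "(LINT x|lebesgue_on U. \<phi> x * (g1 x \<bullet> b - g2 x \<bullet> b))
        = (LINT x|lebesgue_on U. (\<phi> x *\<^sub>R g1 x) \<bullet> b - (\<phi> x *\<^sub>R g2 x) \<bullet> b)"
      by (simp add: algebra_simps)
    also have "\<dots> = (LINT x|lebesgue_on U. (\<phi> x *\<^sub>R g1 x)) \<bullet> b - (LINT x|lebesgue_on U. (\<phi> x *\<^sub>R g2 x)) \<bullet> b"
      by (simp only: Bochner_Integration.integral_diff integrable_inner_left i integral_inner_left)
    also have "\<dots> = 0" using eq[OF \<phi>] by simp
    finally show "(LINT x|lebesgue_on U. \<phi> x * (g1 x \<bullet> b - g2 x \<bullet> b)) = 0" .
  qed
  then have "AE x in lebesgue_on U. \<forall>b\<in>Basis. g1 x \<bullet> b - g2 x \<bullet> b = 0"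
    by (subst AE_ball_countable) (auto simp: countable_finite)
  then show ?thesis
    by eventually_elim (auto intro: euclidean_eqI)
qed

section \<open>Uniqueness and restriction of weak derivatives\<close>

lemma has_weak_grad_unique:
  assumes "open U" "has_weak_grad U v g1" "has_weak_grad U v g2"
  shows "AE p in lebesgue_on U. g1 p = g2 p"
proof (rule fundamental_lemma_eq[OF assms(1)])
  fix \<phi> assume "\<phi> \<in> test_functions U"
  with assms(2,3) have "- (LINT p|lebesgue_on U. \<phi> p *\<^sub>R g1 p) = - (LINT p|lebesgue_on U. \<phi> p *\<^sub>R g2 p)"
    unfolding has_weak_grad_def by metis
  then show "(LINT p|lebesgue_on U. \<phi> p *\<^sub>R g1 p) = (LINT p|lebesgue_on U. \<phi> p *\<^sub>R g2 p)" by simp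
qed (use assms in \<open>auto simp: has_weak_grad_def\<close>)

lemma has_weak_dt_unique:
  assumes "open U" "has_weak_dt U v g1" "has_weak_dt U v g2"
  shows "AE p in lebesgue_on U. g1 p = g2 p"
proof (rule fundamental_lemma_eq[OF assms(1)])
  fix \<phi> assume "\<phi> \<in> test_functions U"
  with assms(2,3) have "- (LINT p|lebesgue_on U. \<phi> p * g1 p) = - (LINT p|lebesgue_on U. \<phi> p * g2 p)"
    unfolding has_weak_dt_def by metis
  then show "(LINT p|lebesgue_on U. \<phi> p *\<^sub>R g1 p) = (LINT p|lebesgue_on U. \<phi> p *\<^sub>R g2 p)" by simp
qed (use assms in \<open>auto simp: has_weak_dt_def\<close>)

text \<open>By uniqueness, the representative chosen by \<open>SOME\<close> can be exchanged almost
  everywhere for any concrete weak gradient.\<close>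

lemma weak_grad_AE:
  assumes "open U" "has_weak_grad U v g"
  shows "has_weak_grad U v (weak_grad U v)" "AE p in lebesgue_on U. weak_grad U v p = g p"
proof -
  show *: "has_weak_grad U v (weak_grad U v)"
    unfolding weak_grad_def by (rule someI[of "has_weak_grad U v", OF assms(2)])
  show "AE p in lebesgue_on U. weak_grad U v p = g p"
    by (rule has_weak_grad_unique[OF assms(1) * assms(2)])
qed

lemma weak_dt_AE:
  assumes "open U" "has_weak_dt U v w"
  shows "AE p in lebesgue_on U. weak_dt U v p = w p"
proof -
  have "has_weak_dt U v (weak_dt U v)"
    unfolding weak_dt_def by (rule someI[of "has_weak_dt U v", OF assms(2)])
  then show ?thesis by (rule has_weak_dt_unique[OF assms(1) _ assms(2)])
qed

lemma has_weak_grad_subset: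
  assumes "has_weak_grad U v g" "V \<subseteq> U" "open U" "open V"
  shows "has_weak_grad V v g"
  unfolding has_weak_grad_def
proof (intro conjI ballI)
  show "locally_integrable V v" "locally_integrable V g"
    using assms by (auto simp: has_weak_grad_def intro: locally_integrable_subset)
  fix \<phi> assume V: "\<phi> \<in> test_functions V"
  then have U: "\<phi> \<in> test_functions U" using assms(2) by (rule test_functions_mono)
  have s: "U \<in> sets lebesgue" "V \<in> sets lebesgue" using assms by (auto simp: borel_open)
  have "(LINT p|lebesgue_on V. v p *\<^sub>R space_grad \<phi> p) = (LINT p|lebesgue_on U. v p *\<^sub>R space_grad \<phi> p)"
    by (rule LINT_lebesgue_on_support[OF s assms(2)]) (simp add: space_grad_outside[OF V])
  moreover have "(LINT p|lebesgue_on V. \<phi> p *\<^sub>R g p) = (LINT p|lebesgue_on U. \<phi> p *\<^sub>R g p)"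
    by (rule LINT_lebesgue_on_support[OF s assms(2)]) (simp add: test_functions_outside[OF V])
  ultimately show "(LINT p|lebesgue_on V. v p *\<^sub>R space_grad \<phi> p) = - (LINT p|lebesgue_on V. \<phi> p *\<^sub>R g p)"
    using assms(1) U by (simp add: has_weak_grad_def)
qed

lemma smooth_segment_bound:
  assumes "smooth F" "\<And>y. \<bar>frechet_derivative F (at y) h\<bar> \<le> B"
  shows "\<bar>F (x + s *\<^sub>R h) - F x\<bar> \<le> B * \<bar>s\<bar>"
proof -
  have d: "((\<lambda>s. F (x + s *\<^sub>R h)) has_real_derivative frechet_derivative F (at (x + s *\<^sub>R h)) h) (at s within S)" for s S
  proof (rule has_derivative_imp_has_field_derivative)
    show "((\<lambda>s. F (x + s *\<^sub>R h)) has_derivative (\<lambda>r. frechet_derivative F (at (x + s *\<^sub>R h)) (r *\<^sub>R h))) (at s within S)"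
      by (rule has_derivative_compose[OF _ smooth_deriv(1)[OF assms(1)], of "\<lambda>s. x + s *\<^sub>R h"])
         (auto intro!: derivative_eq_intros)
    show "r * frechet_derivative F (at (x + s *\<^sub>R h)) h = frechet_derivative F (at (x + s *\<^sub>R h)) (r *\<^sub>R h)" for r
      using linear_scale[OF has_derivative_linear[OF smooth_deriv(1)[OF assms(1)]]] by simp
  qed
  have "norm (F (x + s *\<^sub>R h) - F (x + 0 *\<^sub>R h)) \<le> B * norm (s - 0)"
    by (rule field_differentiable_bound[OF convex_UNIV d]) (use assms(2) in auto)
  then show ?thesis by simp
qed

text \<open>Every difference quotient has integral zero by translation invariance of Lebesgue
  measure; the quotients converge to the derivative under a common majorant.\<close>

lemma integral_directional_derivative_zero:
  fixes F :: "'a::euclidean_space \<Rightarrow> real"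
  assumes F: "F \<in> test_functions U"
  shows "(LINT x|lborel. frechet_derivative F (at x) h) = 0"
proof -
  from F obtain K where K: "smooth F" "compact K" "K \<subseteq> U" "\<And>x. x \<notin> K \<Longrightarrow> F x = 0"
    by (rule test_functionsE) blast
  obtain B where B: "0 < B" "\<And>y. \<bar>frechet_derivative F (at y) h\<bar> \<le> B"
    using test_functions_bounded[OF test_functions_deriv[OF F]] by blast
  obtain R where R: "\<And>x. x \<in> K \<Longrightarrow> norm x \<le> R" using compact_imp_bounded[OF K(2)] by (auto simp: bounded_iff)
  define D where "D m x = real (Suc m) * (F (x + (1 / real (Suc m)) *\<^sub>R h) - F x)" for m x
  \<comment> \<open>Shifts have length at most |h|, so all difference quotients vanish outside this
    ball, and \<open>B\<close> bounds them by the mean value inequality.\<close>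
  let ?w = "\<lambda>x. indicator (cball 0 (R + norm h)) x * B"
  have cont: "continuous_on UNIV F" using K(1) by (rule smooth_continuous)
  have Fm[measurable]: "F \<in> borel_measurable borel" using cont by (rule borel_measurable_continuous_onI)
  have zero: "(LINT x|lborel. D m x) = 0" for m
  proof -
    have int: "integrable lborel F"
    proof -
      have "integrable lborel (\<lambda>x. indicator K x *\<^sub>R F x)"
        using borel_integrable_compact[OF K(2), of F] cont continuous_on_subset by (auto simp: set_integrable_def)
      also have "(\<lambda>x. indicator K x *\<^sub>R F x) = F" using K(4) by (auto split: split_indicator)
      finally show ?thesis .
    qed
    have l: "lborel = distr lborel borel (\<lambda>x. x + c)" for c :: 'a
      using lborel_distr_plus[of c] by (simp add: add.commute[of _ c])
    have "integrable lborel (\<lambda>x. F (x + c))" "(LINT x|lborel. F (x + c)) = (LINT x|lborel. F x)" for c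
      using int integrable_distr_eq[of "\<lambda>x. x + c" lborel borel F] integral_distr[of "\<lambda>x. x + c" lborel borel F] l[of c]
      by (simp_all)
    then show ?thesis using int by (simp add: D_def)
  qed
  have "(\<lambda>m. LINT x|lborel. D m x) \<longlonglongrightarrow> (LINT x|lborel. frechet_derivative F (at x) h)"
  proof (rule integral_dominated_convergence[where w="?w"])
    show "(\<lambda>x. frechet_derivative F (at x) h) \<in> borel_measurable lborel"
      using smooth_continuous[OF smooth_deriv(2)[OF K(1)]] by (simp add: borel_measurable_continuous_onI)
    show "D m \<in> borel_measurable lborel" for m unfolding D_def[abs_def] by measurable
    show "integrable lborel ?w"
      by (intro integrable_mult_left integrable_real_indicator) (auto intro: emeasure_bounded_finite[unfolded infinity_ennreal_def])
    show "AE x in lborel. (\<lambda>m. D m x) \<longlonglongrightarrow> frechet_derivative F (at x) h"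
    proof (intro AE_I2)
      fix x
      have "((\<lambda>s. F (x + s *\<^sub>R h)) has_derivative (\<lambda>r. frechet_derivative F (at (x + 0 *\<^sub>R h)) (r *\<^sub>R h))) (at 0)"
        by (rule has_derivative_compose[OF _ smooth_deriv(1)[OF K(1)], of "\<lambda>s. x + s *\<^sub>R h"])
           (auto intro!: derivative_eq_intros)
      then have "((\<lambda>s. F (x + s *\<^sub>R h)) has_real_derivative frechet_derivative F (at x) h) (at 0)"
        by (rule has_derivative_imp_has_field_derivative)
           (use linear_scale[OF has_derivative_linear[OF smooth_deriv(1)[OF K(1)]]] in simp)
      then have "((\<lambda>s. (F (x + s *\<^sub>R h) - F x) / s) \<longlongrightarrow> frechet_derivative F (at x) h) (at 0)"
        by (simp add: DERIV_def)
      then have "(\<lambda>m. (F (x + (1 / real (Suc m)) *\<^sub>R h) - F x) / (1 / real (Suc m))) \<longlonglongrightarrow> frechet_derivative F (at x) h"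
        by (rule filterlim_compose)
           (use LIMSEQ_Suc[OF lim_1_over_n] in \<open>simp add: filterlim_at del: of_nat_Suc\<close>)
      then show "(\<lambda>m. D m x) \<longlonglongrightarrow> frechet_derivative F (at x) h"
        by (simp add: D_def mult.commute)
    qed
    show "AE x in lborel. norm (D m x) \<le> ?w x" for m
    proof (intro AE_I2)
      fix x
      show "norm (D m x) \<le> ?w x"
      proof (cases "x \<in> cball 0 (R + norm h)")
        case True
        have "\<bar>F (x + (1 / real (Suc m)) *\<^sub>R h) - F x\<bar> \<le> B * \<bar>1 / real (Suc m)\<bar>"
          by (rule smooth_segment_bound[OF K(1) B(2)])
        then have "\<bar>F (x + (1 / real (Suc m)) *\<^sub>R h) - F x\<bar> * real (Suc m) \<le> B"
          by (simp add: pos_le_divide_eq)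
        then show ?thesis using True by (simp add: D_def abs_mult mult.commute)
      next
        case False
        then have n: "norm x > R + norm h" by simp
        then have "x \<notin> K" using R[of x] norm_ge_zero[of h] by (auto simp: not_less)
        moreover have "x + (1 / real (Suc m)) *\<^sub>R h \<notin> K"
        proof
          assume "x + (1 / real (Suc m)) *\<^sub>R h \<in> K"
          then have "norm (x + (1 / real (Suc m)) *\<^sub>R h) \<le> R" by (rule R)
          moreover have "norm ((1 / real (Suc m)) *\<^sub>R h) \<le> norm h"
            by (simp add: divide_le_eq algebra_simps)
          ultimately show False using n norm_triangle_ineq4[of "x + (1 / real (Suc m)) *\<^sub>R h" "(1 / real (Suc m)) *\<^sub>R h"] by simp
        qed
        ultimately show ?thesis using False K(4) by (simp add: D_def)
      qed
    qed
  qed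
  then show ?thesis by (simp add: zero LIMSEQ_const_iff)
qed

subsection \<open>Weak derivatives and Lipschitz functions\<close>

lemma LINT_shift:
  fixes f :: "'a::euclidean_space \<Rightarrow> real"
  assumes "f \<in> borel_measurable borel"
  shows "(LINT x|lborel. f (x + c)) = (LINT x|lborel. f x)"
proof -
  have "lborel = distr lborel borel (\<lambda>x. x + c)"
    using lborel_distr_plus[of c] by (simp add: add.commute[of _ c])
  then show ?thesis
    using assms integral_distr[of "\<lambda>x. x + c" lborel borel f] by simp
qed

lemma integrable_bounded_support:
  fixes f :: "'a::euclidean_space \<Rightarrow> 'b::euclidean_space"
  assumes "f \<in> borel_measurable borel" "bounded S" "\<And>x. norm (f x) \<le> C" "\<And>x. x \<notin> S \<Longrightarrow> f x = 0"
  shows "integrable lborel f"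
proof -
  obtain R where R: "S \<subseteq> cball 0 R" using bounded_subset_ballD[OF assms(2), of 0] ball_subset_cball by blast
  show ?thesis
  proof (rule Bochner_Integration.integrable_bound)
    show "integrable lborel (\<lambda>x. indicator (cball (0::'a) R) x * C)"
      by (intro integrable_mult_left integrable_real_indicator)
         (auto intro: emeasure_bounded_finite[unfolded infinity_ennreal_def])
    show "AE x in lborel. norm (f x) \<le> norm (indicator (cball 0 R) x * C)"
    proof (intro AE_I2)
      fix x show "norm (f x) \<le> norm (indicator (cball 0 R) x * C)"
        using assms(3)[of x] assms(4)[of x] subsetD[OF R, of x] by (cases "x \<in> cball 0 R"; cases "x \<in> S") auto
    qed
  qed (use assms in simp)
qed

lemma bump_borel[measurable]: "bump c r \<in> borel_measurable borel"
  by (intro borel_measurable_continuous_onI smooth_continuous smooth_bump)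

lemma bump_integrable: "0 < r \<Longrightarrow> integrable lborel (bump c r)"
  by (rule integrable_bounded_support[where S="ball c r" and C=1])
     (auto simp: bump_eq_0_iff bump_nonneg bump_le_1)

lemma bump_integral_eq: "(LINT x|lborel. bump c r x) = (LINT x|lborel. bump (0::'a) r x)"
  for c :: "'a::euclidean_space"
  using LINT_shift[of "bump c r" c, symmetric] by (simp add: bump_def)

lemma bump_integral_pos:
  assumes "0 < r"
  shows "0 < (LINT x|lborel. bump c r x)"
proof -
  have "(LINT x|lborel. bump c r x) \<noteq> 0"
  proof
    assume "(LINT x|lborel. bump c r x) = 0"
    then have "AE x in lborel. bump c r x = 0"
      using integral_nonneg_eq_0_iff_AE[OF bump_integrable[OF assms, of c]] by (auto simp: bump_nonneg)
    then have "AE x in lborel. x \<notin> ball c r" by (simp add: bump_eq_0_iff assms)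
    then have "emeasure lborel (ball c r) = 0"
      by (subst (asm) AE_iff_measurable[of "ball c r"]) auto
    then have "Sigma_Algebra.measure lborel (ball c r) = 0" by (simp add: measure_def)
    then show False using assms content_ball_gt_0_iff[of c r] by simp
  qed
  then show ?thesis
    by (metis AE_I2 bump_nonneg integral_nonneg_AE less_le)
qed

lemma frechet_bump_shift: "frechet_derivative (bump c r) (at z) h = frechet_derivative (bump 0 r) (at (z - c)) h"
proof -
  have "((\<lambda>z. bump 0 r (z - c)) has_derivative frechet_derivative (bump 0 r) (at (z - c))) (at z)"
    by (rule has_derivative_compose[OF _ smooth_deriv(1)[OF smooth_bump], of "\<lambda>z. z - c" "\<lambda>h. h"])
       (auto intro!: derivative_eq_intros)
  moreover have "(\<lambda>z. bump 0 r (z - c)) = bump c r" by (rule ext) (simp add: bump_def)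
  ultimately have "(bump c r has_derivative frechet_derivative (bump 0 r) (at (z - c))) (at z)"
    by (simp only:)
  from frechet_derivative_at[OF this] show ?thesis by (simp only:)
qed

text \<open>The integral of \<open>w\<close> against a bump is followed along the segment from
  \<open>y\<close> to \<open>x\<close>, which convexity keeps in \<open>\<Omega>\<close>. Its
  derivative in the position is minus the integral of \<open>w\<close> against a derivative of the
  bump, hence bounded by hypothesis. For a small radius the end values approximate
  \<open>w x\<close> and \<open>w y\<close> times the mass of the bump. Besides slices in space,
  moments in time are treated this way, in dimension one.\<close>

lemma lipschitz_if_weak_derivative_bounded:
  fixes w :: "'a::euclidean_space \<Rightarrow> real"
  assumes \<Omega>: "open \<Omega>" "convex \<Omega>" and w: "continuous_on UNIV w" and C: "0 \<le> C"
    and bd: "\<And>\<zeta> h. \<zeta> \<in> test_functions \<Omega> \<Longrightarrow>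
      abs (LINT x|lborel. w x * frechet_derivative \<zeta> (at x) h) \<le> C * norm h * (LINT x|lborel. abs (\<zeta> x))"
    and xy: "x \<in> \<Omega>" "y \<in> \<Omega>"
  shows "\<bar>w x - w y\<bar> \<le> C * norm (x - y)"
proof (rule field_le_epsilon)
  fix e :: real assume e: "0 < e"
  define p where "p s = y + s *\<^sub>R (x - y)" for s
  have seg: "p s \<in> closed_segment y x" if "s \<in> {0..1}" for s
    using that by (auto simp: p_def closed_segment_def algebra_simps intro!: exI[of _ s])
  have "compact (closed_segment y x)" "closed_segment y x \<subseteq> \<Omega>"
    using \<Omega> xy by (auto intro: closed_segment_subset[THEN subsetD])
  then obtain r0 where r0: "0 < r0" "(\<Union>q\<in>closed_segment y x. ball q r0) \<subseteq> \<Omega>"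
    using compact_subset_open_imp_ball_epsilon_subset[OF _ \<Omega>(1)] by blast
  have wx: "\<exists>r>0. \<forall>z\<in>ball q r. \<bar>w z - w q\<bar> \<le> e / 2" for q
  proof -
    have "isCont w q" using w by (simp add: continuous_on_eq_continuous_at)
    then obtain r where "r > 0" "\<And>z. dist z q < r \<Longrightarrow> dist (w z) (w q) < e / 2"
      using e unfolding continuous_at_eps_delta by (metis half_gt_zero)
    then show ?thesis by (intro exI[of _ r]) (auto simp: dist_commute dist_real_def less_imp_le)
  qed
  obtain r1 r2 where r1: "0 < r1" "\<And>z. z \<in> ball x r1 \<Longrightarrow> \<bar>w z - w x\<bar> \<le> e / 2"
    and r2: "0 < r2" "\<And>z. z \<in> ball y r2 \<Longrightarrow> \<bar>w z - w y\<bar> \<le> e / 2"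
    using wx[of x] wx[of y] by blast
  \<comment> \<open>\<open>r0 / 2\<close> keeps closed balls around the segment inside
    \<open>\<Omega>\<close>; \<open>r1\<close> and \<open>r2\<close> make the means at the two ends
    accurate to \<open>e / 2\<close>.\<close>
  define r where "r = min (r0 / 2) (min r1 r2)"
  have r: "0 < r" "r < r0" "r \<le> r1" "r \<le> r2" using r0 r1 r2 by (auto simp: r_def)
  define J where "J = (LINT z|lborel. bump (0::'a) r z)"
  have J: "0 < J" unfolding J_def by (rule bump_integral_pos[OF r(1)])
  have test: "bump (p s) r \<in> test_functions \<Omega>" if "s \<in> {0..1}" for s
  proof (rule bump_test[OF r(1)])
    show "cball (p s) r \<subseteq> \<Omega>" using r0(2) seg[OF that] r(2) by force
  qed
  have wm[measurable]: "w \<in> borel_measurable borel" using w by (rule borel_measurable_continuous_onI)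
  obtain R where R: "0 < R" "\<And>s. s \<in> {0..1} \<Longrightarrow> cball (p s) r \<subseteq> cball 0 R"
  proof -
    have "norm (p s) \<le> norm y + norm (x - y)" if "s \<in> {0..1}" for s
      using norm_triangle_ineq[of y "s *\<^sub>R (x - y)"] mult_right_mono[of s 1 "norm (x - y)"] that
      by (simp add: p_def)
    then have "cball (p s) r \<subseteq> cball 0 (norm y + norm (x - y) + r)" if "s \<in> {0..1}" for s
      using that by (auto simp: dist_norm norm_minus_commute intro: order_trans[OF norm_triangle_sub])
                    (smt (verit, best) norm_triangle_sub)
    then show ?thesis using that[of "norm y + norm (x - y) + r"] r(1) by (simp add: add_nonneg_pos)
  qed
  obtain a b where ab: "cball (0::'a) R \<subseteq> cbox a b"
    using bounded_subset_cbox_symmetric[OF bounded_cball] by metis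
  have LI: "(LINT z|lborel. f z) = integral (cbox a b) f"
    if "continuous_on UNIV f" "\<And>z. z \<notin> cball 0 R \<Longrightarrow> f z = 0" for f :: "'a \<Rightarrow> real"
  proof -
    have "set_integrable lborel (cbox a b) f"
      unfolding set_integrable_def
      using that by (intro borel_integrable_compact compact_cbox continuous_on_subset[OF that(1)]) auto
    from set_borel_integral_eq_integral(2)[OF this]
    have "(LINT z|lborel. indicator (cbox a b) z *\<^sub>R f z) = integral (cbox a b) f"
      by (simp add: set_lebesgue_integral_def)
    also have "(\<lambda>z. indicator (cbox a b) z *\<^sub>R f z) = f"
      using that(2) subsetD[OF ab] by (intro ext) (metis indicator_simps scaleR_one scaleR_zero_left)
    finally show ?thesis .
  qed
  have off: "z \<notin> cball 0 R \<Longrightarrow> bump (p s) r z = 0" if "s \<in> {0..1}" for s z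
    using R(2)[OF that] ball_subset_cball[of "p s" r] bump_eq_0_iff[OF r(1), of "p s" z] by blast
  have off': "z \<notin> cball 0 R \<Longrightarrow> frechet_derivative (bump (p s) r) (at z) h = 0" if "s \<in> {0..1}" for s z h
    using frechet_derivative_at[OF zero_off_closed_deriv[of "cball 0 R" "bump (p s) r" z], symmetric] off[OF that]
    by simp
  \<comment> \<open>The integral is taken over one fixed box that contains the supports for all
    \<open>s\<close>, as the Leibniz rule requires.\<close>
  define F where "F s = integral (cbox a b) (\<lambda>z. w z * bump (p s) r z)" for s
  define F' where "F' s = integral (cbox a b) (\<lambda>z. - (w z * frechet_derivative (bump (p s) r) (at z) (x - y)))" for s
  have cb: "continuous_on UNIV (\<lambda>z. w z * bump (p s) r z)" for s
    by (intro continuous_on_mult w smooth_continuous smooth_bump)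
  have cb': "continuous_on UNIV (\<lambda>z. w z * frechet_derivative (bump (p s) r) (at z) h)" for s h
    by (intro continuous_on_mult w smooth_continuous smooth_deriv(2) smooth_bump)
  have Fd: "(F has_field_derivative F' s) (at s within {0..1})" if s: "s \<in> {0..1}" for s
    unfolding F_def[abs_def] F'_def
  proof (rule leibniz_rule_field_derivative)
    fix s :: real and z :: 'a
    have eq: "(\<lambda>s. bump (p s) r z) = (\<lambda>s. bump 0 r (z - p s))" by (simp add: bump_def)
    have "((\<lambda>s. bump (p s) r z) has_derivative (\<lambda>q. frechet_derivative (bump 0 r) (at (z - p s)) (- (q *\<^sub>R (x - y))))) (at s within {0..1})"
      unfolding eq
      by (rule has_derivative_compose[OF _ smooth_deriv(1)[OF smooth_bump], of "\<lambda>s. z - p s"])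
         (auto simp: p_def intro!: derivative_eq_intros)
    then have "((\<lambda>s. bump (p s) r z) has_field_derivative - frechet_derivative (bump (p s) r) (at z) (x - y)) (at s within {0..1})"
    proof (rule has_derivative_imp_has_field_derivative)
      have lin: "linear (frechet_derivative (bump 0 r) (at (z - p s)))"
        using has_derivative_linear[OF smooth_deriv(1)[OF smooth_bump]] .
      fix q
      show "q * - frechet_derivative (bump (p s) r) (at z) (x - y) = frechet_derivative (bump 0 r) (at (z - p s)) (- (q *\<^sub>R (x - y)))"
        by (simp add: frechet_bump_shift[of "p s"] linear_neg[OF lin] linear_scale[OF lin])
    qed
    from DERIV_cmult[OF this, of "w z"]
    show "((\<lambda>s. w z * bump (p s) r z) has_field_derivative - (w z * frechet_derivative (bump (p s) r) (at z) (x - y))) (at s within {0..1})"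
      by simp
  next
    show "(\<lambda>z. w z * bump (p s) r z) integrable_on cbox a b" for s
      using cb continuous_on_subset by (intro integrable_continuous) blast
    have "continuous_on ({0..1} \<times> cbox a b) (\<lambda>q. - (w (snd q) * frechet_derivative (bump 0 r) (at (snd q - p (fst q))) (x - y)))"
      unfolding p_def
      by (intro continuous_intros continuous_on_compose2[OF w] continuous_on_compose2[OF smooth_continuous[OF smooth_deriv(2)[OF smooth_bump], of UNIV]]) auto
    then show "continuous_on ({0..1} \<times> cbox a b) (\<lambda>(s, z). - (w z * frechet_derivative (bump (p s) r) (at z) (x - y)))"
      by (simp add: split_beta frechet_bump_shift[of "p _"])
  qed (use s in auto)
  have F'b: "norm (F' s) \<le> C * norm (x - y) * J" if s: "s \<in> {0..1}" for s
  proof -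
    have "F' s = - integral (cbox a b) (\<lambda>z. w z * frechet_derivative (bump (p s) r) (at z) (x - y))"
      by (simp add: F'_def)
    also have "\<dots> = - (LINT z|lborel. w z * frechet_derivative (bump (p s) r) (at z) (x - y))"
      by (subst LI[OF cb']) (use off'[OF s] in auto)
    finally have "norm (F' s) \<le> C * norm (x - y) * (LINT z|lborel. \<bar>bump (p s) r z\<bar>)"
      using bd[OF test[OF s], of "x - y"] by simp
    then show ?thesis by (simp add: J_def bump_nonneg bump_integral_eq[of "p s"])
  qed
  have "norm (F 1 - F 0) \<le> C * norm (x - y) * J * norm (1 - 0 :: real)"
    by (rule field_differentiable_bound[OF _ Fd F'b]) auto
  then have d: "\<bar>F 1 - F 0\<bar> \<le> C * norm (x - y) * J" by simp
  have appr: "\<bar>F s - w (p s) * J\<bar> \<le> e / 2 * J"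
    if s: "s \<in> {0..1}" and q: "\<And>z. z \<in> ball (p s) r \<Longrightarrow> \<bar>w z - w (p s)\<bar> \<le> e / 2" for s
  proof -
    have Fs: "F s = (LINT z|lborel. w z * bump (p s) r z)"
      unfolding F_def by (subst LI[OF cb]) (use off[OF s] in auto)
    have i1: "integrable lborel (bump (p s) r)" by (rule bump_integrable[OF r(1)])
    have "integrable lborel (\<lambda>z. indicator (cball (p s) r) z *\<^sub>R (w z * bump (p s) r z))"
      by (intro borel_integrable_compact compact_cball continuous_on_subset[OF cb]) auto
    also have "(\<lambda>z. indicator (cball (p s) r) z *\<^sub>R (w z * bump (p s) r z)) = (\<lambda>z. w z * bump (p s) r z)"
      using bump_eq_0_iff[OF r(1), of "p s"] by (intro ext) (auto split: split_indicator)
    finally have i2: "integrable lborel (\<lambda>z. w z * bump (p s) r z)" .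
    have "F s - w (p s) * J = (LINT z|lborel. w z * bump (p s) r z) - (LINT z|lborel. w (p s) * bump (p s) r z)"
      by (simp add: Fs J_def bump_integral_eq[of "p s"])
    also have "\<dots> = (LINT z|lborel. w z * bump (p s) r z - w (p s) * bump (p s) r z)"
      by (rule Bochner_Integration.integral_diff[symmetric]) (use i1 i2 in auto)
    finally have "\<bar>F s - w (p s) * J\<bar> \<le> (LINT z|lborel. \<bar>w z * bump (p s) r z - w (p s) * bump (p s) r z\<bar>)"
      using integral_abs_bound by simp
    also have "\<dots> \<le> (LINT z|lborel. e / 2 * bump (p s) r z)"
    proof (rule integral_mono)
      fix z
      have "\<bar>w z - w (p s)\<bar> * bump (p s) r z \<le> e / 2 * bump (p s) r z"
      proof (cases "z \<in> ball (p s) r")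
        case True
        then show ?thesis by (intro mult_right_mono q bump_nonneg)
      next
        case False
        then have "bump (p s) r z = 0" using bump_eq_0_iff[OF r(1)] by blast
        then show ?thesis by simp
      qed
      then show "\<bar>w z * bump (p s) r z - w (p s) * bump (p s) r z\<bar> \<le> e / 2 * bump (p s) r z"
        by (simp add: abs_mult bump_nonneg flip: left_diff_distrib)
    qed (use i1 i2 in auto)
    also have "\<dots> = e / 2 * J" by (simp add: J_def bump_integral_eq[of "p s"])
    finally show ?thesis .
  qed
  have "p 1 = x" "p 0 = y" by (simp_all add: p_def)
  then have "\<bar>F 1 - w x * J\<bar> \<le> e / 2 * J" "\<bar>F 0 - w y * J\<bar> \<le> e / 2 * J"
    using appr[of 1] appr[of 0] r1 r2 r by auto
  with d have "\<bar>w x * J - w y * J\<bar> \<le> C * norm (x - y) * J + e * J" by linarith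
  moreover have "\<bar>w x * J - w y * J\<bar> = \<bar>w x - w y\<bar> * J"
    using J by (simp add: abs_mult flip: left_diff_distrib)
  ultimately have "\<bar>w x - w y\<bar> * J \<le> (C * norm (x - y) + e) * J"
    by (simp add: distrib_right)
  then show "\<bar>w x - w y\<bar> \<le> C * norm (x - y) + e" using J by simp
qed

section \<open>Weak gradients of Borel functions\<close>

lemma LINT_lebesgue_on_borel:
  fixes f :: "'a::euclidean_space \<Rightarrow> 'b::{banach, second_countable_topology}"
  assumes "U \<in> sets borel" "f \<in> borel_measurable borel"
  shows "(LINT x|lebesgue_on U. f x) = (LINT x|lborel. indicator U x *\<^sub>R f x)"
  using assms by (subst LINT_lebesgue_on) (auto simp: integral_completion)

lemma LINT_lebesgue_on_zero_off:
  fixes f :: "'a::euclidean_space \<Rightarrow> 'b::{banach, second_countable_topology}"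
  assumes "U \<in> sets borel" "f \<in> borel_measurable borel" "\<And>x. x \<notin> U \<Longrightarrow> f x = 0"
  shows "(LINT x|lebesgue_on U. f x) = (LINT x|lborel. f x)"
  unfolding LINT_lebesgue_on_borel[OF assms(1,2)]
  using assms(3) by (intro Bochner_Integration.integral_cong) (auto split: split_indicator)

lemma test_functions_borel: "\<phi> \<in> test_functions U \<Longrightarrow> \<phi> \<in> borel_measurable borel"
  by (intro borel_measurable_continuous_onI smooth_continuous test_functions_smooth)

lemma smooth_borel: "smooth \<phi> \<Longrightarrow> \<phi> \<in> borel_measurable borel"
  by (intro borel_measurable_continuous_onI smooth_continuous)

lemma test_functions_integrable: "\<phi> \<in> test_functions U \<Longrightarrow> integrable lborel \<phi>"
proof (erule test_functionsE)
  fix K assume K: "smooth \<phi>" "compact K" "\<And>x. x \<notin> K \<Longrightarrow> \<phi> x = 0" "K \<subseteq> U"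
  have "integrable lborel (\<lambda>x. indicator K x *\<^sub>R \<phi> x)"
    by (intro borel_integrable_compact K smooth_continuous)
  also have "(\<lambda>x. indicator K x *\<^sub>R \<phi> x) = \<phi>" using K(3) by (intro ext) (auto split: split_indicator)
  finally show ?thesis .
qed

lemma locally_integrable_continuous:
  fixes g :: "'a::euclidean_space \<Rightarrow> 'b::euclidean_space"
  assumes "continuous_on UNIV g"
  shows "locally_integrable U g"
  unfolding locally_integrable_def
proof (intro allI impI)
  fix K assume K: "compact K \<and> K \<subseteq> U"
  then have Kl: "K \<in> sets borel" by (simp add: compact_imp_closed)
  have "integrable lborel (\<lambda>x. indicator K x *\<^sub>R g x)"
    using K assms by (intro borel_integrable_compact continuous_on_subset[OF assms]) auto
  then show "integrable (lebesgue_on K) g"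
    using Kl borel_measurable_continuous_onI[OF assms]
    by (subst integrable_lebesgue_on_iff) (auto simp: integrable_completion)
qed

lemma locally_integrable_bounded:
  fixes g :: "'a::euclidean_space \<Rightarrow> 'b::euclidean_space"
  assumes "g \<in> borel_measurable borel" "\<And>x. norm (g x) \<le> C"
  shows "locally_integrable U g"
  unfolding locally_integrable_def
proof (intro allI impI)
  fix K assume K: "compact K \<and> K \<subseteq> U"
  then have Kl[measurable]: "K \<in> sets borel" by (simp add: compact_imp_closed)
  have [measurable]: "g \<in> borel_measurable borel" by fact
  have C: "0 \<le> C" using norm_ge_zero order_trans assms(2) by blast
  have "integrable lborel (\<lambda>x. indicator K x *\<^sub>R g x)"
    using K assms C by (intro integrable_bounded_support[where S=K and C=C])
      (auto simp: compact_imp_bounded split: split_indicator)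
  then show "integrable (lebesgue_on K) g"
    using Kl assms(1) by (subst integrable_lebesgue_on_iff) (auto simp: integrable_completion)
qed

text \<open>A vector identity holds once the inner products with all \<open>h\<close> agree, and the
  scalar form suits Fubini and the fundamental lemma.\<close>

lemma has_weak_grad_iff:
  fixes v :: "'a::euclidean_space \<times> real \<Rightarrow> real"
  assumes U: "open U" and li: "locally_integrable U v" "locally_integrable U g"
  shows "has_weak_grad U v g \<longleftrightarrow> (\<forall>\<phi>\<in>test_functions U. \<forall>h.
    (LINT p|lebesgue_on U. v p * frechet_derivative \<phi> (at p) (h, 0)) = - (LINT p|lebesgue_on U. \<phi> p * (g p \<bullet> h)))"
proof -
  have Ul: "U \<in> sets lebesgue" using U by (simp add: borel_open)
  have e1: "(LINT p|lebesgue_on U. v p *\<^sub>R space_grad \<phi> p) \<bullet> h = (LINT p|lebesgue_on U. v p * frechet_derivative \<phi> (at p) (h, 0))"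
    and e2: "(LINT p|lebesgue_on U. \<phi> p *\<^sub>R g p) \<bullet> h = (LINT p|lebesgue_on U. \<phi> p * (g p \<bullet> h))"
    if \<phi>: "\<phi> \<in> test_functions U" for \<phi> h
  proof -
    have c: "integrable (lebesgue_on U) (\<lambda>p. (space_grad \<phi> p \<bullet> b) *\<^sub>R v p)" for b
      by (intro integrable_test_scaleR Ul li space_grad_test \<phi>)
    have "integrable (lebesgue_on U) (\<lambda>p. \<Sum>b\<in>Basis. ((space_grad \<phi> p \<bullet> b) *\<^sub>R v p) *\<^sub>R b)"
      by (intro Bochner_Integration.integrable_sum integrable_scaleR_left c)
    also have "(\<lambda>p. \<Sum>b\<in>Basis. ((space_grad \<phi> p \<bullet> b) *\<^sub>R v p) *\<^sub>R b) = (\<lambda>p. v p *\<^sub>R space_grad \<phi> p)"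
      by (intro ext) (simp add: mult.commute[of _ "v _"] flip: scaleR_scaleR scaleR_sum_right add: euclidean_representation)
    finally have i: "integrable (lebesgue_on U) (\<lambda>p. v p *\<^sub>R space_grad \<phi> p)" .
    show "(LINT p|lebesgue_on U. v p *\<^sub>R space_grad \<phi> p) \<bullet> h = (LINT p|lebesgue_on U. v p * frechet_derivative \<phi> (at p) (h, 0))"
      using i by (subst integral_inner_left[symmetric]) (simp_all add: space_grad_inner[OF test_functions_smooth[OF \<phi>]])
    show "(LINT p|lebesgue_on U. \<phi> p *\<^sub>R g p) \<bullet> h = (LINT p|lebesgue_on U. \<phi> p * (g p \<bullet> h))"
      using integrable_test_scaleR[OF Ul li(2) \<phi>] by (subst integral_inner_left[symmetric]) simp_all
  qed
  have "x = - y \<longleftrightarrow> (\<forall>h. x \<bullet> h = - (y \<bullet> h))" for x y :: 'a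
    using vector_eq_rdot[of x "- y", symmetric] by (simp only: inner_minus_left)
  then show ?thesis
    unfolding has_weak_grad_def using li by (simp add: e1 e2)
qed

text \<open>Test functions vanish off \<open>U\<close>, so for Borel representatives the integrals
  may be taken over the whole space against \<open>lborel\<close>, where Fubini is at hand.\<close>

lemma has_weak_grad_borel_iff:
  fixes v :: "'a::euclidean_space \<times> real \<Rightarrow> real"
  assumes U: "open U" and li: "locally_integrable U v" "locally_integrable U g"
    and [measurable]: "v \<in> borel_measurable borel" "g \<in> borel_measurable borel"
  shows "has_weak_grad U v g \<longleftrightarrow> (\<forall>\<phi>\<in>test_functions U. \<forall>h.
    (LINT p|lborel. v p * frechet_derivative \<phi> (at p) (h, 0)) = - (LINT p|lborel. \<phi> p * (g p \<bullet> h)))"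
proof -
  have Ub: "U \<in> sets borel" using U by simp
  have "(LINT p|lebesgue_on U. v p * frechet_derivative \<phi> (at p) (h, 0)) = (LINT p|lborel. v p * frechet_derivative \<phi> (at p) (h, 0))"
    "(LINT p|lebesgue_on U. \<phi> p * (g p \<bullet> h)) = (LINT p|lborel. \<phi> p * (g p \<bullet> h))"
    if \<phi>: "\<phi> \<in> test_functions U" for \<phi> h
  proof -
    have [measurable]: "\<phi> \<in> borel_measurable borel" "(\<lambda>p. frechet_derivative \<phi> (at p) (h, 0)) \<in> borel_measurable borel"
      using \<phi> test_functions_deriv[OF \<phi>] by (auto intro: test_functions_borel)
    show "(LINT p|lebesgue_on U. v p * frechet_derivative \<phi> (at p) (h, 0)) = (LINT p|lborel. v p * frechet_derivative \<phi> (at p) (h, 0))"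
      by (rule LINT_lebesgue_on_zero_off[OF Ub]) (use test_functions_outside[OF test_functions_deriv[OF \<phi>]] in auto)
    show "(LINT p|lebesgue_on U. \<phi> p * (g p \<bullet> h)) = (LINT p|lborel. \<phi> p * (g p \<bullet> h))"
      by (rule LINT_lebesgue_on_zero_off[OF Ub]) (use test_functions_outside[OF \<phi>] in auto)
  qed
  then show ?thesis unfolding has_weak_grad_iff[OF U li] by simp
qed

lemma frechet_mult:
  assumes "smooth f" "smooth g"
  shows "frechet_derivative (\<lambda>x. f x * g x) (at x) h = f x * frechet_derivative g (at x) h + frechet_derivative f (at x) h * g x"
  using frechet_derivative_at[OF has_derivative_mult[OF smooth_deriv(1)[OF assms(1)] smooth_deriv(1)[OF assms(2)]], symmetric]
  by simp

text \<open>The derivative of the product of \<open>\<psi>\<close> with a test function has integral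
  zero, and the product rule splits it into the two sides.\<close>

lemma has_weak_grad_smooth:
  fixes \<psi> :: "'a::euclidean_space \<times> real \<Rightarrow> real"
  assumes U: "open U" and \<psi>: "smooth \<psi>"
  shows "has_weak_grad U \<psi> (space_grad \<psi>)"
proof -
  have cont: "continuous_on UNIV \<psi>" "continuous_on UNIV (space_grad \<psi>)"
    using \<psi> by (auto intro: smooth_continuous continuous_space_grad)
  show ?thesis
  proof (subst has_weak_grad_borel_iff[OF U], goal_cases)
    case 5
    show ?case
    proof (intro ballI allI)
      fix \<phi> :: "'a \<times> real \<Rightarrow> real" and h :: 'a assume \<phi>: "\<phi> \<in> test_functions U"
      have i1: "integrable lborel (\<lambda>p. \<psi> p * frechet_derivative \<phi> (at p) (h, 0))"
        by (intro test_functions_integrable[of _ U] test_functions_mult test_functions_deriv \<phi> \<psi>)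
      have "integrable lborel (\<lambda>p. frechet_derivative \<psi> (at p) (h, 0) * \<phi> p)"
        by (intro test_functions_integrable[of _ U] test_functions_mult smooth_deriv(2) \<phi> \<psi>)
      then have i2: "integrable lborel (\<lambda>p. \<phi> p * (space_grad \<psi> p \<bullet> h))"
        by (simp add: space_grad_inner[OF \<psi>] mult.commute)
      have "0 = (LINT p|lborel. frechet_derivative (\<lambda>p. \<psi> p * \<phi> p) (at p) (h, 0))"
        by (rule integral_directional_derivative_zero[symmetric]) (rule test_functions_mult[OF \<phi> \<psi>])
      also have "\<dots> = (LINT p|lborel. \<psi> p * frechet_derivative \<phi> (at p) (h, 0) + \<phi> p * (space_grad \<psi> p \<bullet> h))"
        by (rule Bochner_Integration.integral_cong[OF refl])
           (simp add: frechet_mult[OF \<psi> test_functions_smooth[OF \<phi>]] space_grad_inner[OF \<psi>])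
      also have "\<dots> = (LINT p|lborel. \<psi> p * frechet_derivative \<phi> (at p) (h, 0)) + (LINT p|lborel. \<phi> p * (space_grad \<psi> p \<bullet> h))"
        by (rule Bochner_Integration.integral_add[OF i1 i2])
      finally show "(LINT p|lborel. \<psi> p * frechet_derivative \<phi> (at p) (h, 0)) = - (LINT p|lborel. \<phi> p * (space_grad \<psi> p \<bullet> h))"
        by simp
    qed
  qed (use cont in \<open>auto intro: locally_integrable_continuous borel_measurable_continuous_onI\<close>)
qed

lemma has_weak_grad_add:
  assumes "open U" "has_weak_grad U v1 g1" "has_weak_grad U v2 g2"
  shows "has_weak_grad U (\<lambda>p. v1 p + v2 p) (\<lambda>p. g1 p + g2 p)"
proof -
  have Ul: "U \<in> sets lebesgue" using assms by (simp add: borel_open)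
  have li: "locally_integrable U v1" "locally_integrable U v2" "locally_integrable U g1" "locally_integrable U g2"
    using assms by (auto simp: has_weak_grad_def)
  then have li': "locally_integrable U (\<lambda>p. v1 p + v2 p)" "locally_integrable U (\<lambda>p. g1 p + g2 p)"
    by (auto simp: locally_integrable_def)
  show ?thesis unfolding has_weak_grad_iff[OF assms(1) li']
  proof (intro ballI allI)
    fix \<phi> h assume \<phi>: "\<phi> \<in> test_functions U"
    have i: "integrable (lebesgue_on U) (\<lambda>p. v p * frechet_derivative \<phi> (at p) (h, 0))" if "locally_integrable U v" for v
      using integrable_test_scaleR[OF Ul that test_functions_deriv[OF \<phi>]] by (simp add: mult.commute)
    have j: "integrable (lebesgue_on U) (\<lambda>p. \<phi> p * (g p \<bullet> h))" if "locally_integrable U g" for g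
      using integrable_test_scaleR[OF Ul locally_integrable_inner[OF that] \<phi>] by simp
    show "(LINT p|lebesgue_on U. (v1 p + v2 p) * frechet_derivative \<phi> (at p) (h, 0)) = - (LINT p|lebesgue_on U. \<phi> p * ((g1 p + g2 p) \<bullet> h))"
      using assms(2,3) \<phi> has_weak_grad_iff[OF assms(1) li(1,3)] has_weak_grad_iff[OF assms(1) li(2,4)]
      by (simp add: distrib_right distrib_left inner_add_left i j li)
  qed
qed

section \<open>Slices in time\<close>

lemma lborel_Fubini:
  fixes f :: "'a::euclidean_space \<times> 'b::euclidean_space \<Rightarrow> 'c::{banach, second_countable_topology}"
  assumes "integrable lborel f"
  shows "(LINT p|lborel. f p) = (LINT t|lborel. LINT x|lborel. f (x, t))"
    "(LINT p|lborel. f p) = (LINT x|lborel. LINT t|lborel. f (x, t))"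
  using lborel_pair.integral_snd[of "\<lambda>x t. f (x, t)"] lborel_pair.integral_fst'[of f] assms
  by (simp_all add: lborel_prod)

lemma test_functions_tensor:
  fixes \<zeta> :: "'a::euclidean_space \<Rightarrow> real" and \<eta> :: "real \<Rightarrow> real"
  assumes \<zeta>: "\<zeta> \<in> test_functions \<Omega>" and \<eta>: "\<eta> \<in> test_functions J"
  shows "(\<lambda>p. \<zeta> (fst p) * \<eta> (snd p)) \<in> test_functions (\<Omega> \<times> J)"
    and "frechet_derivative (\<lambda>p. \<zeta> (fst p) * \<eta> (snd p)) (at (x, t)) (h, r)
      = \<zeta> x * (deriv \<eta> t * r) + frechet_derivative \<zeta> (at x) h * \<eta> t"
proof -
  from \<zeta> obtain K where K: "smooth \<zeta>" "compact K" "K \<subseteq> \<Omega>" "\<And>x. x \<notin> K \<Longrightarrow> \<zeta> x = 0"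
    by (rule test_functionsE) blast
  from \<eta> obtain M where M: "smooth \<eta>" "compact M" "M \<subseteq> J" "\<And>x. x \<notin> M \<Longrightarrow> \<eta> x = 0"
    by (rule test_functionsE) blast
  have s: "smooth (\<lambda>p::'a \<times> real. \<zeta> (fst p))" "smooth (\<lambda>p::'a \<times> real. \<eta> (snd p))"
    using smooth_affine[OF K(1) bounded_linear_fst, of 0] smooth_affine[OF M(1) bounded_linear_snd, of 0] by auto
  then show "(\<lambda>p. \<zeta> (fst p) * \<eta> (snd p)) \<in> test_functions (\<Omega> \<times> J)"
    using K(2,3) M(2,3) K(4) M(4)
    by (intro test_functionsI[of _ "K \<times> M"] smooth_mult compact_Times Sigma_mono) (auto, blast+)
  have d1: "frechet_derivative (\<lambda>p. \<zeta> (fst p)) (at (x, t)) (h, r) = frechet_derivative \<zeta> (at x) h"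
  proof -
    have "((\<lambda>p. \<zeta> (fst p)) has_derivative (\<lambda>h. frechet_derivative \<zeta> (at x) (fst h))) (at (x, t))"
      by (rule has_derivative_compose[OF has_derivative_fst[OF has_derivative_ident]])
         (simp add: smooth_deriv(1)[OF K(1)])
    from frechet_derivative_at[OF this, symmetric] show ?thesis by (simp only: fst_conv)
  qed
  have e: "(\<eta> has_derivative (\<lambda>r. deriv \<eta> t * r)) (at t)"
  proof -
    have "\<eta> differentiable (at t)" using smooth_deriv(1)[OF M(1), of t] unfolding differentiable_def by blast
    then have "DERIV \<eta> t :> deriv \<eta> t" by (simp only: DERIV_deriv_iff_real_differentiable)
    then show ?thesis by (simp only: has_field_derivative_def)
  qed
  have d2: "frechet_derivative (\<lambda>p. \<eta> (snd p)) (at (x, t)) (h, r) = deriv \<eta> t * r"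
  proof -
    have "((\<lambda>p. \<eta> (snd p)) has_derivative (\<lambda>h. deriv \<eta> t * snd h)) (at (x, t))"
      by (rule has_derivative_compose[OF has_derivative_snd[OF has_derivative_ident]]) (simp add: e)
    from frechet_derivative_at[OF this, symmetric] show ?thesis by (simp only: snd_conv)
  qed
  show "frechet_derivative (\<lambda>p. \<zeta> (fst p) * \<eta> (snd p)) (at (x, t)) (h, r)
      = \<zeta> x * (deriv \<eta> t * r) + frechet_derivative \<zeta> (at x) h * \<eta> t"
    by (simp add: frechet_mult[OF s] d1 d2)
qed

lemma borel_pair_fst_snd[measurable (raw)]:
  fixes g :: "'a::euclidean_space \<times> real \<Rightarrow> 'b::euclidean_space"
  assumes "g \<in> borel_measurable borel" "f1 \<in> N \<rightarrow>\<^sub>M borel" "f2 \<in> N \<rightarrow>\<^sub>M borel"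
  shows "(\<lambda>x. g (f1 x, f2 x)) \<in> borel_measurable N"
  by (rule measurable_compose[OF borel_measurable_Pair[OF assms(2,3)] assms(1)])

text \<open>Products of \<open>\<zeta>\<close> with test functions in time reduce the claim to the
  fundamental lemma in one variable. The exceptional null set of times depends on
  \<open>\<zeta>\<close> and \<open>h\<close>; removing that dependence takes continuity in
  time.\<close>

lemma weak_grad_slice:
  fixes v :: "'a::euclidean_space \<times> real \<Rightarrow> real"
  assumes \<Omega>: "open \<Omega>" and J: "open J" and w: "has_weak_grad (\<Omega> \<times> J) v g"
    and [measurable]: "v \<in> borel_measurable borel" "g \<in> borel_measurable borel"
    and bd: "\<And>p. \<bar>v p\<bar> \<le> C" "\<And>p. norm (g p) \<le> C"
    and \<zeta>: "\<zeta> \<in> test_functions \<Omega>"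
  shows "AE s in lborel. s \<in> J \<longrightarrow>
    (LINT x|lborel. v (x, s) * frechet_derivative \<zeta> (at x) h) = - (LINT x|lborel. \<zeta> x * (g (x, s) \<bullet> h))"
proof -
  have Q: "open (\<Omega> \<times> J)" using \<Omega> J by (rule open_Times)
  have C: "0 \<le> C" using bd(1)[of undefined] by linarith
  define D where "D x = frechet_derivative \<zeta> (at x) h" for x
  have Dt: "D \<in> test_functions \<Omega>" unfolding D_def[abs_def] by (rule test_functions_deriv[OF \<zeta>])
  have [measurable]: "\<zeta> \<in> borel_measurable borel" "D \<in> borel_measurable borel"
    using \<zeta> Dt by (auto intro: test_functions_borel)
  define e where "e s = (LINT x|lborel. v (x, s) * D x + \<zeta> x * (g (x, s) \<bullet> h))" for s
  have i1: "integrable lborel (\<lambda>x. v (x, s) * D x)" for s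
    by (rule Bochner_Integration.integrable_bound[OF integrable_mult_right[OF integrable_abs[OF test_functions_integrable[OF Dt]], of C]])
       (use bd(1) C in \<open>auto simp: abs_mult intro!: AE_I2 mult_right_mono\<close>)
  have gh: "\<bar>g p \<bullet> h\<bar> \<le> C * norm h" for p
    using Cauchy_Schwarz_ineq2[of "g p" h] mult_right_mono[OF bd(2)[of p] norm_ge_zero[of h]] by linarith
  have i2: "integrable lborel (\<lambda>x. \<zeta> x * (g (x, s) \<bullet> h))" for s
  proof (rule Bochner_Integration.integrable_bound[OF integrable_mult_right[OF integrable_abs[OF test_functions_integrable[OF \<zeta>]], of "C * norm h"]])
    show "AE x in lborel. norm (\<zeta> x * (g (x, s) \<bullet> h)) \<le> norm (C * norm h * \<bar>\<zeta> x\<bar>)"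
      using mult_right_mono[OF gh abs_ge_zero] C by (intro AE_I2) (auto simp: abs_mult mult.commute)
  qed measurable
  have em[measurable]: "e \<in> borel_measurable borel" unfolding e_def[abs_def] by measurable
  have eb: "\<bar>e s\<bar> \<le> C * (LINT x|lborel. \<bar>D x\<bar>) + C * norm h * (LINT x|lborel. \<bar>\<zeta> x\<bar>)" for s
  proof -
    have "\<bar>e s\<bar> \<le> (LINT x|lborel. \<bar>v (x, s) * D x + \<zeta> x * (g (x, s) \<bullet> h)\<bar>)"
      unfolding e_def by (rule integral_abs_bound)
    also have "\<dots> \<le> (LINT x|lborel. C * \<bar>D x\<bar> + C * norm h * \<bar>\<zeta> x\<bar>)"
    proof (rule integral_mono)
      fix x
      have "\<bar>v (x, s) * D x\<bar> \<le> C * \<bar>D x\<bar>" "\<bar>\<zeta> x * (g (x, s) \<bullet> h)\<bar> \<le> C * norm h * \<bar>\<zeta> x\<bar>"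
        using mult_right_mono[OF bd(1) abs_ge_zero] mult_right_mono[OF gh abs_ge_zero]
        by (auto simp: abs_mult mult.commute)
      then show "\<bar>v (x, s) * D x + \<zeta> x * (g (x, s) \<bullet> h)\<bar> \<le> C * \<bar>D x\<bar> + C * norm h * \<bar>\<zeta> x\<bar>" by linarith
    qed (use i1 i2 test_functions_integrable[OF Dt] test_functions_integrable[OF \<zeta>] in auto)
    also have "\<dots> = C * (LINT x|lborel. \<bar>D x\<bar>) + C * norm h * (LINT x|lborel. abs (\<zeta> x))"
      using test_functions_integrable[OF Dt] test_functions_integrable[OF \<zeta>] by simp
    finally show ?thesis .
  qed
  have "AE s in lebesgue_on J. e s = 0"
  proof (rule fundamental_lemma[OF J])
    show "locally_integrable J e" using em eb by (intro locally_integrable_bounded) auto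
    fix \<eta> assume \<eta>: "\<eta> \<in> test_functions J"
    have [measurable]: "\<eta> \<in> borel_measurable borel" using \<eta> by (rule test_functions_borel)
    define \<phi> where "\<phi> = (\<lambda>p::'a \<times> real. \<zeta> (fst p) * \<eta> (snd p))"
    have \<phi>: "\<phi> \<in> test_functions (\<Omega> \<times> J)" unfolding \<phi>_def by (rule test_functions_tensor[OF \<zeta> \<eta>])
    have d\<phi>: "frechet_derivative \<phi> (at (x, t)) (h, 0) = D x * \<eta> t" for x t
      unfolding \<phi>_def D_def by (simp add: test_functions_tensor(2)[OF \<zeta> \<eta>])
    have \<phi>x: "\<phi> (x, t) = \<zeta> x * \<eta> t" for x t by (simp add: \<phi>_def)
    have li: "locally_integrable (\<Omega> \<times> J) v" "locally_integrable (\<Omega> \<times> J) g"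
      using w by (auto simp: has_weak_grad_def)
    have eq: "(LINT p|lborel. v p * frechet_derivative \<phi> (at p) (h, 0)) = - (LINT p|lborel. \<phi> p * (g p \<bullet> h))"
      using w \<phi> has_weak_grad_borel_iff[OF Q li] by simp
    have j1: "integrable lborel (\<lambda>p. v p * frechet_derivative \<phi> (at p) (h, 0))"
      using integrable_mult_right[OF integrable_abs[OF test_functions_integrable[OF test_functions_deriv[OF \<phi>, of "(h, 0)"]]], of C]
    proof (rule Bochner_Integration.integrable_bound)
      have "(\<lambda>p. frechet_derivative \<phi> (at p) (h, 0)) \<in> borel_measurable borel"
        by (rule test_functions_borel[OF test_functions_deriv[OF \<phi>]])
      then show "(\<lambda>p. v p * frechet_derivative \<phi> (at p) (h, 0)) \<in> borel_measurable lborel" by measurable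
    qed (use bd(1) C in \<open>auto simp: abs_mult intro!: AE_I2 mult_right_mono\<close>)
    have j2: "integrable lborel (\<lambda>p. \<phi> p * (g p \<bullet> h))"
      using integrable_mult_right[OF integrable_abs[OF test_functions_integrable[OF \<phi>]], of "C * norm h"]
    proof (rule Bochner_Integration.integrable_bound)
      have "\<phi> \<in> borel_measurable borel" by (rule test_functions_borel[OF \<phi>])
      then show "(\<lambda>p. \<phi> p * (g p \<bullet> h)) \<in> borel_measurable lborel" by measurable
      show "AE p in lborel. norm (\<phi> p * (g p \<bullet> h)) \<le> norm (C * norm h * \<bar>\<phi> p\<bar>)"
        using mult_right_mono[OF gh abs_ge_zero] C by (intro AE_I2) (auto simp: abs_mult mult.commute)
    qed
    have "(LINT s|lebesgue_on J. \<eta> s * e s) = (LINT s|lborel. \<eta> s * e s)"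
      by (rule LINT_lebesgue_on_zero_off) (use J test_functions_outside[OF \<eta>] in auto)
    also have "\<dots> = (LINT s|lborel. LINT x|lborel. v (x, s) * frechet_derivative \<phi> (at (x, s)) (h, 0) + \<phi> (x, s) * (g (x, s) \<bullet> h))"
    proof (rule Bochner_Integration.integral_cong[OF refl])
      fix s
      have "\<eta> s * e s = (LINT x|lborel. \<eta> s * (v (x, s) * D x + \<zeta> x * (g (x, s) \<bullet> h)))"
        unfolding e_def by simp
      also have "\<dots> = (LINT x|lborel. v (x, s) * frechet_derivative \<phi> (at (x, s)) (h, 0) + \<phi> (x, s) * (g (x, s) \<bullet> h))"
        by (rule Bochner_Integration.integral_cong[OF refl]) (simp add: d\<phi> \<phi>x algebra_simps)
      finally show "\<eta> s * e s = \<dots>" .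
    qed
    also have "\<dots> = (LINT p|lborel. v p * frechet_derivative \<phi> (at p) (h, 0) + \<phi> p * (g p \<bullet> h))"
      by (rule lborel_Fubini(1)[symmetric]) (intro Bochner_Integration.integrable_add j1 j2)
    also have "\<dots> = 0" using eq by (simp add: Bochner_Integration.integral_add[OF j1 j2])
    finally show "(LINT s|lebesgue_on J. \<eta> s * e s) = 0" .
  qed
  then have "AE s in lborel. s \<in> J \<longrightarrow> e s = 0"
    using J by (subst (asm) AE_lebesgue_on_iff) (auto simp: borel_open)
  then show ?thesis
  proof eventually_elim
    case (elim s)
    have "e s = (LINT x|lborel. v (x, s) * D x) + (LINT x|lborel. \<zeta> x * (g (x, s) \<bullet> h))"
      unfolding e_def by (rule Bochner_Integration.integral_add[OF i1 i2])
    with elim show ?case by (auto simp: D_def)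
  qed
qed

subsection \<open>Exponential averages in time\<close>

lemma LINT_FTC:
  fixes F f :: "real \<Rightarrow> real"
  assumes "a \<le> b" "\<And>t. t \<in> {a..b} \<Longrightarrow> (F has_real_derivative f t) (at t within {a..b})"
    and "continuous_on {a..b} f"
  shows "(LINT t|lborel. indicator {a..b} t * f t) = F b - F a"
    "integrable lborel (\<lambda>t. indicator {a..b} t * f t)"
proof -
  have s: "set_integrable lborel {a..b} f"
    unfolding set_integrable_def by (intro borel_integrable_compact assms compact_Icc)
  then show "integrable lborel (\<lambda>t. indicator {a..b} t * f t)" by (simp add: set_integrable_def)
  have "(f has_integral (F b - F a)) {a..b}"
    using assms by (intro fundamental_theorem_of_calculus) (auto simp: has_real_derivative_iff_has_vector_derivative)
  then show "(LINT t|lborel. indicator {a..b} t * f t) = F b - F a"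
    using set_borel_integral_eq_integral(2)[OF s] by (simp add: set_lebesgue_integral_def integral_unique)
qed

lemma test_functions_slice:
  fixes \<phi> :: "'a::euclidean_space \<times> real \<Rightarrow> real"
  assumes \<phi>: "\<phi> \<in> test_functions (\<Omega> \<times> J)"
  shows "(\<lambda>x. \<phi> (x, t)) \<in> test_functions \<Omega>"
    and "frechet_derivative (\<lambda>x. \<phi> (x, t)) (at x) h = frechet_derivative \<phi> (at (x, t)) (h, 0)"
proof -
  from \<phi> obtain K where K: "smooth \<phi>" "compact K" "K \<subseteq> \<Omega> \<times> J" "\<And>x. x \<notin> K \<Longrightarrow> \<phi> x = 0"
    by (rule test_functionsE) blast
  have bl: "bounded_linear (\<lambda>x::'a. (x, 0::real))" by (intro bounded_linear_Pair bounded_linear_ident bounded_linear_zero)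
  have sm: "smooth (\<lambda>x. \<phi> (x, t))" using smooth_affine[OF K(1) bl, of "(0, t)"] by simp
  show "(\<lambda>x. \<phi> (x, t)) \<in> test_functions \<Omega>"
  proof (rule test_functionsI[OF sm])
    show "compact (fst ` K)" by (intro compact_continuous_image continuous_intros K)
    show "fst ` K \<subseteq> \<Omega>" using K(3) by auto
    show "\<phi> (x, t) = 0" if "x \<notin> fst ` K" for x using that by (intro K(4)) force
  qed
  have "((\<lambda>x. \<phi> (x, t)) has_derivative (\<lambda>h. frechet_derivative \<phi> (at (x, t)) (h, 0))) (at x)"
  proof (rule has_derivative_compose[OF _ smooth_deriv(1)[OF K(1)]])
    show "((\<lambda>y. (y, t)) has_derivative (\<lambda>h. (h, 0))) (at x)"
      by (intro has_derivative_Pair has_derivative_ident has_derivative_const)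
  qed
  from frechet_derivative_at[OF this]
  show "frechet_derivative (\<lambda>x. \<phi> (x, t)) (at x) h = frechet_derivative \<phi> (at (x, t)) (h, 0)" by (metis (no_types))
qed

lemma borel_measurable_fst_snd[measurable]:
  "fst \<in> borel_measurable (borel :: ('a::euclidean_space \<times> real) measure)"
  "snd \<in> borel_measurable (borel :: ('a::euclidean_space \<times> real) measure)"
  by (intro borel_measurable_continuous_onI continuous_intros)+

lemma borel_measurable_fst_fst[measurable]:
  "(\<lambda>x. fst (fst x)) \<in> borel_measurable ((borel :: ('a::euclidean_space \<times> real) measure) \<Otimes>\<^sub>M lborel)"
  "(\<lambda>x. snd (fst x)) \<in> borel_measurable ((borel :: ('a::euclidean_space \<times> real) measure) \<Otimes>\<^sub>M lborel)"
  by (rule measurable_compose[OF measurable_fst borel_measurable_fst_snd(1)],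
      rule measurable_compose[OF measurable_fst borel_measurable_fst_snd(2)])

section \<open>Averages in time and their weak gradients\<close>

text \<open>A non-measurable \<open>F\<close> is covered by the convention that its Bochner integral
  is zero.\<close>

lemma norm_kernel_integral_le:
  fixes F :: "real \<Rightarrow> 'b::euclidean_space"
  assumes S: "S \<in> sets borel" "bounded S" and F: "\<And>s. norm (F s) \<le> C" "\<And>s. s \<notin> S \<Longrightarrow> F s = 0"
  shows "norm (LINT s|lborel. F s) \<le> C * Sigma_Algebra.measure lborel S"
proof (cases "F \<in> borel_measurable borel")
  case True
  have C: "0 \<le> C" using F(1)[of 0] norm_ge_zero order_trans by blast
  have i: "integrable lborel F" by (rule integrable_bounded_support[OF True S(2) F])
  have fin: "emeasure lborel S < \<infinity>" using emeasure_bounded_finite[OF S(2)] .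
  have i2: "integrable lborel (\<lambda>s. indicator S s * C :: real)"
    using S fin by (intro integrable_mult_left integrable_real_indicator) auto
  have "norm (LINT s|lborel. F s) \<le> (LINT s|lborel. norm (F s))" by (rule integral_norm_bound)
  also have "\<dots> \<le> (LINT s|lborel. indicator S s * C)"
  proof (rule integral_mono[OF integrable_norm[OF i] i2])
    fix s show "norm (F s) \<le> indicator S s * C" using F by (cases "s \<in> S") auto
  qed
  also have "\<dots> = C * Sigma_Algebra.measure lborel S" using S by simp
  finally show ?thesis .
next
  case False
  then have "\<not> integrable lborel F" by auto
  moreover have "0 \<le> C" using F(1)[of 0] norm_ge_zero order_trans by blast
  ultimately show ?thesis by (simp add: not_integrable_integral_eq)
qed

text \<open>Only time is averaged, so the space derivative passes under the integral: the slice
  identity at time \<open>s\<close>, with the test function frozen at time \<open>t\<close>, is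
  multiplied by \<open>K t s\<close> and integrated over \<open>s\<close>. The set \<open>S\<close>
  may exceed \<open>J\<close> by a null set, because the kernel in use lives on a closed
  interval.\<close>

lemma weak_grad_kernel:
  fixes v :: "'a::euclidean_space \<times> real \<Rightarrow> real" and K :: "real \<Rightarrow> real \<Rightarrow> real"
  assumes \<Omega>: "open \<Omega>" and J: "open J" and w: "has_weak_grad (\<Omega> \<times> J) v g"
    and vb[measurable]: "v \<in> borel_measurable borel" "g \<in> borel_measurable borel"
    and bd: "\<And>p. \<bar>v p\<bar> \<le> C" "\<And>p. norm (g p) \<le> C"
    and Km[measurable]: "(\<lambda>p. K (fst p) (snd p)) \<in> borel_measurable borel"
    and KB: "\<And>t s. \<bar>K t s\<bar> \<le> B" and KS: "\<And>t s. s \<notin> S \<Longrightarrow> K t s = 0"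
    and S: "S \<in> sets borel" "bounded S" and SJ: "AE s in lborel. s \<in> S \<longrightarrow> s \<in> J"
  shows "has_weak_grad (\<Omega> \<times> J) (\<lambda>p. LINT s|lborel. K (snd p) s * v (fst p, s))
           (\<lambda>p. LINT s|lborel. K (snd p) s *\<^sub>R g (fst p, s))"
proof -
  let ?V = "\<lambda>p. LINT s|lborel. K (snd p) s * v (fst p, s)"
  let ?G = "\<lambda>p. LINT s|lborel. K (snd p) s *\<^sub>R g (fst p, s)"
  have Q: "open (\<Omega> \<times> J)" using \<Omega> J by (rule open_Times)
  have C: "0 \<le> C" using bd(1)[of undefined] by linarith
  have B: "0 \<le> B" using KB[of 0 0] by linarith
  have Kt[measurable (raw)]: "(\<lambda>x. K (f1 x) (f2 x)) \<in> borel_measurable N"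
    if "f1 \<in> borel_measurable N" "f2 \<in> borel_measurable N" for f1 f2 and N :: "'z measure"
    using measurable_compose[OF borel_measurable_Pair[OF that] Km] by simp
  have vm: "?V \<in> borel_measurable borel"
    by (rule lborel.borel_measurable_lebesgue_integral) (unfold split_beta', measurable)
  have gm: "?G \<in> borel_measurable borel"
    by (rule lborel.borel_measurable_lebesgue_integral) (unfold split_beta', measurable)
  have Kv: "norm (K t s * v (x, s)) \<le> B * C" for t s x
    using mult_mono[OF KB[of t s] bd(1)[of "(x, s)"] B abs_ge_zero] by (simp add: abs_mult)
  have Kg: "norm (K t s *\<^sub>R g (x, s)) \<le> B * C" for t s x
    using mult_mono[OF KB[of t s] bd(2)[of "(x, s)"] B norm_ge_zero] by simp
  let ?M = "B * C * Sigma_Algebra.measure lborel S"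
  have Vb: "norm (?V p) \<le> ?M" for p
    by (rule norm_kernel_integral_le[OF S]) (use Kv KS in auto)
  have Gb: "norm (?G p) \<le> ?M" for p
    by (rule norm_kernel_integral_le[OF S]) (use Kg KS in auto)
  have iv: "integrable lborel (\<lambda>s. K t s * v (x, s))" for t x
    by (rule integrable_bounded_support[OF _ S(2) Kv]) (use KS in auto)
  have ig: "integrable lborel (\<lambda>s. K t s *\<^sub>R g (x, s))" for t x
    by (rule integrable_bounded_support[OF _ S(2) Kg]) (use KS in auto)
  show ?thesis
  proof (subst has_weak_grad_borel_iff[OF Q _ _ vm gm], goal_cases)
    case 1 show ?case by (rule locally_integrable_bounded[OF vm Vb])
  next
    case 2 show ?case by (rule locally_integrable_bounded[OF gm Gb])
  next
    case 3
    show ?case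
    proof (intro ballI allI)
      fix \<phi> h assume \<phi>: "\<phi> \<in> test_functions (\<Omega> \<times> J)"
      define D where "D p = frechet_derivative \<phi> (at p) (h, 0)" for p
      have Dt: "D \<in> test_functions (\<Omega> \<times> J)" unfolding D_def[abs_def] by (rule test_functions_deriv[OF \<phi>])
      have [measurable]: "\<phi> \<in> borel_measurable borel" "D \<in> borel_measurable borel"
        using \<phi> Dt by (auto intro: test_functions_borel)
      from \<phi> obtain KK where KK: "compact KK" "\<And>x. x \<notin> KK \<Longrightarrow> \<phi> x = 0" by (rule test_functionsE) blast
      from Dt obtain KD where KD: "compact KD" "\<And>x. x \<notin> KD \<Longrightarrow> D x = 0" by (rule test_functionsE) blast
      obtain B1 where B1: "0 < B1" "\<And>p. \<bar>\<phi> p\<bar> \<le> B1" using test_functions_bounded[OF \<phi>] by blast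
      obtain B2 where B2: "0 < B2" "\<And>p. \<bar>D p\<bar> \<le> B2" using test_functions_bounded[OF Dt] by blast
      have gh: "\<bar>g p \<bullet> h\<bar> \<le> C * norm h" for p
        using Cauchy_Schwarz_ineq2[of "g p" h] mult_right_mono[OF bd(2)[of p] norm_ge_zero[of h]] by linarith
      \<comment> \<open>The test function is taken at time \<open>t\<close>, the slices of
        \<open>v\<close> and \<open>g\<close> at time \<open>s\<close>. With the two times
        decoupled, the identity holds for each \<open>t\<close> separately.\<close>
      have E0: "(LINT x|lborel. ?V (x, t) * D (x, t) + \<phi> (x, t) * (?G (x, t) \<bullet> h)) = 0" for t
      proof -
        define F where "F x s = K t s * (v (x, s) * D (x, t) + \<phi> (x, t) * (g (x, s) \<bullet> h))" for x s
        have Fm: "(\<lambda>p. F (fst p) (snd p)) \<in> borel_measurable borel"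
          unfolding F_def by measurable
        have "bounded (fst ` KK \<union> fst ` KD)"
          using KK(1) KD(1) by (auto intro!: compact_imp_bounded compact_continuous_image continuous_intros)
        then have bS: "bounded ((fst ` KK \<union> fst ` KD) \<times> S)" using S(2) by (rule bounded_Times)
        have Fi: "integrable lborel (\<lambda>p. F (fst p) (snd p))"
        proof (rule integrable_bounded_support[OF Fm bS])
          fix p
          have "\<bar>v (fst p, snd p) * D (fst p, t)\<bar> \<le> C * B2"
            using mult_mono[OF bd(1) B2(2) C abs_ge_zero] by (simp add: abs_mult)
          moreover have "\<bar>\<phi> (fst p, t) * (g (fst p, snd p) \<bullet> h)\<bar> \<le> B1 * (C * norm h)"
            using mult_mono[OF B1(2) gh less_imp_le[OF B1(1)] abs_ge_zero] by (simp add: abs_mult)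
          ultimately have "\<bar>v (fst p, snd p) * D (fst p, t) + \<phi> (fst p, t) * (g (fst p, snd p) \<bullet> h)\<bar> \<le> C * B2 + B1 * (C * norm h)"
            by linarith
          then show "norm (F (fst p) (snd p)) \<le> B * (C * B2 + B1 * (C * norm h))"
            unfolding F_def using mult_mono[OF KB _ B abs_ge_zero] by (simp add: abs_mult)
        next
          fix p assume "p \<notin> (fst ` KK \<union> fst ` KD) \<times> S"
          then consider "snd p \<notin> S" | "fst p \<notin> fst ` KK" "fst p \<notin> fst ` KD" by (cases p) auto
          then show "F (fst p) (snd p) = 0"
          proof cases
            case 1 then show ?thesis by (simp add: F_def KS)
          next
            case 2
            then have "(fst p, t) \<notin> KK \<and> (fst p, t) \<notin> KD"
              using image_eqI[of "fst p" fst "(fst p, t)"] by auto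
            then show ?thesis by (simp add: F_def KK KD)
          qed
        qed
        have "(LINT x|lborel. ?V (x, t) * D (x, t) + \<phi> (x, t) * (?G (x, t) \<bullet> h)) = (LINT x|lborel. LINT s|lborel. F x s)"
        proof (rule Bochner_Integration.integral_cong[OF refl])
          fix x
          have i1: "integrable lborel (\<lambda>s. D (x, t) * (K t s * v (x, s)))" using iv by (rule integrable_mult_right)
          have i2: "integrable lborel (\<lambda>s. \<phi> (x, t) * ((K t s *\<^sub>R g (x, s)) \<bullet> h))"
            by (intro integrable_mult_right integrable_inner_left ig)
          have "?G (x, t) \<bullet> h = (LINT s|lborel. (K t s *\<^sub>R g (x, s)) \<bullet> h)"
            using ig[of t x] by (subst integral_inner_left) auto
          then have "?V (x, t) * D (x, t) + \<phi> (x, t) * (?G (x, t) \<bullet> h)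
            = (LINT s|lborel. D (x, t) * (K t s * v (x, s))) + (LINT s|lborel. \<phi> (x, t) * ((K t s *\<^sub>R g (x, s)) \<bullet> h))"
            by (simp only: Bochner_Integration.integral_mult_right_zero fst_conv snd_conv mult.commute)
          also have "\<dots> = (LINT s|lborel. D (x, t) * (K t s * v (x, s)) + \<phi> (x, t) * ((K t s *\<^sub>R g (x, s)) \<bullet> h))"
            by (rule Bochner_Integration.integral_add[OF i1 i2, symmetric])
          also have "\<dots> = (LINT s|lborel. F x s)"
            by (rule Bochner_Integration.integral_cong[OF refl]) (simp add: F_def algebra_simps)
          finally show "?V (x, t) * D (x, t) + \<phi> (x, t) * (?G (x, t) \<bullet> h) = (LINT s|lborel. F x s)" .
        qed
        also have "\<dots> = (LINT s|lborel. LINT x|lborel. F x s)"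
          using lborel_Fubini[OF Fi] by simp
        also have "\<dots> = (LINT s|(lborel :: real measure). 0)"
        proof (rule integral_cong_AE)
          show "(\<lambda>s. LINT x|lborel. F x s) \<in> borel_measurable lborel" unfolding F_def by measurable
          show "AE s in lborel. (LINT x|lborel. F x s) = 0"
            using weak_grad_slice[OF \<Omega> J w vb bd test_functions_slice(1)[OF \<phi>, of t], of h] SJ
          proof eventually_elim
            case (elim s)
            show ?case
            proof (cases "s \<in> S")
              case True
              have e: "(LINT x|lborel. v (x, s) * D (x, t)) = - (LINT x|lborel. \<phi> (x, t) * (g (x, s) \<bullet> h))"
                using elim True by (simp add: test_functions_slice(2)[OF \<phi>] D_def)
              have j1: "integrable lborel (\<lambda>x. v (x, s) * D (x, t))"
              proof (rule integrable_bounded_support[of _ "fst ` KD" "C * B2"])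
                show "bounded (fst ` KD)"
                  using KD(1) by (auto intro!: compact_imp_bounded compact_continuous_image continuous_intros)
                show "norm (v (x, s) * D (x, t)) \<le> C * B2" for x
                  using mult_mono[OF bd(1) B2(2) C abs_ge_zero] by (simp add: abs_mult)
                show "v (x, s) * D (x, t) = 0" if "x \<notin> fst ` KD" for x
                proof -
                  have "(x, t) \<notin> KD" using that by force
                  then show ?thesis by (simp add: KD)
                qed
              qed measurable
              have j2: "integrable lborel (\<lambda>x. \<phi> (x, t) * (g (x, s) \<bullet> h))"
              proof (rule integrable_bounded_support[of _ "fst ` KK" "B1 * (C * norm h)"])
                show "bounded (fst ` KK)"
                  using KK(1) by (auto intro!: compact_imp_bounded compact_continuous_image continuous_intros)
                show "norm (\<phi> (x, t) * (g (x, s) \<bullet> h)) \<le> B1 * (C * norm h)" for x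
                  using mult_mono[OF B1(2) gh less_imp_le[OF B1(1)] abs_ge_zero] by (simp add: abs_mult)
                show "\<phi> (x, t) * (g (x, s) \<bullet> h) = 0" if "x \<notin> fst ` KK" for x
                proof -
                  have "(x, t) \<notin> KK" using that by force
                  then show ?thesis by (simp add: KK)
                qed
              qed measurable
              have "(LINT x|lborel. F x s) = K t s * (LINT x|lborel. v (x, s) * D (x, t) + \<phi> (x, t) * (g (x, s) \<bullet> h))"
                unfolding F_def by (rule Bochner_Integration.integral_mult_right_zero)
              also have "\<dots> = 0" using e by (simp add: Bochner_Integration.integral_add[OF j1 j2])
              finally show ?thesis .
            qed (simp add: F_def KS)
          qed measurable
        qed simp
        finally show ?thesis by simp
      qed
      have i1: "integrable lborel (\<lambda>p. ?V p * D p)"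
      proof (rule integrable_bounded_support[OF _ compact_imp_bounded[OF KD(1)]])
        show "norm (?V p * D p) \<le> ?M * B2" for p
          using mult_mono[OF Vb B2(2) order_trans[OF norm_ge_zero Vb] abs_ge_zero] by (simp add: abs_mult)
      qed (use vm KD in auto)
      have i2: "integrable lborel (\<lambda>p. \<phi> p * (?G p \<bullet> h))"
      proof (rule integrable_bounded_support[OF _ compact_imp_bounded[OF KK(1)]])
        have "\<bar>?G p \<bullet> h\<bar> \<le> ?M * norm h" for p
          using Cauchy_Schwarz_ineq2[of "?G p" h] mult_right_mono[OF Gb norm_ge_zero] by (rule order_trans)
        then show "norm (\<phi> p * (?G p \<bullet> h)) \<le> B1 * (?M * norm h)" for p
          using mult_mono[OF B1(2) _ less_imp_le[OF B1(1)] abs_ge_zero] by (simp add: abs_mult)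
      qed (use gm KK in auto)
      have "(LINT p|lborel. ?V p * D p) + (LINT p|lborel. \<phi> p * (?G p \<bullet> h)) = (LINT p|lborel. ?V p * D p + \<phi> p * (?G p \<bullet> h))"
        by (rule Bochner_Integration.integral_add[OF i1 i2, symmetric])
      also have "\<dots> = (LINT t|lborel. LINT x|lborel. ?V (x, t) * D (x, t) + \<phi> (x, t) * (?G (x, t) \<bullet> h))"
        by (rule lborel_Fubini(1)) (intro Bochner_Integration.integrable_add i1 i2)
      also have "\<dots> = 0" by (simp only: E0 Bochner_Integration.integral_zero)
      finally show "(LINT p|lborel. ?V p * frechet_derivative \<phi> (at p) (h, 0)) = - (LINT p|lborel. \<phi> p * (?G p \<bullet> h))"
        unfolding D_def by linarith
    qed
  qed
qed

text \<open>The average \<open>v t = (LINT s|lborel. kern h t s * w s)\<close> solves \<open>h v' = w - v\<close>. The first summand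
  carries its initial value, the mean of \<open>w\<close> over \<open>[0, h]\<close>.\<close>

definition kern :: "real \<Rightarrow> real \<Rightarrow> real \<Rightarrow> real" where
  "kern h t s = exp (- t / h) / h * indicator {0..h} s + exp ((s - t) / h) / h * indicator {0..t} s"

lemma kern_measurable[measurable (raw)]:
  assumes [measurable]: "f1 \<in> borel_measurable N" "f2 \<in> borel_measurable N"
  shows "(\<lambda>x. kern h (f1 x) (f2 x)) \<in> borel_measurable N"
proof -
  have "(\<lambda>x. kern h (f1 x) (f2 x)) = (\<lambda>x. exp (- f1 x / h) / h * (if 0 \<le> f2 x \<and> f2 x \<le> h then 1 else 0)
      + exp ((f2 x - f1 x) / h) / h * (if 0 \<le> f2 x \<and> f2 x \<le> f1 x then 1 else 0))"
    by (simp add: kern_def indicator_def of_bool_def fun_eq_iff)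
  also have "\<dots> \<in> borel_measurable N" by measurable
  finally show ?thesis .
qed

lemma kern_bounds:
  assumes "0 < h" "0 \<le> t"
  shows "0 \<le> kern h t s" "kern h t s \<le> 2 / h"
    and "s \<notin> {0..max h t} \<Longrightarrow> kern h t s = 0"
proof -
  show "0 \<le> kern h t s" using assms by (simp add: kern_def)
  have "exp (- t / h) / h * indicator {0..h} s \<le> 1 / h * 1"
    using assms by (intro mult_mono divide_right_mono) (auto split: split_indicator)
  moreover have "exp ((s - t) / h) / h * indicator {0..t} s \<le> 1 / h"
    using assms by (auto intro!: divide_right_mono simp: divide_le_0_iff split: split_indicator)
  ultimately show "kern h t s \<le> 2 / h" by (simp add: kern_def)
  show "s \<notin> {0..max h t} \<Longrightarrow> kern h t s = 0" using assms by (auto simp: kern_def split: split_indicator)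
qed

lemma exp_piece_integral:
  fixes h :: real
  assumes "0 < h" "a \<le> b"
  shows "(LINT s|lborel. exp ((s - t) / h) / h * indicator {a..b} s) = exp ((b - t) / h) - exp ((a - t) / h)"
    and "integrable lborel (\<lambda>s. exp ((s - t) / h) / h * indicator {a..b} s)"
proof -
  have d: "((\<lambda>s. exp ((s - t) / h)) has_real_derivative exp ((s - t) / h) / h) (at s within {a..b})" for s
    using assms by (auto intro!: derivative_eq_intros)
  have c: "continuous_on {a..b} (\<lambda>s. exp ((s - t) / h) / h)" using assms by (intro continuous_intros) auto
  show "(LINT s|lborel. exp ((s - t) / h) / h * indicator {a..b} s) = exp ((b - t) / h) - exp ((a - t) / h)"
    "integrable lborel (\<lambda>s. exp ((s - t) / h) / h * indicator {a..b} s)"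
    using LINT_FTC[OF assms(2) d c] by (simp_all add: mult.commute)
qed

lemma exp_piece_integral':
  fixes h :: real
  assumes "0 < h" "a \<le> b"
  shows "(LINT t|lborel. exp ((s - t) / h) / h * indicator {a..b} t) = exp ((s - a) / h) - exp ((s - b) / h)"
    and "integrable lborel (\<lambda>t. exp ((s - t) / h) / h * indicator {a..b} t)"
proof -
  have d: "((\<lambda>t. - exp ((s - t) / h)) has_real_derivative exp ((s - t) / h) / h) (at t within {a..b})" for t
    using assms by (auto intro!: derivative_eq_intros)
  have c: "continuous_on {a..b} (\<lambda>t. exp ((s - t) / h) / h)" using assms by (intro continuous_intros) auto
  show "(LINT t|lborel. exp ((s - t) / h) / h * indicator {a..b} t) = exp ((s - a) / h) - exp ((s - b) / h)"
    "integrable lborel (\<lambda>t. exp ((s - t) / h) / h * indicator {a..b} t)"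
    using LINT_FTC[OF assms(2) d c] by (simp_all add: mult.commute)
qed

lemma const_piece_integral:
  fixes h c :: real
  assumes "0 < h"
  shows "(LINT s|lborel. c / h * indicator {0..h} s) = c"
    and "integrable lborel (\<lambda>s. c / h * indicator {0..h} s)"
  using assms by simp_all

lemma kern_integral:
  assumes "0 < h" "0 \<le> t"
  shows "(LINT s|lborel. kern h t s) = 1" "integrable lborel (kern h t)"
proof -
  have e: "kern h t = (\<lambda>s. exp (- t / h) / h * indicator {0..h} s + exp ((s - t) / h) / h * indicator {0..t} s)"
    by (simp add: kern_def fun_eq_iff)
  show "(LINT s|lborel. kern h t s) = 1"
    unfolding e
    by (subst Bochner_Integration.integral_add[OF const_piece_integral(2)[OF assms(1)] exp_piece_integral(2)[OF assms]])
       (simp only: const_piece_integral(1)[OF assms(1)] exp_piece_integral(1)[OF assms], simp)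
  show "integrable lborel (kern h t)"
    unfolding e
    by (rule Bochner_Integration.integrable_add[OF const_piece_integral(2)[OF assms(1)] exp_piece_integral(2)[OF assms]])
qed

text \<open>This is the mass in the other variable: each of the two summands of the kernel
  contributes at most one. It is what bounds the averaging operator in L1.\<close>

lemma kern_integral_time:
  assumes h: "0 < h" and \<tau>: "0 < \<tau>" and s: "0 \<le> s"
  shows "(LINT t|lborel. indicator {0<..<\<tau>} t * kern h t s) \<le> 2"
    "integrable lborel (\<lambda>t. indicator {0<..<\<tau>} t * kern h t s)"
proof -
  have st: "s \<le> max s \<tau>" by simp
  \<comment> \<open>The first summand is enlarged by dropping its restriction on \<open>s\<close>.
    The second lives on times from \<open>s\<close> on, and \<open>max s \<tau>\<close> keeps its
    interval nonempty when \<open>s\<close> exceeds \<open>\<tau>\<close>.\<close>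
  let ?b = "\<lambda>t. exp ((0 - t) / h) / h * indicator {0..\<tau>} t + exp ((s - t) / h) / h * indicator {s..max s \<tau>} t"
  note i1 = exp_piece_integral'[OF h less_imp_le[OF \<tau>], of 0]
  note i2 = exp_piece_integral'[OF h st, of s]
  have ib: "integrable lborel ?b" using i1(2) i2(2) by (rule Bochner_Integration.integrable_add)
  have le: "indicator {0<..<\<tau>} t * kern h t s \<le> ?b t" for t
    using h by (auto simp: kern_def split: split_indicator)
  have nn: "0 \<le> indicator {0<..<\<tau>} t * kern h t s" for t
    using h kern_bounds(1)[OF h, of t s] by (auto split: split_indicator)
  show i: "integrable lborel (\<lambda>t. indicator {0<..<\<tau>} t * kern h t s)"
  proof (rule Bochner_Integration.integrable_bound[OF ib], measurable, intro AE_I2)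
    fix t show "norm (indicator {0<..<\<tau>} t * kern h t s) \<le> norm (?b t)"
      using le[of t] nn[of t] unfolding real_norm_def by linarith
  qed
  have "(LINT t|lborel. indicator {0<..<\<tau>} t * kern h t s) \<le> (LINT t|lborel. ?b t)"
    by (rule integral_mono[OF i ib le])
  also have "\<dots> = (exp ((0 - 0) / h) - exp ((0 - \<tau>) / h)) + (exp ((s - s) / h) - exp ((s - max s \<tau>) / h))"
    by (subst Bochner_Integration.integral_add[OF i1(2) i2(2)]) (simp only: i1(1) i2(1))
  also have "\<dots> \<le> 2"
  proof -
    have "exp ((0 - 0) / h) = 1" "exp ((s - s) / h) = 1" by simp_all
    then show ?thesis
      using exp_ge_zero[of "(0 - \<tau>) / h"] exp_ge_zero[of "(s - max s \<tau>) / h"] by linarith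
  qed
  finally show "(LINT t|lborel. indicator {0<..<\<tau>} t * kern h t s) \<le> 2" .
qed

text \<open>As the kernel has mass one, the error is the mean of \<open>c s - c t\<close>. Within
  distance \<open>\<delta>\<close> of \<open>t\<close> the integrand is at most \<open>e\<close>.
  The initial summand of the kernel has mass exp(-t/h), its other summand has mass at most
  exp(-\<delta>/h) before \<open>t - \<delta>\<close>, and there the integrand is at most
  \<open>2 * C\<close>.\<close>

lemma kern_approx:
  fixes c :: "real \<Rightarrow> 'b::euclidean_space"
  assumes c: "continuous_on UNIV c" "\<And>s. norm (c s) \<le> C" and h: "0 < h" and t: "0 < t"
    and \<delta>: "0 < \<delta>" "\<delta> < t" and e: "0 \<le> e" "\<And>s. \<bar>s - t\<bar> \<le> \<delta> \<Longrightarrow> norm (c s - c t) \<le> e"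
  shows "norm ((LINT s|lborel. kern h t s *\<^sub>R c s) - c t) \<le> e + 2 * C * (exp (- t / h) + exp (- \<delta> / h))"
proof -
  have C: "0 \<le> C" using c(2)[of 0] norm_ge_zero order_trans by blast
  have [measurable]: "c \<in> borel_measurable borel" using c(1) by (rule borel_measurable_continuous_onI)
  note k = kern_integral[OF h less_imp_le[OF t]]
  have ik: "integrable lborel (\<lambda>s. kern h t s *\<^sub>R c s)"
  proof (rule Bochner_Integration.integrable_bound[OF integrable_mult_right[OF k(2), of C]])
    show "AE s in lborel. norm (kern h t s *\<^sub>R c s) \<le> norm (C * kern h t s)"
      using c(2) C kern_bounds(1)[OF h less_imp_le[OF t]] by (auto simp: abs_mult mult.commute intro!: AE_I2 mult_right_mono)
  qed measurable
  have ict: "integrable lborel (\<lambda>s. kern h t s *\<^sub>R c t)" using k(2) by (rule integrable_scaleR_left)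
  have "(LINT s|lborel. kern h t s *\<^sub>R c s) - c t = (LINT s|lborel. kern h t s *\<^sub>R c s) - (LINT s|lborel. kern h t s *\<^sub>R c t)"
    using k by simp
  also have "\<dots> = (LINT s|lborel. kern h t s *\<^sub>R c s - kern h t s *\<^sub>R c t)"
    by (rule Bochner_Integration.integral_diff[symmetric, OF ik ict])
  finally have eq: "(LINT s|lborel. kern h t s *\<^sub>R c s) - c t = (LINT s|lborel. kern h t s *\<^sub>R c s - kern h t s *\<^sub>R c t)" .
  have td: "0 \<le> t - \<delta>" using \<delta> by simp
  let ?b = "\<lambda>s. e * kern h t s + 2 * C * (exp (- t / h) / h * indicator {0..h} s + exp ((s - t) / h) / h * indicator {0..t - \<delta>} s)"
  note p1 = const_piece_integral[OF h, of "exp (- t / h)"]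
  note p2 = exp_piece_integral[OF h td, of t]
  have ib: "integrable lborel ?b"
    by (intro Bochner_Integration.integrable_add integrable_mult_right k p1 p2)
  have "norm ((LINT s|lborel. kern h t s *\<^sub>R c s) - c t) \<le> (LINT s|lborel. norm (kern h t s *\<^sub>R c s - kern h t s *\<^sub>R c t))"
    unfolding eq by (rule integral_norm_bound)
  also have "\<dots> \<le> (LINT s|lborel. ?b s)"
  proof (rule integral_mono[OF integrable_norm[OF Bochner_Integration.integrable_diff[OF ik ict]] ib])
    fix s
    have k0: "0 \<le> kern h t s" by (rule kern_bounds(1)[OF h less_imp_le[OF t]])
    have n: "norm (kern h t s *\<^sub>R c s - kern h t s *\<^sub>R c t) = kern h t s * norm (c s - c t)"
      using k0 by (simp flip: scaleR_diff_right)
    have r0: "0 \<le> exp (- t / h) / h * indicator {0..h} s + exp ((s - t) / h) / h * indicator {0..t - \<delta>} s"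
      using h by simp
    show "norm (kern h t s *\<^sub>R c s - kern h t s *\<^sub>R c t) \<le> ?b s"
    proof (cases "\<bar>s - t\<bar> \<le> \<delta>")
      case True
      have "kern h t s * norm (c s - c t) \<le> kern h t s * e" by (rule mult_left_mono[OF e(2)[OF True] k0])
      moreover have "0 \<le> 2 * C * (exp (- t / h) / h * indicator {0..h} s + exp ((s - t) / h) / h * indicator {0..t - \<delta>} s)"
        using r0 C by simp
      moreover have "kern h t s * e = e * kern h t s" by (rule mult.commute)
      ultimately show ?thesis unfolding n by linarith
    next
      case False
      have "kern h t s \<le> exp (- t / h) / h * indicator {0..h} s + exp ((s - t) / h) / h * indicator {0..t - \<delta>} s"
        using False h by (auto simp: kern_def split: split_indicator)
      moreover have "norm (c s - c t) \<le> 2 * C" using norm_triangle_ineq4[of "c s" "c t"] c(2)[of s] c(2)[of t] by linarith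
      ultimately have "kern h t s * norm (c s - c t) \<le> (exp (- t / h) / h * indicator {0..h} s + exp ((s - t) / h) / h * indicator {0..t - \<delta>} s) * (2 * C)"
        using r0 by (intro mult_mono) auto
      moreover have "0 \<le> e * kern h t s" using e(1) k0 by simp
      ultimately show ?thesis unfolding n
        by (subst mult.commute[of "2 * C"]) linarith
    qed
  qed
  also have "\<dots> = e + 2 * C * (exp (- t / h) + (exp ((t - \<delta> - t) / h) - exp ((0 - t) / h)))"
  proof -
    let ?R = "\<lambda>s. exp (- t / h) / h * indicator {0..h} s + exp ((s - t) / h) / h * indicator {0..t - \<delta>} s"
    have "(LINT s|lborel. ?b s) = (LINT s|lborel. e * kern h t s) + (LINT s|lborel. 2 * C * ?R s)"
      by (intro Bochner_Integration.integral_add Bochner_Integration.integrable_add integrable_mult_right k p1 p2)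
    also have "(LINT s|lborel. e * kern h t s) = e" using k by simp
    also have "(LINT s|lborel. 2 * C * ?R s) = 2 * C * (LINT s|lborel. ?R s)"
      by (rule Bochner_Integration.integral_mult_right_zero)
    also have "(LINT s|lborel. ?R s) = exp (- t / h) + (exp ((t - \<delta> - t) / h) - exp ((0 - t) / h))"
      by (simp only: Bochner_Integration.integral_add[OF p1(2) p2(2)] p1(1) p2(1))
    finally show ?thesis .
  qed
  also have "\<dots> \<le> e + 2 * C * (exp (- t / h) + exp (- \<delta> / h))"
    using C by (intro add_left_mono mult_left_mono) auto
  finally show ?thesis .
qed

lemma exp_scale_tendsto_0:
  assumes "0 < (t::real)" "\<And>n. 0 < h n" "h \<longlonglongrightarrow> 0"
  shows "(\<lambda>n. exp (- t / h n)) \<longlonglongrightarrow> 0"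
proof -
  have "exp (- t / h n) \<le> h n / t" for n
  proof -
    have "t / h n \<le> exp (t / h n)" using exp_ge_add_one_self[of "t / h n"] by linarith
    then have "inverse (exp (t / h n)) \<le> inverse (t / h n)" using assms by (intro le_imp_inverse_le) auto
    then show ?thesis using assms(2)[of n] assms(1) by (simp add: exp_minus)
  qed
  moreover have lim: "(\<lambda>n. h n / t) \<longlonglongrightarrow> 0" using tendsto_divide[OF assms(3) tendsto_const[of t]] assms(1) by simp
  ultimately show ?thesis
    by (intro tendsto_sandwich[OF _ _ tendsto_const[of 0] lim] always_eventually allI) (simp_all only: exp_ge_zero)
qed

lemma kern_tendsto:
  fixes c :: "real \<Rightarrow> 'b::euclidean_space"
  assumes c: "continuous_on UNIV c" "\<And>s. norm (c s) \<le> C" and t: "0 < t" and h: "\<And>n. 0 < h n" "h \<longlonglongrightarrow> 0"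
  shows "(\<lambda>n. LINT s|lborel. kern (h n) t s *\<^sub>R c s) \<longlonglongrightarrow> c t"
proof (rule LIMSEQ_I)
  fix r :: real assume r: "0 < r"
  have "isCont c t" using c(1) by (simp add: continuous_on_eq_continuous_at)
  then obtain d where d: "d > 0" "\<And>s. dist s t < d \<Longrightarrow> dist (c s) (c t) < r / 2"
    using half_gt_zero[OF r] unfolding continuous_at_eps_delta by blast
  define \<delta> where "\<delta> = min (d / 2) (t / 2)"
  have \<delta>: "0 < \<delta>" "\<delta> < t" using d t by (auto simp: \<delta>_def)
  have e: "norm (c s - c t) \<le> r / 2" if "\<bar>s - t\<bar> \<le> \<delta>" for s
  proof -
    have "dist s t < d" using that d(1) by (auto simp: \<delta>_def dist_real_def)
    from d(2)[OF this] show ?thesis by (simp add: dist_norm)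
  qed
  have "(\<lambda>n. 2 * C * (exp (- t / h n) + exp (- \<delta> / h n))) \<longlonglongrightarrow> 2 * C * (0 + 0)"
    by (intro tendsto_mult tendsto_add tendsto_const exp_scale_tendsto_0 h t \<delta>)
  then have "\<forall>\<^sub>F n in sequentially. 2 * C * (exp (- t / h n) + exp (- \<delta> / h n)) < r / 2"
    using r by (intro order_tendstoD(2)) auto
  then obtain N where N: "\<And>n. n \<ge> N \<Longrightarrow> 2 * C * (exp (- t / h n) + exp (- \<delta> / h n)) < r / 2"
    by (auto simp: eventually_sequentially)
  show "\<exists>N. \<forall>n\<ge>N. norm ((LINT s|lborel. kern (h n) t s *\<^sub>R c s) - c t) < r"
  proof (intro exI[of _ N] allI impI)
    fix n assume "n \<ge> N"
    from N[OF this] have "2 * C * (exp (- t / h n) + exp (- \<delta> / h n)) < r / 2" .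
    moreover have "norm ((LINT s|lborel. kern (h n) t s *\<^sub>R c s) - c t) \<le> r / 2 + 2 * C * (exp (- t / h n) + exp (- \<delta> / h n))"
      by (rule kern_approx[OF c h(1) t \<delta>]) (use r e in auto)
    ultimately show "norm ((LINT s|lborel. kern (h n) t s *\<^sub>R c s) - c t) < r" by linarith
  qed
qed

lemma kern_avg_bound:
  fixes c :: "real \<Rightarrow> 'b::euclidean_space"
  assumes [measurable]: "c \<in> borel_measurable borel" and c: "\<And>s. norm (c s) \<le> C" and h: "0 < h" and t: "0 \<le> t"
  shows "integrable lborel (\<lambda>s. kern h t s *\<^sub>R c s)" "norm (LINT s|lborel. kern h t s *\<^sub>R c s) \<le> C"
proof -
  have C: "0 \<le> C" using c[of 0] norm_ge_zero order_trans by blast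
  note k = kern_integral[OF h t]
  have le: "norm (kern h t s *\<^sub>R c s) \<le> C * kern h t s" for s
    using c[of s] kern_bounds(1)[OF h t, of s] by (simp add: mult.commute mult_right_mono)
  show i: "integrable lborel (\<lambda>s. kern h t s *\<^sub>R c s)"
  proof (rule Bochner_Integration.integrable_bound[OF integrable_mult_right[OF k(2), of C]])
    show "AE s in lborel. norm (kern h t s *\<^sub>R c s) \<le> norm (C * kern h t s)"
      using le by (intro AE_I2) (metis abs_ge_self order_trans real_norm_def)
  qed measurable
  have "norm (LINT s|lborel. kern h t s *\<^sub>R c s) \<le> (LINT s|lborel. norm (kern h t s *\<^sub>R c s))"
    by (rule integral_norm_bound)
  also have "\<dots> \<le> (LINT s|lborel. C * kern h t s)"
    by (rule integral_mono[OF integrable_norm[OF i] integrable_mult_right[OF k(2)] le])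
  also have "\<dots> = C" using k by simp
  finally show "norm (LINT s|lborel. kern h t s *\<^sub>R c s) \<le> C" .
qed

section \<open>L1 convergence of the averages\<close>

lemma kern_avg_measurable:
  fixes g :: "'a::euclidean_space \<times> real \<Rightarrow> 'b::euclidean_space"
  assumes [measurable]: "g \<in> borel_measurable borel"
  shows "(\<lambda>p. LINT s|lborel. kern h (snd p) s *\<^sub>R g (fst p, s)) \<in> borel_measurable borel"
  by (rule lborel.borel_measurable_lebesgue_integral) (unfold split_beta', measurable)

text \<open>Exchanging the integrals over \<open>t\<close> and \<open>s\<close> leaves the mass of
  the kernel in \<open>t\<close>, which is at most two.\<close>

lemma kern_L1_bound:
  fixes f :: "'a::euclidean_space \<times> real \<Rightarrow> real"
  assumes \<Omega>: "\<Omega> \<in> sets borel" "bounded \<Omega>" and \<tau>: "0 < \<tau>" and h: "0 < h" "h \<le> \<tau>"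
    and [measurable]: "f \<in> borel_measurable borel" and f: "\<And>p. 0 \<le> f p" "\<And>p. f p \<le> C"
    and off: "\<And>p. p \<notin> \<Omega> \<times> {0<..<\<tau>} \<Longrightarrow> f p = 0"
  shows "(LINT p|lborel. indicator (\<Omega> \<times> {0<..<\<tau>}) p * (LINT s|lborel. kern h (snd p) s * f (fst p, s))) \<le> 2 * (LINT p|lborel. f p)"
    "integrable lborel (\<lambda>p. indicator (\<Omega> \<times> {0<..<\<tau>}) p * (LINT s|lborel. kern h (snd p) s * f (fst p, s)))"
proof -
  let ?Q = "\<Omega> \<times> {0<..<\<tau>}"
  have Qb: "?Q \<in> sets borel" using \<Omega>(1) by (intro borel_Times) auto
  have C: "0 \<le> C" using f[of undefined] by linarith
  have bQ: "bounded ?Q" using \<Omega>(2) by (intro bounded_Times) auto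
  have fn: "norm (f p) \<le> C" for p using f[of p] by simp
  have m: "(\<lambda>p. LINT s|lborel. kern h (snd p) s * f (fst p, s)) \<in> borel_measurable borel"
    using kern_avg_measurable[of f h] by simp
  have ff: "integrable lborel f" by (rule integrable_bounded_support[OF _ bQ fn off]) measurable
  have A: "norm (indicator ?Q p * (LINT s|lborel. kern h (snd p) s * f (fst p, s))) \<le> C" for p
  proof (cases "p \<in> ?Q")
    case True
    then show ?thesis using kern_avg_bound(2)[of "\<lambda>s. f (fst p, s)" C h "snd p"] fn h by (cases p) auto
  qed (use C in simp)
  show ia: "integrable lborel (\<lambda>p. indicator ?Q p * (LINT s|lborel. kern h (snd p) s * f (fst p, s)))"
    by (rule integrable_bounded_support[OF _ bQ A]) (use m Qb in \<open>auto intro!: borel_measurable_times\<close>)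
  have "(LINT p|lborel. indicator ?Q p * (LINT s|lborel. kern h (snd p) s * f (fst p, s)))
      = (LINT x|lborel. LINT t|lborel. indicator ?Q (x, t) * (LINT s|lborel. kern h t s * f (x, s)))"
    using lborel_Fubini(2)[OF ia] by simp
  also have "\<dots> = (LINT x|lborel. LINT t|lborel. LINT s|lborel. indicator {0<..<\<tau>} t * kern h t s * f (x, s))"
  proof (intro Bochner_Integration.integral_cong refl)
    fix x t
    show "indicator ?Q (x, t) * (LINT s|lborel. kern h t s * f (x, s)) = (LINT s|lborel. indicator {0<..<\<tau>} t * kern h t s * f (x, s))"
    proof (cases "x \<in> \<Omega>")
      case True
      then show ?thesis by (simp add: indicator_times mult.assoc)
    next
      case False
      then have "f (x, s) = 0" for s by (intro off) auto
      then show ?thesis by simp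
    qed
  qed
  also have "\<dots> = (LINT x|lborel. LINT s|lborel. LINT t|lborel. indicator {0<..<\<tau>} t * kern h t s * f (x, s))"
  proof (rule Bochner_Integration.integral_cong[OF refl])
    fix x
    have "integrable lborel (\<lambda>q::real \<times> real. indicator {0<..<\<tau>} (fst q) * kern h (fst q) (snd q) * f (x, snd q))"
    proof (rule integrable_bounded_support[where S="{0<..<\<tau>} \<times> {0<..<\<tau>}" and C="2 / h * C"])
      show "norm (indicator {0<..<\<tau>} (fst q) * kern h (fst q) (snd q) * f (x, snd q)) \<le> 2 / h * C" for q
      proof (cases "fst q \<in> {0<..<\<tau>}")
        case True
        then show ?thesis
          using mult_mono[OF kern_bounds(2)[OF h(1)] f(2)[of "(x, snd q)"] _ f(1)] kern_bounds(1)[OF h(1)] f(1) h by (simp add: abs_mult)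
      qed (use C h in simp)
      show "indicator {0<..<\<tau>} (fst q) * kern h (fst q) (snd q) * f (x, snd q) = 0" if "q \<notin> {0<..<\<tau>} \<times> {0<..<\<tau>}" for q
        using that off[of "(x, snd q)"] by (cases q) auto
      show "bounded ({0<..<\<tau>} \<times> {0<..<\<tau>})" by (intro bounded_Times) auto
    qed measurable
    from lborel_Fubini[OF this]
    show "(LINT t|lborel. LINT s|lborel. indicator {0<..<\<tau>} t * kern h t s * f (x, s)) = (LINT s|lborel. LINT t|lborel. indicator {0<..<\<tau>} t * kern h t s * f (x, s))"
      by simp
  qed
  also have "\<dots> \<le> (LINT x|lborel. LINT s|lborel. 2 * f (x, s))"
  proof -
    let ?k = "\<lambda>s. LINT t|lborel. indicator {0<..<\<tau>} t * kern h t s"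
    have km: "?k \<in> borel_measurable borel"
      by (rule lborel.borel_measurable_lebesgue_integral) (unfold split_beta', measurable)
    have kf: "(LINT t|lborel. indicator {0<..<\<tau>} t * kern h t s * f (x, s)) = ?k s * f (x, s)" for x s by simp
    have k0: "0 \<le> ?k s" for s
      using kern_bounds(1)[OF h(1)] by (intro integral_nonneg_AE AE_I2) (auto split: split_indicator)
    have le: "?k s * f (x, s) \<le> 2 * f (x, s)" for x s
    proof (cases "s \<in> {0<..<\<tau>}")
      case True
      then show ?thesis using kern_integral_time(1)[OF h(1) \<tau>, of s] f(1) by (intro mult_right_mono) auto
    qed (use off[of "(x, s)"] in auto)
    have i2: "integrable lborel (\<lambda>p. 2 * f p)" using ff by simp
    have i1: "integrable lborel (\<lambda>p. ?k (snd p) * f p)"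
    proof (rule Bochner_Integration.integrable_bound[OF i2])
      show "AE p in lborel. norm (?k (snd p) * f p) \<le> norm (2 * f p)"
        using le[of "snd p" "fst p" for p] k0 f by (intro AE_I2) (simp add: abs_mult)
      show "(\<lambda>p. ?k (snd p) * f p) \<in> borel_measurable lborel"
        using measurable_compose[OF borel_measurable_fst_snd(2) km] by (intro borel_measurable_times) auto
    qed
    have "(LINT p|lborel. ?k (snd p) * f p) \<le> (LINT p|lborel. 2 * f p)"
      by (rule integral_mono[OF i1 i2]) (use le[of "snd p" "fst p" for p] in simp)
    then show ?thesis unfolding kf lborel_Fubini(2)[OF i1] lborel_Fubini(2)[OF i2] by simp
  qed
  also have "\<dots> = (LINT p|lborel. 2 * f p)"
    using lborel_Fubini(2)[of "\<lambda>p. 2 * f p"] ff by simp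
  finally show "(LINT p|lborel. indicator ?Q p * (LINT s|lborel. kern h (snd p) s * f (fst p, s))) \<le> 2 * (LINT p|lborel. f p)"
    by simp
qed

text \<open>A measurable function is almost everywhere a limit of continuous ones. Projecting these
  onto the ball of radius \<open>C\<close> gives them the bound without moving the limit, which lies
  in the ball.\<close>

lemma bounded_continuous_approx:
  fixes g :: "'a::euclidean_space \<Rightarrow> 'b::euclidean_space"
  assumes g: "g \<in> borel_measurable borel" "\<And>p. norm (g p) \<le> C"
  obtains c where "\<And>m. continuous_on UNIV (c m)" "\<And>m p. norm (c m p) \<le> C" "AE p in lborel. (\<lambda>m. c m p) \<longlonglongrightarrow> g p"
proof -
  have C: "0 \<le> C" using g(2) norm_ge_zero order_trans by blast
  have "g \<in> borel_measurable (lebesgue_on UNIV)" using g(1) by (rule borel_measurable_imp_lebesgue)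
  then have "g measurable_on UNIV" by (subst measurable_on_iff_borel_measurable) auto
  then obtain N k where N: "negligible N" "\<And>n. continuous_on UNIV (k n)" "\<And>x. x \<notin> N \<Longrightarrow> (\<lambda>n. k n x) \<longlonglongrightarrow> g x"
    by (auto simp: measurable_on_def)
  let ?P = "closest_point (cball (0::'b) C)"
  have cp: "continuous_on UNIV ?P" using C by (intro continuous_on_closest_point) auto
  show ?thesis
  proof (rule that[of "\<lambda>m p. ?P (k m p)"])
    show "continuous_on UNIV (\<lambda>p. ?P (k m p))" for m
      by (rule continuous_on_compose2[OF cp N(2)]) auto
    show "norm (?P (k m p)) \<le> C" for m p
      using closest_point_in_set[of "cball (0::'b) C" "k m p"] C by auto
    have "AE p in lborel. p \<notin> N"
      using N(1) by (subst AE_completion_iff[symmetric]) (simp only: negligible_iff_null_sets AE_not_in)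
    then show "AE p in lborel. (\<lambda>m. ?P (k m p)) \<longlonglongrightarrow> g p"
    proof eventually_elim
      case (elim p)
      have "(\<lambda>m. ?P (k m p)) \<longlonglongrightarrow> ?P (g p)"
        using continuous_on_tendsto_compose[OF cp N(3)[OF elim]] by simp
      moreover have "?P (g p) = g p" using g(2)[of p] by (intro closest_point_self) simp
      ultimately show ?case by simp
    qed
  qed
qed

text \<open>Averages converge pointwise for continuous functions. A merely measurable
  \<open>g\<close> is replaced by continuous \<open>c m\<close>, and the L1 bound for averages
  controls the error uniformly in \<open>n\<close>.\<close>

lemma kern_L1_tendsto:
  fixes g :: "'a::euclidean_space \<times> real \<Rightarrow> 'b::euclidean_space"
  assumes \<Omega>: "\<Omega> \<in> sets borel" "bounded \<Omega>" and \<tau>: "0 < \<tau>"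
    and h: "\<And>n. 0 < h n" "\<And>n. h n \<le> \<tau>" "h \<longlonglongrightarrow> 0"
    and gm[measurable]: "g \<in> borel_measurable borel" and g: "\<And>p. norm (g p) \<le> C"
  shows "(\<lambda>n. LINT p|lborel. indicator (\<Omega> \<times> {0<..<\<tau>}) p * norm ((LINT s|lborel. kern (h n) (snd p) s *\<^sub>R g (fst p, s)) - g p)) \<longlonglongrightarrow> 0"
proof -
  let ?Q = "\<Omega> \<times> {0<..<\<tau>}"
  have Qb[measurable]: "?Q \<in> sets borel" using \<Omega>(1) by (intro borel_Times) auto
  have C: "0 \<le> C" using g norm_ge_zero order_trans by blast
  have bQ: "bounded ?Q" using \<Omega>(2) by (intro bounded_Times) auto
  obtain c where c: "\<And>m. continuous_on UNIV (c m)" "\<And>m p. norm (c m p) \<le> C" "AE p in lborel. (\<lambda>m. c m p) \<longlonglongrightarrow> g p"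
    using bounded_continuous_approx[OF gm g] by blast
  have cm[measurable]: "c m \<in> borel_measurable borel" for m using c(1) by (rule borel_measurable_continuous_onI)
  define A where "A n k p = (LINT s|lborel. kern (h n) (snd p) s *\<^sub>R k (fst p, s))" for n and k :: "'a \<times> real \<Rightarrow> 'b" and p
  have Am[measurable]: "A n k \<in> borel_measurable borel" if "k \<in> borel_measurable borel" for n k
    unfolding A_def[abs_def] using that by (rule kern_avg_measurable)
  have Ab: "norm (A n k p) \<le> C" if "k \<in> borel_measurable borel" "\<And>p. norm (k p) \<le> C" "p \<in> ?Q" for n k p
    unfolding A_def using that h(1)
    by (intro kern_avg_bound(2)) (auto intro: measurable_compose[OF _ that(1)])
  have qi: "integrable lborel (\<lambda>p. indicator ?Q p * norm (k1 p - k2 p))"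
    if "k1 \<in> borel_measurable borel" "k2 \<in> borel_measurable borel" "\<And>p. p \<in> ?Q \<Longrightarrow> norm (k1 p) \<le> C" "\<And>p. p \<in> ?Q \<Longrightarrow> norm (k2 p) \<le> C"
    for k1 k2 :: "'a \<times> real \<Rightarrow> 'b"
  proof (rule integrable_bounded_support[OF _ bQ, where C="2 * C"])
    show "(\<lambda>p. indicator ?Q p * norm (k1 p - k2 p)) \<in> borel_measurable borel" using that(1,2) by measurable
    show "norm (indicator ?Q p * norm (k1 p - k2 p)) \<le> 2 * C" for p
      using that(3,4)[of p] norm_triangle_ineq4[of "k1 p" "k2 p"] C by (cases "p \<in> ?Q") auto
  qed simp
  define \<delta> where "\<delta> m = (LINT p|lborel. indicator ?Q p * norm (g p - c m p))" for m
  define E where "E n m = (LINT p|lborel. indicator ?Q p * norm (A n (c m) p - c m p))" for n m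
  have iQ: "integrable lborel (\<lambda>p. indicator ?Q p * (2 * C) :: real)"
    using emeasure_bounded_finite[OF bQ] by (intro integrable_mult_left integrable_real_indicator) auto
  have \<delta>0: "\<delta> \<longlonglongrightarrow> 0"
  proof -
    have "\<delta> \<longlonglongrightarrow> (LINT p|lborel. (0::real) * (0 * norm (g (p :: 'a \<times> real))))"
      unfolding \<delta>_def[abs_def]
    proof (rule integral_dominated_convergence[OF _ _ iQ])
      show "AE p in lborel. (\<lambda>m. indicator ?Q p * norm (g p - c m p)) \<longlonglongrightarrow> 0 * (0 * norm (g p))"
        using c(3)
      proof eventually_elim
        case (elim p)
        have "(\<lambda>m. indicator ?Q p * norm (g p - c m p)) \<longlonglongrightarrow> indicator ?Q p * norm (g p - g p)"
          by (intro tendsto_intros elim)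
        then show ?case by simp
      qed
      show "AE p in lborel. norm (indicator ?Q p * norm (g p - c m p)) \<le> indicator ?Q p * (2 * C)" for m
      proof (intro AE_I2)
        fix p
        show "norm (indicator ?Q p * norm (g p - c m p)) \<le> indicator ?Q p * (2 * C)"
          using g[of p] c(2)[of m p] norm_triangle_ineq4[of "g p" "c m p"] by (cases "p \<in> ?Q") auto
      qed
    qed measurable
    then show ?thesis by simp
  qed
  have E0: "(\<lambda>n. E n m) \<longlonglongrightarrow> 0" for m
  proof -
    have "(\<lambda>n. E n m) \<longlonglongrightarrow> (LINT p|lborel. (0::real) * (0 * norm (g (p :: 'a \<times> real))))"
      unfolding E_def
    proof (rule integral_dominated_convergence[OF _ _ iQ])
      show "AE p in lborel. (\<lambda>n. indicator ?Q p * norm (A n (c m) p - c m p)) \<longlonglongrightarrow> 0 * (0 * norm (g p))"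
      proof (intro AE_I2)
        fix p :: "'a \<times> real"
        show "(\<lambda>n. indicator ?Q p * norm (A n (c m) p - c m p)) \<longlonglongrightarrow> 0 * (0 * norm (g p))"
        proof (cases "p \<in> ?Q")
          case True
          have "(\<lambda>n. A n (c m) p) \<longlonglongrightarrow> c m (fst p, snd p)"
            unfolding A_def
          proof (rule kern_tendsto[OF _ c(2) _ h(1,3)])
            show "continuous_on UNIV (\<lambda>s. c m (fst p, s))"
              by (rule continuous_on_compose2[OF c(1)]) (auto intro!: continuous_intros)
            show "0 < snd p" using True by auto
          qed
          then have "(\<lambda>n. norm (A n (c m) p - c m p)) \<longlonglongrightarrow> 0"
            by (simp add: tendsto_norm_zero LIM_zero)
          then show ?thesis using True by simp
        qed simp
      qed
      show "AE p in lborel. norm (indicator ?Q p * norm (A n (c m) p - c m p)) \<le> indicator ?Q p * (2 * C)" for n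
      proof (intro AE_I2)
        fix p
        show "norm (indicator ?Q p * norm (A n (c m) p - c m p)) \<le> indicator ?Q p * (2 * C)"
          using Ab[OF cm c(2), of p n m] c(2)[of m p] norm_triangle_ineq4[of "A n (c m) p" "c m p"] by (cases "p \<in> ?Q") auto
      qed
    qed measurable
    then show ?thesis by simp
  qed
  \<comment> \<open>Two of the three copies of \<open>\<delta> m\<close> come from the averaged
    error, as the kernel has mass at most two in its first variable, and one from
    \<open>g - c m\<close> itself.\<close>
  have main: "(LINT p|lborel. indicator ?Q p * norm (A n g p - g p)) \<le> 3 * \<delta> m + E n m" for n m
  proof -
    let ?f = "\<lambda>p. indicator ?Q p * norm (g p - c m p)"
    have fb: "?f p \<le> 2 * C" "0 \<le> ?f p" for p
      using g[of p] c(2)[of m p] norm_triangle_ineq4[of "g p" "c m p"] C by (cases "p \<in> ?Q"; auto)+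
    note kb = kern_L1_bound[OF \<Omega> \<tau> h(1) h(2), of ?f "2 * C" n]
    have kb1: "(LINT p|lborel. indicator ?Q p * (LINT s|lborel. kern (h n) (snd p) s * ?f (fst p, s))) \<le> 2 * \<delta> m"
      and kb2: "integrable lborel (\<lambda>p. indicator ?Q p * (LINT s|lborel. kern (h n) (snd p) s * ?f (fst p, s)))"
      unfolding \<delta>_def by (rule kb; use fb in auto)+
    have AE0: "AE s in lborel. s \<noteq> (0::real) \<and> s \<noteq> \<tau>"
      using AE_lborel_singleton[of 0] AE_lborel_singleton[of \<tau>] by eventually_elim auto
    have pt: "indicator ?Q p * norm (A n g p - g p) \<le> indicator ?Q p * (LINT s|lborel. kern (h n) (snd p) s * ?f (fst p, s))
        + (?f p + indicator ?Q p * norm (A n (c m) p - c m p))" for p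
    proof (cases "p \<in> ?Q")
      case True
      then have t: "0 \<le> snd p" "snd p \<le> \<tau>" "fst p \<in> \<Omega>" by auto
      have ig: "integrable lborel (\<lambda>s. kern (h n) (snd p) s *\<^sub>R g (fst p, s))"
        "integrable lborel (\<lambda>s. kern (h n) (snd p) s *\<^sub>R c m (fst p, s))"
        by (rule kern_avg_bound(1)[OF _ _ h(1) t(1)], measurable, rule g)
           (rule kern_avg_bound(1)[OF _ _ h(1) t(1)], measurable, rule c(2))
      have igf: "integrable lborel (\<lambda>s. kern (h n) (snd p) s * ?f (fst p, s))"
        using kern_avg_bound(1)[of "\<lambda>s. ?f (fst p, s)" "2 * C", OF _ _ h(1)[of n] t(1)] fb by simp
      have "A n g p - A n (c m) p = (LINT s|lborel. kern (h n) (snd p) s *\<^sub>R g (fst p, s) - kern (h n) (snd p) s *\<^sub>R c m (fst p, s))"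
        unfolding A_def by (rule Bochner_Integration.integral_diff[symmetric, OF ig])
      then have "norm (A n g p - A n (c m) p) \<le> (LINT s|lborel. norm (kern (h n) (snd p) s *\<^sub>R g (fst p, s) - kern (h n) (snd p) s *\<^sub>R c m (fst p, s)))"
        using integral_norm_bound by simp
      also have "\<dots> \<le> (LINT s|lborel. kern (h n) (snd p) s * ?f (fst p, s))"
      proof (rule integral_mono_AE)
        show "AE s in lborel. norm (kern (h n) (snd p) s *\<^sub>R g (fst p, s) - kern (h n) (snd p) s *\<^sub>R c m (fst p, s)) \<le> kern (h n) (snd p) s * ?f (fst p, s)"
          using AE0
        proof eventually_elim
          case (elim s)
          have e: "norm (kern (h n) (snd p) s *\<^sub>R g (fst p, s) - kern (h n) (snd p) s *\<^sub>R c m (fst p, s)) = kern (h n) (snd p) s * norm (g (fst p, s) - c m (fst p, s))"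
            using kern_bounds(1)[OF h(1) t(1)] by (simp flip: scaleR_diff_right)
          show ?case
          proof (cases "s \<in> {0<..<\<tau>}")
            case True
            then show ?thesis using t(3) unfolding e by simp
          next
            case False
            \<comment> \<open>Neither \<open>h n\<close> nor \<open>snd p\<close> exceeds
              \<open>\<tau>\<close>, so the kernel vanishes at all times outside the slab except
              possibly its two ends, which \<open>AE0\<close> excludes.\<close>
            then have "s \<notin> {0..max (h n) (snd p)}" using elim t h(2)[of n] by auto
            then show ?thesis unfolding e using kern_bounds(3)[OF h(1) t(1)] by simp
          qed
        qed
      qed (use ig igf in auto)
      finally have "norm (A n g p - A n (c m) p) \<le> (LINT s|lborel. kern (h n) (snd p) s * ?f (fst p, s))" .
      moreover have "norm (A n g p - g p) \<le> norm (A n g p - A n (c m) p) + (norm (g p - c m p) + norm (A n (c m) p - c m p))"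
        using norm_triangle_ineq[of "A n g p - A n (c m) p" "A n (c m) p - c m p + (c m p - g p)"]
          norm_triangle_ineq[of "A n (c m) p - c m p" "c m p - g p"] norm_minus_commute[of "c m p" "g p"] by simp
      ultimately show ?thesis using True by simp
    qed simp
    have i2: "integrable lborel ?f" by (rule qi) (use g c in auto)
    have i3: "integrable lborel (\<lambda>p. indicator ?Q p * norm (A n (c m) p - c m p))"
      by (rule qi) (use Ab[OF cm c(2)] c in auto)
    have i1: "integrable lborel (\<lambda>p. indicator ?Q p * norm (A n g p - g p))"
      by (rule qi) (use Ab[OF gm g] g in auto)
    have "(LINT p|lborel. indicator ?Q p * norm (A n g p - g p)) \<le>
       (LINT p|lborel. indicator ?Q p * (LINT s|lborel. kern (h n) (snd p) s * ?f (fst p, s)) + (?f p + indicator ?Q p * norm (A n (c m) p - c m p)))"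
      by (rule integral_mono[OF i1 Bochner_Integration.integrable_add[OF kb2 Bochner_Integration.integrable_add[OF i2 i3]] pt])
    also have "\<dots> = (LINT p|lborel. indicator ?Q p * (LINT s|lborel. kern (h n) (snd p) s * ?f (fst p, s))) + (\<delta> m + E n m)"
      unfolding \<delta>_def E_def
      by (simp only: Bochner_Integration.integral_add[OF kb2 Bochner_Integration.integrable_add[OF i2 i3]] Bochner_Integration.integral_add[OF i2 i3])
    finally show ?thesis using kb1 by linarith
  qed
  have "(\<lambda>n. LINT p|lborel. indicator ?Q p * norm (A n g p - g p)) \<longlonglongrightarrow> 0"
  proof (rule LIMSEQ_I)
    fix r :: real assume r: "0 < r"
    have "\<forall>\<^sub>F m in sequentially. \<delta> m < r / 6" using r by (intro order_tendstoD(2)[OF \<delta>0]) auto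
    then obtain m where m: "\<delta> m < r / 6" by (auto simp: eventually_sequentially)
    have "\<forall>\<^sub>F n in sequentially. E n m < r / 2" using r by (intro order_tendstoD(2)[OF E0]) auto
    then obtain N where N: "\<And>n. n \<ge> N \<Longrightarrow> E n m < r / 2" by (auto simp: eventually_sequentially)
    show "\<exists>N. \<forall>n\<ge>N. norm ((LINT p|lborel. indicator ?Q p * norm (A n g p - g p)) - 0) < r"
    proof (intro exI[of _ N] allI impI)
      fix n assume "n \<ge> N"
      have "0 \<le> (LINT p|lborel. indicator ?Q p * norm (A n g p - g p))"
        by (intro integral_nonneg_AE AE_I2) simp
      then show "norm ((LINT p|lborel. indicator ?Q p * norm (A n g p - g p)) - 0) < r"
        using main[of n m] m N[OF \<open>n \<ge> N\<close>] by simp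
    qed
  qed
  then show ?thesis unfolding A_def .
qed

text \<open>Fubini, and the fundamental theorem of calculus on each line in time. With a product for
  \<open>a\<close> this becomes integration by parts.\<close>

lemma time_parts:
  fixes a b :: "'a::euclidean_space \<times> real \<Rightarrow> real"
  assumes \<Omega>: "\<Omega> \<in> sets borel" "bounded \<Omega>" and \<tau>: "0 < \<tau>"
    and bm[measurable]: "b \<in> borel_measurable borel"
    and B: "\<And>x t. x \<in> \<Omega> \<Longrightarrow> t \<in> {0..\<tau>} \<Longrightarrow> \<bar>b (x, t)\<bar> \<le> B"
    and d: "\<And>x t. x \<in> \<Omega> \<Longrightarrow> t \<in> {0..\<tau>} \<Longrightarrow> ((\<lambda>t. a (x, t)) has_real_derivative b (x, t)) (at t within {0..\<tau>})"
    and c: "\<And>x. x \<in> \<Omega> \<Longrightarrow> continuous_on {0..\<tau>} (\<lambda>t. b (x, t))"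
  shows "(LINT p|lborel. indicator (\<Omega> \<times> {0<..<\<tau>}) p * b p) = (LINT x|lborel. indicator \<Omega> x * (a (x, \<tau>) - a (x, 0)))"
    "integrable lborel (\<lambda>p. indicator (\<Omega> \<times> {0<..<\<tau>}) p * b p)"
proof -
  let ?Q = "\<Omega> \<times> {0<..<\<tau>}"
  have Qb[measurable]: "?Q \<in> sets borel" using \<Omega>(1) by (intro borel_Times) auto
  have bQ: "bounded ?Q" using \<Omega>(2) by (intro bounded_Times) auto
  show i: "integrable lborel (\<lambda>p. indicator ?Q p * b p)"
  proof (rule integrable_bounded_support[OF _ bQ, where C="\<bar>B\<bar>"])
    show "norm (indicator ?Q p * b p) \<le> \<bar>B\<bar>" for p
      using B[of "fst p" "snd p"] by (cases "p \<in> ?Q") auto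
  qed auto
  have "(LINT p|lborel. indicator ?Q p * b p) = (LINT x|lborel. LINT t|lborel. indicator ?Q (x, t) * b (x, t))"
    by (rule lborel_Fubini(2)[OF i])
  also have "\<dots> = (LINT x|lborel. indicator \<Omega> x * (a (x, \<tau>) - a (x, 0)))"
  proof (rule Bochner_Integration.integral_cong[OF refl])
    fix x
    show "(LINT t|lborel. indicator ?Q (x, t) * b (x, t)) = indicator \<Omega> x * (a (x, \<tau>) - a (x, 0))"
    proof (cases "x \<in> \<Omega>")
      case True
      have AE0: "AE t in lborel. t \<noteq> (0::real) \<and> t \<noteq> \<tau>"
        using AE_lborel_singleton[of 0] AE_lborel_singleton[of \<tau>] by eventually_elim auto
      have "(LINT t|lborel. indicator ?Q (x, t) * b (x, t)) = (LINT t|lborel. indicator {0..\<tau>} t * b (x, t))"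
      proof (rule integral_cong_AE)
        show "AE t in lborel. indicator ?Q (x, t) * b (x, t) = indicator {0..\<tau>} t * b (x, t)"
          using AE0 by eventually_elim (use True in \<open>auto split: split_indicator\<close>)
        have "(\<lambda>t. indicator ?Q (x, t) * b (x, t)) = (\<lambda>t. indicator {0<..<\<tau>} t * b (x, t))"
          using True by (intro ext) (auto split: split_indicator)
        then show "(\<lambda>t. indicator ?Q (x, t) * b (x, t)) \<in> borel_measurable lborel" by simp
      qed measurable
      also have "\<dots> = a (x, \<tau>) - a (x, 0)"
        by (rule LINT_FTC(1)) (use \<tau> d[OF True] c[OF True] in auto)
      finally show ?thesis using True by simp
    qed simp
  qed
  finally show "(LINT p|lborel. indicator ?Q p * b p) = (LINT x|lborel. indicator \<Omega> x * (a (x, \<tau>) - a (x, 0)))" .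
qed

subsection \<open>Continuous representatives of functions with bounded gradient\<close>

text \<open>Young's inequality |a| <= (e + a^2 / e) / 2 is integrated with \<open>e\<close> equal to
  the norm of \<open>d\<close>, which produces the factor (|\<Omega>| + 1) / 2. If that norm is
  zero, \<open>e\<close> is let tend to zero instead.\<close>

lemma L1_le_L2:
  fixes d :: "'a::euclidean_space \<Rightarrow> real"
  assumes \<Omega>: "open \<Omega>" "bounded \<Omega>" and d: "d \<in> L2 \<Omega>"
  shows "integrable (lebesgue_on \<Omega>) d"
    "(LINT x|lebesgue_on \<Omega>. \<bar>d x\<bar>) \<le> norm_L2 \<Omega> d * (Sigma_Algebra.measure lebesgue \<Omega> + 1) / 2"
proof -
  have lm: "\<Omega> \<in> lmeasurable" using \<Omega> by (simp add: lmeasurable_open)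
  have sp: "emeasure (lebesgue_on \<Omega>) (space (lebesgue_on \<Omega>)) = emeasure lebesgue \<Omega>"
    using lm by (simp add: emeasure_restrict_space fmeasurableD)
  have "finite_measure (lebesgue_on \<Omega>)" using lm by (simp add: finite_measure_lebesgue_on)
  then interpret finite_measure "lebesgue_on \<Omega>" .
  have dm: "d \<in> borel_measurable (lebesgue_on \<Omega>)" and d2: "integrable (lebesgue_on \<Omega>) (\<lambda>x. (d x)\<^sup>2)"
    using d by (auto simp: L2_def)
  have "Sigma_Algebra.measure (lebesgue_on \<Omega>) (space (lebesgue_on \<Omega>)) = Sigma_Algebra.measure lebesgue \<Omega>"
    by (simp only: measure_def sp)
  then have mu: "Sigma_Algebra.measure (lebesgue_on \<Omega>) \<Omega> = Sigma_Algebra.measure lebesgue \<Omega>"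
    by simp
  let ?m = "Sigma_Algebra.measure lebesgue \<Omega>"
  have young: "\<bar>a\<bar> \<le> (e + a\<^sup>2 / e) / 2" if "0 < e" for a e :: real
  proof -
    have "0 \<le> (e - \<bar>a\<bar>)\<^sup>2" by simp
    then have "2 * e * \<bar>a\<bar> \<le> e\<^sup>2 + a\<^sup>2" by (simp add: power2_diff)
    then have "2 * \<bar>a\<bar> \<le> (e\<^sup>2 + a\<^sup>2) / e" using that by (simp add: pos_le_divide_eq ac_simps)
    also have "\<dots> = e + a\<^sup>2 / e" using that by (simp add: add_divide_distrib power2_eq_square)
    finally show ?thesis by simp
  qed
  show i: "integrable (lebesgue_on \<Omega>) d"
  proof (rule Bochner_Integration.integrable_bound)
    show "integrable (lebesgue_on \<Omega>) (\<lambda>x. (1 + (d x)\<^sup>2 / 1) / 2)" using d2 by simp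
    show "AE x in lebesgue_on \<Omega>. norm (d x) \<le> norm ((1 + (d x)\<^sup>2 / 1) / 2)"
      using young[of 1] by (intro AE_I2) (simp add: abs_of_nonneg)
  qed (rule dm)
  have N: "norm_L2 \<Omega> d = sqrt (LINT x|lebesgue_on \<Omega>. (d x)\<^sup>2)" by (simp add: norm_L2_def)
  have N2: "(norm_L2 \<Omega> d)\<^sup>2 = (LINT x|lebesgue_on \<Omega>. (d x)\<^sup>2)" unfolding N by (simp add: integral_nonneg_AE)
  have bnd: "(LINT x|lebesgue_on \<Omega>. \<bar>d x\<bar>) \<le> (e * ?m + (norm_L2 \<Omega> d)\<^sup>2 / e) / 2" if e: "0 < e" for e
  proof -
    have "(LINT x|lebesgue_on \<Omega>. \<bar>d x\<bar>) \<le> (LINT x|lebesgue_on \<Omega>. (e + (d x)\<^sup>2 / e) / 2)"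
      by (rule integral_mono) (use i d2 young[OF e] in auto)
    also have "\<dots> = (e * ?m + (norm_L2 \<Omega> d)\<^sup>2 / e) / 2"
      using d2 by (simp add: N2 mu add_divide_distrib)
    finally show ?thesis .
  qed
  have m0: "0 \<le> ?m" by simp
  show "(LINT x|lebesgue_on \<Omega>. \<bar>d x\<bar>) \<le> norm_L2 \<Omega> d * (?m + 1) / 2"
  proof (cases "norm_L2 \<Omega> d = 0")
    case True
    have "(LINT x|lebesgue_on \<Omega>. \<bar>d x\<bar>) \<le> 0 + e" if e: "0 < e" for e
    proof -
      have "(LINT x|lebesgue_on \<Omega>. \<bar>d x\<bar>) \<le> (e / (?m + 1) * ?m) / 2"
        using bnd[of "e / (?m + 1)"] e m0 True by simp
      also have "\<dots> \<le> e"
      proof -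
        have "e / (m + 1) * m / 2 \<le> e" if "0 \<le> m" for m :: real
        proof -
          have "m / ((m + 1) * 2) \<le> 1" using that by (simp add: pos_divide_le_eq)
          from mult_left_mono[OF this less_imp_le[OF e]] show ?thesis by simp
        qed
        from this[OF m0] show ?thesis .
      qed
      finally show ?thesis by simp
    qed
    then have "(LINT x|lebesgue_on \<Omega>. \<bar>d x\<bar>) \<le> 0" by (rule field_le_epsilon)
    then show ?thesis using True by simp
  next
    case False
    then have p: "0 < norm_L2 \<Omega> d" by (simp add: N less_le integral_nonneg_AE)
    then show ?thesis using bnd[OF p] by (simp add: power2_eq_square algebra_simps)
  qed
qed

text \<open>From (p + q)^2 <= 2 p^2 + 2 q^2. This squared form replaces Minkowski's inequality
  wherever only smallness matters.\<close>

lemma norm_L2_triangle_sq: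
  fixes a b c :: "'a::euclidean_space \<Rightarrow> real"
  assumes "(\<lambda>x. a x - b x) \<in> L2 \<Omega>" "(\<lambda>x. b x - c x) \<in> L2 \<Omega>"
  shows "(\<lambda>x. a x - c x) \<in> L2 \<Omega>"
    "(norm_L2 \<Omega> (\<lambda>x. a x - c x))\<^sup>2 \<le> 2 * (norm_L2 \<Omega> (\<lambda>x. a x - b x))\<^sup>2 + 2 * (norm_L2 \<Omega> (\<lambda>x. b x - c x))\<^sup>2"
proof -
  have m: "(\<lambda>x. a x - b x) \<in> borel_measurable (lebesgue_on \<Omega>)" "(\<lambda>x. b x - c x) \<in> borel_measurable (lebesgue_on \<Omega>)"
    and i: "integrable (lebesgue_on \<Omega>) (\<lambda>x. (a x - b x)\<^sup>2)" "integrable (lebesgue_on \<Omega>) (\<lambda>x. (b x - c x)\<^sup>2)"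
    using assms by (auto simp: L2_def)
  have sq: "(a x - c x)\<^sup>2 \<le> 2 * (a x - b x)\<^sup>2 + 2 * (b x - c x)\<^sup>2" for x
  proof -
    have "0 \<le> ((a x - b x) - (b x - c x))\<^sup>2" by simp
    then show ?thesis by (simp add: power2_eq_square algebra_simps)
  qed
  have ac: "(\<lambda>x. a x - c x) \<in> borel_measurable (lebesgue_on \<Omega>)"
    using borel_measurable_add[OF m] by simp
  have ib: "integrable (lebesgue_on \<Omega>) (\<lambda>x. 2 * (a x - b x)\<^sup>2 + 2 * (b x - c x)\<^sup>2)"
    using i by simp
  have iac: "integrable (lebesgue_on \<Omega>) (\<lambda>x. (a x - c x)\<^sup>2)"
  proof (rule Bochner_Integration.integrable_bound[OF ib])
    show "AE x in lebesgue_on \<Omega>. norm ((a x - c x)\<^sup>2) \<le> norm (2 * (a x - b x)\<^sup>2 + 2 * (b x - c x)\<^sup>2)"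
      using sq by (intro AE_I2) simp
  qed (use ac in measurable)
  then show "(\<lambda>x. a x - c x) \<in> L2 \<Omega>" using ac by (simp add: L2_def)
  have "(LINT x|lebesgue_on \<Omega>. (a x - c x)\<^sup>2) \<le> (LINT x|lebesgue_on \<Omega>. 2 * (a x - b x)\<^sup>2 + 2 * (b x - c x)\<^sup>2)"
    by (rule integral_mono[OF iac ib sq])
  also have "\<dots> = 2 * (LINT x|lebesgue_on \<Omega>. (a x - b x)\<^sup>2) + 2 * (LINT x|lebesgue_on \<Omega>. (b x - c x)\<^sup>2)"
    using i by simp
  finally show "(norm_L2 \<Omega> (\<lambda>x. a x - c x))\<^sup>2 \<le> 2 * (norm_L2 \<Omega> (\<lambda>x. a x - b x))\<^sup>2 + 2 * (norm_L2 \<Omega> (\<lambda>x. b x - c x))\<^sup>2"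
    by (simp add: norm_L2_def integral_nonneg_AE)
qed

lemma norm_L2_minus: "norm_L2 \<Omega> (\<lambda>x. a x - b x) = norm_L2 \<Omega> (\<lambda>x. b x - a x)"
  by (simp add: norm_L2_def power2_commute)

lemma norm_L2_cong_AE:
  assumes "f \<in> borel_measurable (lebesgue_on \<Omega>)" "g \<in> borel_measurable (lebesgue_on \<Omega>)"
    "AE x in lebesgue_on \<Omega>. f x = g x"
  shows "norm_L2 \<Omega> f = norm_L2 \<Omega> g"
proof -
  have "(LINT x|lebesgue_on \<Omega>. (f x)\<^sup>2) = (LINT x|lebesgue_on \<Omega>. (g x)\<^sup>2)"
  proof (rule integral_cong_AE)
    show "AE x in lebesgue_on \<Omega>. (f x)\<^sup>2 = (g x)\<^sup>2" using assms(3) by eventually_elim simp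
  qed (use assms in measurable)
  then show ?thesis by (simp add: norm_L2_def)
qed

text \<open>Where |w| exceeds \<open>e\<close>, it is at least \<open>e / 2\<close> on a ball whose
  radius depends only on \<open>L\<close> and \<open>e\<close>. That ball stays inside
  \<open>\<Omega>\<close>, since \<open>w\<close> vanishes on the frontier and cannot fall from
  \<open>e\<close> to zero over so short a distance. Its volume bounds the L2 norm from below. In
  this way convergence in L2 becomes uniform convergence.\<close>

lemma sup_small_if_L2_small:
  fixes \<Omega> :: "'a::euclidean_space set"
  assumes \<Omega>: "open \<Omega>" "bounded \<Omega>" and L: "0 \<le> L" and e: "0 < e"
  obtains d where "0 < d" "\<And>w. L-lipschitz_on (closure \<Omega>) w \<Longrightarrow> (\<And>x. x \<in> frontier \<Omega> \<Longrightarrow> w x = 0) \<Longrightarrow> w \<in> L2 \<Omega> \<Longrightarrow>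
      norm_L2 \<Omega> w < d \<Longrightarrow> (\<forall>x\<in>closure \<Omega>. \<bar>w x\<bar> \<le> e)"
proof -
  \<comment> \<open>\<open>L + 1\<close> avoids a division by zero and still gives
    \<open>L * r \<le> e / 2\<close>.\<close>
  define r where "r = e / (2 * (L + 1))"
  have r: "0 < r" "L * r \<le> e / 2" using L e by (auto simp: r_def field_simps)
  define c where "c = Sigma_Algebra.measure lebesgue (ball (0::'a) r)"
  have c: "0 < c" unfolding c_def using content_ball_gt_0_iff[of "0::'a" r] r by simp
  define d where "d = e / 2 * sqrt c"
  have d: "0 < d" using c e by (simp add: d_def)
  show ?thesis
  proof (rule that[OF d])
    fix w :: "'a \<Rightarrow> real"
    assume w: "L-lipschitz_on (closure \<Omega>) w" "\<And>x. x \<in> frontier \<Omega> \<Longrightarrow> w x = 0" "w \<in> L2 \<Omega>" "norm_L2 \<Omega> w < d"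
    have lip: "\<bar>w x - w y\<bar> \<le> L * dist x y" if "x \<in> closure \<Omega>" "y \<in> closure \<Omega>" for x y
      using lipschitz_onD[OF w(1) that] by (simp add: dist_real_def)
    show "\<forall>x\<in>closure \<Omega>. \<bar>w x\<bar> \<le> e"
    proof (rule ccontr)
      assume "\<not> (\<forall>x\<in>closure \<Omega>. \<bar>w x\<bar> \<le> e)"
      then obtain x where x: "x \<in> closure \<Omega>" "e < \<bar>w x\<bar>" by force
      have xO: "x \<in> \<Omega>" using w(2)[of x] x e \<Omega>(1) by (cases "x \<in> \<Omega>") (auto simp: frontier_def interior_open)
      have sub: "ball x r \<subseteq> \<Omega>"
      proof (rule ccontr)
        assume "\<not> ball x r \<subseteq> \<Omega>"
        moreover have "x \<in> ball x r \<inter> \<Omega>" using xO r(1) by simp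
        ultimately have "ball x r \<inter> frontier \<Omega> \<noteq> {}"
          by (intro connected_Int_frontier convex_connected convex_ball) blast+
        then obtain z where z: "z \<in> ball x r" "z \<in> frontier \<Omega>" by blast
        then have "\<bar>w x - w z\<bar> \<le> L * dist x z" using x by (intro lip) (auto simp: frontier_def)
        also have "\<dots> \<le> L * r" using z L by (intro mult_left_mono) auto
        finally show False using r(2) x(2) w(2)[OF z(2)] e by simp
      qed
      have big: "(e / 2)\<^sup>2 \<le> (w z)\<^sup>2" if "z \<in> ball x r" for z
      proof -
        have "\<bar>w x - w z\<bar> \<le> L * dist x z" using x sub that closure_subset[of \<Omega>] by (intro lip) auto
        also have "\<dots> \<le> L * r" using that L by (intro mult_left_mono) auto
        finally have "e / 2 \<le> \<bar>w z\<bar>" using r(2) x(2) by linarith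
        then show ?thesis using e by (metis abs_le_square_iff abs_of_nonneg half_gt_zero less_imp_le)
      qed
      have Ol: "\<Omega> \<in> sets lebesgue" using \<Omega> by (simp add: borel_open)
      have iw: "integrable lebesgue (\<lambda>z. indicator \<Omega> z *\<^sub>R (w z)\<^sup>2)"
        using w(3) integrable_lebesgue_on_iff[OF Ol, of "\<lambda>z. (w z)\<^sup>2"] by (simp add: L2_def)
      have ball: "Sigma_Algebra.measure lebesgue (ball x r) = c"
        unfolding c_def using content_ball_conv_unit_ball[of r x] content_ball_conv_unit_ball[of r "0::'a"] r(1) by simp
      have "(e / 2)\<^sup>2 * c = (LINT z|lebesgue. indicator (ball x r) z * (e / 2)\<^sup>2)"
        by (simp add: ball mult.commute)
      also have "\<dots> \<le> (LINT z|lebesgue. indicator \<Omega> z *\<^sub>R (w z)\<^sup>2)"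
      proof (rule integral_mono)
        show "integrable lebesgue (\<lambda>z. indicator (ball x r) z * (e / 2)\<^sup>2 :: real)"
          by (intro integrable_mult_left integrable_real_indicator)
             (auto intro: emeasure_bounded_finite[unfolded infinity_ennreal_def])
        show "indicator (ball x r) z * (e / 2)\<^sup>2 \<le> indicator \<Omega> z *\<^sub>R (w z)\<^sup>2" for z
          using big[of z] sub by (cases "z \<in> ball x r") auto
      qed (rule iw)
      also have "\<dots> = (norm_L2 \<Omega> w)\<^sup>2"
        by (simp add: norm_L2_def LINT_lebesgue_on[OF Ol] integral_nonneg_AE)
      also have "\<dots> < d\<^sup>2"
        using w(4) by (intro power_strict_mono) (auto simp: norm_L2_def integral_nonneg_AE)
      also have "\<dots> = (e / 2)\<^sup>2 * c" using c by (simp add: d_def power_mult_distrib power_divide)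
      finally show False by simp
    qed
  qed
qed

lemma continuous_in_L2:
  fixes w :: "'a::euclidean_space \<Rightarrow> real"
  assumes \<Omega>: "open \<Omega>" "bounded \<Omega>" and w: "continuous_on (closure \<Omega>) w"
  shows "w \<in> L2 \<Omega>"
proof -
  have Ol: "\<Omega> \<in> sets lebesgue" using \<Omega> by (simp add: borel_open)
  have Ob[measurable]: "\<Omega> \<in> sets borel" using \<Omega> by simp
  have "continuous_on \<Omega> w" using w closure_subset continuous_on_subset by blast
  then have wm: "w \<in> borel_measurable (lebesgue_on \<Omega>)"
    by (intro continuous_imp_measurable_on_sets_lebesgue Ol)
  have "compact (w ` closure \<Omega>)" using w \<Omega>(2) by (intro compact_continuous_image) auto
  then obtain B where "\<forall>x\<in>closure \<Omega>. \<bar>w x\<bar> \<le> B" by (auto dest!: compact_imp_bounded simp: bounded_iff)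
  then have B: "\<And>x. x \<in> closure \<Omega> \<Longrightarrow> \<bar>w x\<bar> \<le> B" by blast
  have fin: "finite_measure (lebesgue_on \<Omega>)" using \<Omega> by (simp add: finite_measure_lebesgue_on lmeasurable_open)
  have "integrable (lebesgue_on \<Omega>) (\<lambda>x. (w x)\<^sup>2)"
  proof (rule finite_measure.integrable_const_bound[OF fin, of _ "B\<^sup>2"])
    show "AE x in lebesgue_on \<Omega>. norm ((w x)\<^sup>2) \<le> B\<^sup>2"
    proof (rule AE_I2)
      fix x assume "x \<in> space (lebesgue_on \<Omega>)"
      then have "\<bar>w x\<bar> \<le> B" using B closure_subset[of \<Omega>] by (auto simp: space_restrict_space)
      then show "norm ((w x)\<^sup>2) \<le> B\<^sup>2" by (simp add: abs_le_square_iff[symmetric])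
    qed
  qed (use wm in measurable)
  then show ?thesis using wm by (simp add: L2_def)
qed

section \<open>Null sets, slices and dense sets of times\<close>

lemma AE_lborel_slices:
  fixes P :: "'a::euclidean_space \<times> 'b::euclidean_space \<Rightarrow> bool"
  assumes "AE p in lborel. P p"
  shows "AE t in lborel. AE x in lborel. P (x, t)"
proof -
  obtain N where N: "N \<in> null_sets lborel" "{p. \<not> P p} \<subseteq> N"
    using assms by (auto simp: eventually_ae_filter)
  have Nm: "N \<in> sets (lborel \<Otimes>\<^sub>M lborel)" unfolding lborel_prod using N(1) by auto
  have "AE p in lborel \<Otimes>\<^sub>M lborel. p \<notin> N" using N(1) by (simp add: lborel_prod AE_not_in)
  then have "AE x in lborel. AE t in lborel. (x, t) \<notin> N" by (rule lborel_pair.AE_pair)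
  moreover have "{x \<in> space (lborel \<Otimes>\<^sub>M lborel). (fst x, snd x) \<notin> N} \<in> sets (lborel \<Otimes>\<^sub>M lborel)"
    using sets.compl_sets[OF Nm] by (simp add: set_diff_eq)
  ultimately have "AE t in lborel. AE x in lborel. (x, t) \<notin> N"
    by (subst (asm) lborel_pair.AE_commute)
  then show ?thesis
  proof eventually_elim
    case (elim t)
    then show ?case by eventually_elim (use N(2) in auto)
  qed
qed

lemma AE_lborel_from_slices:
  fixes P :: "'a::euclidean_space \<times> 'b::euclidean_space \<Rightarrow> bool"
  assumes m: "{p. P p} \<in> sets borel" and ae: "AE t in lborel. AE x in lborel. P (x, t)"
  shows "AE p in lborel. P p"
proof -
  have Pm: "{x \<in> space (lborel \<Otimes>\<^sub>M lborel). P x} \<in> sets (lborel \<Otimes>\<^sub>M lborel)"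
    unfolding lborel_prod using m by simp
  then have "AE x in lborel. AE t in lborel. P (x, t)"
    using ae by (subst lborel_pair.AE_commute) simp_all
  from lborel_pair.AE_pair_measure[OF Pm this] show ?thesis unfolding lborel_prod .
qed

lemma open_open_time: "open (open_time T)"
proof (cases T)
  case (real r)
  then have "open_time T = {0<..<r}" by (auto simp: open_time_def)
  then show ?thesis by simp
next
  case PInf
  then have "open_time T = {0<..}" by (auto simp: open_time_def)
  then show ?thesis by simp
qed (simp add: open_time_def)

lemma open_time_subset_closed: "open_time T \<subseteq> closed_time T"
  by (auto simp: open_time_def closed_time_def)

lemma closed_closed_time: "closed (closed_time T)"
  by (cases T) (auto simp: closed_time_def intro!: closed_Collect_conj closed_Collect_le continuous_intros)

lemma convex_closed_time: "convex (closed_time T)"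
  unfolding closed_time_def convex_alt
proof clarify
  fix x y u :: real assume a: "0 \<le> x" "ereal x \<le> T" "0 \<le> y" "ereal y \<le> T" "0 \<le> u" "u \<le> 1"
  have "(1 - u) *\<^sub>R x + u *\<^sub>R y \<le> max x y" using a convex_bound_le[of x "max x y" y "1 - u" u] by simp
  then have "ereal ((1 - u) *\<^sub>R x + u *\<^sub>R y) \<le> ereal (max x y)" by (simp only: ereal_less_eq)
  also have "\<dots> \<le> T" using a by (simp add: max_def)
  finally show "0 \<le> (1 - u) *\<^sub>R x + u *\<^sub>R y \<and> ereal ((1 - u) *\<^sub>R x + u *\<^sub>R y) \<le> T" using a by simp
qed

lemma zero_in_closed_time: "0 < T \<Longrightarrow> 0 \<in> closed_time T"
  by (auto simp: closed_time_def simp flip: zero_ereal_def)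

text \<open>A set of full measure meets every interval. The interval is placed to the right of
  \<open>t\<close>, or to its left when \<open>t\<close> is the end time.\<close>

lemma good_times_dense:
  assumes T: "0 < T" and ae: "AE s in lborel. s \<in> open_time T \<longrightarrow> P s" and t: "t \<in> closed_time T"
  obtains s where "\<And>n::nat. s n \<in> open_time T \<and> P (s n)" "s \<longlonglongrightarrow> t"
proof -
  have "\<exists>s. s \<in> open_time T \<and> P s \<and> \<bar>s - t\<bar> < \<delta>" if \<delta>: "0 < \<delta>" for \<delta>
  proof -
    obtain a b where ab: "a < b" "\<And>s. a < s \<Longrightarrow> s < b \<Longrightarrow> s \<in> open_time T \<and> \<bar>s - t\<bar> < \<delta>"
    proof (cases "ereal t < T")
      case True
      then obtain b where b: "ereal t < ereal b" "ereal b < T" using ereal_dense2 by blast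
      show ?thesis
      proof (rule that[of t "min b (t + \<delta>)"])
        show "t < min b (t + \<delta>)" using b(1) \<delta> by simp
        fix s assume s: "t < s" "s < min b (t + \<delta>)"
        then have "ereal s < T" using b(2) by (intro less_trans[OF _ b(2)]) simp
        then show "s \<in> open_time T \<and> \<bar>s - t\<bar> < \<delta>" using s t by (auto simp: open_time_def closed_time_def)
      qed
    next
      case False
      then have tT: "ereal t = T" using t by (auto simp: closed_time_def)
      then have t0: "0 < t" using T by (metis ereal_less(2))
      show ?thesis
      proof (rule that[of "max 0 (t - \<delta>)" t])
        show "max 0 (t - \<delta>) < t" using t0 \<delta> by simp
        fix s assume s: "max 0 (t - \<delta>) < s" "s < t"
        then show "s \<in> open_time T \<and> \<bar>s - t\<bar> < \<delta>" using tT by (auto simp: open_time_def)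
      qed
    qed
    have "\<exists>s. a < s \<and> s < b \<and> P s"
    proof (rule ccontr)
      assume n: "\<not> (\<exists>s. a < s \<and> s < b \<and> P s)"
      have "AE s in lborel. s \<notin> {a<..<b}"
        using ae by eventually_elim (use n ab(2) in auto)
      then have "emeasure lborel {a<..<b} = 0"
        by (subst (asm) AE_iff_measurable[of "{a<..<b}"]) auto
      then show False using ab(1) by simp
    qed
    then show ?thesis using ab(2) by blast
  qed
  then have "\<forall>n::nat. \<exists>s. s \<in> open_time T \<and> P s \<and> \<bar>s - t\<bar> < 1 / real (Suc n)" by simp
  then obtain s where s: "\<And>n. s n \<in> open_time T \<and> P (s n) \<and> \<bar>s n - t\<bar> < 1 / real (Suc n)" by metis
  have "(\<lambda>n. s n - t) \<longlonglongrightarrow> 0"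
  proof (rule Lim_null_comparison)
    show "\<forall>\<^sub>F n in sequentially. norm (s n - t) \<le> 1 / real (Suc n)"
      using s by (intro always_eventually allI) (simp add: less_imp_le)
  qed (rule LIMSEQ_Suc[OF lim_1_over_n])
  then have "s \<longlonglongrightarrow> t" by (simp add: LIM_zero_iff)
  with s show ?thesis using that by blast
qed

lemma C0_L2_sequence:
  assumes u: "u \<in> C0_L2 \<Omega> T" and t: "t \<in> closed_time T" and s: "\<And>n::nat. s n \<in> closed_time T" "s \<longlonglongrightarrow> t"
  shows "(\<lambda>n. norm_L2 \<Omega> (\<lambda>x. u (x, s n) - u (x, t))) \<longlonglongrightarrow> 0"
proof -
  let ?f = "\<lambda>s. norm_L2 \<Omega> (\<lambda>x. u (x, s) - u (x, t))"
  have f0: "?f t = 0" by (simp add: norm_L2_def)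
  have "(?f \<longlongrightarrow> ?f t) (at t within closed_time T)" unfolding f0 using u t by (simp add: C0_L2_def)
  then have "continuous (at t within closed_time T) ?f" by (simp add: continuous_within)
  then have "(?f \<circ> s) \<longlonglongrightarrow> ?f t" using s unfolding continuous_within_sequentially by blast
  then show ?thesis by (simp only: f0 o_def)
qed

lemma L2_diff: "a \<in> L2 \<Omega> \<Longrightarrow> b \<in> L2 \<Omega> \<Longrightarrow> (\<lambda>x. a x - b x) \<in> L2 \<Omega>"
proof -
  assume ab: "a \<in> L2 \<Omega>" "b \<in> L2 \<Omega>"
  have "(\<lambda>x. a x - (\<lambda>_. 0) x) \<in> L2 \<Omega>" "(\<lambda>x. (\<lambda>_. 0) x - b x) \<in> L2 \<Omega>" using ab by (simp_all add: L2_def)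
  then show ?thesis by (rule norm_L2_triangle_sq(1))
qed

lemma has_weak_grad_cong:
  fixes v :: "'a::euclidean_space \<times> real \<Rightarrow> real"
  assumes U: "open U" and v: "has_weak_grad U v g"
    and ae: "AE p in lebesgue_on U. v p = v' p" "AE p in lebesgue_on U. g p = g' p"
    and li: "locally_integrable U v'" "locally_integrable U g'"
  shows "has_weak_grad U v' g'"
proof -
  have Ul: "U \<in> sets lebesgue" using U by (simp add: borel_open)
  have lv: "locally_integrable U v" "locally_integrable U g" using v by (auto simp: has_weak_grad_def)
  show ?thesis
    unfolding has_weak_grad_iff[OF U li]
  proof (intro ballI allI)
    fix \<phi> h assume \<phi>: "\<phi> \<in> test_functions U"
    have i: "integrable (lebesgue_on U) (\<lambda>p. v p * frechet_derivative \<phi> (at p) (h, 0))" if "locally_integrable U v" for v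
      using integrable_test_scaleR[OF Ul that test_functions_deriv[OF \<phi>]] by (simp add: mult.commute)
    have j: "integrable (lebesgue_on U) (\<lambda>p. \<phi> p * (g p \<bullet> h))" if "locally_integrable U g" for g
      using integrable_test_scaleR[OF Ul locally_integrable_inner[OF that] \<phi>] by simp
    have "(LINT p|lebesgue_on U. v' p * frechet_derivative \<phi> (at p) (h, 0)) = (LINT p|lebesgue_on U. v p * frechet_derivative \<phi> (at p) (h, 0))"
    proof (rule integral_cong_AE[OF borel_measurable_integrable[OF i[OF li(1)]] borel_measurable_integrable[OF i[OF lv(1)]]])
      show "AE p in lebesgue_on U. v' p * frechet_derivative \<phi> (at p) (h, 0) = v p * frechet_derivative \<phi> (at p) (h, 0)"
        using ae(1) by eventually_elim simp
    qed
    moreover have "(LINT p|lebesgue_on U. \<phi> p * (g' p \<bullet> h)) = (LINT p|lebesgue_on U. \<phi> p * (g p \<bullet> h))"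
    proof (rule integral_cong_AE[OF borel_measurable_integrable[OF j[OF li(2)]] borel_measurable_integrable[OF j[OF lv(2)]]])
      show "AE p in lebesgue_on U. \<phi> p * (g' p \<bullet> h) = \<phi> p * (g p \<bullet> h)"
        using ae(2) by eventually_elim simp
    qed
    ultimately show "(LINT p|lebesgue_on U. v' p * frechet_derivative \<phi> (at p) (h, 0)) = - (LINT p|lebesgue_on U. \<phi> p * (g' p \<bullet> h))"
      using v \<phi> has_weak_grad_iff[OF U lv] by simp
  qed
qed

section \<open>Lipschitz slices at almost every time and at every time\<close>

text \<open>Membership in \<open>Kinf_bd\<close> provides Lipschitz slices whose constants may vary
  with time; the bound on the weak gradient \<open>g\<close> makes \<open>C\<close> valid for almost
  every time.\<close>

lemma Kinf_lipschitz_slices: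
  fixes \<Omega> :: "'a::euclidean_space set"
  assumes \<Omega>: "open \<Omega>" "bounded \<Omega>" "convex \<Omega>" "\<Omega> \<noteq> {}" and T: "0 < T" and u: "u \<in> Kinf_bd \<Omega> T u0"
    and u': "u' \<in> borel_measurable borel" "\<And>p. \<bar>u' p\<bar> \<le> C" "AE p in lebesgue_on (cylinder \<Omega> T). u p = u' p"
    and g: "g \<in> borel_measurable borel" "\<And>p. norm (g p) \<le> C" "has_weak_grad (cylinder \<Omega> T) u' g"
  shows "AE t in lborel. t \<in> open_time T \<longrightarrow> (\<exists>w. C-lipschitz_on (closure \<Omega>) w \<and>
    (AE x in lebesgue_on \<Omega>. u (x, t) = w x) \<and> (\<forall>x\<in>frontier \<Omega>. w x = u0 x))"
proof -
  have C: "0 \<le> C" using g(2) norm_ge_zero order_trans by blast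
  have Ol: "\<Omega> \<in> sets lebesgue" and Ob: "\<Omega> \<in> sets borel" using \<Omega> by (auto simp: borel_open)
  have uC: "u \<in> C0_L2 \<Omega> T" using u by (auto simp: Kinf_bd_def Kinf_def)
  have uL2: "(\<lambda>x. u (x, t)) \<in> L2 \<Omega>" if "t \<in> closed_time T" for t using uC that by (auto simp: C0_L2_def)
  have otl: "open_time T \<in> sets lebesgue" using open_open_time[of T] by (simp add: borel_open)
  have cl: "open (cylinder \<Omega> T)" unfolding cylinder_def using \<Omega>(1) open_open_time by (rule open_Times)
  have cyl: "cylinder \<Omega> T \<in> sets lebesgue" using cl by (simp add: borel_open)
  have bd: "AE t in lborel. t \<in> open_time T \<longrightarrow> (\<exists>w\<in>W1inf \<Omega>. (AE x in lebesgue_on \<Omega>. u (x, t) = w x) \<and> (\<forall>x\<in>frontier \<Omega>. w x = u0 x))"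
    using u unfolding Kinf_bd_def by (simp add: AE_lebesgue_on_iff[OF otl])
  have "AE p in lborel. p \<in> cylinder \<Omega> T \<longrightarrow> u p = u' p"
    using u'(3) by (simp add: AE_lebesgue_on_iff[OF cyl])
  from AE_lborel_slices[OF this]
  have us: "AE t in lborel. t \<in> open_time T \<longrightarrow> (AE x in lborel. x \<in> \<Omega> \<longrightarrow> u (x, t) = u' (x, t))"
    by eventually_elim (auto simp: cylinder_def elim: eventually_mono)
  define m where "m t D = (LINT x|lebesgue_on \<Omega>. u (x, t) * D x)" for t and D :: "'a \<Rightarrow> real"
  \<comment> \<open>For a given \<open>\<zeta>\<close> the bound holds at almost every time.
    Continuity of \<open>u\<close> in L2 makes the integral continuous in time, so the bound holds
    at every time and therefore for all \<open>\<zeta>\<close> at once.\<close>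
  have key: "\<bar>m t (\<lambda>x. frechet_derivative \<zeta> (at x) h)\<bar> \<le> C * norm h * (LINT x|lborel. \<bar>\<zeta> x\<bar>)"
    if t: "t \<in> open_time T" and \<zeta>: "\<zeta> \<in> test_functions \<Omega>" for t \<zeta> h
  proof -
    define D where "D x = frechet_derivative \<zeta> (at x) h" for x
    have Dt: "D \<in> test_functions \<Omega>" unfolding D_def[abs_def] by (rule test_functions_deriv[OF \<zeta>])
    have [measurable]: "D \<in> borel_measurable borel" "\<zeta> \<in> borel_measurable borel" "u' \<in> borel_measurable borel" "g \<in> borel_measurable borel"
      using Dt \<zeta> u' g by (auto intro: test_functions_borel)
    have Dl: "D \<in> borel_measurable (lebesgue_on \<Omega>)" by (rule borel_measurable_imp_lebesgue) measurable
    obtain B where B: "0 < B" "\<And>x. \<bar>D x\<bar> \<le> B" using test_functions_bounded[OF Dt] by blast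
    let ?K = "C * norm h * (LINT x|lborel. \<bar>\<zeta> x\<bar>)"
    have "AE s in lborel. s \<in> open_time T \<longrightarrow> \<bar>m s D\<bar> \<le> ?K"
      using us weak_grad_slice[OF \<Omega>(1) open_open_time g(3)[unfolded cylinder_def] u'(1) g(1) u'(2) g(2) \<zeta>, of h]
    proof eventually_elim
      case (elim s)
      show ?case
      proof
        assume s: "s \<in> open_time T"
        have sl: "AE x in lebesgue_on \<Omega>. u (x, s) = u' (x, s)" using elim(1) s by (simp add: AE_lebesgue_on_iff[OF Ol])
        have um: "(\<lambda>x. u (x, s)) \<in> borel_measurable (lebesgue_on \<Omega>)"
          using uL2[of s] s open_time_subset_closed by (auto simp: L2_def)
        have "m s D = (LINT x|lebesgue_on \<Omega>. u' (x, s) * D x)"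
          unfolding m_def
        proof (rule integral_cong_AE)
          show "(\<lambda>x. u (x, s) * D x) \<in> borel_measurable (lebesgue_on \<Omega>)" using um Dl by (rule borel_measurable_times)
          show "(\<lambda>x. u' (x, s) * D x) \<in> borel_measurable (lebesgue_on \<Omega>)" by (rule borel_measurable_imp_lebesgue) measurable
          show "AE x in lebesgue_on \<Omega>. u (x, s) * D x = u' (x, s) * D x" using sl by eventually_elim simp
        qed
        also have "\<dots> = (LINT x|lborel. u' (x, s) * D x)"
          by (rule LINT_lebesgue_on_zero_off[OF Ob]) (use test_functions_outside[OF Dt] in auto)
        also have "\<dots> = - (LINT x|lborel. \<zeta> x * (g (x, s) \<bullet> h))" using elim(2) s by (simp add: D_def)
        finally have "\<bar>m s D\<bar> \<le> (LINT x|lborel. \<bar>\<zeta> x * (g (x, s) \<bullet> h)\<bar>)" using integral_abs_bound by simp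
        also have "\<dots> \<le> (LINT x|lborel. C * norm h * \<bar>\<zeta> x\<bar>)"
        proof (rule integral_mono')
          show "integrable lborel (\<lambda>x. C * norm h * \<bar>\<zeta> x\<bar>)" using test_functions_integrable[OF \<zeta>] by simp
          fix x
          have "\<bar>g (x, s) \<bullet> h\<bar> \<le> C * norm h"
            using Cauchy_Schwarz_ineq2[of "g (x, s)" h] mult_right_mono[OF g(2)[of "(x, s)"] norm_ge_zero[of h]] by linarith
          then show "\<bar>\<zeta> x * (g (x, s) \<bullet> h)\<bar> \<le> C * norm h * \<bar>\<zeta> x\<bar>"
            using mult_right_mono[of "\<bar>g (x, s) \<bullet> h\<bar>" "C * norm h" "\<bar>\<zeta> x\<bar>"] by (simp add: abs_mult mult.commute)
          show "0 \<le> C * norm h * \<bar>\<zeta> x\<bar>" using C by simp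
        qed
        also have "\<dots> = ?K" by simp
        finally show "\<bar>m s D\<bar> \<le> ?K" .
      qed
    qed
    then obtain s where s: "\<And>n. s n \<in> open_time T \<and> \<bar>m (s n) D\<bar> \<le> ?K" "s \<longlonglongrightarrow> t"
      using good_times_dense[OF T, of "\<lambda>s. \<bar>m s D\<bar> \<le> ?K"] t open_time_subset_closed by blast
    let ?c = "(Sigma_Algebra.measure lebesgue \<Omega> + 1) / 2"
    have sc: "s n \<in> closed_time T" "t \<in> closed_time T" for n using s t open_time_subset_closed by auto
    have lim: "(\<lambda>n. norm_L2 \<Omega> (\<lambda>x. u (x, s n) - u (x, t))) \<longlonglongrightarrow> 0"
      by (rule C0_L2_sequence[OF uC sc(2) sc(1) s(2)])
    have "\<bar>m t D\<bar> \<le> ?K + B * (norm_L2 \<Omega> (\<lambda>x. u (x, s n) - u (x, t)) * ?c)" for n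
    proof -
      have d: "(\<lambda>x. u (x, s n) - u (x, t)) \<in> L2 \<Omega>" using uL2 sc by (intro L2_diff) auto
      have id: "integrable (lebesgue_on \<Omega>) (\<lambda>x. u (x, s) * D x)" if "s \<in> closed_time T" for s
      proof (rule Bochner_Integration.integrable_bound)
        show "integrable (lebesgue_on \<Omega>) (\<lambda>x. B * u (x, s))" using L1_le_L2(1)[OF \<Omega>(1,2) uL2[OF that]] by simp
        show "(\<lambda>x. u (x, s) * D x) \<in> borel_measurable (lebesgue_on \<Omega>)"
          using L1_le_L2(1)[OF \<Omega>(1,2) uL2[OF that]] Dl by (intro borel_measurable_times) auto
        show "AE x in lebesgue_on \<Omega>. norm (u (x, s) * D x) \<le> norm (B * u (x, s))"
        proof (intro AE_I2)
          fix x
          show "norm (u (x, s) * D x) \<le> norm (B * u (x, s))"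
            using B(1) mult_left_mono[OF B(2)[of x] abs_ge_zero[of "u (x, s)"]] by (simp add: abs_mult mult.commute)
        qed
      qed
      have "m (s n) D - m t D = (LINT x|lebesgue_on \<Omega>. (u (x, s n) - u (x, t)) * D x)"
        unfolding m_def using id[OF sc(1)] id[OF sc(2)] by (simp add: left_diff_distrib)
      then have "\<bar>m (s n) D - m t D\<bar> \<le> (LINT x|lebesgue_on \<Omega>. \<bar>(u (x, s n) - u (x, t)) * D x\<bar>)"
        using integral_abs_bound by simp
      also have "\<dots> \<le> (LINT x|lebesgue_on \<Omega>. B * \<bar>u (x, s n) - u (x, t)\<bar>)"
      proof (rule integral_mono')
        show "integrable (lebesgue_on \<Omega>) (\<lambda>x. B * \<bar>u (x, s n) - u (x, t)\<bar>)" using L1_le_L2(1)[OF \<Omega>(1,2) d] by simp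
        fix x
        show "\<bar>(u (x, s n) - u (x, t)) * D x\<bar> \<le> B * \<bar>u (x, s n) - u (x, t)\<bar>"
          using mult_left_mono[OF B(2) abs_ge_zero[of "u (x, s n) - u (x, t)"]] by (simp add: abs_mult mult.commute)
        show "0 \<le> B * \<bar>u (x, s n) - u (x, t)\<bar>" using B by simp
      qed
      also have "\<dots> = B * (LINT x|lebesgue_on \<Omega>. \<bar>u (x, s n) - u (x, t)\<bar>)" by simp
      also have "\<dots> \<le> B * (norm_L2 \<Omega> (\<lambda>x. u (x, s n) - u (x, t)) * ?c)"
        using L1_le_L2(2)[OF \<Omega>(1,2) d] B by (intro mult_left_mono) auto
      finally show ?thesis using s(1)[of n] by linarith
    qed
    then have "\<bar>m t D\<bar> \<le> ?K + B * (0 * ?c)"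
      by (intro LIMSEQ_le_const[OF tendsto_add[OF tendsto_const tendsto_mult[OF tendsto_const tendsto_mult[OF lim tendsto_const]]]]) auto
    then show ?thesis by (simp add: D_def[abs_def])
  qed
  show ?thesis using bd
  proof eventually_elim
    case (elim t)
    show ?case
    proof
      assume t: "t \<in> open_time T"
      then obtain w K where w: "K-lipschitz_on (closure \<Omega>) w" "AE x in lebesgue_on \<Omega>. u (x, t) = w x" "\<forall>x\<in>frontier \<Omega>. w x = u0 x"
        using elim by (auto simp: W1inf_def)
      have cw: "continuous_on (closure \<Omega>) w" using w(1) by (rule lipschitz_on_continuous_on)
      \<comment> \<open>Nearest point projection extends the slice continuously to the whole space,
        as the Lipschitz criterion demands.\<close>
      define W where "W x = w (closest_point (closure \<Omega>) x)" for x
      have cc: "closed (closure \<Omega>)" "convex (closure \<Omega>)" "closure \<Omega> \<noteq> {}" using \<Omega> by (auto simp: convex_closure)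
      have cW: "continuous_on UNIV W" unfolding W_def
        by (rule continuous_on_compose2[OF cw continuous_on_closest_point[OF cc(2,1,3)]]) (use closest_point_in_set[OF cc(1,3)] in auto)
      have Ww: "W x = w x" if "x \<in> closure \<Omega>" for x using that by (simp add: W_def closest_point_self)
      have Wm: "W \<in> borel_measurable borel" using cW by (rule borel_measurable_continuous_onI)
      have "\<bar>W x - W y\<bar> \<le> C * norm (x - y)" if "x \<in> \<Omega>" "y \<in> \<Omega>" for x y
      proof (rule lipschitz_if_weak_derivative_bounded[OF \<Omega>(1,3) cW C _ that])
        fix \<zeta> h assume \<zeta>: "\<zeta> \<in> test_functions \<Omega>"
        have Dt: "(\<lambda>x. frechet_derivative \<zeta> (at x) h) \<in> test_functions \<Omega>" by (rule test_functions_deriv[OF \<zeta>])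
        have Dm[measurable]: "(\<lambda>x. frechet_derivative \<zeta> (at x) h) \<in> borel_measurable borel" using Dt by (rule test_functions_borel)
        have um: "(\<lambda>x. u (x, t)) \<in> borel_measurable (lebesgue_on \<Omega>)"
          using uL2[of t] t open_time_subset_closed by (auto simp: L2_def)
        have "(LINT x|lborel. W x * frechet_derivative \<zeta> (at x) h) = (LINT x|lebesgue_on \<Omega>. W x * frechet_derivative \<zeta> (at x) h)"
          by (rule LINT_lebesgue_on_zero_off[OF Ob, symmetric]) (use Wm test_functions_outside[OF Dt] in auto)
        also have "\<dots> = m t (\<lambda>x. frechet_derivative \<zeta> (at x) h)"
          unfolding m_def
        proof (rule integral_cong_AE)
          show "(\<lambda>x. W x * frechet_derivative \<zeta> (at x) h) \<in> borel_measurable (lebesgue_on \<Omega>)"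
            by (intro borel_measurable_times borel_measurable_imp_lebesgue Wm Dm)
          show "(\<lambda>x. u (x, t) * frechet_derivative \<zeta> (at x) h) \<in> borel_measurable (lebesgue_on \<Omega>)"
            by (intro borel_measurable_times borel_measurable_imp_lebesgue um Dm)
          have "AE x in lebesgue_on \<Omega>. x \<in> \<Omega>" by (rule AE_I2) (simp add: space_restrict_space)
          with w(2) show "AE x in lebesgue_on \<Omega>. W x * frechet_derivative \<zeta> (at x) h = u (x, t) * frechet_derivative \<zeta> (at x) h"
            by eventually_elim (use Ww closure_subset in auto)
        qed
        finally show "\<bar>(LINT x|lborel. W x * frechet_derivative \<zeta> (at x) h)\<bar> \<le> C * norm h * (LINT x|lborel. \<bar>\<zeta> x\<bar>)"
          using key[OF t \<zeta>, of h] by simp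
      qed
      then have "C-lipschitz_on \<Omega> W" using C by (intro lipschitz_onI) (auto simp: dist_real_def dist_norm)
      then have "C-lipschitz_on (closure \<Omega>) W" by (rule lipschitz_on_closure) (rule continuous_on_subset[OF cW], simp)
      then have "C-lipschitz_on (closure \<Omega>) w" using Ww by (simp add: lipschitz_on_def)
      with w show "\<exists>w. C-lipschitz_on (closure \<Omega>) w \<and> (AE x in lebesgue_on \<Omega>. u (x, t) = w x) \<and> (\<forall>x\<in>frontier \<Omega>. w x = u0 x)"
        by blast
    qed
  qed
qed

lemma norm_L2_sup_bound:
  assumes \<Omega>: "open \<Omega>" "bounded \<Omega>" and f: "f \<in> L2 \<Omega>" and e: "\<And>x. x \<in> \<Omega> \<Longrightarrow> \<bar>f x\<bar> \<le> e"
  shows "(norm_L2 \<Omega> f)\<^sup>2 \<le> e\<^sup>2 * Sigma_Algebra.measure lebesgue \<Omega>"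
proof -
  have Ol: "\<Omega> \<in> sets lebesgue" using \<Omega> by (simp add: borel_open)
  have lm: "\<Omega> \<in> lmeasurable" using \<Omega> by (simp add: lmeasurable_open)
  have "(norm_L2 \<Omega> f)\<^sup>2 = (LINT x|lebesgue_on \<Omega>. (f x)\<^sup>2)" by (simp add: norm_L2_def integral_nonneg_AE)
  also have "\<dots> = (LINT x|lebesgue. indicator \<Omega> x *\<^sub>R (f x)\<^sup>2)" by (rule LINT_lebesgue_on[OF Ol])
  also have "\<dots> \<le> (LINT x|lebesgue. indicator \<Omega> x * e\<^sup>2)"
  proof (rule integral_mono)
    show "integrable lebesgue (\<lambda>x. indicator \<Omega> x *\<^sub>R (f x)\<^sup>2)"
      using f integrable_lebesgue_on_iff[OF Ol, of "\<lambda>x. (f x)\<^sup>2"] by (simp add: L2_def)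
    show "integrable lebesgue (\<lambda>x. indicator \<Omega> x * e\<^sup>2)"
      using lm by (intro integrable_mult_left integrable_real_indicator) (auto simp: fmeasurable_def)
    show "indicator \<Omega> x *\<^sub>R (f x)\<^sup>2 \<le> indicator \<Omega> x * e\<^sup>2" for x
      using e[of x] by (cases "x \<in> \<Omega>") (auto simp: abs_le_square_iff[symmetric])
  qed
  also have "\<dots> = e\<^sup>2 * Sigma_Algebra.measure lebesgue \<Omega>" by (simp add: mult.commute)
  finally show ?thesis .
qed

lemma norm_L2_zero_AE:
  assumes "f \<in> L2 \<Omega>" "norm_L2 \<Omega> f = 0"
  shows "AE x in lebesgue_on \<Omega>. f x = 0"
proof -
  have "(LINT x|lebesgue_on \<Omega>. (f x)\<^sup>2) = 0" using assms(2) by (simp add: norm_L2_def)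
  then have "AE x in lebesgue_on \<Omega>. (f x)\<^sup>2 = 0"
    using assms(1) integral_nonneg_eq_0_iff_AE[of "lebesgue_on \<Omega>" "\<lambda>x. (f x)\<^sup>2"] by (simp add: L2_def)
  then show ?thesis by eventually_elim simp
qed

lemma norm_L2_nonneg: "0 \<le> norm_L2 \<Omega> f"
  by (simp add: norm_L2_def integral_nonneg_AE)

text \<open>Slices at good times tending to \<open>t\<close> are Cauchy in L2. Their differences
  have Lipschitz constant \<open>C + C\<close> and vanish on the frontier, so the slices are even
  uniformly Cauchy, and the uniform limit inherits the Lipschitz constant and the boundary
  values.\<close>

lemma slices_all_times:
  fixes \<Omega> :: "'a::euclidean_space set"
  assumes \<Omega>: "open \<Omega>" "bounded \<Omega>" and T: "0 < T" and uC: "u \<in> C0_L2 \<Omega> T"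
    and C: "0 \<le> C"
    and ae: "AE t in lborel. t \<in> open_time T \<longrightarrow> (\<exists>w. C-lipschitz_on (closure \<Omega>) w \<and>
      (AE x in lebesgue_on \<Omega>. u (x, t) = w x) \<and> (\<forall>x\<in>frontier \<Omega>. w x = u0 x))"
    and t: "t \<in> closed_time T"
  shows "\<exists>w. C-lipschitz_on (closure \<Omega>) w \<and> (AE x in lebesgue_on \<Omega>. u (x, t) = w x) \<and> (\<forall>x\<in>frontier \<Omega>. w x = u0 x)"
proof -
  define P where "P t w \<longleftrightarrow> C-lipschitz_on (closure \<Omega>) w \<and> (AE x in lebesgue_on \<Omega>. u (x, t) = w x) \<and> (\<forall>x\<in>frontier \<Omega>. w x = u0 x)" for t w
  obtain s where s0: "\<And>n. s n \<in> open_time T \<and> (\<exists>w. P (s n) w)" and st: "s \<longlonglongrightarrow> t"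
    using good_times_dense[OF T ae t] unfolding P_def by blast
  obtain w where w: "\<And>n. P (s n) (w n)" using s0 by metis
  have sc: "s n \<in> closed_time T" for n using s0 open_time_subset_closed by blast
  have uL2: "(\<lambda>x. u (x, t)) \<in> L2 \<Omega>" if "t \<in> closed_time T" for t using uC that by (auto simp: C0_L2_def)
  have cw: "continuous_on (closure \<Omega>) f" if "K-lipschitz_on (closure \<Omega>) f" for f :: "'a \<Rightarrow> real" and K
    using that by (rule lipschitz_on_continuous_on)
  have wL: "C-lipschitz_on (closure \<Omega>) (w n)" "AE x in lebesgue_on \<Omega>. u (x, s n) = w n x" "\<And>x. x \<in> frontier \<Omega> \<Longrightarrow> w n x = u0 x" for n
    using w[of n] by (auto simp: P_def)
  have wL2: "w n \<in> L2 \<Omega>" for n by (rule continuous_in_L2[OF \<Omega> cw[OF wL(1)]])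
  define N where "N n = norm_L2 \<Omega> (\<lambda>x. u (x, s n) - u (x, t))" for n
  have N0: "N \<longlonglongrightarrow> 0" unfolding N_def[abs_def] by (rule C0_L2_sequence[OF uC t sc st])
  have Nn: "0 \<le> N n" for n by (simp add: N_def norm_L2_nonneg)
  have "uniformly_Cauchy_on (closure \<Omega>) w"
    unfolding uniformly_Cauchy_on_def
  proof (intro allI impI)
    fix e :: real assume e: "0 < e"
    obtain d where d: "0 < d" "\<And>w. (C + C)-lipschitz_on (closure \<Omega>) w \<Longrightarrow> (\<And>x. x \<in> frontier \<Omega> \<Longrightarrow> w x = 0) \<Longrightarrow> w \<in> L2 \<Omega> \<Longrightarrow>
        norm_L2 \<Omega> w < d \<Longrightarrow> (\<forall>x\<in>closure \<Omega>. \<bar>w x\<bar> \<le> e / 2)"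
      using sup_small_if_L2_small[OF \<Omega>, of "C + C" "e / 2"] C e by (metis add_nonneg_nonneg half_gt_zero)
    obtain M where M: "\<And>n. n \<ge> M \<Longrightarrow> N n < d / 2"
      using order_tendstoD(2)[OF N0, of "d / 2"] d(1) by (auto simp: eventually_sequentially)
    show "\<exists>M. \<forall>x\<in>closure \<Omega>. \<forall>m\<ge>M. \<forall>n\<ge>M. dist (w m x) (w n x) < e"
    proof (intro exI[of _ M] ballI allI impI)
      fix x m n assume x: "x \<in> closure \<Omega>" and mn: "M \<le> m" "M \<le> n"
      have wd: "(\<lambda>x. w m x - w n x) \<in> L2 \<Omega>" by (rule L2_diff[OF wL2 wL2])
      have ud: "(\<lambda>x. u (x, s m) - u (x, t)) \<in> L2 \<Omega>" "(\<lambda>x. u (x, t) - u (x, s n)) \<in> L2 \<Omega>" "(\<lambda>x. u (x, s m) - u (x, s n)) \<in> L2 \<Omega>"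
        by (intro L2_diff uL2 sc t)+
      have eq: "norm_L2 \<Omega> (\<lambda>x. w m x - w n x) = norm_L2 \<Omega> (\<lambda>x. u (x, s m) - u (x, s n))"
      proof (rule norm_L2_cong_AE)
        show "AE x in lebesgue_on \<Omega>. w m x - w n x = u (x, s m) - u (x, s n)"
          using wL(2)[of m] wL(2)[of n] by eventually_elim simp
      qed (use wd ud(3) in \<open>auto simp: L2_def\<close>)
      have "(norm_L2 \<Omega> (\<lambda>x. u (x, s m) - u (x, s n)))\<^sup>2 \<le> 2 * (N m)\<^sup>2 + 2 * (N n)\<^sup>2"
        using norm_L2_triangle_sq(2)[OF ud(1,2)] unfolding N_def norm_L2_minus[of \<Omega> "\<lambda>x. u (x, t)" "\<lambda>x. u (x, s n)"] .
      also have "\<dots> < 2 * (d / 2)\<^sup>2 + 2 * (d / 2)\<^sup>2"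
        using M[OF mn(1)] M[OF mn(2)] Nn by (intro add_strict_mono mult_strict_left_mono power_strict_mono) auto
      also have "\<dots> = d\<^sup>2" by (simp add: power2_eq_square)
      finally have "norm_L2 \<Omega> (\<lambda>x. w m x - w n x) < d" unfolding eq using d(1) by (simp add: power_less_imp_less_base)
      then have "\<bar>w m x - w n x\<bar> \<le> e / 2"
        using d(2)[OF lipschitz_on_diff[OF wL(1)[of m] wL(1)[of n]] _ wd] wL(3) x by simp
      then show "dist (w m x) (w n x) < e" using e by (simp add: dist_real_def)
    qed
  qed
  then obtain l where l: "uniform_limit (closure \<Omega>) w l sequentially"
    using Cauchy_uniformly_convergent uniformly_convergent_on_def by blast
  have lp: "(\<lambda>n. w n x) \<longlonglongrightarrow> l x" if "x \<in> closure \<Omega>" for x using tendsto_uniform_limitI[OF l that] .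
  have lL: "C-lipschitz_on (closure \<Omega>) l"
  proof (rule lipschitz_onI[OF _ C])
    fix x y assume xy: "x \<in> closure \<Omega>" "y \<in> closure \<Omega>"
    have "(\<lambda>n. dist (w n x) (w n y)) \<longlonglongrightarrow> dist (l x) (l y)" by (intro tendsto_dist lp xy)
    then show "dist (l x) (l y) \<le> C * dist x y"
      by (rule LIMSEQ_le_const2) (use lipschitz_onD[OF wL(1) xy] in blast)
  qed
  have lb: "l x = u0 x" if "x \<in> frontier \<Omega>" for x
  proof -
    have "x \<in> closure \<Omega>" using that by (simp add: frontier_def)
    from lp[OF this] wL(3)[OF that] show ?thesis by (simp add: LIMSEQ_const_iff)
  qed
  have lL2: "l \<in> L2 \<Omega>" by (rule continuous_in_L2[OF \<Omega> cw[OF lL]])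
  have d1: "(\<lambda>x. u (x, t) - l x) \<in> L2 \<Omega>" by (rule L2_diff[OF uL2[OF t] lL2])
  let ?\<mu> = "Sigma_Algebra.measure lebesgue \<Omega>"
  have "(norm_L2 \<Omega> (\<lambda>x. u (x, t) - l x))\<^sup>2 \<le> 0 + e" if e: "0 < e" for e
  proof -
    \<comment> \<open>A function bounded by \<open>r\<close> contributes at most
      \<open>e / 2\<close> to the squared distance; the other half of \<open>e\<close> is left for
      \<open>2 * (N n)\<^sup>2\<close>.\<close>
    define r where "r = sqrt (e / (4 * (?\<mu> + 1)))"
    have "0 < 4 * (?\<mu> + 1)" by (intro mult_pos_pos add_nonneg_pos measure_nonneg) simp_all
    then have r: "0 < r" unfolding r_def by (intro real_sqrt_gt_zero divide_pos_pos e)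
    have r2: "2 * (r\<^sup>2 * ?\<mu>) \<le> e / 2"
    proof -
      have "r\<^sup>2 = e / (4 * (?\<mu> + 1))"
        unfolding r_def using e \<open>0 < 4 * (?\<mu> + 1)\<close> by (intro real_sqrt_pow2 divide_nonneg_pos) auto
      moreover have "?\<mu> / (?\<mu> + 1) \<le> 1" using measure_nonneg[of lebesgue \<Omega>] by (simp add: pos_divide_le_eq add_nonneg_pos)
      then have "e / 2 * (?\<mu> / (?\<mu> + 1)) \<le> e / 2 * 1" using e by (intro mult_left_mono) auto
      moreover have "2 * (e / (4 * b) * a) = e / 2 * (a / b)" for a b :: real
        by (cases "b = 0") (simp_all add: field_simps)
      ultimately show ?thesis by (simp only: mult_1_right)
    qed
    have "\<forall>\<^sub>F n in sequentially. \<forall>x\<in>closure \<Omega>. dist (w n x) (l x) < r"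
      using l r by (simp add: uniform_limit_iff)
    moreover have "\<forall>\<^sub>F n in sequentially. N n < sqrt (e / 4)"
      using e by (intro order_tendstoD(2)[OF N0]) simp
    ultimately have "\<forall>\<^sub>F n in sequentially. (\<forall>x\<in>closure \<Omega>. dist (w n x) (l x) < r) \<and> N n < sqrt (e / 4)"
      by (rule eventually_conj)
    then obtain n where n: "\<And>x. x \<in> closure \<Omega> \<Longrightarrow> \<bar>w n x - l x\<bar> < r" "N n < sqrt (e / 4)"
      unfolding eventually_sequentially dist_real_def by blast
    have ds: "(\<lambda>x. u (x, t) - u (x, s n)) \<in> L2 \<Omega>" "(\<lambda>x. u (x, s n) - l x) \<in> L2 \<Omega>" "(\<lambda>x. w n x - l x) \<in> L2 \<Omega>"
      by (intro L2_diff uL2 sc t lL2 wL2)+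
    have eq: "norm_L2 \<Omega> (\<lambda>x. u (x, s n) - l x) = norm_L2 \<Omega> (\<lambda>x. w n x - l x)"
    proof (rule norm_L2_cong_AE)
      show "AE x in lebesgue_on \<Omega>. u (x, s n) - l x = w n x - l x" using wL(2)[of n] by eventually_elim simp
    qed (use ds in \<open>auto simp: L2_def\<close>)
    have "(norm_L2 \<Omega> (\<lambda>x. w n x - l x))\<^sup>2 \<le> r\<^sup>2 * ?\<mu>"
      using n(1) closure_subset by (intro norm_L2_sup_bound[OF \<Omega> ds(3)]) (force intro: less_imp_le)
    moreover have "(N n)\<^sup>2 \<le> e / 4"
    proof -
      have "(N n)\<^sup>2 \<le> (sqrt (e / 4))\<^sup>2" using n(2) Nn by (intro power_mono) auto
      then show ?thesis using e by simp
    qed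
    moreover have "(norm_L2 \<Omega> (\<lambda>x. u (x, t) - l x))\<^sup>2 \<le> 2 * (N n)\<^sup>2 + 2 * (norm_L2 \<Omega> (\<lambda>x. w n x - l x))\<^sup>2"
      using norm_L2_triangle_sq(2)[OF ds(1,2)] unfolding N_def norm_L2_minus[of \<Omega> "\<lambda>x. u (x, t)" "\<lambda>x. u (x, s n)"] eq .
    ultimately show ?thesis using r2 by linarith
  qed
  then have "(norm_L2 \<Omega> (\<lambda>x. u (x, t) - l x))\<^sup>2 \<le> 0" by (rule field_le_epsilon)
  then have "norm_L2 \<Omega> (\<lambda>x. u (x, t) - l x) = 0" by simp
  from norm_L2_zero_AE[OF d1 this] have "AE x in lebesgue_on \<Omega>. u (x, t) = l x" by eventually_elim simp
  with lL lb show ?thesis by blast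
qed

text \<open>The difference of two slices is Lipschitz with constant \<open>C + C\<close> and zero on
  the frontier, so smallness in L2 forces smallness at every point.\<close>

lemma slices_continuous_in_time:
  fixes \<Omega> :: "'a::euclidean_space set"
  assumes \<Omega>: "open \<Omega>" "bounded \<Omega>" and uC: "u \<in> C0_L2 \<Omega> T" and C: "0 \<le> C"
    and V: "\<And>t. t \<in> closed_time T \<Longrightarrow> C-lipschitz_on (closure \<Omega>) (V t)"
      "\<And>t. t \<in> closed_time T \<Longrightarrow> AE x in lebesgue_on \<Omega>. u (x, t) = V t x"
      "\<And>t x. t \<in> closed_time T \<Longrightarrow> x \<in> frontier \<Omega> \<Longrightarrow> V t x = u0 x"
    and t: "t \<in> closed_time T" "\<And>n::nat. s n \<in> closed_time T" "s \<longlonglongrightarrow> t" and x: "x \<in> closure \<Omega>"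
  shows "(\<lambda>n. V (s n) x) \<longlonglongrightarrow> V t x"
proof (rule LIMSEQ_I)
  fix r :: real assume r: "0 < r"
  obtain d where d: "0 < d" "\<And>w. (C + C)-lipschitz_on (closure \<Omega>) w \<Longrightarrow> (\<And>x. x \<in> frontier \<Omega> \<Longrightarrow> w x = 0) \<Longrightarrow> w \<in> L2 \<Omega> \<Longrightarrow>
      norm_L2 \<Omega> w < d \<Longrightarrow> (\<forall>x\<in>closure \<Omega>. \<bar>w x\<bar> \<le> r / 2)"
    using sup_small_if_L2_small[OF \<Omega>, of "C + C" "r / 2"] C r by (metis add_nonneg_nonneg half_gt_zero)
  obtain M where M: "\<And>n. n \<ge> M \<Longrightarrow> norm_L2 \<Omega> (\<lambda>x. u (x, s n) - u (x, t)) < d"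
    using order_tendstoD(2)[OF C0_L2_sequence[OF uC t] d(1)] by (auto simp: eventually_sequentially)
  have vL2: "V t \<in> L2 \<Omega>" if "t \<in> closed_time T" for t
    by (rule continuous_in_L2[OF \<Omega> lipschitz_on_continuous_on[OF V(1)[OF that]]])
  show "\<exists>N. \<forall>n\<ge>N. norm (V (s n) x - V t x) < r"
  proof (intro exI[of _ M] allI impI)
    fix n assume n: "M \<le> n"
    have vd: "(\<lambda>x. V (s n) x - V t x) \<in> L2 \<Omega>" by (intro L2_diff vL2 t)
    have ud: "(\<lambda>x. u (x, s n) - u (x, t)) \<in> L2 \<Omega>" using uC t by (intro L2_diff) (auto simp: C0_L2_def)
    have "norm_L2 \<Omega> (\<lambda>x. V (s n) x - V t x) = norm_L2 \<Omega> (\<lambda>x. u (x, s n) - u (x, t))"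
    proof (rule norm_L2_cong_AE)
      show "AE x in lebesgue_on \<Omega>. V (s n) x - V t x = u (x, s n) - u (x, t)"
        using V(2)[OF t(1)] V(2)[OF t(2)[of n]] by eventually_elim simp
    qed (use vd ud in \<open>auto simp: L2_def\<close>)
    then have "norm_L2 \<Omega> (\<lambda>x. V (s n) x - V t x) < d" using M[OF n] by simp
    then have "\<bar>V (s n) x - V t x\<bar> \<le> r / 2"
      using d(2)[OF lipschitz_on_diff[OF V(1)[OF t(2)[of n]] V(1)[OF t(1)]] _ vd] V(3) t x by simp
    then show "norm (V (s n) x - V t x) < r" using r by simp
  qed
qed

text \<open>The regular slices at all closed times are glued and extended by nearest point
  projection in space and in time. The projections are 1-Lipschitz, so the constant in space
  survives; joint continuity combines it with continuity in time at a fixed point.\<close>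

lemma slice_representative:
  fixes \<Omega> :: "'a::euclidean_space set"
  assumes \<Omega>: "open \<Omega>" "bounded \<Omega>" "convex \<Omega>" "\<Omega> \<noteq> {}" and T: "0 < T" and u: "u \<in> Kinf_bd \<Omega> T u0"
  obtains U L C g where "0 \<le> L" "continuous_on UNIV U"
    "\<And>x y t. \<bar>U (x, t) - U (y, t)\<bar> \<le> L * norm (x - y)"
    "\<And>x t. x \<in> frontier \<Omega> \<Longrightarrow> U (x, t) = u0 x"
    "\<And>p. \<bar>U p\<bar> \<le> C"
    "AE p in lebesgue_on (cylinder \<Omega> T). u p = U p"
    "g \<in> borel_measurable borel" "\<And>p. norm (g p) \<le> C"
    "has_weak_grad (cylinder \<Omega> T) U g" "has_weak_grad (cylinder \<Omega> T) u g"
proof -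
  let ?Q = "cylinder \<Omega> T"
  have Qo: "open ?Q" unfolding cylinder_def using \<Omega>(1) open_open_time by (rule open_Times)
  have Qb: "?Q \<in> sets borel" and Ql: "?Q \<in> sets lebesgue" using Qo by (auto simp: borel_open)
  have Ol: "\<Omega> \<in> sets lebesgue" using \<Omega> by (simp add: borel_open)
  obtain g0 where uC: "u \<in> C0_L2 \<Omega> T" and ui: "u \<in> Linf ?Q" and g0: "has_weak_grad ?Q u g0" "g0 \<in> Linf ?Q"
    using u by (auto simp: Kinf_bd_def Kinf_def)
  obtain C1 C2 where C12: "AE p in lebesgue_on ?Q. norm (u p) \<le> C1" "AE p in lebesgue_on ?Q. norm (g0 p) \<le> C2"
    using ui g0(2) by (auto simp: Linf_def)
  define C where "C = max 0 (max C1 C2)"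
  have C0: "0 \<le> C" by (simp add: C_def)
  have Cu: "AE p in lebesgue_on ?Q. norm (u p) \<le> C" "AE p in lebesgue_on ?Q. norm (g0 p) \<le> C"
    using C12 by (eventually_elim; simp add: C_def)+
  have um0: "u \<in> borel_measurable (lebesgue_on ?Q)" "g0 \<in> borel_measurable (lebesgue_on ?Q)"
    using ui g0(2) by (simp_all add: Linf_def)
  obtain u' where u': "u' \<in> borel_measurable borel" "AE p in lebesgue_on ?Q. u p = u' p" "\<And>p. norm (u' p) \<le> C" "\<And>p. p \<notin> ?Q \<Longrightarrow> u' p = 0"
    by (rule bounded_borel_representative[OF Qb um0(1) Cu(1) C0]) blast
  obtain g where g: "g \<in> borel_measurable borel" "AE p in lebesgue_on ?Q. g0 p = g p" "\<And>p. norm (g p) \<le> C" "\<And>p. p \<notin> ?Q \<Longrightarrow> g p = 0"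
    by (rule bounded_borel_representative[OF Qb um0(2) Cu(2) C0]) blast
  have lig: "locally_integrable ?Q g" by (rule locally_integrable_bounded[OF g(1) g(3)])
  have wu': "has_weak_grad ?Q u' g"
    by (rule has_weak_grad_cong[OF Qo g0(1) u'(2) g(2) locally_integrable_bounded[OF u'(1) u'(3)] lig])
  have wu: "has_weak_grad ?Q u g"
    using g0(1) by (intro has_weak_grad_cong[OF Qo g0(1) _ g(2) _ lig]) (auto simp: has_weak_grad_def)
  have u'b: "\<bar>u' p\<bar> \<le> C" for p using u'(3)[of p] by simp
  note ae = Kinf_lipschitz_slices[OF \<Omega> T u u'(1) u'b u'(2) g(1) g(3) wu']
  have "\<forall>t\<in>closed_time T. \<exists>w. C-lipschitz_on (closure \<Omega>) w \<and> (AE x in lebesgue_on \<Omega>. u (x, t) = w x) \<and> (\<forall>x\<in>frontier \<Omega>. w x = u0 x)"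
    using slices_all_times[OF \<Omega>(1,2) T uC C0 ae] by blast
  then obtain V where V: "\<And>t. t \<in> closed_time T \<Longrightarrow> C-lipschitz_on (closure \<Omega>) (V t)"
      "\<And>t. t \<in> closed_time T \<Longrightarrow> AE x in lebesgue_on \<Omega>. u (x, t) = V t x"
      "\<And>t x. t \<in> closed_time T \<Longrightarrow> x \<in> frontier \<Omega> \<Longrightarrow> V t x = u0 x" by metis
  define cx where "cx = closest_point (closure \<Omega>)"
  define ct where "ct = closest_point (closed_time T)"
  have ccx: "closed (closure \<Omega>)" "convex (closure \<Omega>)" "closure \<Omega> \<noteq> {}" using \<Omega> by (auto simp: convex_closure)
  have cct: "closed (closed_time T)" "convex (closed_time T)" "closed_time T \<noteq> {}"
    using closed_closed_time convex_closed_time zero_in_closed_time[OF T] by auto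
  have cxin: "cx x \<in> closure \<Omega>" for x unfolding cx_def by (rule closest_point_in_set[OF ccx(1,3)])
  have ctin: "ct t \<in> closed_time T" for t unfolding ct_def by (rule closest_point_in_set[OF cct(1,3)])
  have cxid: "x \<in> closure \<Omega> \<Longrightarrow> cx x = x" for x unfolding cx_def by (rule closest_point_self)
  have ctid: "t \<in> closed_time T \<Longrightarrow> ct t = t" for t unfolding ct_def by (rule closest_point_self)
  define U where "U p = V (ct (snd p)) (cx (fst p))" for p
  have ULip: "\<bar>U (x, t) - U (y, t)\<bar> \<le> C * norm (x - y)" for x y t
  proof -
    have "\<bar>U (x, t) - U (y, t)\<bar> \<le> C * dist (cx x) (cx y)"
      using lipschitz_onD[OF V(1)[OF ctin] cxin cxin, of t x y] by (simp add: U_def dist_real_def)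
    also have "\<dots> \<le> C * dist x y" unfolding cx_def by (rule mult_left_mono[OF closest_point_lipschitz[OF ccx(2,1,3)] C0])
    finally show ?thesis by (simp add: dist_norm)
  qed
  have Ucont: "continuous_on UNIV U"
  proof (subst continuous_on_sequentially, intro allI ballI impI)
    fix p :: "nat \<Rightarrow> 'a \<times> real" and q
    assume "q \<in> UNIV" and "(\<forall>n. p n \<in> UNIV) \<and> p \<longlonglongrightarrow> q"
    then have pq: "p \<longlonglongrightarrow> q" by simp
    have ctc: "(\<lambda>n. ct (snd (p n))) \<longlonglongrightarrow> ct (snd q)"
      unfolding ct_def by (rule continuous_on_tendsto_compose[OF continuous_on_closest_point[OF cct(2,1,3), of UNIV] tendsto_snd[OF pq]]) auto
    have lim: "(\<lambda>n. V (ct (snd (p n))) (cx (fst q))) \<longlonglongrightarrow> V (ct (snd q)) (cx (fst q))"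
      by (rule slices_continuous_in_time[OF \<Omega>(1,2) uC C0 V(1) V(2) V(3) ctin ctin ctc cxin])
    have "(\<lambda>n. C * norm (fst (p n) - fst q) + \<bar>V (ct (snd (p n))) (cx (fst q)) - V (ct (snd q)) (cx (fst q))\<bar>) \<longlonglongrightarrow> C * norm (fst q - fst q) + \<bar>V (ct (snd q)) (cx (fst q)) - V (ct (snd q)) (cx (fst q))\<bar>"
      by (intro tendsto_intros pq lim)
    then have z: "(\<lambda>n. C * norm (fst (p n) - fst q) + \<bar>V (ct (snd (p n))) (cx (fst q)) - V (ct (snd q)) (cx (fst q))\<bar>) \<longlonglongrightarrow> 0" by simp
    have "(\<lambda>n. U (p n) - U q) \<longlonglongrightarrow> 0"
    proof (rule Lim_null_comparison[OF _ z], intro always_eventually allI)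
      fix n
      have "\<bar>U (fst (p n), snd (p n)) - U (fst q, snd (p n))\<bar> \<le> C * norm (fst (p n) - fst q)" by (rule ULip)
      then show "norm (U (p n) - U q) \<le> C * norm (fst (p n) - fst q) + \<bar>V (ct (snd (p n))) (cx (fst q)) - V (ct (snd q)) (cx (fst q))\<bar>"
        unfolding U_def fst_conv snd_conv real_norm_def by linarith
    qed
    then show "(U \<circ> p) \<longlonglongrightarrow> U q" by (simp add: LIM_zero_iff o_def)
  qed
  have Ub: "U (x, t) = u0 x" if "x \<in> frontier \<Omega>" for x t
  proof -
    have "x \<in> closure \<Omega>" using that by (simp add: frontier_def)
    then show ?thesis using V(3)[OF ctin that] by (simp add: U_def cxid)
  qed
  have "\<Omega> \<noteq> UNIV" using \<Omega>(2) not_bounded_UNIV by auto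
  \<comment> \<open>A nonempty bounded set has a frontier point. There \<open>U\<close> is known at
    all times, and the Lipschitz constant times the diameter bounds the deviation from it.\<close>
  then obtain z where z: "z \<in> frontier \<Omega>" using frontier_not_empty[OF \<Omega>(4)] by blast
  have Ubd: "\<bar>U p\<bar> \<le> \<bar>u0 z\<bar> + C * diameter (closure \<Omega>)" for p
  proof -
    have zc: "z \<in> closure \<Omega>" using z by (simp add: frontier_def)
    have "\<bar>V (ct (snd p)) (cx (fst p)) - V (ct (snd p)) z\<bar> \<le> C * dist (cx (fst p)) z"
      using lipschitz_onD[OF V(1)[OF ctin] cxin zc] by (simp add: dist_real_def)
    also have "\<dots> \<le> C * diameter (closure \<Omega>)"
      using diameter_bounded_bound[OF bounded_closure[OF \<Omega>(2)] cxin zc] C0 by (intro mult_left_mono)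
    finally show ?thesis using V(3)[OF ctin z, of "snd p"] unfolding U_def by linarith
  qed
  have Uu: "AE x in lebesgue_on \<Omega>. u (x, t) = U (x, t)" if "t \<in> closed_time T" for t
  proof -
    have "AE x in lebesgue_on \<Omega>. x \<in> \<Omega>" by (rule AE_I2) (simp add: space_restrict_space)
    with V(2)[OF that] show ?thesis
    proof eventually_elim
      case (elim x)
      then show ?case using closure_subset[of \<Omega>] by (auto simp: U_def ctid[OF that] cxid)
    qed
  qed
  have Um[measurable]: "U \<in> borel_measurable borel" using Ucont by (rule borel_measurable_continuous_onI)
  have [measurable]: "u' \<in> borel_measurable borel" by (rule u'(1))
  have [measurable]: "?Q \<in> sets borel" by (rule Qb)
  have "AE p in lborel. p \<in> ?Q \<longrightarrow> u' p = U p"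
  proof (rule AE_lborel_from_slices)
    show "{p. p \<in> ?Q \<longrightarrow> u' p = U p} \<in> sets borel" by measurable
    have "AE p in lborel. p \<in> ?Q \<longrightarrow> u p = u' p" using u'(2) by (simp add: AE_lebesgue_on_iff[OF Ql])
    from AE_lborel_slices[OF this]
    show "AE t in lborel. AE x in lborel. (x, t) \<in> ?Q \<longrightarrow> u' (x, t) = U (x, t)"
    proof eventually_elim
      case (elim t)
      show ?case
      proof (cases "t \<in> open_time T")
        case True
        then have "AE x in lborel. x \<in> \<Omega> \<longrightarrow> u (x, t) = U (x, t)"
          using Uu[of t] open_time_subset_closed by (auto simp: AE_lebesgue_on_iff[OF Ol])
        with elim show ?thesis by eventually_elim (auto simp: cylinder_def)
      qed (simp add: cylinder_def)
    qed
  qed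
  then have u'U: "AE p in lebesgue_on ?Q. u' p = U p" by (simp add: AE_lebesgue_on_iff[OF Ql])
  have uU: "AE p in lebesgue_on ?Q. u p = U p" using u'(2) u'U by eventually_elim simp
  have wU: "has_weak_grad ?Q U g"
    by (rule has_weak_grad_cong[OF Qo wu' u'U _ locally_integrable_continuous[OF Ucont] lig]) simp
  let ?B = "C + (\<bar>u0 z\<bar> + C * diameter (closure \<Omega>))"
  have "0 \<le> diameter (closure \<Omega>)" using diameter_ge_0[OF bounded_closure[OF \<Omega>(2)]] .
  then have B: "C \<le> ?B" "\<bar>u0 z\<bar> + C * diameter (closure \<Omega>) \<le> ?B" using C0 by auto
  show ?thesis
    by (rule that[of C U ?B g, OF C0 Ucont ULip Ub order_trans[OF Ubd B(2)] uU g(1) order_trans[OF g(3) B(1)] wU wu])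
qed

section \<open>The time average of a continuous function\<close>

text \<open>Time is clamped to \<open>[0, \<tau>]\<close>, where the kernel is nonnegative with mass
  one, so that bounds and continuity hold on the whole space.\<close>

definition tavg :: "real \<Rightarrow> real \<Rightarrow> ('a::euclidean_space \<times> real \<Rightarrow> real) \<Rightarrow> 'a \<times> real \<Rightarrow> real" where
  "tavg h \<tau> U p = (LINT s|lborel. kern h (max 0 (min \<tau> (snd p))) s * U (fst p, s))"

lemma LINT_indicator_Icc:
  fixes f :: "real \<Rightarrow> real"
  assumes "continuous_on {a..b} f"
  shows "(LINT s|lborel. indicator {a..b} s * f s) = integral {a..b} f" "integrable lborel (\<lambda>s. indicator {a..b} s * f s)"
proof -
  have s: "set_integrable lborel {a..b} f"
    unfolding set_integrable_def by (intro borel_integrable_compact assms compact_Icc)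
  then show "integrable lborel (\<lambda>s. indicator {a..b} s * f s)" by (simp add: set_integrable_def)
  show "(LINT s|lborel. indicator {a..b} s * f s) = integral {a..b} f"
    using set_borel_integral_eq_integral(2)[OF s] by (simp add: set_lebesgue_integral_def)
qed

lemma tavg_formula:
  assumes U: "continuous_on UNIV (\<lambda>s. U (x, s))" and h: "0 < h" and t: "t \<in> {0..\<tau>}"
  shows "tavg h \<tau> U (x, t) = exp (- t / h) * (integral {0..h} (\<lambda>s. U (x, s)) / h + integral {0..t} (\<lambda>s. exp (s / h) * U (x, s)) / h)"
proof -
  have c1: "continuous_on {0..h} (\<lambda>s. U (x, s))" and c2: "continuous_on {0..t} (\<lambda>s. exp (s / h) * U (x, s))"
    using h by (auto intro!: continuous_intros continuous_on_subset[OF U])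
  note i1 = LINT_indicator_Icc[OF c1] and i2 = LINT_indicator_Icc[OF c2]
  have "tavg h \<tau> U (x, t) = (LINT s|lborel. exp (- t / h) / h * (indicator {0..h} s * U (x, s)) + exp (- t / h) / h * (indicator {0..t} s * (exp (s / h) * U (x, s))))"
    unfolding tavg_def
  proof (rule Bochner_Integration.integral_cong[OF refl])
    fix s
    have "exp ((s - t) / h) = exp (- t / h) * exp (s / h)" by (simp add: diff_divide_distrib flip: exp_add)
    then show "kern h (max 0 (min \<tau> (snd (x, t)))) s * U (fst (x, t), s) = exp (- t / h) / h * (indicator {0..h} s * U (x, s)) + exp (- t / h) / h * (indicator {0..t} s * (exp (s / h) * U (x, s)))"
      using t by (simp add: kern_def algebra_simps)
  qed
  also have "\<dots> = exp (- t / h) / h * integral {0..h} (\<lambda>s. U (x, s)) + exp (- t / h) / h * integral {0..t} (\<lambda>s. exp (s / h) * U (x, s))"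
    using i1 i2 by (subst Bochner_Integration.integral_add) auto
  finally show ?thesis by (simp add: distrib_left)
qed

text \<open>The average is exp(-t/h) times a constant plus a primitive, and the product rule gives h
  v' = U - v, one-sided at the ends.\<close>

lemma tavg_deriv:
  assumes U: "continuous_on UNIV (\<lambda>s. U (x, s))" and h: "0 < h" and t: "t \<in> {0..\<tau>}"
  shows "((\<lambda>t. tavg h \<tau> U (x, t)) has_real_derivative (U (x, t) - tavg h \<tau> U (x, t)) / h) (at t within {0..\<tau>})"
proof -
  define a where "a = integral {0..h} (\<lambda>s. U (x, s)) / h"
  define A where "A t = integral {0..t} (\<lambda>s. exp (s / h) * U (x, s))" for t
  have c: "continuous_on {0..\<tau>} (\<lambda>s. exp (s / h) * U (x, s))"
    using h by (auto intro!: continuous_intros continuous_on_subset[OF U])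
  have dA: "(A has_real_derivative exp (t / h) * U (x, t)) (at t within {0..\<tau>})"
    unfolding A_def[abs_def] by (rule integral_has_real_derivative[OF c t])
  have f: "tavg h \<tau> U (x, t) = exp (- t / h) * (a + A t / h)" if "t \<in> {0..\<tau>}" for t
    unfolding a_def A_def by (rule tavg_formula[OF U h that])
  have d1: "((\<lambda>t. exp (- t / h)) has_real_derivative exp (- t / h) * (- 1 / h)) (at t within {0..\<tau>})"
    using h by (auto intro!: derivative_eq_intros)
  have d2: "((\<lambda>t. a + A t / h) has_real_derivative (exp (t / h) * U (x, t)) / h) (at t within {0..\<tau>})"
    using DERIV_add[OF DERIV_const[of a] DERIV_cdivide[OF dA, of h]] by simp
  have "((\<lambda>t. exp (- t / h) * (a + A t / h)) has_real_derivative
      exp (- t / h) * (- 1 / h) * (a + A t / h) + (exp (t / h) * U (x, t)) / h * exp (- t / h)) (at t within {0..\<tau>})"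
    by (rule DERIV_mult[OF d1 d2])
  also have "exp (- t / h) * (- 1 / h) * (a + A t / h) + (exp (t / h) * U (x, t)) / h * exp (- t / h) = (U (x, t) - tavg h \<tau> U (x, t)) / h"
  proof -
    have e: "exp (t / h) * exp (- t / h) = 1" by (simp flip: exp_add)
    have "(exp (t / h) * U (x, t)) / h * exp (- t / h) = (exp (t / h) * exp (- t / h)) * U (x, t) / h" by simp
    also have "\<dots> = U (x, t) / h" by (simp only: e mult_1_left)
    finally show ?thesis unfolding f[OF t] by (simp add: diff_divide_distrib)
  qed
  finally have R: "((\<lambda>t. exp (- t / h) * (a + A t / h)) has_real_derivative (U (x, t) - tavg h \<tau> U (x, t)) / h) (at t within {0..\<tau>})" .
  from has_field_derivative_transform_within[OF R zero_less_one t] show ?thesis using f by simp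
qed

text \<open>The bounds and the preservation of constants belong to any mean with nonnegative weights
  of mass one. Continuity in time comes from the differential equation, which bounds the time
  derivative by \<open>2 * C / h\<close>.\<close>

lemma tavg_props:
  fixes U :: "'a::euclidean_space \<times> real \<Rightarrow> real"
  assumes U: "continuous_on UNIV U" "\<And>p. \<bar>U p\<bar> \<le> C" and h: "0 < h" and \<tau>: "0 < \<tau>"
    and L: "0 \<le> L" "\<And>x y t. \<bar>U (x, t) - U (y, t)\<bar> \<le> L * norm (x - y)"
  shows "\<bar>tavg h \<tau> U p\<bar> \<le> C"
    "\<bar>tavg h \<tau> U (x, t) - tavg h \<tau> U (y, t)\<bar> \<le> L * norm (x - y)"
    "continuous_on UNIV (tavg h \<tau> U)"
    "(\<And>s. U (x, s) = c) \<Longrightarrow> tavg h \<tau> U (x, t) = c"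
proof -
  define k where "k t = max 0 (min \<tau> t)" for t :: real
  have k: "0 \<le> k t" "k t \<le> \<tau>" for t using \<tau> by (auto simp: k_def)
  have Um[measurable]: "U \<in> borel_measurable borel" using U(1) by (rule borel_measurable_continuous_onI)
  have Us: "continuous_on UNIV (\<lambda>s. U (x, s))" for x
    by (rule continuous_on_compose2[OF U(1)]) (auto intro!: continuous_intros)
  have C0: "0 \<le> C" using U(2)[of undefined] by linarith
  show b: "\<bar>tavg h \<tau> U p\<bar> \<le> C" for p
    using kern_avg_bound(2)[of "\<lambda>s. U (fst p, s)" C h "k (snd p)"] U(2) h k(1) by (simp add: tavg_def k_def)
  have i: "integrable lborel (\<lambda>s. kern h (k t) s * U (x, s))" for x t
    using kern_avg_bound(1)[of "\<lambda>s. U (x, s)" C h "k t"] U(2) h k(1) by simp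
  show lip: "\<bar>tavg h \<tau> U (x, t) - tavg h \<tau> U (y, t)\<bar> \<le> L * norm (x - y)" for x y t
  proof -
    have "tavg h \<tau> U (x, t) - tavg h \<tau> U (y, t) = (LINT s|lborel. kern h (k t) s * U (x, s) - kern h (k t) s * U (y, s))"
      unfolding tavg_def using Bochner_Integration.integral_diff[OF i[of t x] i[of t y]] by (simp add: k_def)
    also have "\<dots> = (LINT s|lborel. kern h (k t) s * (U (x, s) - U (y, s)))" by (simp add: right_diff_distrib)
    finally show ?thesis
      using kern_avg_bound(2)[of "\<lambda>s. U (x, s) - U (y, s)" "L * norm (x - y)" h "k t"] L(2) h k(1) by simp
  qed
  show "tavg h \<tau> U (x, t) = c" if "\<And>s. U (x, s) = c"
    using kern_integral[OF h k(1)[of t]] by (simp add: tavg_def that k_def)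
  have tl: "\<bar>tavg h \<tau> U (x, t) - tavg h \<tau> U (x, s)\<bar> \<le> 2 * C / h * \<bar>t - s\<bar>" for x t s
  proof -
    have tk: "tavg h \<tau> U (x, t) = tavg h \<tau> U (x, k t)" for t using k[of t] by (simp add: tavg_def k_def)
    have "norm (tavg h \<tau> U (x, k t) - tavg h \<tau> U (x, k s)) \<le> 2 * C / h * norm (k t - k s)"
    proof (rule field_differentiable_bound[OF convex_real_interval(5)[of 0 \<tau>]])
      fix z assume z: "z \<in> {0..\<tau>}"
      show "((\<lambda>t. tavg h \<tau> U (x, t)) has_real_derivative (U (x, z) - tavg h \<tau> U (x, z)) / h) (at z within {0..\<tau>})"
        by (rule tavg_deriv[where U=U, OF Us h z])
      have "\<bar>U (x, z) - tavg h \<tau> U (x, z)\<bar> \<le> 2 * C" using U(2)[of "(x, z)"] b[of "(x, z)"] by linarith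
      then show "norm ((U (x, z) - tavg h \<tau> U (x, z)) / h) \<le> 2 * C / h" using h by (simp add: divide_right_mono)
    qed (use k in auto)
    also have "\<dots> \<le> 2 * C / h * \<bar>t - s\<bar>" using C0 h by (intro mult_left_mono) (auto simp: k_def)
    finally show ?thesis by (simp add: tk[symmetric])
  qed
  show "continuous_on UNIV (tavg h \<tau> U)"
  proof (subst continuous_on_sequentially, intro allI ballI impI)
    fix p :: "nat \<Rightarrow> 'a \<times> real" and q
    assume "q \<in> UNIV" "(\<forall>n. p n \<in> UNIV) \<and> p \<longlonglongrightarrow> q"
    then have pq: "p \<longlonglongrightarrow> q" by simp
    have "(\<lambda>n. L * norm (fst (p n) - fst q) + 2 * C / h * \<bar>snd (p n) - snd q\<bar>) \<longlonglongrightarrow> L * norm (fst q - fst q) + 2 * C / h * \<bar>snd q - snd q\<bar>"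
      using h by (intro tendsto_intros pq) auto
    then have z: "(\<lambda>n. L * norm (fst (p n) - fst q) + 2 * C / h * \<bar>snd (p n) - snd q\<bar>) \<longlonglongrightarrow> 0" by simp
    have "(\<lambda>n. tavg h \<tau> U (p n) - tavg h \<tau> U q) \<longlonglongrightarrow> 0"
    proof (rule Lim_null_comparison[OF _ z], intro always_eventually allI)
      fix n
      show "norm (tavg h \<tau> U (p n) - tavg h \<tau> U q) \<le> L * norm (fst (p n) - fst q) + 2 * C / h * \<bar>snd (p n) - snd q\<bar>"
        using lip[of "fst (p n)" "snd (p n)" "fst q"] tl[of "fst q" "snd (p n)" "snd q"] by simp
    qed
    then show "(tavg h \<tau> U \<circ> p) \<longlonglongrightarrow> tavg h \<tau> U q" by (simp add: LIM_zero_iff o_def)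
  qed
qed

subsection \<open>The variational inequality for averaged competitors\<close>

lemma lebesgue_AE_measurable:
  fixes f g :: "'a::euclidean_space \<Rightarrow> 'b::topological_space"
  assumes f: "f \<in> borel_measurable lebesgue" and ae: "AE x in lebesgue. f x = g x"
  shows "g \<in> borel_measurable lebesgue"
proof (rule measurableI)
  fix A :: "'b set" assume A: "A \<in> sets borel"
  have fA: "f -` A \<in> sets lebesgue" using measurable_sets[OF f A] by simp
  have "AE x in lebesgue. x \<in> f -` A \<longleftrightarrow> x \<in> g -` A" using ae by eventually_elim simp
  then have "g -` A \<in> sets lebesgue" by (rule completion.in_sets_AE[OF _ fA]) simp
  then show "g -` A \<inter> space lebesgue \<in> sets lebesgue" by simp
qed simp

text \<open>Measurability of \<open>g\<close> is part of the conclusion, by completeness of Lebesgue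
  measure. This matters for expressions such as \<open>f (snd p) (weak_grad Q u p)\<close>, built
  from a representative picked by choice.\<close>

lemma lebesgue_on_AE_cong:
  fixes f g :: "'a::euclidean_space \<Rightarrow> real"
  assumes U: "U \<in> sets lebesgue" and f: "integrable (lebesgue_on U) f" and ae: "AE x in lebesgue_on U. f x = g x"
  shows "integrable (lebesgue_on U) g" "(LINT x|lebesgue_on U. g x) = (LINT x|lebesgue_on U. f x)"
proof -
  let ?f = "\<lambda>x. indicator U x *\<^sub>R f x" and ?g = "\<lambda>x. indicator U x *\<^sub>R g x"
  have fi: "integrable lebesgue ?f" using f by (simp only: integrable_lebesgue_on_iff[OF U])
  have "AE x in lborel. x \<in> U \<longrightarrow> f x = g x" using ae by (simp only: AE_lebesgue_on_iff[OF U])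
  then have "AE x in lborel. ?f x = ?g x" by eventually_elim (auto split: split_indicator)
  then have ae': "AE x in lebesgue. ?f x = ?g x" by (rule AE_completion)
  have gm: "?g \<in> borel_measurable lebesgue" by (rule lebesgue_AE_measurable[OF borel_measurable_integrable[OF fi] ae'])
  have "integrable lebesgue ?g" by (rule integrable_cong_AE_imp[OF fi gm]) (use ae' in auto)
  then show "integrable (lebesgue_on U) g" by (simp only: integrable_lebesgue_on_iff[OF U])
  have "(LINT x|lebesgue. ?g x) = (LINT x|lebesgue. ?f x)"
    by (rule integral_cong_AE[OF gm borel_measurable_integrable[OF fi]]) (use ae' in auto)
  then show "(LINT x|lebesgue_on U. g x) = (LINT x|lebesgue_on U. f x)" by (simp only: LINT_lebesgue_on[OF U])
qed

lemma C1_lipschitz_on_ball: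
  fixes \<phi> :: "'a::euclidean_space \<Rightarrow> real"
  assumes "C1 \<phi>" and M: "\<And>x. x \<in> ball 0 R \<Longrightarrow> norm (grad \<phi> x) \<le> M" and xy: "x \<in> ball 0 R" "y \<in> ball 0 R"
  shows "\<bar>\<phi> x - \<phi> y\<bar> \<le> M * norm (x - y)"
proof -
  obtain G where G: "\<And>x. GDERIV \<phi> x :> G x" using assms(1) by (auto simp: C1_def)
  have gG: "grad \<phi> x = G x" for x by (rule grad_eqI[OF G])
  have M0: "0 \<le> M" using M[OF xy(1)] norm_ge_zero order_trans by blast
  have "norm (\<phi> x - \<phi> y) \<le> M * norm (x - y)"
  proof (rule differentiable_bound[OF convex_ball _ _ xy])
    fix z assume z: "z \<in> ball (0::'a) R"
    show "(\<phi> has_derivative (\<lambda>h. h \<bullet> G z)) (at z within ball 0 R)"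
      using G[of z] unfolding gderiv_def by (rule has_derivative_at_withinI)
    show "onorm (\<lambda>h. h \<bullet> G z) \<le> M"
    proof (rule onorm_bound[OF M0])
      fix h
      have "norm (h \<bullet> G z) \<le> norm h * norm (G z)" using Cauchy_Schwarz_ineq2 by simp
      also have "\<dots> \<le> norm h * M" using M[OF z] gG by (intro mult_left_mono) auto
      finally show "norm (h \<bullet> G z) \<le> M * norm h" by (simp add: mult.commute)
    qed
  qed
  then show ?thesis by simp
qed

lemma C1_continuous: "C1 \<phi> \<Longrightarrow> continuous_on UNIV \<phi>"
proof -
  assume "C1 \<phi>"
  then obtain G where G: "\<And>x. GDERIV \<phi> x :> G x" by (auto simp: C1_def)
  show ?thesis
    using has_derivative_continuous[OF G[unfolded gderiv_def]] by (intro continuous_at_imp_continuous_on) blast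
qed

lemma C1_directional:
  assumes "C1 \<phi>"
  shows "((\<lambda>s. (\<phi> (x + s *\<^sub>R h) - \<phi> x) / s) \<longlongrightarrow> grad \<phi> x \<bullet> h) (at 0)"
proof -
  obtain G where G: "\<And>x. GDERIV \<phi> x :> G x" using assms(1) by (auto simp: C1_def)
  have "((\<lambda>s. \<phi> (x + s *\<^sub>R h)) has_derivative (\<lambda>r. (r *\<^sub>R h) \<bullet> G x)) (at 0)"
  proof (rule has_derivative_compose[of "\<lambda>s. x + s *\<^sub>R h" "\<lambda>r. r *\<^sub>R h" 0 UNIV \<phi>])
    show "((\<lambda>s. x + s *\<^sub>R h) has_derivative (\<lambda>r. r *\<^sub>R h)) (at 0)" by (auto intro!: derivative_eq_intros)
    show "(\<phi> has_derivative (\<lambda>k. k \<bullet> G x)) (at (x + 0 *\<^sub>R h))" using G[of x] by (simp add: gderiv_def)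
  qed
  then have "((\<lambda>s. \<phi> (x + s *\<^sub>R h)) has_real_derivative (grad \<phi> x \<bullet> h)) (at 0)"
    by (rule has_derivative_imp_has_field_derivative) (simp add: grad_eqI[OF G] inner_commute)
  then show ?thesis by (simp add: DERIV_def)
qed

text \<open>A function measurable in time and continuous in \<open>\<xi>\<close> is composed with a
  measurable map. For a simple map only finitely many functions \<open>f t \<xi>\<close> occur;
  continuity passes to the limit, and the bound on \<open>f t \<xi> - f t 0\<close> supplies the
  majorant.\<close>

lemma caratheodory_integrable:
  fixes f :: "real \<Rightarrow> 'a::euclidean_space \<Rightarrow> real" and G :: "'a \<times> real \<Rightarrow> 'a"
  assumes \<Omega>: "open \<Omega>" "bounded \<Omega>" and \<tau>: "0 < \<tau>"
    and fint: "\<And>\<xi>. integrable (lebesgue_on {0<..<\<tau>}) (\<lambda>t. f t \<xi>)"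
    and good: "AE t in lborel. t \<in> {0<..<\<tau>} \<longrightarrow> continuous_on UNIV (f t) \<and> (\<forall>\<xi>\<in>ball 0 R. \<bar>f t \<xi> - f t 0\<bar> \<le> K)"
    and G: "G \<in> borel_measurable borel" "\<And>p. norm (G p) < R"
  shows "integrable (lebesgue_on (\<Omega> \<times> {0<..<\<tau>})) (\<lambda>p. f (snd p) (G p))"
proof -
  let ?I = "{0<..<\<tau>}" and ?Q = "\<Omega> \<times> {0<..<\<tau>}"
  have Il: "?I \<in> sets lebesgue" by simp
  have Qo: "open ?Q" using \<Omega>(1) by (intro open_Times) auto
  have Qb[measurable]: "?Q \<in> sets borel" and Ql: "?Q \<in> sets lebesgue" using Qo by (auto simp: borel_open)
  have "\<exists>\<phi>. \<phi> \<in> borel_measurable borel \<and> (AE t in lborel. indicator ?I t * f t \<xi> = \<phi> t)" for \<xi>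
  proof -
    have "integrable lebesgue (\<lambda>t. indicator ?I t *\<^sub>R f t \<xi>)" using fint[of \<xi>] by (simp only: integrable_lebesgue_on_iff[OF Il])
    then have "(\<lambda>t. indicator ?I t *\<^sub>R f t \<xi>) \<in> borel_measurable lebesgue" by (rule borel_measurable_integrable)
    then obtain g where "g \<in> borel_measurable borel" "AE t in lborel. indicator ?I t *\<^sub>R f t \<xi> = g t"
      by (rule euclidean_borel_representative)
    then show ?thesis by (intro exI[of _ g]) simp
  qed
  \<comment> \<open>The null set depends on \<open>\<xi>\<close>, but only countably many
    \<open>\<xi>\<close> will be used: the values of the simple functions, and zero.\<close>
  then obtain \<phi> where \<phi>[measurable]: "\<And>\<xi>. \<phi> \<xi> \<in> borel_measurable borel" and \<phi>ae: "\<And>\<xi>. AE t in lborel. indicator ?I t * f t \<xi> = \<phi> \<xi> t"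
    by metis
  have \<phi>m: "(\<lambda>p. \<phi> \<xi> (snd p)) \<in> borel_measurable (borel :: ('a \<times> real) measure)" for \<xi>
    by (rule measurable_compose[OF borel_measurable_fst_snd(2) \<phi>])
  have lift: "AE p in (lborel :: ('a \<times> real) measure). P (snd p)" if "AE t in lborel. P t" for P :: "real \<Rightarrow> bool"
  proof -
    obtain N where N: "N \<in> null_sets lborel" "{t. \<not> P t} \<subseteq> N" using \<open>AE t in lborel. P t\<close> by (auto simp: eventually_ae_filter)
    have "AE p in (lborel :: ('a \<times> real) measure). snd p \<notin> N"
    proof (rule AE_lborel_from_slices)
      have "{p :: 'a \<times> real. snd p \<in> N} \<in> sets borel"
        using measurable_sets[OF borel_measurable_fst_snd(2), of N] N(1) by (auto simp: vimage_def)
      then show "{p :: 'a \<times> real. snd p \<notin> N} \<in> sets borel" by (simp add: Collect_neg_eq)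
      have "AE t in lborel. t \<notin> N" using N(1) by (rule AE_not_in)
      then show "AE t in lborel. AE x in lborel. snd (x :: 'a, t) \<notin> N" by eventually_elim simp
    qed
    then show ?thesis by eventually_elim (use N(2) in auto)
  qed
  obtain S where S: "\<And>i. simple_function borel (S i)" "\<And>p. (\<lambda>i. S i p) \<longlonglongrightarrow> G p"
    using borel_measurable_implies_sequence_metric[OF G(1), of 0] by auto
  have fin: "finite (range (S i))" for i using simple_functionD(1)[OF S(1)[of i]] by simp
  define F where "F i p = indicator ?Q p * (\<Sum>y\<in>range (S i). indicator (S i -` {y}) p * \<phi> y (snd p))" for i p
  have Fm: "F i \<in> borel_measurable borel" for i
  proof -
    have "S i -` {y} \<in> sets borel" for y using simple_functionD(2)[OF S(1)[of i], of "{y}"] by simp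
    then show ?thesis unfolding F_def[abs_def]
      by (intro borel_measurable_times borel_measurable_sum borel_measurable_indicator \<phi>m Qb)
  qed
  have Fae: "AE p in lborel. \<forall>i. F i p = indicator ?Q p * f (snd p) (S i p)"
  proof -
    have "AE p in (lborel :: ('a \<times> real) measure). \<forall>y\<in>range (S i). indicator ?I (snd p) * f (snd p) y = \<phi> y (snd p)" for i
      using lift[OF \<phi>ae] fin[of i] by (subst AE_ball_countable) (auto intro: countable_finite)
    then have "AE p in lborel. F i p = indicator ?Q p * f (snd p) (S i p)" for i
    proof (rule AE_mp[OF _ AE_I2], intro impI)
      fix p :: "'a \<times> real" assume a: "\<forall>y\<in>range (S i). indicator ?I (snd p) * f (snd p) y = \<phi> y (snd p)"
      have "(\<Sum>y\<in>range (S i). indicator (S i -` {y}) p * \<phi> y (snd p)) = (\<Sum>y\<in>range (S i). if y = S i p then \<phi> y (snd p) else 0)"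
        by (intro sum.cong) (auto split: split_indicator)
      also have "\<dots> = \<phi> (S i p) (snd p)" using fin[of i] by simp
      finally have s: "(\<Sum>y\<in>range (S i). indicator (S i -` {y}) p * \<phi> y (snd p)) = indicator ?I (snd p) * f (snd p) (S i p)"
        using bspec[OF a rangeI[of "S i" p]] by simp
      show "F i p = indicator ?Q p * f (snd p) (S i p)"
        unfolding F_def s by (cases "p \<in> ?Q") auto
    qed
    then show ?thesis by (simp add: AE_all_countable)
  qed
  have goodp: "AE p in (lborel :: ('a \<times> real) measure). snd p \<in> ?I \<longrightarrow> continuous_on UNIV (f (snd p)) \<and> (\<forall>\<xi>\<in>ball 0 R. \<bar>f (snd p) \<xi> - f (snd p) 0\<bar> \<le> K)"
    using lift[OF good] .
  let ?F = "\<lambda>p. indicator ?Q p * f (snd p) (G p)"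
  have Flim: "AE p in lborel. lim (\<lambda>i. F i p) = ?F p"
    using Fae goodp
  proof eventually_elim
    case (elim p)
    have "(\<lambda>i. indicator ?Q p * f (snd p) (S i p)) \<longlonglongrightarrow> ?F p"
    proof (cases "p \<in> ?Q")
      case True
      then have "continuous_on UNIV (f (snd p))" using elim(2) by auto
      from continuous_on_tendsto_compose[OF this S(2)[of p]] show ?thesis by (intro tendsto_mult tendsto_const) auto
    qed simp
    then show ?case using elim(1) by (simp add: limI)
  qed
  have limm: "(\<lambda>p. lim (\<lambda>i. F i p)) \<in> borel_measurable borel" using Fm by measurable
  have FL: "?F \<in> borel_measurable lebesgue"
    by (rule lebesgue_AE_measurable[OF _ AE_completion[OF Flim]]) (use limm in \<open>auto intro: measurable_completion\<close>)
  have i0: "integrable lborel (\<lambda>p. indicator ?Q p * (\<bar>\<phi> 0 (snd p)\<bar> + \<bar>K\<bar>))"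
  proof -
    have "integrable lebesgue (\<lambda>t. indicator ?I t *\<^sub>R f t 0)" using fint[of 0] by (simp only: integrable_lebesgue_on_iff[OF Il])
    then have "integrable lebesgue (\<phi> 0)"
      by (rule integrable_cong_AE_imp) (use AE_completion[OF \<phi>ae[of 0]] in \<open>auto intro: measurable_completion\<close>)
    then have p0: "integrable lborel (\<phi> 0)" by (simp add: integrable_completion)
    have p1: "integrable lborel (\<lambda>t. indicator ?I t * (\<bar>\<phi> 0 t\<bar> + \<bar>K\<bar>))"
    proof -
      have "integrable lborel (\<lambda>t. indicator ?I t *\<^sub>R \<bar>\<phi> 0 t\<bar>)" using p0 by (intro integrable_mult_indicator) auto
      moreover have "integrable lborel (\<lambda>t. indicator ?I t * \<bar>K\<bar>)"
        using \<tau> by (intro integrable_mult_left integrable_real_indicator) auto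
      ultimately show ?thesis by (simp add: distrib_left)
    qed
    have "integrable (lborel \<Otimes>\<^sub>M lborel) (\<lambda>p. indicator ?Q p * (\<bar>\<phi> 0 (snd p)\<bar> + \<bar>K\<bar>))"
    proof (rule lborel_pair.Fubini_integrable)
      show "(\<lambda>p. indicator ?Q p * (\<bar>\<phi> 0 (snd p)\<bar> + \<bar>K\<bar>)) \<in> borel_measurable (lborel \<Otimes>\<^sub>M lborel)"
        unfolding lborel_prod using \<phi>m by (intro borel_measurable_times borel_measurable_add borel_measurable_indicator borel_measurable_abs) auto
      have e: "indicator ?Q (x, t) * (\<bar>\<phi> 0 (snd (x, t))\<bar> + \<bar>K\<bar>) = indicator \<Omega> x * (indicator ?I t * (\<bar>\<phi> 0 t\<bar> + \<bar>K\<bar>))" for x t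
        by (auto split: split_indicator)
      show "AE x in lborel. integrable lborel (\<lambda>t. indicator ?Q (x, t) * (\<bar>\<phi> 0 (snd (x, t))\<bar> + \<bar>K\<bar>))"
        unfolding e using p1 by (intro AE_I2 integrable_mult_right)
      have "(LINT t|lborel. norm (indicator ?Q (x, t) * (\<bar>\<phi> 0 (snd (x, t))\<bar> + \<bar>K\<bar>))) = indicator \<Omega> x * (LINT t|lborel. indicator ?I t * (\<bar>\<phi> 0 t\<bar> + \<bar>K\<bar>))" for x
        unfolding e by (simp add: abs_mult)
      moreover have "integrable lborel (\<lambda>x. indicator \<Omega> x * (LINT t|lborel. indicator ?I t * (\<bar>\<phi> 0 t\<bar> + \<bar>K\<bar>)))"
        using \<Omega> emeasure_bounded_finite[OF \<Omega>(2)] by (intro integrable_mult_left integrable_real_indicator) auto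
      ultimately show "integrable lborel (\<lambda>x. LINT t|lborel. norm (indicator ?Q (x, t) * (\<bar>\<phi> 0 (snd (x, t))\<bar> + \<bar>K\<bar>)))" by simp
    qed
    then show ?thesis unfolding lborel_prod .
  qed
  have i0l: "integrable lebesgue (\<lambda>p. indicator ?Q p * (\<bar>\<phi> 0 (snd p)\<bar> + \<bar>K\<bar>))"
    using i0 by (subst integrable_completion) (auto dest: borel_measurable_integrable)
  have "integrable lebesgue ?F"
  proof (rule Bochner_Integration.integrable_bound[OF i0l FL])
    have "AE p in lborel. norm (?F p) \<le> norm (indicator ?Q p * (\<bar>\<phi> 0 (snd p)\<bar> + \<bar>K\<bar>))"
      using goodp lift[OF \<phi>ae[of 0]]
    proof eventually_elim
      case (elim p)
      show ?case
      proof (cases "p \<in> ?Q")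
        case True
        then have "snd p \<in> ?I" by auto
        then have "\<bar>f (snd p) (G p) - f (snd p) 0\<bar> \<le> K" "f (snd p) 0 = \<phi> 0 (snd p)"
          using elim G(2)[of p] by auto
        then show ?thesis using True by auto
      qed simp
    qed
    then show "AE p in lebesgue. norm (?F p) \<le> norm (indicator ?Q p * (\<bar>\<phi> 0 (snd p)\<bar> + \<bar>K\<bar>))" by (rule AE_completion)
  qed
  then show ?thesis by (simp only: integrable_lebesgue_on_iff[OF Ql] real_scaleR_def)
qed

text \<open>Integration by parts on each line in time, for \<open>v * \<phi>\<close>; a test
  function of the slab vanishes at both end times.\<close>

lemma has_weak_dt_classical:
  fixes v b :: "'a::euclidean_space \<times> real \<Rightarrow> real"
  assumes \<Omega>: "open \<Omega>" "bounded \<Omega>" and \<tau>: "0 < \<tau>"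
    and [measurable]: "v \<in> borel_measurable borel" "b \<in> borel_measurable borel"
    and bd: "\<And>p. \<bar>v p\<bar> \<le> B" "\<And>p. \<bar>b p\<bar> \<le> B"
    and d: "\<And>x t. t \<in> {0..\<tau>} \<Longrightarrow> ((\<lambda>t. v (x, t)) has_real_derivative b (x, t)) (at t within {0..\<tau>})"
    and c: "\<And>x. continuous_on {0..\<tau>} (\<lambda>t. b (x, t))"
  shows "has_weak_dt (\<Omega> \<times> {0<..<\<tau>}) v b"
  unfolding has_weak_dt_def
proof (intro conjI ballI)
  let ?Q = "\<Omega> \<times> {0<..<\<tau>}"
  have Qo: "open ?Q" using \<Omega>(1) by (intro open_Times) auto
  have Qb[measurable]: "?Q \<in> sets borel" using Qo by simp
  have Ob: "\<Omega> \<in> sets borel" using \<Omega> by simp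
  have B: "0 \<le> B" using bd(1)[of undefined] by linarith
  show li: "locally_integrable ?Q v" "locally_integrable ?Q b"
    using bd by (auto intro!: locally_integrable_bounded[where C=B])
  fix \<phi> assume \<phi>: "\<phi> \<in> test_functions ?Q"
  have sm: "smooth \<phi>" using \<phi> by (rule test_functions_smooth)
  have \<phi>t: "time_deriv \<phi> \<in> test_functions ?Q" using \<phi> by (rule time_deriv_test)
  have [measurable]: "\<phi> \<in> borel_measurable borel" "time_deriv \<phi> \<in> borel_measurable borel"
    using \<phi> \<phi>t by (auto intro: test_functions_borel)
  obtain B1 where B1: "0 < B1" "\<And>p. \<bar>\<phi> p\<bar> \<le> B1" using test_functions_bounded[OF \<phi>] by blast
  obtain B2 where B2: "0 < B2" "\<And>p. \<bar>time_deriv \<phi> p\<bar> \<le> B2" using test_functions_bounded[OF \<phi>t] by blast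
  have cs: "continuous_on S (\<lambda>t. k (x, t))" if "smooth k" for k :: "'a \<times> real \<Rightarrow> real" and x S
    by (rule continuous_on_compose2[OF smooth_continuous[OF that, of UNIV]]) (auto intro!: continuous_intros)
  have cv: "continuous_on {0..\<tau>} (\<lambda>t. v (x, t))" for x
    by (rule DERIV_continuous_on) (rule d)
  have z: "(LINT p|lborel. indicator ?Q p * (v p * time_deriv \<phi> p + b p * \<phi> p)) = (LINT x|lborel. indicator \<Omega> x * (v (x, \<tau>) * \<phi> (x, \<tau>) - v (x, 0) * \<phi> (x, 0)))"
  proof (rule time_parts(1)[OF Ob \<Omega>(2) \<tau>, where a="\<lambda>p. v p * \<phi> p" and B="B * B2 + B * B1"])
    show "(\<lambda>p. v p * time_deriv \<phi> p + b p * \<phi> p) \<in> borel_measurable borel" by measurable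
    fix x t assume "x \<in> \<Omega>" and t: "t \<in> {0..\<tau>}"
    have "\<bar>v (x, t) * time_deriv \<phi> (x, t)\<bar> \<le> B * B2" "\<bar>b (x, t) * \<phi> (x, t)\<bar> \<le> B * B1"
      using mult_mono[OF bd(1) B2(2) B abs_ge_zero] mult_mono[OF bd(2) B1(2) B abs_ge_zero] by (simp_all add: abs_mult)
    then show "\<bar>v (x, t) * time_deriv \<phi> (x, t) + b (x, t) * \<phi> (x, t)\<bar> \<le> B * B2 + B * B1" by linarith
    have "((\<lambda>t. v (x, t) * \<phi> (x, t)) has_real_derivative b (x, t) * \<phi> (x, t) + time_deriv \<phi> (x, t) * v (x, t)) (at t within {0..\<tau>})"
      by (rule DERIV_mult[OF d[OF t] has_field_derivative_at_within[OF time_deriv_eq(1)[OF sm]]])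
    then show "((\<lambda>t. v (x, t) * \<phi> (x, t)) has_real_derivative v (x, t) * time_deriv \<phi> (x, t) + b (x, t) * \<phi> (x, t)) (at t within {0..\<tau>})"
      by (simp add: add.commute mult.commute)
  next
    fix x
    show "continuous_on {0..\<tau>} (\<lambda>t. v (x, t) * time_deriv \<phi> (x, t) + b (x, t) * \<phi> (x, t))"
      by (intro continuous_intros cv c cs sm smooth_time_deriv)
  qed
  have off: "\<phi> (x, \<tau>) = 0" "\<phi> (x, 0) = 0" for x using test_functions_outside[OF \<phi>] by auto
  have off2: "p \<notin> ?Q \<Longrightarrow> \<phi> p = 0" "p \<notin> ?Q \<Longrightarrow> time_deriv \<phi> p = 0" for p
    using test_functions_outside[OF \<phi>] test_functions_outside[OF \<phi>t] by auto
  have i1: "integrable lborel (\<lambda>p. v p * time_deriv \<phi> p)"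
    using test_functions_integrable[OF \<phi>t] bd(1)
    by (intro Bochner_Integration.integrable_bound[OF integrable_mult_right[OF integrable_abs[OF test_functions_integrable[OF \<phi>t]], of B]])
       (auto simp: abs_mult B intro!: AE_I2 mult_right_mono)
  have i2: "integrable lborel (\<lambda>p. \<phi> p * b p)"
  proof (rule Bochner_Integration.integrable_bound[OF integrable_mult_right[OF integrable_abs[OF test_functions_integrable[OF \<phi>]], of B]], measurable, intro AE_I2)
    fix p show "norm (\<phi> p * b p) \<le> norm (B * \<bar>\<phi> p\<bar>)"
      using mult_right_mono[OF bd(2)[of p] abs_ge_zero[of "\<phi> p"]] by (simp add: abs_mult B mult.commute)
  qed
  have e: "(\<lambda>p. indicator ?Q p * (v p * time_deriv \<phi> p + b p * \<phi> p)) = (\<lambda>p. v p * time_deriv \<phi> p + \<phi> p * b p)"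
  proof
    fix p show "indicator ?Q p * (v p * time_deriv \<phi> p + b p * \<phi> p) = v p * time_deriv \<phi> p + \<phi> p * b p"
      using off2[of p] by (cases "p \<in> ?Q") auto
  qed
  have "(LINT p|lborel. v p * time_deriv \<phi> p + \<phi> p * b p) = 0" using z unfolding e by (simp add: off)
  then have "(LINT p|lborel. v p * time_deriv \<phi> p) = - (LINT p|lborel. \<phi> p * b p)"
    by (simp add: Bochner_Integration.integral_add[OF i1 i2])
  moreover have "(LINT p|lebesgue_on ?Q. v p * time_deriv \<phi> p) = (LINT p|lborel. v p * time_deriv \<phi> p)"
    by (rule LINT_lebesgue_on_zero_off[OF Qb]) (use off2 in auto)
  moreover have "(LINT p|lebesgue_on ?Q. \<phi> p * b p) = (LINT p|lborel. \<phi> p * b p)"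
    by (rule LINT_lebesgue_on_zero_off[OF Qb]) (use off2 in auto)
  ultimately show "(LINT p|lebesgue_on ?Q. v p * time_deriv \<phi> p) = - (LINT p|lebesgue_on ?Q. \<phi> p * b p)" by simp
qed

text \<open>Uniform continuity on the compact set \<open>closure \<Omega> \<times> cball t 1\<close>
  makes nearby slices uniformly close, and \<open>\<Omega>\<close> has finite measure.\<close>

lemma continuous_C0_L2:
  fixes v :: "'a::euclidean_space \<times> real \<Rightarrow> real"
  assumes \<Omega>: "open \<Omega>" "bounded \<Omega>" and v: "continuous_on UNIV v"
  shows "v \<in> C0_L2 \<Omega> T"
proof -
  have vs: "continuous_on S (\<lambda>x. v (x, t))" for t S
    by (rule continuous_on_compose2[OF v]) (auto intro!: continuous_intros)
  have L2s: "(\<lambda>x. v (x, t)) \<in> L2 \<Omega>" for t by (rule continuous_in_L2[OF \<Omega> vs])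
  have "((\<lambda>s. norm_L2 \<Omega> (\<lambda>x. v (x, s) - v (x, t))) \<longlongrightarrow> 0) (at t within S)" for t S
  proof (rule tendstoI)
    fix e :: real assume e: "0 < e"
    let ?m = "Sigma_Algebra.measure lebesgue \<Omega>"
    define r where "r = e / (?m + 1)"
    have m1: "0 < ?m + 1" by (intro add_nonneg_pos measure_nonneg) simp
    have r: "0 < r" using e m1 by (simp only: r_def divide_pos_pos)
    have rm: "r\<^sup>2 * ?m < e\<^sup>2"
    proof -
      have m0: "0 \<le> ?m" by (rule measure_nonneg)
      have gen: "m < (m + 1)\<^sup>2" if "0 \<le> m" for m :: real
        using that by (simp add: power2_eq_square algebra_simps add_pos_nonneg)
      have "?m < (?m + 1)\<^sup>2" using m0 by (rule gen)
      then have "r\<^sup>2 * ?m < r\<^sup>2 * (?m + 1)\<^sup>2" using r by (intro mult_strict_left_mono) auto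
      also have "\<dots> = (r * (?m + 1))\<^sup>2" by (rule power_mult_distrib[symmetric])
      also have "r * (?m + 1) = e" using m1 by (simp only: r_def nonzero_divide_eq_eq[symmetric] less_irrefl) auto
      finally show ?thesis .
    qed
    have "compact (closure \<Omega> \<times> cball t 1)" using \<Omega>(2) by (intro compact_Times) auto
    then have "uniformly_continuous_on (closure \<Omega> \<times> cball t 1) v"
      by (intro compact_uniformly_continuous continuous_on_subset[OF v]) auto
    then obtain d where d: "0 < d" "\<And>p q. p \<in> closure \<Omega> \<times> cball t 1 \<Longrightarrow> q \<in> closure \<Omega> \<times> cball t 1 \<Longrightarrow> dist q p < d \<Longrightarrow> dist (v q) (v p) < r"
      using r unfolding uniformly_continuous_on_def by metis
    have "norm_L2 \<Omega> (\<lambda>x. v (x, s) - v (x, t)) < e" if s: "dist s t < min d 1" for s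
    proof -
      have "\<bar>v (x, s) - v (x, t)\<bar> \<le> r" if x: "x \<in> \<Omega>" for x
      proof -
        have "dist (v (x, s)) (v (x, t)) < r"
          using x s closure_subset[of \<Omega>] by (intro d(2)) (auto simp: dist_Pair_Pair dist_commute)
        then show ?thesis by (simp add: dist_real_def)
      qed
      then have "(norm_L2 \<Omega> (\<lambda>x. v (x, s) - v (x, t)))\<^sup>2 \<le> r\<^sup>2 * ?m"
        by (intro norm_L2_sup_bound[OF \<Omega>] L2_diff L2s)
      then have "(norm_L2 \<Omega> (\<lambda>x. v (x, s) - v (x, t)))\<^sup>2 < e\<^sup>2" using rm by linarith
      then show ?thesis using e by (simp add: power_less_imp_less_base)
    qed
    then show "\<forall>\<^sub>F s in at t within S. dist (norm_L2 \<Omega> (\<lambda>x. v (x, s) - v (x, t))) 0 < e"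
      unfolding eventually_at using d(1) by (intro exI[of _ "min d 1"]) (auto simp: dist_real_def abs_of_nonneg[OF norm_L2_nonneg])
  qed
  with L2s show ?thesis by (simp add: C0_L2_def)
qed

lemma cylinder_ereal: "cylinder \<Omega> (ereal \<tau>) = \<Omega> \<times> {0<..<\<tau>}"
  by (auto simp: cylinder_def open_time_def)

text \<open>\<open>U\<close> and \<open>g\<close> are representatives of \<open>u\<close> and its gradient which are defined and bounded on the whole
  space, and \<open>v0\<close> is a continuous extension of \<open>u0\<close> from the closure of \<open>\<Omega>\<close>.\<close>

locale slab =
  fixes \<Omega> :: "'a::euclidean_space set" and \<tau> :: real and f :: "real \<Rightarrow> 'a \<Rightarrow> real"
    and u0 v0 :: "'a \<Rightarrow> real" and u U :: "'a \<times> real \<Rightarrow> real" and g :: "'a \<times> real \<Rightarrow> 'a"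
    and L B :: real
  assumes open_\<Omega>: "open \<Omega>" and bounded_\<Omega>: "bounded \<Omega>" and tau_pos: "0 < \<tau>" and L_nonneg: "0 \<le> L"
    and U_cont: "continuous_on UNIV U"
    and U_lipschitz: "\<And>x y t. \<bar>U (x, t) - U (y, t)\<bar> \<le> L * norm (x - y)"
    and U_frontier: "\<And>x t. x \<in> frontier \<Omega> \<Longrightarrow> U (x, t) = u0 x"
    and U_bound: "\<And>p. \<bar>U p\<bar> \<le> B" and g_borel: "g \<in> borel_measurable borel" and g_bound: "\<And>p. norm (g p) \<le> B"
    and U_grad: "has_weak_grad (\<Omega> \<times> {0<..<\<tau>}) U g" and u_grad: "has_weak_grad (\<Omega> \<times> {0<..<\<tau>}) u g"
    and u_AE: "AE p in lebesgue_on (\<Omega> \<times> {0<..<\<tau>}). u p = U p"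
    and v0_cont: "continuous_on UNIV v0" and v0_eq: "\<And>x. x \<in> closure \<Omega> \<Longrightarrow> v0 x = u0 x"
    and f_int: "\<And>\<xi>. integrable (lebesgue_on {0<..<\<tau>}) (\<lambda>t. f t \<xi>)"
    and f_C1: "AE t in lborel. t \<in> {0<..<\<tau>} \<longrightarrow> C1 (f t)"
    and f_grad: "\<And>R. 0 < R \<Longrightarrow> \<exists>M>0. \<forall>t\<in>{0<..<\<tau>}. C1 (f t) \<longrightarrow> (\<forall>\<xi>\<in>ball 0 R. norm (grad (f t) \<xi>) \<le> M)"
    and solution: "variational_solution_finite f \<Omega> \<tau> u0 u"
begin

section \<open>Integrals and energies on a slab of finite length\<close>

abbreviation Q :: "('a \<times> real) set" where "Q \<equiv> \<Omega> \<times> {0<..<\<tau>}"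

lemma Q_open: "open Q" using open_\<Omega> by (intro open_Times) auto
lemma Q_borel[measurable]: "Q \<in> sets borel" using Q_open by simp
lemma Q_lebesgue: "Q \<in> sets lebesgue" using Q_open by (simp add: borel_open)
lemma Q_bounded: "bounded Q" using bounded_\<Omega> by (intro bounded_Times) auto
lemma \<Omega>_borel[measurable]: "\<Omega> \<in> sets borel" using open_\<Omega> by simp
lemma U_borel[measurable]: "U \<in> borel_measurable borel" using U_cont by (rule borel_measurable_continuous_onI)
lemma g_borel'[measurable]: "g \<in> borel_measurable borel" by (rule g_borel)
lemma B_nonneg: "0 \<le> B" using U_bound[of undefined] by linarith

text \<open>A bridge between \<open>lebesgue_on Q\<close>, in which the notions of solution are
  phrased, and \<open>lborel\<close>, in which Fubini and integration by parts are carried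
  out.\<close>

lemma bounded_on_Q:
  fixes F :: "'a \<times> real \<Rightarrow> real"
  assumes [measurable]: "F \<in> borel_measurable borel" and F: "\<And>p. p \<in> Q \<Longrightarrow> \<bar>F p\<bar> \<le> K"
  shows "integrable lborel (\<lambda>p. indicator Q p * F p)" "integrable (lebesgue_on Q) F"
    "(LINT p|lebesgue_on Q. F p) = (LINT p|lborel. indicator Q p * F p)"
proof -
  show i: "integrable lborel (\<lambda>p. indicator Q p * F p)"
  proof (rule integrable_bounded_support[OF _ Q_bounded, where C="\<bar>K\<bar>"])
    show "norm (indicator Q p * F p) \<le> \<bar>K\<bar>" for p using F[of p] by (cases "p \<in> Q") auto
  qed auto
  then have "integrable lebesgue (\<lambda>p. indicator Q p *\<^sub>R F p)"
    by (subst integrable_completion) (auto dest: borel_measurable_integrable)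
  then show "integrable (lebesgue_on Q) F" by (simp only: integrable_lebesgue_on_iff[OF Q_lebesgue])
  show "(LINT p|lebesgue_on Q. F p) = (LINT p|lborel. indicator Q p * F p)"
    using LINT_lebesgue_on_borel[OF Q_borel, of F] by simp
qed

lemma bounded_on_\<Omega>:
  fixes F :: "'a \<Rightarrow> real"
  assumes [measurable]: "F \<in> borel_measurable borel" and F: "\<And>x. x \<in> \<Omega> \<Longrightarrow> \<bar>F x\<bar> \<le> K"
  shows "integrable lborel (\<lambda>x. indicator \<Omega> x * F x)"
proof (rule integrable_bounded_support[OF _ bounded_\<Omega>, where C="\<bar>K\<bar>"])
  show "norm (indicator \<Omega> x * F x) \<le> \<bar>K\<bar>" for x using F[of x] by (cases "x \<in> \<Omega>") auto
qed auto

lemma f_locally_lipschitz: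
  assumes "0 < R"
  obtains M where "0 < M" "AE t in lborel. t \<in> {0<..<\<tau>} \<longrightarrow> C1 (f t) \<and>
    (\<forall>\<xi>\<in>ball 0 R. norm (grad (f t) \<xi>) \<le> M) \<and> (\<forall>\<xi>\<in>ball 0 R. \<forall>\<zeta>\<in>ball 0 R. \<bar>f t \<xi> - f t \<zeta>\<bar> \<le> M * norm (\<xi> - \<zeta>))"
proof -
  obtain M where M: "0 < M" "\<And>t. t \<in> {0<..<\<tau>} \<Longrightarrow> C1 (f t) \<Longrightarrow> (\<forall>\<xi>\<in>ball 0 R. norm (grad (f t) \<xi>) \<le> M)"
    using f_grad[OF assms] by blast
  show ?thesis
  proof (rule that[OF M(1)])
    show "AE t in lborel. t \<in> {0<..<\<tau>} \<longrightarrow> C1 (f t) \<and>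
    (\<forall>\<xi>\<in>ball 0 R. norm (grad (f t) \<xi>) \<le> M) \<and> (\<forall>\<xi>\<in>ball 0 R. \<forall>\<zeta>\<in>ball 0 R. \<bar>f t \<xi> - f t \<zeta>\<bar> \<le> M * norm (\<xi> - \<zeta>))"
      using f_C1
    proof eventually_elim
      case (elim t)
      show ?case
      proof
        assume t: "t \<in> {0<..<\<tau>}"
        then have c: "C1 (f t)" using elim by blast
        have "\<forall>\<xi>\<in>ball 0 R. \<forall>\<zeta>\<in>ball 0 R. \<bar>f t \<xi> - f t \<zeta>\<bar> \<le> M * norm (\<xi> - \<zeta>)"
          using C1_lipschitz_on_ball[OF c, of R M] M(2)[OF t c] by blast
        then show "C1 (f t) \<and> (\<forall>\<xi>\<in>ball 0 R. norm (grad (f t) \<xi>) \<le> M) \<and>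
          (\<forall>\<xi>\<in>ball 0 R. \<forall>\<zeta>\<in>ball 0 R. \<bar>f t \<xi> - f t \<zeta>\<bar> \<le> M * norm (\<xi> - \<zeta>))"
          using c M(2)[OF t c] by blast
      qed
    qed
  qed
qed

lemma f_comp_integrable:
  assumes G: "G \<in> borel_measurable borel" "\<And>p. norm (G p) < R"
  shows "integrable (lebesgue_on Q) (\<lambda>p. f (snd p) (G p))"
proof -
  have R: "0 < R" using G(2)[of undefined] norm_ge_zero[of "G undefined"] by linarith
  obtain M where M: "0 < M" "AE t in lborel. t \<in> {0<..<\<tau>} \<longrightarrow> C1 (f t) \<and>
    (\<forall>\<xi>\<in>ball 0 R. norm (grad (f t) \<xi>) \<le> M) \<and> (\<forall>\<xi>\<in>ball 0 R. \<forall>\<zeta>\<in>ball 0 R. \<bar>f t \<xi> - f t \<zeta>\<bar> \<le> M * norm (\<xi> - \<zeta>))"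
    by (rule f_locally_lipschitz[OF R])
  show ?thesis
  proof (rule caratheodory_integrable[OF open_\<Omega> bounded_\<Omega> tau_pos f_int _ G, where K="M * R"])
    show "AE t in lborel. t \<in> {0<..<\<tau>} \<longrightarrow> continuous_on UNIV (f t) \<and> (\<forall>\<xi>\<in>ball 0 R. \<bar>f t \<xi> - f t 0\<bar> \<le> M * R)"
      using M(2)
    proof eventually_elim
      case (elim t)
      show ?case
      proof (intro impI conjI ballI)
        assume t: "t \<in> {0<..<\<tau>}"
        then show "continuous_on UNIV (f t)" using elim C1_continuous by blast
        fix \<xi> :: 'a assume x: "\<xi> \<in> ball 0 R"
        have "0 \<in> ball (0::'a) R" using R by simp
        then have "\<bar>f t \<xi> - f t 0\<bar> \<le> M * norm (\<xi> - 0)" using elim t x by blast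
        also have "\<dots> \<le> M * R" using x M(1) by (intro mult_left_mono) auto
        finally show "\<bar>f t \<xi> - f t 0\<bar> \<le> M * R" .
      qed
    qed
  qed
qed

lemma AE_Q_time:
  assumes "AE t in lborel. t \<in> {0<..<\<tau>} \<longrightarrow> P t"
  shows "AE p in lebesgue_on Q. P (snd p)"
proof -
  obtain N where N: "N \<in> null_sets lborel" "{t. \<not> (t \<in> {0<..<\<tau>} \<longrightarrow> P t)} \<subseteq> N"
    using assms by (auto simp: eventually_ae_filter)
  have "AE p in (lborel :: ('a \<times> real) measure). snd p \<notin> N"
  proof (rule AE_lborel_from_slices)
    have "{p :: 'a \<times> real. snd p \<in> N} \<in> sets borel"
      using measurable_sets[OF borel_measurable_fst_snd(2), of N] N(1) by (auto simp: vimage_def)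
    then show "{p :: 'a \<times> real. snd p \<notin> N} \<in> sets borel" by (simp add: Collect_neg_eq)
    have "AE t in lborel. t \<notin> N" using N(1) by (rule AE_not_in)
    then show "AE t in lborel. AE x in lborel. snd (x :: 'a, t) \<notin> N" by eventually_elim simp
  qed
  then have "AE p in lborel. p \<in> Q \<longrightarrow> P (snd p)" by eventually_elim (use N(2) in auto)
  then show ?thesis by (simp only: AE_lebesgue_on_iff[OF Q_lebesgue])
qed

text \<open>The Lipschitz bound in \<open>\<xi>\<close>, uniform in time, turns L1 convergence of
  uniformly bounded gradients into convergence of the energies.\<close>

lemma f_comp_diff:
  assumes M: "AE t in lborel. t \<in> {0<..<\<tau>} \<longrightarrow> (\<forall>\<xi>\<in>ball 0 R. \<forall>\<zeta>\<in>ball 0 R. \<bar>f t \<xi> - f t \<zeta>\<bar> \<le> M * norm (\<xi> - \<zeta>))" "0 < M"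
    and G: "G1 \<in> borel_measurable borel" "\<And>p. norm (G1 p) < R" "G2 \<in> borel_measurable borel" "\<And>p. norm (G2 p) < R"
  shows "\<bar>(LINT p|lebesgue_on Q. f (snd p) (G1 p)) - (LINT p|lebesgue_on Q. f (snd p) (G2 p))\<bar>
    \<le> M * (LINT p|lborel. indicator Q p * norm (G1 p - G2 p))"
proof -
  have [measurable]: "G1 \<in> borel_measurable borel" "G2 \<in> borel_measurable borel" by fact+
  note i1 = f_comp_integrable[OF G(1,2)] and i2 = f_comp_integrable[OF G(3,4)]
  have nb: "\<bar>norm (G1 p - G2 p)\<bar> \<le> 2 * R" for p
    using norm_triangle_ineq4[of "G1 p" "G2 p"] G(2)[of p] G(4)[of p] by simp
  have m: "(\<lambda>p. norm (G1 p - G2 p)) \<in> borel_measurable borel" by measurable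
  note nQ = bounded_on_Q[OF m nb]
  have "(LINT p|lebesgue_on Q. f (snd p) (G1 p)) - (LINT p|lebesgue_on Q. f (snd p) (G2 p))
    = (LINT p|lebesgue_on Q. f (snd p) (G1 p) - f (snd p) (G2 p))"
    by (rule Bochner_Integration.integral_diff[symmetric, OF i1 i2])
  also have "\<bar>\<dots>\<bar> \<le> (LINT p|lebesgue_on Q. \<bar>f (snd p) (G1 p) - f (snd p) (G2 p)\<bar>)" by (rule integral_abs_bound)
  also have "\<dots> \<le> (LINT p|lebesgue_on Q. M * norm (G1 p - G2 p))"
  proof (rule integral_mono_AE)
    show "integrable (lebesgue_on Q) (\<lambda>p. \<bar>f (snd p) (G1 p) - f (snd p) (G2 p)\<bar>)"
      by (intro integrable_abs Bochner_Integration.integrable_diff i1 i2)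
    show "integrable (lebesgue_on Q) (\<lambda>p. M * norm (G1 p - G2 p))" by (intro integrable_mult_right nQ)
    show "AE p in lebesgue_on Q. \<bar>f (snd p) (G1 p) - f (snd p) (G2 p)\<bar> \<le> M * norm (G1 p - G2 p)"
      using AE_Q_time[OF M(1)] by eventually_elim (use G(2,4) in auto)
  qed
  also have "\<dots> = M * (LINT p|lborel. indicator Q p * norm (G1 p - G2 p))"
    using nQ(3) by simp
  finally show ?thesis .
qed

definition Gavg :: "real \<Rightarrow> 'a \<times> real \<Rightarrow> 'a" where
  "Gavg h p = (LINT s|lborel. kern h (max 0 (min \<tau> (snd p))) s *\<^sub>R g (fst p, s))"

text \<open>As \<open>h \<le> \<tau>\<close>, the kernel is supported in \<open>[0, \<tau>]\<close>,
  which differs from the open time interval by two points, so the commutation of averaging and weak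
  gradient applies.\<close>

lemma Gavg_props:
  assumes h: "0 < h" "h \<le> \<tau>"
  shows "Gavg h \<in> borel_measurable borel" "norm (Gavg h p) \<le> B" "has_weak_grad Q (tavg h \<tau> U) (Gavg h)"
proof -
  let ?K = "\<lambda>t s. kern h (max 0 (min \<tau> t)) s"
  show "Gavg h \<in> borel_measurable borel" unfolding Gavg_def[abs_def]
    by (rule lborel.borel_measurable_lebesgue_integral) (unfold split_beta', measurable)
  show "norm (Gavg h p) \<le> B"
    unfolding Gavg_def by (rule kern_avg_bound(2)[OF _ _ h(1)]) (use g_bound in auto)
  have "has_weak_grad Q (\<lambda>p. LINT s|lborel. ?K (snd p) s * U (fst p, s)) (\<lambda>p. LINT s|lborel. ?K (snd p) s *\<^sub>R g (fst p, s))"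
  proof (rule weak_grad_kernel[OF open_\<Omega> _ U_grad U_borel g_borel U_bound g_bound, where S="{0..\<tau>}" and B="2 / h"])
    show "(\<lambda>p::real \<times> real. ?K (fst p) (snd p)) \<in> borel_measurable borel" by measurable
    show "\<bar>?K t s\<bar> \<le> 2 / h" for t s using kern_bounds(1,2)[OF h(1), of "max 0 (min \<tau> t)" s] by simp
    show "?K t s = 0" if "s \<notin> {0..\<tau>}" for t s
      using that h tau_pos by (intro kern_bounds(3)[OF h(1)]) auto
    show "AE s in lborel. s \<in> {0..\<tau>} \<longrightarrow> s \<in> {0<..<\<tau>}"
      using AE_lborel_singleton[of 0] AE_lborel_singleton[of \<tau>] by eventually_elim auto
  qed auto
  then show "has_weak_grad Q (tavg h \<tau> U) (Gavg h)" by (simp add: tavg_def[abs_def] Gavg_def[abs_def])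
qed

lemma tavg_bound: "0 < h \<Longrightarrow> \<bar>tavg h \<tau> U p\<bar> \<le> B"
  and tavg_cont: "0 < h \<Longrightarrow> continuous_on UNIV (tavg h \<tau> U)"
  and tavg_lipschitz: "0 < h \<Longrightarrow> \<bar>tavg h \<tau> U (x, t) - tavg h \<tau> U (y, t)\<bar> \<le> L * norm (x - y)"
  and tavg_const: "0 < h \<Longrightarrow> (\<And>s. U (z, s) = c) \<Longrightarrow> tavg h \<tau> U (z, t) = c"
  using tavg_props[OF U_cont U_bound _ tau_pos L_nonneg U_lipschitz] by blast+

lemma U_slice_cont: "continuous_on S (\<lambda>t. U (x, t))"
  by (rule continuous_on_compose2[OF U_cont]) (auto intro!: continuous_intros)

section \<open>Competitors built from the average and a smooth variation\<close>

context
  fixes \<psi> :: "'a \<times> real \<Rightarrow> real"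
  assumes \<psi>: "\<psi> \<in> test_functions (\<Omega> \<times> {..<\<tau>})"
begin

lemma \<psi>_smooth: "smooth \<psi>" using \<psi> by (rule test_functions_smooth)

lemma \<psi>_borel[measurable]: "\<psi> \<in> borel_measurable borel" "time_deriv \<psi> \<in> borel_measurable borel" "space_grad \<psi> \<in> borel_measurable borel"
  using \<psi>_smooth by (auto intro: smooth_borel smooth_time_deriv borel_measurable_continuous_onI continuous_space_grad)

lemma \<psi>_slice_cont: "continuous_on S (\<lambda>t. \<psi> (x, t))" "continuous_on S (\<lambda>t. time_deriv \<psi> (x, t))"
  by (rule continuous_on_compose2[OF smooth_continuous[OF \<psi>_smooth, of UNIV]], auto intro!: continuous_intros)
     (rule continuous_on_compose2[OF smooth_continuous[OF smooth_time_deriv[OF \<psi>_smooth], of UNIV]], auto intro!: continuous_intros)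

text \<open>The support may reach time zero but neither the end time nor the frontier: the variation
  is free initially, and its end and boundary values vanish.\<close>

lemma \<psi>_end: "\<psi> (x, \<tau>) = 0" "x \<in> frontier \<Omega> \<Longrightarrow> \<psi> (x, t) = 0"
  using test_functions_outside[OF \<psi>] open_\<Omega> by (auto simp: frontier_def interior_open)

text \<open>On the frontier \<open>U\<close> is constant in time, so the average keeps the boundary
  values and \<open>\<psi>\<close> adds nothing there. The function \<open>b\<close> is the
  right-hand side of the differential equation of the average plus the time derivative of
  \<open>\<psi>\<close>.\<close>

lemma competitor:
  assumes h: "0 < h" "h \<le> \<tau>"
  defines "v \<equiv> \<lambda>p. tavg h \<tau> U p + \<psi> p"
    and "b \<equiv> \<lambda>p. (U p - tavg h \<tau> U p) / h + time_deriv \<psi> p"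
  shows "v \<in> Kinf_bd \<Omega> (ereal \<tau>) u0" "has_weak_grad Q v (\<lambda>p. Gavg h p + space_grad \<psi> p)"
    "has_weak_dt Q v b" "b \<in> L2 Q"
    "b \<in> borel_measurable borel" "\<exists>K. \<forall>p. \<bar>b p\<bar> \<le> K" "v \<in> borel_measurable borel" "\<exists>K. \<forall>p. \<bar>v p\<bar> \<le> K"
proof -
  obtain B1 where B1: "0 < B1" "\<And>p. \<bar>\<psi> p\<bar> \<le> B1" using test_functions_bounded[OF \<psi>] by blast
  obtain B2 where B2: "0 < B2" "\<And>p. \<bar>time_deriv \<psi> p\<bar> \<le> B2" using test_functions_bounded[OF time_deriv_test[OF \<psi>]] by blast
  obtain B3 where B3: "0 < B3" "\<And>p. norm (space_grad \<psi> p) \<le> B3" using space_grad_bounded[OF \<psi>] by blast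
  have w: "continuous_on UNIV (tavg h \<tau> U)" "\<And>p. \<bar>tavg h \<tau> U p\<bar> \<le> B" using tavg_cont[OF h(1)] tavg_bound[OF h(1)] by auto
  then have wm[measurable]: "tavg h \<tau> U \<in> borel_measurable borel" by (intro borel_measurable_continuous_onI)
  have vc: "continuous_on UNIV v" unfolding v_def by (intro continuous_on_add w smooth_continuous \<psi>_smooth)
  show vm[measurable]: "v \<in> borel_measurable borel" using vc by (rule borel_measurable_continuous_onI)
  show bm[measurable]: "b \<in> borel_measurable borel" unfolding b_def by measurable
  define K where "K = (B + B1) + (2 * B / h + B2)"
  have K0: "0 \<le> 2 * B / h" using B_nonneg h by simp
  have vb: "\<bar>v p\<bar> \<le> K" for p
    using w(2)[of p] B1(2)[of p] K0 B2(1) unfolding v_def K_def by linarith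
  have bb: "\<bar>b p\<bar> \<le> K" for p
  proof -
    have "\<bar>U p - tavg h \<tau> U p\<bar> \<le> 2 * B" using w(2)[of p] U_bound[of p] by linarith
    then have "\<bar>(U p - tavg h \<tau> U p) / h\<bar> \<le> 2 * B / h" using h by (simp add: divide_right_mono)
    then show ?thesis using B2(2)[of p] B_nonneg B1(1) unfolding b_def K_def by linarith
  qed
  show "\<exists>K. \<forall>p. \<bar>b p\<bar> \<le> K" "\<exists>K. \<forall>p. \<bar>v p\<bar> \<le> K" using vb bb by blast+
  show wg: "has_weak_grad Q v (\<lambda>p. Gavg h p + space_grad \<psi> p)"
    unfolding v_def by (rule has_weak_grad_add[OF Q_open Gavg_props(3)[OF h] has_weak_grad_smooth[OF Q_open \<psi>_smooth]])
  have \<psi>lip: "\<bar>\<psi> (x, t) - \<psi> (y, t)\<bar> \<le> B3 * norm (x - y)" for x y t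
  proof -
    have "\<bar>frechet_derivative \<psi> (at p) (x - y, 0)\<bar> \<le> B3 * norm (x - y)" for p
      using Cauchy_Schwarz_ineq2[of "space_grad \<psi> p" "x - y"] mult_right_mono[OF B3(2)[of p] norm_ge_zero[of "x - y"]]
      by (simp add: space_grad_inner[OF \<psi>_smooth])
    from smooth_segment_bound[OF \<psi>_smooth this, of "(y, t)" 1] show ?thesis by simp
  qed
  show "v \<in> Kinf_bd \<Omega> (ereal \<tau>) u0"
    unfolding Kinf_bd_def Kinf_def cylinder_ereal
  proof (intro CollectI conjI)
    show "v \<in> Linf Q" unfolding Linf_def using vb borel_measurable_imp_lebesgue[OF vm]
      by (auto intro!: exI[of _ K])
    show "v \<in> C0_L2 \<Omega> (ereal \<tau>)" by (rule continuous_C0_L2[OF open_\<Omega> bounded_\<Omega> vc])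
    have "(\<lambda>p. Gavg h p + space_grad \<psi> p) \<in> Linf Q"
    proof -
      have [measurable]: "Gavg h \<in> borel_measurable borel" by (rule Gavg_props(1)[OF h])
      have m: "(\<lambda>p. Gavg h p + space_grad \<psi> p) \<in> borel_measurable borel" by measurable
      have "norm (Gavg h p + space_grad \<psi> p) \<le> B + B3" for p
        by (rule norm_triangle_le) (intro add_mono Gavg_props(2)[OF h] B3(2))
      then show ?thesis unfolding Linf_def using borel_measurable_imp_lebesgue[OF m] by (auto intro!: exI[of _ "B + B3"])
    qed
    with wg show "\<exists>g. has_weak_grad Q v g \<and> g \<in> Linf Q" by blast
    show "AE t in lebesgue_on (open_time (ereal \<tau>)). \<exists>w\<in>W1inf \<Omega>. (AE x in lebesgue_on \<Omega>. v (x, t) = w x) \<and> (\<forall>x\<in>frontier \<Omega>. w x = u0 x)"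
    proof (intro AE_I2 bexI[where x="\<lambda>x. v (x, t)" for t] conjI ballI)
      fix t x assume x: "x \<in> frontier \<Omega>"
      show "v (x, t) = u0 x" unfolding v_def \<psi>_end(2)[OF x] using tavg_const[OF h(1) U_frontier[OF x]] by simp
    next
      fix t
      have "(L + B3)-lipschitz_on (closure \<Omega>) (\<lambda>x. v (x, t))"
      proof (rule lipschitz_onI)
        fix x y
        have "\<bar>v (x, t) - v (y, t)\<bar> \<le> L * norm (x - y) + B3 * norm (x - y)"
          using tavg_lipschitz[OF h(1), of x t y] \<psi>lip[of x t y] unfolding v_def by linarith
        then show "dist (v (x, t)) (v (y, t)) \<le> (L + B3) * dist x y"
          by (simp add: dist_real_def dist_norm distrib_right)
      qed (use L_nonneg B3 in simp)
      then show "(\<lambda>x. v (x, t)) \<in> W1inf \<Omega>" by (auto simp: W1inf_def)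
    qed auto
  qed
  show "has_weak_dt Q v b"
  proof (rule has_weak_dt_classical[OF open_\<Omega> bounded_\<Omega> tau_pos vm bm vb bb])
    fix x t assume t: "t \<in> {0..\<tau>}"
    show "((\<lambda>t. v (x, t)) has_real_derivative b (x, t)) (at t within {0..\<tau>})"
      unfolding v_def b_def
      by (rule DERIV_add[OF tavg_deriv[where U=U, OF U_slice_cont h(1) t] has_field_derivative_at_within[OF time_deriv_eq(1)[OF \<psi>_smooth]]])
  next
    fix x
    have "continuous_on {0..\<tau>} (\<lambda>t. tavg h \<tau> U (x, t))"
      by (rule continuous_on_compose2[OF w(1)]) (auto intro!: continuous_intros)
    then show "continuous_on {0..\<tau>} (\<lambda>t. b (x, t))"
      unfolding b_def using h by (intro continuous_intros U_slice_cont \<psi>_slice_cont) auto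
  qed
  show "b \<in> L2 Q"
  proof -
    have m: "(\<lambda>p. (b p)\<^sup>2) \<in> borel_measurable borel" by measurable
    have "\<bar>(b p)\<^sup>2\<bar> \<le> K\<^sup>2" for p using bb[of p] by (simp add: abs_le_square_iff[symmetric])
    from bounded_on_Q(2)[OF m this] borel_measurable_imp_lebesgue[OF bm] show ?thesis by (simp add: L2_def)
  qed
qed

text \<open>For \<open>v = tavg h \<tau> U + \<psi>\<close> the contribution \<open>\<partial>\<^sub>t (tavg h \<tau> U) * (tavg h \<tau> U - U)\<close> equals
  \<open>- h (\<partial>\<^sub>t (tavg h \<tau> U))\<^sup>2\<close> and is dropped, as is the terminal term; what remains of
  \<open>\<partial>\<^sub>t v * (v - U)\<close> is integrated by parts in time.\<close>

lemma competitor_inequality: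
  assumes h: "0 < h" "h \<le> \<tau>"
  shows "(LINT p|lebesgue_on Q. f (snd p) (g p))
    \<le> - (LINT p|lborel. indicator Q p * (U p * time_deriv \<psi> p))
      + (LINT x|lborel. indicator \<Omega> x * ((tavg h \<tau> U (x, 0) - v0 x)\<^sup>2 / 2 - v0 x * \<psi> (x, 0)))
      + (LINT p|lebesgue_on Q. f (snd p) (Gavg h p + space_grad \<psi> p))"
proof -
  let ?w = "tavg h \<tau> U"
  define v where "v = (\<lambda>p. tavg h \<tau> U p + \<psi> p)"
  define b where "b = (\<lambda>p. (U p - tavg h \<tau> U p) / h + time_deriv \<psi> p)"
  have comp: "v \<in> Kinf_bd \<Omega> (ereal \<tau>) u0" "has_weak_grad Q v (\<lambda>p. Gavg h p + space_grad \<psi> p)"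
    "has_weak_dt Q v b" "b \<in> L2 Q"
    "b \<in> borel_measurable borel" "\<exists>K. \<forall>p. \<bar>b p\<bar> \<le> K" "v \<in> borel_measurable borel" "\<exists>K. \<forall>p. \<bar>v p\<bar> \<le> K"
    unfolding v_def b_def by (rule competitor[OF h])+
  obtain B1 where B1: "0 < B1" "\<And>p. \<bar>\<psi> p\<bar> \<le> B1" using test_functions_bounded[OF \<psi>] by blast
  obtain B2 where B2: "0 < B2" "\<And>p. \<bar>time_deriv \<psi> p\<bar> \<le> B2" using test_functions_bounded[OF time_deriv_test[OF \<psi>]] by blast
  obtain B3 where B3: "0 < B3" "\<And>p. norm (space_grad \<psi> p) \<le> B3" using space_grad_bounded[OF \<psi>] by blast
  obtain K1 where K1: "\<And>p. \<bar>b p\<bar> \<le> K1" using comp(6) by blast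
  obtain K2 where K2: "\<And>p. \<bar>v p\<bar> \<le> K2" using comp(8) by blast
  have w: "continuous_on UNIV ?w" "\<And>p. \<bar>?w p\<bar> \<le> B" using tavg_cont[OF h(1)] tavg_bound[OF h(1)] by auto
  have [measurable]: "?w \<in> borel_measurable borel" using w(1) by (rule borel_measurable_continuous_onI)
  have [measurable]: "b \<in> borel_measurable borel" "v \<in> borel_measurable borel" "Gavg h \<in> borel_measurable borel"
    using comp(5,7) Gavg_props(1)[OF h] by auto
  have v0m[measurable]: "v0 \<in> borel_measurable borel" using v0_cont by (rule borel_measurable_continuous_onI)
  have Ob: "\<Omega> \<in> sets borel" by (rule \<Omega>_borel)
  have gR: "norm (g p) < B + B3 + 1" for p using g_bound[of p] B3(1) by linarith
  have GR: "norm (Gavg h p + space_grad \<psi> p) < B + B3 + 1" for p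
  proof -
    have "norm (Gavg h p + space_grad \<psi> p) \<le> B + B3"
      by (rule norm_triangle_le) (intro add_mono Gavg_props(2)[OF h] B3(2))
    then show ?thesis by linarith
  qed
  have ig: "integrable (lebesgue_on Q) (\<lambda>p. f (snd p) (g p))" by (rule f_comp_integrable[OF g_borel gR])
  have iG: "integrable (lebesgue_on Q) (\<lambda>p. f (snd p) (Gavg h p + space_grad \<psi> p))"
    by (rule f_comp_integrable[OF _ GR]) measurable
  have main: "(LINT p|lebesgue_on Q. f (snd p) (weak_grad Q u p))
        \<le> (LINT p|lebesgue_on Q. weak_dt Q v p * (v p - u p) + f (snd p) (weak_grad Q v p))
          + 1/2 * (norm_L2 \<Omega> (\<lambda>x. v (x, 0) - u0 x))\<^sup>2
          - 1/2 * (norm_L2 \<Omega> (\<lambda>x. v (x, \<tau>) - u (x, \<tau>)))\<^sup>2"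
    using solution comp(1,3,4) unfolding variational_solution_finite_def Let_def cylinder_ereal by blast
  have l: "(LINT p|lebesgue_on Q. f (snd p) (weak_grad Q u p)) = (LINT p|lebesgue_on Q. f (snd p) (g p))"
  proof (rule lebesgue_on_AE_cong(2)[OF Q_lebesgue ig])
    show "AE p in lebesgue_on Q. f (snd p) (g p) = f (snd p) (weak_grad Q u p)"
      using weak_grad_AE(2)[OF Q_open u_grad] by eventually_elim simp
  qed
  have bvm: "(\<lambda>p. b p * (v p - U p)) \<in> borel_measurable borel" by measurable
  have bvb: "\<bar>b p * (v p - U p)\<bar> \<le> K1 * (K2 + B)" for p
  proof -
    have "\<bar>v p - U p\<bar> \<le> K2 + B" using K2[of p] U_bound[of p] by linarith
    then show ?thesis using mult_mono[OF K1[of p] _ order_trans[OF abs_ge_zero K1] abs_ge_zero] by (simp add: abs_mult)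
  qed
  note ibv = bounded_on_Q[OF bvm bvb]
  have r: "(LINT p|lebesgue_on Q. weak_dt Q v p * (v p - u p) + f (snd p) (weak_grad Q v p))
     = (LINT p|lebesgue_on Q. b p * (v p - U p) + f (snd p) (Gavg h p + space_grad \<psi> p))"
  proof (rule lebesgue_on_AE_cong(2)[OF Q_lebesgue Bochner_Integration.integrable_add[OF ibv(2) iG]])
    show "AE p in lebesgue_on Q. b p * (v p - U p) + f (snd p) (Gavg h p + space_grad \<psi> p) = weak_dt Q v p * (v p - u p) + f (snd p) (weak_grad Q v p)"
      using weak_grad_AE(2)[OF Q_open comp(2)] weak_dt_AE[OF Q_open comp(3)] u_AE by eventually_elim simp
  qed
  have r2: "\<dots> = (LINT p|lborel. indicator Q p * (b p * (v p - U p))) + (LINT p|lebesgue_on Q. f (snd p) (Gavg h p + space_grad \<psi> p))"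
    by (simp only: Bochner_Integration.integral_add[OF ibv(2) iG] ibv(3))
  \<comment> \<open>With w the average, (U - w) / h is its time derivative. Thus \<open>da\<close>
    is the derivative of w \<psi> plus that of \<psi>^2 / 2, the exact part of the product
    \<open>b * (v - U)\<close>; what is left is \<open>- U * time_deriv \<psi>\<close> and a
    nonpositive square.\<close>
  define a where "a p = ?w p * \<psi> p + (\<psi> p)\<^sup>2 / 2" for p
  define da where "da p = (U p - ?w p) / h * \<psi> p + ?w p * time_deriv \<psi> p + \<psi> p * time_deriv \<psi> p" for p
  have dam[measurable]: "da \<in> borel_measurable borel" unfolding da_def by measurable
  have wk: "\<bar>(U p - ?w p) / h\<bar> \<le> 2 * B / h" for p
  proof -
    have "\<bar>U p - ?w p\<bar> \<le> 2 * B" using w(2)[of p] U_bound[of p] by linarith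
    then show ?thesis using h by (simp add: divide_right_mono)
  qed
  have dab: "\<bar>da p\<bar> \<le> 2 * B / h * B1 + B * B2 + B1 * B2" for p
  proof -
    have "\<bar>(U p - ?w p) / h * \<psi> p\<bar> \<le> 2 * B / h * B1"
      unfolding abs_mult by (rule mult_mono[OF wk B1(2)]) (use B_nonneg h in auto)
    moreover have "\<bar>?w p * time_deriv \<psi> p\<bar> \<le> B * B2"
      unfolding abs_mult by (rule mult_mono[OF w(2) B2(2)]) (use B_nonneg in auto)
    moreover have "\<bar>\<psi> p * time_deriv \<psi> p\<bar> \<le> B1 * B2"
      unfolding abs_mult by (rule mult_mono[OF B1(2) B2(2)]) (use B1 in auto)
    ultimately show ?thesis unfolding da_def by linarith
  qed
  have parts: "(LINT p|lborel. indicator Q p * da p) = (LINT x|lborel. indicator \<Omega> x * (a (x, \<tau>) - a (x, 0)))"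
  proof (rule time_parts(1)[OF Ob bounded_\<Omega> tau_pos dam dab])
    fix x t assume t: "t \<in> {0..\<tau>}"
    have d\<psi>: "((\<lambda>t. \<psi> (x, t)) has_real_derivative time_deriv \<psi> (x, t)) (at t within {0..\<tau>})"
      by (rule has_field_derivative_at_within[OF time_deriv_eq(1)[OF \<psi>_smooth]])
    have dw: "((\<lambda>t. ?w (x, t)) has_real_derivative (U (x, t) - ?w (x, t)) / h) (at t within {0..\<tau>})"
      by (rule tavg_deriv[where U=U, OF U_slice_cont h(1) t])
    show "((\<lambda>t. a (x, t)) has_real_derivative da (x, t)) (at t within {0..\<tau>})"
      unfolding a_def da_def
      by (rule DERIV_cong[OF DERIV_add[OF DERIV_mult[OF dw d\<psi>] DERIV_cdivide[OF DERIV_power[OF d\<psi>, of 2], of 2]]])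
         (simp add: algebra_simps)
  next
    fix x
    have "continuous_on {0..\<tau>} (\<lambda>t. ?w (x, t))"
      by (rule continuous_on_compose2[OF w(1)]) (auto intro!: continuous_intros)
    then show "continuous_on {0..\<tau>} (\<lambda>t. da (x, t))"
      unfolding da_def using h by (intro continuous_intros U_slice_cont \<psi>_slice_cont) auto
  qed
  have pt: "b p * (v p - U p) \<le> da p - U p * time_deriv \<psi> p" for p
  proof -
    define d where "d = (U p - ?w p) / h"
    have Uw: "U p = ?w p + d * h" using h by (simp add: d_def)
    have "da p - U p * time_deriv \<psi> p - b p * (v p - U p) = d * d * h"
      unfolding da_def b_def v_def d_def[symmetric] by (subst (1 2) Uw) (simp add: algebra_simps)
    also have "\<dots> \<ge> 0" using h by simp
    finally show ?thesis by simp
  qed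
  have Utm: "(\<lambda>p. U p * time_deriv \<psi> p) \<in> borel_measurable borel" by measurable
  have Utb: "\<bar>U p * time_deriv \<psi> p\<bar> \<le> B * B2" for p
    unfolding abs_mult by (rule mult_mono[OF U_bound B2(2)]) (use B_nonneg in auto)
  note iUt = bounded_on_Q[OF Utm Utb] and ida = bounded_on_Q[OF dam dab]
  have "(LINT p|lborel. indicator Q p * (b p * (v p - U p))) \<le> (LINT p|lborel. indicator Q p * da p - indicator Q p * (U p * time_deriv \<psi> p))"
  proof (rule integral_mono[OF ibv(1) Bochner_Integration.integrable_diff[OF ida(1) iUt(1)]])
    fix p show "indicator Q p * (b p * (v p - U p)) \<le> indicator Q p * da p - indicator Q p * (U p * time_deriv \<psi> p)"
      using pt[of p] by (cases "p \<in> Q") auto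
  qed
  also have "\<dots> = (LINT p|lborel. indicator Q p * da p) - (LINT p|lborel. indicator Q p * (U p * time_deriv \<psi> p))"
    by (rule Bochner_Integration.integral_diff[OF ida(1) iUt(1)])
  finally have s1: "(LINT p|lborel. indicator Q p * (b p * (v p - U p)))
      \<le> (LINT x|lborel. indicator \<Omega> x * (a (x, \<tau>) - a (x, 0))) - (LINT p|lborel. indicator Q p * (U p * time_deriv \<psi> p))"
    unfolding parts .
  have a\<tau>: "a (x, \<tau>) = 0" for x by (simp add: a_def \<psi>_end)
  have xm: "(\<lambda>x. F (x, 0)) \<in> borel_measurable borel" if "F \<in> borel_measurable borel" for F :: "'a \<times> real \<Rightarrow> real"
    using that by measurable
  have cc: "compact (closure \<Omega>)" using bounded_\<Omega> by simp
  then obtain V where V: "\<And>x. x \<in> \<Omega> \<Longrightarrow> \<bar>v0 x\<bar> \<le> V"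
  proof -
    have "compact (v0 ` closure \<Omega>)" by (rule compact_continuous_image[OF continuous_on_subset[OF v0_cont] cc]) simp
    then obtain V where "\<forall>y\<in>v0 ` closure \<Omega>. norm y \<le> V" by (meson compact_imp_bounded bounded_iff)
    then have "\<bar>v0 x\<bar> \<le> V" if "x \<in> \<Omega>" for x using that closure_subset[of \<Omega>] by auto
    then show ?thesis using that by blast
  qed
  define n where "n x = (v (x, 0) - v0 x)\<^sup>2" for x
  have nm[measurable]: "n \<in> borel_measurable borel" unfolding n_def using xm[of v] by measurable
  have nb: "\<bar>n x\<bar> \<le> (K2 + V)\<^sup>2" if "x \<in> \<Omega>" for x
  proof -
    have "\<bar>v (x, 0) - v0 x\<bar> \<le> K2 + V" using K2[of "(x, 0)"] V[OF that] by linarith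
    then show ?thesis unfolding n_def by (simp add: abs_le_square_iff[symmetric])
  qed
  have N: "(norm_L2 \<Omega> (\<lambda>x. v (x, 0) - u0 x))\<^sup>2 = (LINT x|lborel. indicator \<Omega> x * n x)"
  proof -
    have "(norm_L2 \<Omega> (\<lambda>x. v (x, 0) - u0 x))\<^sup>2 = (LINT x|lebesgue_on \<Omega>. (v (x, 0) - u0 x)\<^sup>2)"
      by (simp add: norm_L2_def integral_nonneg_AE)
    also have "\<dots> = (LINT x|lebesgue_on \<Omega>. n x)"
      using v0_eq closure_subset[of \<Omega>] by (intro Bochner_Integration.integral_cong refl) (auto simp: n_def space_restrict_space)
    finally show ?thesis using LINT_lebesgue_on_borel[OF Ob nm] by simp
  qed
  have am: "(\<lambda>x. - a (x, 0)) \<in> borel_measurable borel"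
  proof -
    have "a \<in> borel_measurable borel" unfolding a_def by measurable
    from xm[OF this] show ?thesis by simp
  qed
  have ab: "\<bar>- a (x, 0)\<bar> \<le> B * B1 + B1\<^sup>2 / 2" for x
  proof -
    have "\<bar>?w (x, 0) * \<psi> (x, 0)\<bar> \<le> B * B1" unfolding abs_mult by (rule mult_mono[OF w(2) B1(2)]) (use B_nonneg in auto)
    moreover have "(\<psi> (x, 0))\<^sup>2 \<le> B1\<^sup>2" using B1(2)[of "(x, 0)"] B1(1) by (simp add: abs_le_square_iff[symmetric])
    ultimately show ?thesis unfolding a_def by (smt (verit) divide_right_mono zero_le_power2 divide_nonneg_pos)
  qed
  have i1: "integrable lborel (\<lambda>x. indicator \<Omega> x * (- a (x, 0)))" by (rule bounded_on_\<Omega>[OF am ab])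
  have i2: "integrable lborel (\<lambda>x. indicator \<Omega> x * n x / 2)" using bounded_on_\<Omega>[OF nm nb] by simp
  \<comment> \<open>The primitive at time zero meets the initial penalty: in (w + \<psi> - v0)^2 / 2
    - w \<psi> - \<psi>^2 / 2 everything cancels except (w - v0)^2 / 2 - v0 \<psi>.\<close>
  have "(LINT x|lborel. indicator \<Omega> x * (a (x, \<tau>) - a (x, 0))) + 1/2 * (LINT x|lborel. indicator \<Omega> x * n x)
     = (LINT x|lborel. indicator \<Omega> x * (- a (x, 0)) + indicator \<Omega> x * n x / 2)"
    by (subst Bochner_Integration.integral_add[OF i1 i2]) (simp add: a\<tau>)
  also have "\<dots> = (LINT x|lborel. indicator \<Omega> x * ((?w (x, 0) - v0 x)\<^sup>2 / 2 - v0 x * \<psi> (x, 0)))"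
    by (intro Bochner_Integration.integral_cong refl) (simp add: a_def n_def v_def power2_eq_square field_simps)
  finally have s2: "(LINT x|lborel. indicator \<Omega> x * (a (x, \<tau>) - a (x, 0))) + 1/2 * (LINT x|lborel. indicator \<Omega> x * n x)
     = (LINT x|lborel. indicator \<Omega> x * ((?w (x, 0) - v0 x)\<^sup>2 / 2 - v0 x * \<psi> (x, 0)))" .
  have "0 \<le> 1/2 * (norm_L2 \<Omega> (\<lambda>x. v (x, \<tau>) - u (x, \<tau>)))\<^sup>2" by simp
  then show ?thesis using main s1 s2 unfolding l r r2 N by linarith
qed

end

end

subsection \<open>Initial values and the weak equation\<close>

lemma test_functions_frechet_bound:
  fixes \<zeta> :: "'a::euclidean_space \<Rightarrow> real"
  assumes \<zeta>: "\<zeta> \<in> test_functions U"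
  obtains D where "0 < D" "\<And>x h. \<bar>frechet_derivative \<zeta> (at x) h\<bar> \<le> D * norm h"
proof -
  have "\<forall>b. \<exists>B>0. \<forall>x. \<bar>frechet_derivative \<zeta> (at x) b\<bar> \<le> B"
    using test_functions_bounded[OF test_functions_deriv[OF \<zeta>]] by metis
  then obtain B where B: "\<And>b x. 0 < B b \<and> \<bar>frechet_derivative \<zeta> (at x) b\<bar> \<le> B b" by metis
  have "\<bar>frechet_derivative \<zeta> (at x) h\<bar> \<le> sum B Basis * norm h" for x h
  proof -
    have lin: "linear (frechet_derivative \<zeta> (at x))"
      using has_derivative_linear[OF smooth_deriv(1)[OF test_functions_smooth[OF \<zeta>]]] .
    have "frechet_derivative \<zeta> (at x) h = frechet_derivative \<zeta> (at x) (\<Sum>b\<in>Basis. (h \<bullet> b) *\<^sub>R b)"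
      by (simp only: euclidean_representation)
    also have "\<dots> = (\<Sum>b\<in>Basis. (h \<bullet> b) * frechet_derivative \<zeta> (at x) b)"
      by (simp add: linear_sum[OF lin] linear_scale[OF lin])
    finally have "\<bar>frechet_derivative \<zeta> (at x) h\<bar> \<le> (\<Sum>b\<in>Basis. \<bar>(h \<bullet> b) * frechet_derivative \<zeta> (at x) b\<bar>)"
      using sum_abs by simp
    also have "\<dots> \<le> (\<Sum>b\<in>Basis. norm h * B b)"
      unfolding abs_mult using B by (intro sum_mono mult_mono Basis_le_norm) auto
    also have "\<dots> = sum B Basis * norm h" by (simp add: sum_distrib_left mult.commute)
    finally show ?thesis .
  qed
  moreover have "0 < sum B Basis" using B by (intro sum_pos) auto
  ultimately show ?thesis using that by blast
qed

section \<open>Removal of the averaging\<close>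

context slab
begin

text \<open>At time zero the average is the mean of \<open>U\<close> over \<open>[0, h]\<close>, a
  difference quotient of a primitive of \<open>U\<close>.\<close>

lemma tavg_initial_tendsto:
  assumes h: "\<And>n. 0 < h n" "\<And>n. h n \<le> \<tau>" "h \<longlonglongrightarrow> 0"
  shows "(\<lambda>n. tavg (h n) \<tau> U (x, 0)) \<longlonglongrightarrow> U (x, 0)"
proof -
  define A where "A t = integral {0..t} (\<lambda>s. U (x, s))" for t
  have "(A has_real_derivative U (x, 0)) (at 0 within {0..\<tau>})"
    unfolding A_def[abs_def] by (rule integral_has_real_derivative[OF U_slice_cont]) (use tau_pos in auto)
  then have "((\<lambda>t. (A t - A 0) / (t - 0)) \<longlongrightarrow> U (x, 0)) (at 0 within {0..\<tau>})"
    by (simp only: has_field_derivative_iff)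
  moreover have "filterlim h (at 0 within {0..\<tau>}) sequentially"
    unfolding filterlim_at using h by (auto simp: less_imp_le less_imp_neq[THEN not_sym] intro!: always_eventually)
  ultimately have "(\<lambda>n. (A (h n) - A 0) / (h n - 0)) \<longlonglongrightarrow> U (x, 0)" by (rule filterlim_compose)
  moreover have "(A (h n) - A 0) / (h n - 0) = tavg (h n) \<tau> U (x, 0)" for n
    using tavg_formula[of U x "h n" 0 \<tau>, OF U_slice_cont h(1)] tau_pos by (simp add: A_def)
  ultimately show ?thesis by simp
qed

lemma v0_bounded:
  obtains V where "0 \<le> V" "\<And>x. x \<in> \<Omega> \<Longrightarrow> \<bar>v0 x\<bar> \<le> V"
proof -
  have "compact (v0 ` closure \<Omega>)"
    using bounded_\<Omega> by (intro compact_continuous_image continuous_on_subset[OF v0_cont]) auto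
  then obtain V where V: "\<forall>y\<in>v0 ` closure \<Omega>. norm y \<le> V" by (meson compact_imp_bounded bounded_iff)
  have "\<bar>v0 x\<bar> \<le> \<bar>V\<bar>" if "x \<in> \<Omega>" for x
  proof -
    have "x \<in> closure \<Omega>" using that closure_subset by blast
    then have "norm (v0 x) \<le> V" using V by blast
    then show ?thesis by simp
  qed
  then show ?thesis using that[of "\<bar>V\<bar>"] by simp
qed

lemma v0_borel[measurable]: "v0 \<in> borel_measurable borel"
  using v0_cont by (rule borel_measurable_continuous_onI)

lemma U_slice_borel[measurable]: "(\<lambda>x. U (x, t)) \<in> borel_measurable borel"
  by measurable

text \<open>Two terms depend on \<open>h\<close>: the energy of the competitor, which converges by
  L1 convergence of the averaged gradients, and the initial term, which converges by dominated
  convergence.\<close>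

lemma limit_inequality:
  assumes \<psi>: "\<psi> \<in> test_functions (\<Omega> \<times> {..<\<tau>})"
  shows "(LINT p|lebesgue_on Q. f (snd p) (g p))
    \<le> - (LINT p|lborel. indicator Q p * (U p * time_deriv \<psi> p))
      + (LINT x|lborel. indicator \<Omega> x * ((U (x, 0) - v0 x)\<^sup>2 / 2 - v0 x * \<psi> (x, 0)))
      + (LINT p|lebesgue_on Q. f (snd p) (g p + space_grad \<psi> p))"
proof -
  define h where "h n = \<tau> / real (Suc n)" for n
  have h: "0 < h n" "h n \<le> \<tau>" for n using tau_pos by (simp_all add: h_def divide_le_eq)
  have h0: "h \<longlonglongrightarrow> 0"
    using tendsto_mult[OF tendsto_const[of \<tau>] LIMSEQ_Suc[OF lim_1_over_n]] by (simp add: h_def[abs_def])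
  obtain B1 where B1: "0 < B1" "\<And>p. \<bar>\<psi> p\<bar> \<le> B1" using test_functions_bounded[OF \<psi>] by blast
  obtain B3 where B3: "0 < B3" "\<And>p. norm (space_grad \<psi> p) \<le> B3" using space_grad_bounded[OF \<psi>] by blast
  obtain V where V: "0 \<le> V" "\<And>x. x \<in> \<Omega> \<Longrightarrow> \<bar>v0 x\<bar> \<le> V" by (rule v0_bounded) blast
  note [measurable] = \<psi>_borel[OF \<psi>]
  \<comment> \<open>The ball of this radius contains the gradient and its averages, also after the
    shift by \<open>space_grad \<psi>\<close>, so one Lipschitz constant serves for all
    \<open>n\<close>.\<close>
  define R where "R = B + B3 + 1"
  have R: "0 < R" using B_nonneg B3 by (simp add: R_def)
  obtain M where M: "0 < M" "AE t in lborel. t \<in> {0<..<\<tau>} \<longrightarrow> C1 (f t) \<and>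
    (\<forall>\<xi>\<in>ball 0 R. norm (grad (f t) \<xi>) \<le> M) \<and> (\<forall>\<xi>\<in>ball 0 R. \<forall>\<zeta>\<in>ball 0 R. \<bar>f t \<xi> - f t \<zeta>\<bar> \<le> M * norm (\<xi> - \<zeta>))"
    by (rule f_locally_lipschitz[OF R])
  have M': "AE t in lborel. t \<in> {0<..<\<tau>} \<longrightarrow> (\<forall>\<xi>\<in>ball 0 R. \<forall>\<zeta>\<in>ball 0 R. \<bar>f t \<xi> - f t \<zeta>\<bar> \<le> M * norm (\<xi> - \<zeta>))"
    using M(2) by eventually_elim blast
  have gR: "norm (k + space_grad \<psi> p) < R" if "norm k \<le> B" for k p
    using norm_triangle_le[OF add_mono[OF that B3(2)[of p]]] by (simp add: R_def)
  let ?P = "\<lambda>n. LINT p|lebesgue_on Q. f (snd p) (Gavg (h n) p + space_grad \<psi> p)"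
  let ?Plim = "LINT p|lebesgue_on Q. f (snd p) (g p + space_grad \<psi> p)"
  have P: "?P \<longlonglongrightarrow> ?Plim"
  proof -
    have k: "(\<lambda>n. M * (LINT p|lborel. indicator Q p * norm ((LINT s|lborel. kern (h n) (snd p) s *\<^sub>R g (fst p, s)) - g p))) \<longlonglongrightarrow> M * 0"
      by (intro tendsto_mult tendsto_const kern_L1_tendsto[OF \<Omega>_borel bounded_\<Omega> tau_pos h h0 g_borel g_bound])
    have "(\<lambda>n. ?P n - ?Plim) \<longlonglongrightarrow> 0"
    proof (rule Lim_null_comparison)
      show "\<forall>\<^sub>F n in sequentially. norm (?P n - ?Plim) \<le> M * (LINT p|lborel. indicator Q p * norm ((LINT s|lborel. kern (h n) (snd p) s *\<^sub>R g (fst p, s)) - g p))"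
      proof (intro always_eventually allI)
        fix n
        have [measurable]: "Gavg (h n) \<in> borel_measurable borel" by (rule Gavg_props(1)[OF h])
        have "\<bar>?P n - ?Plim\<bar> \<le> M * (LINT p|lborel. indicator Q p * norm ((Gavg (h n) p + space_grad \<psi> p) - (g p + space_grad \<psi> p)))"
          by (rule f_comp_diff[OF M' M(1)]) (use gR[OF Gavg_props(2)[OF h]] gR[OF g_bound] in \<open>auto intro: borel_measurable_add\<close>)
        also have "(LINT p|lborel. indicator Q p * norm ((Gavg (h n) p + space_grad \<psi> p) - (g p + space_grad \<psi> p)))
           = (LINT p|lborel. indicator Q p * norm ((LINT s|lborel. kern (h n) (snd p) s *\<^sub>R g (fst p, s)) - g p))"
        proof (intro Bochner_Integration.integral_cong refl)
          fix p show "indicator Q p * norm ((Gavg (h n) p + space_grad \<psi> p) - (g p + space_grad \<psi> p)) = indicator Q p * norm ((LINT s|lborel. kern (h n) (snd p) s *\<^sub>R g (fst p, s)) - g p)"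
            by (cases "p \<in> Q") (auto simp: Gavg_def)
        qed
        finally show "norm (?P n - ?Plim) \<le> M * (LINT p|lborel. indicator Q p * norm ((LINT s|lborel. kern (h n) (snd p) s *\<^sub>R g (fst p, s)) - g p))"
          by simp
      qed
    qed (use k in simp)
    then show ?thesis by (simp add: LIM_zero_iff)
  qed
  let ?S = "\<lambda>n. LINT x|lborel. indicator \<Omega> x * ((tavg (h n) \<tau> U (x, 0) - v0 x)\<^sup>2 / 2 - v0 x * \<psi> (x, 0))"
  let ?Slim = "LINT x|lborel. indicator \<Omega> x * ((U (x, 0) - v0 x)\<^sup>2 / 2 - v0 x * \<psi> (x, 0))"
  have S: "?S \<longlonglongrightarrow> ?Slim"
  proof (rule integral_dominated_convergence[where w="\<lambda>x. indicator \<Omega> x * ((B + V)\<^sup>2 / 2 + V * B1)"])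
    have xm[measurable]: "(\<lambda>x. \<psi> (x, 0)) \<in> borel_measurable borel" by measurable
    show "(\<lambda>x. indicator \<Omega> x * ((U (x, 0) - v0 x)\<^sup>2 / 2 - v0 x * \<psi> (x, 0))) \<in> borel_measurable lborel" by measurable
    show "(\<lambda>x. indicator \<Omega> x * ((tavg (h n) \<tau> U (x, 0) - v0 x)\<^sup>2 / 2 - v0 x * \<psi> (x, 0))) \<in> borel_measurable lborel" for n
    proof -
      have [measurable]: "tavg (h n) \<tau> U \<in> borel_measurable borel"
        by (rule borel_measurable_continuous_onI[OF tavg_cont[OF h(1)]])
      show ?thesis by measurable
    qed
    show "integrable lborel (\<lambda>x. indicator \<Omega> x * ((B + V)\<^sup>2 / 2 + V * B1))"
      by (rule bounded_on_\<Omega>[where K="(B + V)\<^sup>2 / 2 + V * B1"]) (use V B1 in auto)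
    show "AE x in lborel. (\<lambda>n. indicator \<Omega> x * ((tavg (h n) \<tau> U (x, 0) - v0 x)\<^sup>2 / 2 - v0 x * \<psi> (x, 0))) \<longlonglongrightarrow> indicator \<Omega> x * ((U (x, 0) - v0 x)\<^sup>2 / 2 - v0 x * \<psi> (x, 0))"
      by (intro AE_I2 tendsto_intros tavg_initial_tendsto h h0) auto
    show "AE x in lborel. norm (indicator \<Omega> x * ((tavg (h n) \<tau> U (x, 0) - v0 x)\<^sup>2 / 2 - v0 x * \<psi> (x, 0))) \<le> indicator \<Omega> x * ((B + V)\<^sup>2 / 2 + V * B1)" for n
    proof (intro AE_I2)
      fix x
      show "norm (indicator \<Omega> x * ((tavg (h n) \<tau> U (x, 0) - v0 x)\<^sup>2 / 2 - v0 x * \<psi> (x, 0))) \<le> indicator \<Omega> x * ((B + V)\<^sup>2 / 2 + V * B1)"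
      proof (cases "x \<in> \<Omega>")
        case True
        have "\<bar>tavg (h n) \<tau> U (x, 0) - v0 x\<bar> \<le> B + V" using tavg_bound[OF h(1)[of n], of "(x, 0)"] V(2)[OF True] by linarith
        then have "(tavg (h n) \<tau> U (x, 0) - v0 x)\<^sup>2 \<le> (B + V)\<^sup>2" by (simp add: abs_le_square_iff[symmetric])
        moreover have "\<bar>v0 x * \<psi> (x, 0)\<bar> \<le> V * B1" unfolding abs_mult by (rule mult_mono[OF V(2)[OF True] B1(2)]) (use V in auto)
        moreover have "0 \<le> (tavg (h n) \<tau> U (x, 0) - v0 x)\<^sup>2" by simp
        ultimately have "\<bar>(tavg (h n) \<tau> U (x, 0) - v0 x)\<^sup>2 / 2 - v0 x * \<psi> (x, 0)\<bar> \<le> (B + V)\<^sup>2 / 2 + V * B1" by linarith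
        then show ?thesis using True by simp
      qed simp
    qed
  qed
  have "(\<lambda>n. - (LINT p|lborel. indicator Q p * (U p * time_deriv \<psi> p)) + ?S n + ?P n) \<longlonglongrightarrow> - (LINT p|lborel. indicator Q p * (U p * time_deriv \<psi> p)) + ?Slim + ?Plim"
    by (intro tendsto_add tendsto_const S P)
  then show ?thesis
    by (rule LIMSEQ_le_const) (use competitor_inequality[OF \<psi> h] in blast)
qed

section \<open>Attainment of the initial values\<close>

text \<open>A bump centred at time zero and scaled to be one there. On nonnegative times it
  decreases from one to zero within \<open>\<delta>\<close>, so there its derivative has a sign and
  total integral minus one.\<close>

definition cutoff :: "real \<Rightarrow> real \<Rightarrow> real" where
  "cutoff \<delta> t = bump 0 \<delta> t / bump (0::real) \<delta> 0"

lemma cutoff_props: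
  assumes \<delta>: "0 < \<delta>" "\<delta> < \<tau>"
  shows "cutoff \<delta> \<in> test_functions {..<\<tau>}" "cutoff \<delta> 0 = 1" "0 \<le> cutoff \<delta> t" "cutoff \<delta> t \<le> 1"
    "\<delta> \<le> t \<Longrightarrow> cutoff \<delta> t = 0" "0 \<le> t \<Longrightarrow> deriv (cutoff \<delta>) t \<le> 0" "\<delta> \<le> t \<Longrightarrow> deriv (cutoff \<delta>) t = 0"
    "(cutoff \<delta> has_real_derivative deriv (cutoff \<delta>) t) (at t)"
proof -
  have p: "0 < bump (0::real) \<delta> 0" using bump_pos_iff[OF \<delta>(1), of "0::real" 0] \<delta> by simp
  have c: "cutoff \<delta> = (\<lambda>t. (1 / bump (0::real) \<delta> 0) * bump 0 \<delta> t)" by (simp add: cutoff_def fun_eq_iff)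
  show "cutoff \<delta> \<in> test_functions {..<\<tau>}" unfolding c
    using \<delta> by (intro test_functions_mult smooth_const bump_test) auto
  show "cutoff \<delta> 0 = 1" using p by (simp add: cutoff_def)
  show "0 \<le> cutoff \<delta> t" unfolding cutoff_def by (rule divide_nonneg_pos[OF bump_nonneg p])
  show z: "cutoff \<delta> t = 0" if "\<delta> \<le> t" for t
    using that \<delta> bump_eq_0_iff[OF \<delta>(1), of "0::real" t] by (simp add: cutoff_def)
  have "((\<lambda>t. exp_bump 0 (\<delta>\<^sup>2 - t\<^sup>2)) has_real_derivative exp_bump 2 (\<delta>\<^sup>2 - t\<^sup>2) * (- (2 * t))) (at t)" for t
  proof -
    have q: "((\<lambda>t. \<delta>\<^sup>2 - t\<^sup>2) has_real_derivative - (2 * t)) (at t)"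
      by (auto intro!: derivative_eq_intros)
    have "((\<lambda>t. exp_bump 0 (\<delta>\<^sup>2 - t\<^sup>2)) has_real_derivative
        (exp_bump (0 + 2) (\<delta>\<^sup>2 - t\<^sup>2) - real 0 * exp_bump (0 + 1) (\<delta>\<^sup>2 - t\<^sup>2)) * (- (2 * t))) (at t)"
      by (rule DERIV_chain2[where f="exp_bump 0" and g="\<lambda>t. \<delta>\<^sup>2 - t\<^sup>2", OF exp_bump_deriv q])
    then show ?thesis by (simp add: numeral_2_eq_2)
  qed
  then have "((\<lambda>t. (1 / bump (0::real) \<delta> 0) * exp_bump 0 (\<delta>\<^sup>2 - t\<^sup>2)) has_real_derivative (1 / bump (0::real) \<delta> 0) * (exp_bump 2 (\<delta>\<^sup>2 - t\<^sup>2) * (- (2 * t)))) (at t)" for t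
    by (rule DERIV_cmult)
  then have d: "(cutoff \<delta> has_real_derivative (1 / bump (0::real) \<delta> 0) * (exp_bump 2 (\<delta>\<^sup>2 - t\<^sup>2) * (- (2 * t)))) (at t)" for t
    unfolding c by (simp add: bump_def)
  then have dd: "deriv (cutoff \<delta>) t = (1 / bump (0::real) \<delta> 0) * (exp_bump 2 (\<delta>\<^sup>2 - t\<^sup>2) * (- (2 * t)))" for t
    by (rule DERIV_imp_deriv)
  show "(cutoff \<delta> has_real_derivative deriv (cutoff \<delta>) t) (at t)" unfolding dd by (rule d)
  have eb: "0 \<le> exp_bump 2 r" for r by (simp add: exp_bump_def)
  show "deriv (cutoff \<delta>) t \<le> 0" if "0 \<le> t"
    unfolding dd using that p eb by (intro mult_nonneg_nonpos mult_nonneg_nonpos) auto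
  show "deriv (cutoff \<delta>) t = 0" if "\<delta> \<le> t"
  proof -
    have "\<delta>\<^sup>2 \<le> t\<^sup>2" using that \<delta> by (intro power_mono) auto
    then show ?thesis unfolding dd by (simp add: exp_bump_def)
  qed
  have "bump (0::real) \<delta> t \<le> bump 0 \<delta> 0"
  proof (cases "t\<^sup>2 < \<delta>\<^sup>2")
    case True
    then have "1 / \<delta>\<^sup>2 \<le> 1 / (\<delta>\<^sup>2 - t\<^sup>2)" using \<delta> by (intro divide_left_mono) auto
    then show ?thesis using True \<delta> by (simp add: bump_def exp_bump_def)
  qed (use p in \<open>simp add: bump_def exp_bump_def\<close>)
  then show "cutoff \<delta> t \<le> 1" using p by (simp add: cutoff_def)
qed

text \<open>Inserting \<open>\<psi> = s \<zeta>(x) cutoff \<delta> t\<close> and letting \<open>\<delta> \<rightarrow> 0\<close> leaves \<open>0 \<le> s S + D0 / 2\<close> for every real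
  \<open>s\<close>, with \<open>S\<close> the integral below and \<open>D0\<close> independent of \<open>s\<close>.\<close>

lemma initial_values_test:
  assumes \<zeta>: "\<zeta> \<in> test_functions \<Omega>"
  shows "(LINT x|lborel. indicator \<Omega> x * (\<zeta> x * (U (x, 0) - v0 x))) = 0"
proof -
  define S where "S = (LINT x|lborel. indicator \<Omega> x * (\<zeta> x * (U (x, 0) - v0 x)))"
  define D0 where "D0 = (LINT x|lborel. indicator \<Omega> x * (U (x, 0) - v0 x)\<^sup>2)"
  obtain V where V: "0 \<le> V" "\<And>x. x \<in> \<Omega> \<Longrightarrow> \<bar>v0 x\<bar> \<le> V" by (rule v0_bounded) blast
  obtain Bz where Bz: "0 < Bz" "\<And>x. \<bar>\<zeta> x\<bar> \<le> Bz" using test_functions_bounded[OF \<zeta>] by blast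
  have [measurable]: "\<zeta> \<in> borel_measurable borel" using \<zeta> by (rule test_functions_borel)
  let ?m = "Sigma_Algebra.measure lborel \<Omega>"
  have ind: "integrable lborel (\<lambda>x. indicator \<Omega> x * k :: real)" "(LINT x|lborel. indicator \<Omega> x * k) = ?m * k" for k
    using emeasure_bounded_finite[OF bounded_\<Omega>] by (auto intro!: integrable_mult_left integrable_real_indicator)
  have key: "0 \<le> c * S + D0 / 2" for c
  proof (rule field_le_epsilon)
    fix e :: real assume e: "0 < e"
    define \<zeta>c where "\<zeta>c x = c * \<zeta> x" for x
    have \<zeta>c: "\<zeta>c \<in> test_functions \<Omega>" unfolding \<zeta>c_def[abs_def] by (rule test_functions_mult[OF \<zeta> smooth_const])
    have \<zeta>cm[measurable]: "\<zeta>c \<in> borel_measurable borel" using \<zeta>c by (rule test_functions_borel)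
    have Bc: "\<bar>\<zeta>c x\<bar> \<le> \<bar>c\<bar> * Bz" for x unfolding \<zeta>c_def abs_mult by (rule mult_left_mono[OF Bz(2)]) simp
    obtain D where D: "0 < D" "\<And>x h. \<bar>frechet_derivative \<zeta>c (at x) h\<bar> \<le> D * norm h"
      by (rule test_functions_frechet_bound[OF \<zeta>c]) blast
    define R where "R = B + D + 1"
    have R: "0 < R" using B_nonneg D by (simp add: R_def)
    obtain M where M: "0 < M" "AE t in lborel. t \<in> {0<..<\<tau>} \<longrightarrow> C1 (f t) \<and>
      (\<forall>\<xi>\<in>ball 0 R. norm (grad (f t) \<xi>) \<le> M) \<and> (\<forall>\<xi>\<in>ball 0 R. \<forall>\<zeta>\<in>ball 0 R. \<bar>f t \<xi> - f t \<zeta>\<bar> \<le> M * norm (\<xi> - \<zeta>))"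
      by (rule f_locally_lipschitz[OF R])
    have M': "AE t in lborel. t \<in> {0<..<\<tau>} \<longrightarrow> (\<forall>\<xi>\<in>ball 0 R. \<forall>\<zeta>\<in>ball 0 R. \<bar>f t \<xi> - f t \<zeta>\<bar> \<le> M * norm (\<xi> - \<zeta>))"
      using M(2) by eventually_elim blast
    \<comment> \<open>\<open>\<omega>\<close> bounds the oscillation of \<open>U\<close> near time
      zero, and \<open>\<delta>1\<close> below bounds the length of the time layer. They are chosen
      so that freezing \<open>U\<close> and adding the gradient of \<open>\<psi>\<close> cost at
      most \<open>e / 2\<close> each; the added one avoids a division by zero.\<close>
    define \<omega> where "\<omega> = e / (2 * (\<bar>c\<bar> * Bz * ?m + 1))"
    have q1: "0 < \<bar>c\<bar> * Bz * ?m + 1" using Bz by (intro add_nonneg_pos mult_nonneg_nonneg measure_nonneg) auto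
    have \<omega>: "0 < \<omega>" unfolding \<omega>_def by (intro divide_pos_pos mult_pos_pos e q1) simp
    have gen: "k * (e / (2 * (k + 1))) \<le> e / 2" if "0 \<le> k" for k
    proof -
      have "k / (k + 1) \<le> 1" using that by (simp add: pos_divide_le_eq)
      from mult_left_mono[OF this, of "e / 2"] e have "e / 2 * (k / (k + 1)) \<le> e / 2" by simp
      moreover have "k * (e / (2 * b)) = e / 2 * (k / b)" for b by (simp add: mult.commute)
      ultimately show ?thesis by (simp only:)
    qed
    have \<omega>2: "\<bar>c\<bar> * Bz * ?m * \<omega> \<le> e / 2"
      unfolding \<omega>_def by (rule gen) (use Bz in \<open>simp add: mult_nonneg_nonneg measure_nonneg\<close>)
    have "uniformly_continuous_on (closure \<Omega> \<times> {0..\<tau>}) U"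
      using bounded_\<Omega> by (intro compact_uniformly_continuous compact_Times continuous_on_subset[OF U_cont]) auto
    then obtain d where d: "0 < d" "\<And>p q. p \<in> closure \<Omega> \<times> {0..\<tau>} \<Longrightarrow> q \<in> closure \<Omega> \<times> {0..\<tau>} \<Longrightarrow> dist q p < d \<Longrightarrow> dist (U q) (U p) < \<omega>"
      using \<omega> unfolding uniformly_continuous_on_def by metis
    define \<delta>1 where "\<delta>1 = e / (2 * (M * D * ?m + 1))"
    have q2: "0 < M * D * ?m + 1" using M(1) D(1) by (intro add_nonneg_pos mult_nonneg_nonneg measure_nonneg) auto
    have \<delta>1: "0 < \<delta>1" unfolding \<delta>1_def by (intro divide_pos_pos mult_pos_pos e q2) simp
    define \<delta> where "\<delta> = min (d / 2) (min (\<tau> / 2) \<delta>1)"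
    have \<delta>: "0 < \<delta>" "\<delta> < \<tau>" "\<delta> < d" "\<delta> \<le> \<delta>1" using d \<delta>1 tau_pos by (auto simp: \<delta>_def)
    have \<delta>2: "M * D * ?m * \<delta> \<le> e / 2"
    proof -
      have n: "0 \<le> M * D * ?m" using M(1) D(1) by (intro mult_nonneg_nonneg measure_nonneg) auto
      have "M * D * ?m * \<delta> \<le> M * D * ?m * \<delta>1" by (rule mult_left_mono[OF \<delta>(4) n])
      also have "\<dots> \<le> e / 2" unfolding \<delta>1_def by (rule gen[OF n])
      finally show ?thesis .
    qed
    note cp = cutoff_props[OF \<delta>(1,2)]
    define \<psi> where "\<psi> = (\<lambda>p::'a \<times> real. \<zeta>c (fst p) * cutoff \<delta> (snd p))"
    have \<psi>: "\<psi> \<in> test_functions (\<Omega> \<times> {..<\<tau>})" unfolding \<psi>_def by (rule test_functions_tensor(1)[OF \<zeta>c cp(1)])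
    note [measurable] = \<psi>_borel[OF \<psi>]
    have \<psi>t: "time_deriv \<psi> (x, t) = \<zeta>c x * deriv (cutoff \<delta>) t" for x t
      unfolding time_deriv_eq(2)[OF test_functions_smooth[OF \<psi>]] unfolding \<psi>_def
      by (subst test_functions_tensor(2)[OF \<zeta>c cp(1)])
         (simp add: linear_0[OF has_derivative_linear[OF smooth_deriv(1)[OF test_functions_smooth[OF \<zeta>c]]]])
    have \<psi>g: "norm (space_grad \<psi> p) \<le> D * cutoff \<delta> (snd p)" for p
    proof -
      obtain x t where p: "p = (x, t)" by force
      let ?k = "space_grad \<psi> p"
      have "norm ?k * norm ?k = ?k \<bullet> ?k" by (simp add: power2_norm_eq_inner[symmetric] power2_eq_square)
      also have "\<dots> = frechet_derivative \<psi> (at (x, t)) (?k, 0)" by (simp add: space_grad_inner[OF test_functions_smooth[OF \<psi>]] p)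
      also have "\<dots> = frechet_derivative \<zeta>c (at x) ?k * cutoff \<delta> t"
        unfolding \<psi>_def by (subst test_functions_tensor(2)[OF \<zeta>c cp(1)]) simp
      also have "\<dots> \<le> (D * norm ?k) * cutoff \<delta> t"
        using D(2)[of x ?k] by (intro mult_right_mono cp(3)) linarith
      finally have "norm ?k * norm ?k \<le> (D * cutoff \<delta> t) * norm ?k" by (simp add: mult_ac)
      then have "norm ?k \<le> D * cutoff \<delta> t"
        using D(1) cp(3)[of t] by (cases "norm ?k = 0") auto
      then show ?thesis by (simp add: p)
    qed
    have \<psi>0: "\<psi> (x, 0) = \<zeta>c x" for x by (simp add: \<psi>_def cp(2))
    have gR: "norm (g p) < R" "norm (g p + space_grad \<psi> p) < R" for p
    proof -
      have "norm (space_grad \<psi> p) \<le> D" using order_trans[OF \<psi>g[of p] mult_left_le[OF cp(4)[of "snd p"] less_imp_le[OF D(1)]]] by simp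
      then show "norm (g p + space_grad \<psi> p) < R" using norm_triangle_le[OF add_mono[OF g_bound[of p]], of "space_grad \<psi> p" D] by (simp add: R_def)
      show "norm (g p) < R" using g_bound[of p] D(1) by (simp add: R_def)
    qed
    \<comment> \<open>The variation lives on a time layer of length \<open>\<delta>\<close> with
      gradient at most \<open>D\<close>, so it changes the energy by at most \<open>M * D\<close>
      times the measure of the layer.\<close>
    have fd: "(LINT p|lebesgue_on Q. f (snd p) (g p + space_grad \<psi> p)) - (LINT p|lebesgue_on Q. f (snd p) (g p)) \<le> e / 2"
    proof -
      have Db: "\<bar>indicator (\<Omega> \<times> {0<..<\<delta>}) p * D\<bar> \<le> D" for p :: "'a \<times> real" using D(1) by (auto split: split_indicator)
      have Qd[measurable]: "\<Omega> \<times> {0<..<\<delta>} \<in> sets borel" by (intro borel_Times) auto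
      have sg: "(\<lambda>p. norm (space_grad \<psi> p)) \<in> borel_measurable borel" by measurable
      have sgb: "\<bar>norm (space_grad \<psi> p)\<bar> \<le> D" for p
        using order_trans[OF \<psi>g[of p] mult_left_le[OF cp(4)[of "snd p"] less_imp_le[OF D(1)]]] by simp
      have tp: "(LINT p|lborel. indicator (\<Omega> \<times> {0<..<\<delta>}) p * D) = (LINT x|lborel. indicator \<Omega> x * (D * \<delta> - D * 0))"
        "integrable lborel (\<lambda>p. indicator (\<Omega> \<times> {0<..<\<delta>}) p * D)"
        using time_parts[OF \<Omega>_borel bounded_\<Omega> \<delta>(1), of "\<lambda>_. D" D "\<lambda>p. D * snd p"] D(1)
        by (auto intro!: derivative_eq_intros continuous_intros)
      have "(LINT p|lebesgue_on Q. f (snd p) (g p + space_grad \<psi> p)) - (LINT p|lebesgue_on Q. f (snd p) (g p))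
         \<le> M * (LINT p|lborel. indicator Q p * norm ((g p + space_grad \<psi> p) - g p))"
        by (rule order_trans[OF abs_ge_self f_comp_diff[OF M' M(1)]]) (use gR in auto)
      also have "(LINT p|lborel. indicator Q p * norm ((g p + space_grad \<psi> p) - g p)) = (LINT p|lborel. indicator Q p * norm (space_grad \<psi> p))" by simp
      also have "\<dots> \<le> (LINT p|lborel. indicator (\<Omega> \<times> {0<..<\<delta>}) p * D)"
      proof (rule integral_mono[OF bounded_on_Q(1)[OF sg sgb] tp(2)])
        fix p
        show "indicator Q p * norm (space_grad \<psi> p) \<le> indicator (\<Omega> \<times> {0<..<\<delta>}) p * D"
        proof (cases "p \<in> \<Omega> \<times> {0<..<\<delta>}")
          case True
          then show ?thesis using sgb[of p] D(1) by (auto split: split_indicator)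
        next
          case False
          show ?thesis
          proof (cases "p \<in> Q")
            case True
            then have "\<delta> \<le> snd p" using False by (cases p) auto
            then show ?thesis using \<psi>g[of p] cp(5) False by simp
          qed (use False in simp)
        qed
      qed
      also have "\<dots> = ?m * (D * \<delta>)" unfolding tp(1) using ind(2)[of "D * \<delta>"] by simp
      also have "M * (?m * (D * \<delta>)) = M * D * ?m * \<delta>" by simp
      finally show ?thesis using \<delta>2 M(1) by (simp add: mult_left_mono)
    qed
    \<comment> \<open>Once \<open>U\<close> is frozen at time zero, the integral against the
      derivative of the cutoff is exact and gives minus the initial value.\<close>
    define U0 where "U0 p = U (fst p, 0::real)" for p :: "'a \<times> real"
    have U0m[measurable]: "U0 \<in> borel_measurable borel" unfolding U0_def by measurable
    obtain B2 where B2: "0 < B2" "\<And>p. \<bar>time_deriv \<psi> p\<bar> \<le> B2" using test_functions_bounded[OF time_deriv_test[OF \<psi>]] by blast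
    have m1: "(\<lambda>p. U p * time_deriv \<psi> p) \<in> borel_measurable borel" "(\<lambda>p. U0 p * time_deriv \<psi> p) \<in> borel_measurable borel" by measurable
    have b1: "\<bar>U p * time_deriv \<psi> p\<bar> \<le> B * B2" "\<bar>U0 p * time_deriv \<psi> p\<bar> \<le> B * B2" for p
      unfolding abs_mult U0_def by (rule mult_mono[OF U_bound B2(2)]; use B_nonneg in auto)+
    note i1 = bounded_on_Q[OF m1(1) b1(1)] and i2 = bounded_on_Q[OF m1(2) b1(2)]
    have cds: "continuous_on S' (\<lambda>t. deriv (cutoff \<delta>) t)" for S'
    proof -
      have "deriv (cutoff \<delta>) t = frechet_derivative (cutoff \<delta>) (at t) 1" for t
        using frechet_derivative_at[OF cp(8)[of t, unfolded has_field_derivative_def], symmetric] by simp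
      then show ?thesis using smooth_continuous[OF smooth_deriv(2)[OF test_functions_smooth[OF cp(1)], of 1], of S'] by simp
    qed
    have dm[measurable]: "deriv (cutoff \<delta>) \<in> borel_measurable borel" using cds by (rule borel_measurable_continuous_onI)
    have tp0: "(LINT p|lborel. indicator Q p * (U0 p * time_deriv \<psi> p)) = (LINT x|lborel. indicator \<Omega> x * (U (x, 0) * \<psi> (x, \<tau>) - U (x, 0) * \<psi> (x, 0)))"
    proof -
      have "(LINT p|lborel. indicator Q p * (U0 p * time_deriv \<psi> p)) = (LINT x|lborel. indicator \<Omega> x * (U0 (x, \<tau>) * \<psi> (x, \<tau>) - U0 (x, 0) * \<psi> (x, 0)))"
      proof (rule time_parts(1)[OF \<Omega>_borel bounded_\<Omega> tau_pos m1(2) b1(2), where a="\<lambda>p. U0 p * \<psi> p"])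
        fix x t
        show "((\<lambda>t. U0 (x, t) * \<psi> (x, t)) has_real_derivative U0 (x, t) * time_deriv \<psi> (x, t)) (at t within {0..\<tau>})"
          unfolding U0_def fst_conv
          by (rule DERIV_cmult[OF has_field_derivative_at_within[OF time_deriv_eq(1)[OF test_functions_smooth[OF \<psi>]]]])
        show "continuous_on {0..\<tau>} (\<lambda>t. U0 (x, t) * time_deriv \<psi> (x, t))"
          unfolding U0_def fst_conv by (intro continuous_intros \<psi>_slice_cont[OF \<psi>])
      qed
      then show ?thesis by (simp add: U0_def)
    qed
    \<comment> \<open>This bounds the error of freezing. The derivative of the cutoff is
      nonpositive, so its absolute integral stays one however small \<open>\<delta>\<close> is, and
      the oscillation \<open>\<omega>\<close> alone makes \<open>E\<close> small.\<close>
    define E where "E = (LINT p|lborel. indicator Q p * (- (\<omega> * (\<bar>c\<bar> * Bz) * deriv (cutoff \<delta>) (snd p))))"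
    have tpE: "E = (LINT x|lborel. indicator \<Omega> x * (- (\<omega> * (\<bar>c\<bar> * Bz) * cutoff \<delta> \<tau>) - (- (\<omega> * (\<bar>c\<bar> * Bz) * cutoff \<delta> 0))))"
      and iE: "integrable lborel (\<lambda>p. indicator Q p * (- (\<omega> * (\<bar>c\<bar> * Bz) * deriv (cutoff \<delta>) (snd p))))"
    proof -
      have em: "(\<lambda>p::'a \<times> real. - (\<omega> * (\<bar>c\<bar> * Bz) * deriv (cutoff \<delta>) (snd p))) \<in> borel_measurable borel"
        using measurable_compose[OF borel_measurable_fst_snd(2) dm] by measurable
      have "compact (deriv (cutoff \<delta>) ` {0..\<tau>})" by (intro compact_continuous_image cds) auto
      then obtain Bd where "\<forall>y\<in>deriv (cutoff \<delta>) ` {0..\<tau>}. norm y \<le> Bd" by (meson compact_imp_bounded bounded_iff)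
      then have Bd: "\<bar>deriv (cutoff \<delta>) t\<bar> \<le> Bd" if "t \<in> {0..\<tau>}" for t using that by simp
      have eb: "\<bar>- (\<omega> * (\<bar>c\<bar> * Bz) * deriv (cutoff \<delta>) (snd (x :: 'a, t)))\<bar> \<le> \<omega> * (\<bar>c\<bar> * Bz) * Bd" if "t \<in> {0..\<tau>}" for x t
        using mult_left_mono[OF Bd[OF that], of "\<omega> * (\<bar>c\<bar> * Bz)"] \<omega> Bz by (simp add: abs_mult)
      have ed: "((\<lambda>t. - (\<omega> * (\<bar>c\<bar> * Bz) * cutoff \<delta> (snd (x :: 'a, t)))) has_real_derivative - (\<omega> * (\<bar>c\<bar> * Bz) * deriv (cutoff \<delta>) (snd (x, t)))) (at t within {0..\<tau>})" for x t
        unfolding snd_conv by (intro DERIV_minus DERIV_cmult has_field_derivative_at_within[OF cp(8)])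
      have ec: "continuous_on {0..\<tau>} (\<lambda>t. - (\<omega> * (\<bar>c\<bar> * Bz) * deriv (cutoff \<delta>) (snd (x :: 'a, t))))" for x
        unfolding snd_conv by (intro continuous_intros cds)
      note tt = time_parts[OF \<Omega>_borel bounded_\<Omega> tau_pos em eb ed ec]
      show "E = (LINT x|lborel. indicator \<Omega> x * (- (\<omega> * (\<bar>c\<bar> * Bz) * cutoff \<delta> \<tau>) - (- (\<omega> * (\<bar>c\<bar> * Bz) * cutoff \<delta> 0))))"
        unfolding E_def using tt(1) by simp
      show "integrable lborel (\<lambda>p. indicator Q p * (- (\<omega> * (\<bar>c\<bar> * Bz) * deriv (cutoff \<delta>) (snd p))))"
        using tt(2) .
    qed
    have E2: "E \<le> e / 2"
    proof -
      have "E = ?m * (\<omega> * (\<bar>c\<bar> * Bz))"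
        unfolding tpE using ind(2)[of "\<omega> * (\<bar>c\<bar> * Bz)"] cp(2) cp(5)[of \<tau>] \<delta>(2) by simp
      also have "\<dots> = \<bar>c\<bar> * Bz * ?m * \<omega>" by simp
      finally show ?thesis using \<omega>2 by simp
    qed
    have ud: "- (LINT p|lborel. indicator Q p * (U p * time_deriv \<psi> p)) \<le> - (LINT p|lborel. indicator Q p * (U0 p * time_deriv \<psi> p)) + E"
    proof -
      have "(LINT p|lborel. indicator Q p * (U0 p * time_deriv \<psi> p)) - (LINT p|lborel. indicator Q p * (U p * time_deriv \<psi> p))
         = (LINT p|lborel. indicator Q p * (U0 p * time_deriv \<psi> p) - indicator Q p * (U p * time_deriv \<psi> p))"
        by (rule Bochner_Integration.integral_diff[symmetric, OF i2(1) i1(1)])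
      also have "\<dots> \<le> E"
        unfolding E_def
      proof (rule integral_mono[OF Bochner_Integration.integrable_diff[OF i2(1) i1(1)] iE])
        fix p :: "'a \<times> real"
        obtain x t where p: "p = (x, t)" by force
        show "indicator Q p * (U0 p * time_deriv \<psi> p) - indicator Q p * (U p * time_deriv \<psi> p) \<le> indicator Q p * (- (\<omega> * (\<bar>c\<bar> * Bz) * deriv (cutoff \<delta>) (snd p)))"
        proof (cases "p \<in> Q")
          case True
          then have xt: "x \<in> \<Omega>" "0 < t" "t < \<tau>" by (auto simp: p)
          have dn: "deriv (cutoff \<delta>) t \<le> 0" using cp(6)[of t] xt by simp
          have "U0 p * time_deriv \<psi> p - U p * time_deriv \<psi> p = (U (x, 0) - U (x, t)) * \<zeta>c x * deriv (cutoff \<delta>) t"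
            by (simp add: p U0_def \<psi>t algebra_simps)
          also have "\<dots> \<le> \<bar>U (x, 0) - U (x, t)\<bar> * \<bar>\<zeta>c x\<bar> * \<bar>deriv (cutoff \<delta>) t\<bar>"
            by (metis abs_ge_self abs_mult)
          also have "\<dots> \<le> \<omega> * (\<bar>c\<bar> * Bz) * \<bar>deriv (cutoff \<delta>) t\<bar>"
          proof (cases "t < \<delta>")
            case True
            have "dist (U (x, 0)) (U (x, t)) < \<omega>"
              using xt True \<delta> closure_subset[of \<Omega>] by (intro d(2)) (auto simp: dist_Pair_Pair dist_real_def)
            then have "\<bar>U (x, 0) - U (x, t)\<bar> \<le> \<omega>" by (simp add: dist_real_def)
            then show ?thesis using Bc[of x] \<omega> by (intro mult_right_mono mult_mono) auto
          qed (simp add: cp(7))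
          also have "\<bar>deriv (cutoff \<delta>) t\<bar> = - deriv (cutoff \<delta>) t" using dn by simp
          finally show ?thesis using True by (simp add: p)
        qed simp
      qed
      finally show ?thesis by simp
    qed
    have x0: "(\<lambda>x. - (U (x, 0) * \<psi> (x, 0))) \<in> borel_measurable borel" "(\<lambda>x. (U (x, 0) - v0 x)\<^sup>2 / 2 - v0 x * \<psi> (x, 0)) \<in> borel_measurable borel" by measurable
    have xb1: "\<bar>- (U (x, 0) * \<psi> (x, 0))\<bar> \<le> B * (\<bar>c\<bar> * Bz)" for x
      unfolding abs_minus_cancel abs_mult \<psi>0 by (rule mult_mono[OF U_bound Bc]) (use B_nonneg in auto)
    have Dm: "(\<lambda>x. (U (x, 0) - v0 x)\<^sup>2) \<in> borel_measurable borel" "(\<lambda>x. \<zeta> x * (U (x, 0) - v0 x)) \<in> borel_measurable borel" by measurable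
    have uv: "\<bar>U (x, 0) - v0 x\<bar> \<le> B + V" if "x \<in> \<Omega>" for x using U_bound[of "(x, 0)"] V(2)[OF that] by linarith
    have Db: "\<bar>(U (x, 0) - v0 x)\<^sup>2\<bar> \<le> (B + V)\<^sup>2" if "x \<in> \<Omega>" for x
      using uv[OF that] by (simp add: abs_le_square_iff[symmetric])
    have Sb: "\<bar>\<zeta> x * (U (x, 0) - v0 x)\<bar> \<le> Bz * (B + V)" if "x \<in> \<Omega>" for x
      unfolding abs_mult by (rule mult_mono[OF Bz(2) uv[OF that]]) (use Bz in auto)
    have xb2: "\<bar>(U (x, 0) - v0 x)\<^sup>2 / 2 - v0 x * \<psi> (x, 0)\<bar> \<le> (B + V)\<^sup>2 + V * (\<bar>c\<bar> * Bz)" if "x \<in> \<Omega>" for x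
    proof -
      have "\<bar>v0 x * \<psi> (x, 0)\<bar> \<le> V * (\<bar>c\<bar> * Bz)" unfolding abs_mult \<psi>0 by (rule mult_mono[OF V(2)[OF that] Bc]) (use V in auto)
      moreover have "0 \<le> (U (x, 0) - v0 x)\<^sup>2" by simp
      ultimately show ?thesis using Db[OF that] by linarith
    qed
    note j1 = bounded_on_\<Omega>[OF x0(1) xb1] and j2 = bounded_on_\<Omega>[OF x0(2) xb2]
      and jD = bounded_on_\<Omega>[OF Dm(1) Db] and jS = bounded_on_\<Omega>[OF Dm(2) Sb]
    have fin: "- (LINT x|lborel. indicator \<Omega> x * (U (x, 0) * \<psi> (x, \<tau>) - U (x, 0) * \<psi> (x, 0)))
        + (LINT x|lborel. indicator \<Omega> x * ((U (x, 0) - v0 x)\<^sup>2 / 2 - v0 x * \<psi> (x, 0))) = c * S + D0 / 2"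
    proof -
      have "(LINT x|lborel. indicator \<Omega> x * (U (x, 0) * \<psi> (x, \<tau>) - U (x, 0) * \<psi> (x, 0))) = (LINT x|lborel. indicator \<Omega> x * (- (U (x, 0) * \<psi> (x, 0))))"
        by (simp add: \<psi>_end(1)[OF \<psi>])
      then have "- (LINT x|lborel. indicator \<Omega> x * (U (x, 0) * \<psi> (x, \<tau>) - U (x, 0) * \<psi> (x, 0)))
        + (LINT x|lborel. indicator \<Omega> x * ((U (x, 0) - v0 x)\<^sup>2 / 2 - v0 x * \<psi> (x, 0)))
        = (LINT x|lborel. indicator \<Omega> x * ((U (x, 0) - v0 x)\<^sup>2 / 2 - v0 x * \<psi> (x, 0)) - indicator \<Omega> x * (- (U (x, 0) * \<psi> (x, 0))))"
        by (simp only: Bochner_Integration.integral_diff[OF j2 j1])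
      also have "\<dots> = (LINT x|lborel. c * (indicator \<Omega> x * (\<zeta> x * (U (x, 0) - v0 x))) + indicator \<Omega> x * (U (x, 0) - v0 x)\<^sup>2 / 2)"
        by (intro Bochner_Integration.integral_cong refl) (simp add: \<psi>0 \<zeta>c_def algebra_simps)
      also have "\<dots> = c * S + D0 / 2"
        unfolding S_def D0_def using jS jD by (subst Bochner_Integration.integral_add) auto
      finally show ?thesis .
    qed
    show "0 \<le> c * S + D0 / 2 + e"
      using limit_inequality[OF \<psi>] fd ud E2 fin unfolding tp0 by linarith
  qed
  \<comment> \<open>An affine function of \<open>c\<close> that is bounded below on the whole line
    has slope zero.\<close>
  have "S = 0"
  proof (rule ccontr)
    assume "S \<noteq> 0"
    then have "- ((D0 / 2 + 1) / S) * S + D0 / 2 = -1" by simp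
    then show False using key[of "- ((D0 / 2 + 1) / S)"] by simp
  qed
  then show ?thesis by (simp add: S_def)
qed

lemma initial_values:
  shows "AE x in lborel. x \<in> \<Omega> \<longrightarrow> U (x, 0) = v0 x"
    "(LINT x|lborel. indicator \<Omega> x * (U (x, 0) - v0 x)\<^sup>2) = 0"
proof -
  have Ol: "\<Omega> \<in> sets lebesgue" using open_\<Omega> by (simp add: borel_open)
  have "AE x in lebesgue_on \<Omega>. U (x, 0) - v0 x = 0"
  proof (rule fundamental_lemma[OF open_\<Omega>])
    show "locally_integrable \<Omega> (\<lambda>x. U (x, 0) - v0 x)"
      by (rule locally_integrable_continuous)
         (intro continuous_on_diff v0_cont continuous_on_compose2[OF U_cont] continuous_intros, auto)
    fix \<zeta> assume \<zeta>: "\<zeta> \<in> test_functions \<Omega>"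
    have [measurable]: "\<zeta> \<in> borel_measurable borel" using \<zeta> by (rule test_functions_borel)
    have m: "(\<lambda>x. \<zeta> x * (U (x, 0) - v0 x)) \<in> borel_measurable borel" by measurable
    show "(LINT x|lebesgue_on \<Omega>. \<zeta> x * (U (x, 0) - v0 x)) = 0"
      using initial_values_test[OF \<zeta>] LINT_lebesgue_on_borel[OF \<Omega>_borel m] by simp
  qed
  then show ae: "AE x in lborel. x \<in> \<Omega> \<longrightarrow> U (x, 0) = v0 x"
    unfolding AE_lebesgue_on_iff[OF Ol] by eventually_elim simp
  have "(LINT x|lborel. indicator \<Omega> x * (U (x, 0) - v0 x)\<^sup>2) = (LINT x|(lborel :: 'a measure). (0::real))"
    by (rule integral_cong_AE, measurable) (use ae in eventually_elim, auto split: split_indicator)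
  then show "(LINT x|lborel. indicator \<Omega> x * (U (x, 0) - v0 x)\<^sup>2) = 0" by simp
qed

end

section \<open>First variation and moments in time\<close>

lemma scaled_test_function:
  fixes \<phi> :: "'a::euclidean_space \<times> real \<Rightarrow> real"
  assumes "smooth \<phi>"
  shows "space_grad (\<lambda>p. s * \<phi> p) p = s *\<^sub>R space_grad \<phi> p" "time_deriv (\<lambda>p. s * \<phi> p) p = s * time_deriv \<phi> p"
proof -
  have sm: "smooth (\<lambda>p. s * \<phi> p)" by (intro smooth_mult smooth_const assms)
  have d: "frechet_derivative (\<lambda>p. s * \<phi> p) (at p) h = s * frechet_derivative \<phi> (at p) h" for h
    using frechet_mult[OF smooth_const[of s] assms, of p h] by simp
  have "space_grad (\<lambda>p. s * \<phi> p) p \<bullet> h = (s *\<^sub>R space_grad \<phi> p) \<bullet> h" for h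
    by (simp add: space_grad_inner[OF sm] space_grad_inner[OF assms] d)
  then show "space_grad (\<lambda>p. s * \<phi> p) p = s *\<^sub>R space_grad \<phi> p" using vector_eq_rdot by blast
  show "time_deriv (\<lambda>p. s * \<phi> p) p = s * time_deriv \<phi> p"
    by (simp add: time_deriv_eq(2)[OF sm] time_deriv_eq(2)[OF assms] d)
qed

context slab
begin

text \<open>For every real \<open>s\<close> the energy change under the shift by
  \<open>s * \<phi>\<close> is at least \<open>s\<close> times the integral of
  \<open>U * time_deriv \<phi>\<close>. Dividing by positive and by negative \<open>s\<close> gives
  opposite inequalities, which meet in the limit because \<open>f t\<close> is
  differentiable.\<close>

lemma weak_equation:
  assumes \<phi>: "\<phi> \<in> test_functions Q"
  shows "integrable (lebesgue_on Q) (\<lambda>p. grad (f (snd p)) (g p) \<bullet> space_grad \<phi> p)"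
    "(LINT p|lebesgue_on Q. U p * time_deriv \<phi> p) = (LINT p|lebesgue_on Q. grad (f (snd p)) (g p) \<bullet> space_grad \<phi> p)"
    "integrable (lebesgue_on Q) (\<lambda>p. U p * time_deriv \<phi> p)"
proof -
  have sm: "smooth \<phi>" using \<phi> by (rule test_functions_smooth)
  have \<phi>': "\<phi> \<in> test_functions (\<Omega> \<times> {..<\<tau>})" by (rule test_functions_mono[OF \<phi>]) auto
  note [measurable] = \<psi>_borel[OF \<phi>']
  obtain B2 where B2: "0 < B2" "\<And>p. \<bar>time_deriv \<phi> p\<bar> \<le> B2" using test_functions_bounded[OF time_deriv_test[OF \<phi>]] by blast
  obtain B3 where B3: "0 < B3" "\<And>p. norm (space_grad \<phi> p) \<le> B3" using space_grad_bounded[OF \<phi>] by blast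
  have m: "(\<lambda>p. U p * time_deriv \<phi> p) \<in> borel_measurable borel" by measurable
  have mb: "\<bar>U p * time_deriv \<phi> p\<bar> \<le> B * B2" for p unfolding abs_mult by (rule mult_mono[OF U_bound B2(2)]) (use B_nonneg in auto)
  note iU = bounded_on_Q[OF m mb]
  show "integrable (lebesgue_on Q) (\<lambda>p. U p * time_deriv \<phi> p)" by (rule iU)
  define X where "X = (LINT p|lebesgue_on Q. U p * time_deriv \<phi> p)"
  define R where "R = B + B3 + 1"
  have R: "0 < R" using B_nonneg B3 by (simp add: R_def)
  obtain M where M: "0 < M" "AE t in lborel. t \<in> {0<..<\<tau>} \<longrightarrow> C1 (f t) \<and>
    (\<forall>\<xi>\<in>ball 0 R. norm (grad (f t) \<xi>) \<le> M) \<and> (\<forall>\<xi>\<in>ball 0 R. \<forall>\<zeta>\<in>ball 0 R. \<bar>f t \<xi> - f t \<zeta>\<bar> \<le> M * norm (\<xi> - \<zeta>))"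
    by (rule f_locally_lipschitz[OF R])
  define E where "E s p = (f (snd p) (g p + s *\<^sub>R space_grad \<phi> p) - f (snd p) (g p)) / s" for s p
  have gR: "norm (g p) < R" "\<bar>s\<bar> \<le> 1 \<Longrightarrow> norm (g p + s *\<^sub>R space_grad \<phi> p) < R" for s p
  proof -
    show "norm (g p) < R" using g_bound[of p] B3(1) by (simp add: R_def)
    assume s: "\<bar>s\<bar> \<le> 1"
    have "norm (s *\<^sub>R space_grad \<phi> p) \<le> 1 * B3" unfolding norm_scaleR by (rule mult_mono[OF s B3(2)]) auto
    then have "norm (g p + s *\<^sub>R space_grad \<phi> p) \<le> B + 1 * B3" by (intro norm_triangle_le add_mono g_bound)
    then show "norm (g p + s *\<^sub>R space_grad \<phi> p) < R" by (simp add: R_def)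
  qed
  \<comment> \<open>Clamping \<open>s\<close> to [-1, 1] makes the bound by \<open>R\<close> hold
    for all \<open>s\<close>, as the integrability result expects.\<close>
  define H where "H s p = g p + (max (-1) (min 1 s)) *\<^sub>R space_grad \<phi> p" for s p
  have Hs: "H s = (\<lambda>p. g p + s *\<^sub>R space_grad \<phi> p)" if "\<bar>s\<bar> \<le> 1" for s using that by (auto simp: H_def fun_eq_iff)
  have HR: "norm (H s p) < R" for s p unfolding H_def by (rule gR(2)) auto
  have Hm: "H s \<in> borel_measurable borel" for s unfolding H_def[abs_def] by measurable
  note i0 = f_comp_integrable[OF g_borel gR(1)]
  have i1: "integrable (lebesgue_on Q) (\<lambda>p. f (snd p) (g p + s *\<^sub>R space_grad \<phi> p))" if "\<bar>s\<bar> \<le> 1" for s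
    using f_comp_integrable[OF Hm HR, of s] unfolding Hs[OF that] .
  have iE: "integrable (lebesgue_on Q) (E s)" if "\<bar>s\<bar> \<le> 1" for s
    unfolding E_def[abs_def] by (intro integrable_divide Bochner_Integration.integrable_diff i0 i1 that)
  have LE: "(LINT p|lebesgue_on Q. E s p) = ((LINT p|lebesgue_on Q. f (snd p) (g p + s *\<^sub>R space_grad \<phi> p)) - (LINT p|lebesgue_on Q. f (snd p) (g p))) / s"
    if "\<bar>s\<bar> \<le> 1" for s
    unfolding E_def using Bochner_Integration.integral_diff[OF i1[OF that] i0] by simp
  have ineq: "s * X \<le> (LINT p|lebesgue_on Q. f (snd p) (g p + s *\<^sub>R space_grad \<phi> p)) - (LINT p|lebesgue_on Q. f (snd p) (g p))" for s
  proof -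
    have t: "(\<lambda>p. s * \<phi> p) \<in> test_functions (\<Omega> \<times> {..<\<tau>})" by (rule test_functions_mult[OF \<phi>' smooth_const])
    \<comment> \<open>A test function of the slab vanishes at time zero. Together with the initial
      values of \<open>U\<close> this removes the whole initial term.\<close>
    have z: "\<phi> (x, 0) = 0" for x using test_functions_outside[OF \<phi>] by auto
    have "(LINT p|lborel. indicator Q p * (U p * (s * time_deriv \<phi> p))) = s * X"
      unfolding X_def iU(3) by (simp add: algebra_simps flip: integral_mult_right_zero)
    then show ?thesis
      using limit_inequality[OF t] initial_values(2) by (simp add: scaled_test_function[OF sm] z)
  qed
  have Eb: "AE p in lebesgue_on Q. norm (E s p) \<le> M * B3" if s: "\<bar>s\<bar> \<le> 1" "s \<noteq> 0" for s
    using AE_Q_time[OF M(2)]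
  proof eventually_elim
    case (elim p)
    have "g p + s *\<^sub>R space_grad \<phi> p \<in> ball 0 R" "g p \<in> ball 0 R" using gR(1)[of p] gR(2)[OF s(1), of p] by auto
    then have "\<bar>f (snd p) (g p + s *\<^sub>R space_grad \<phi> p) - f (snd p) (g p)\<bar> \<le> M * norm ((g p + s *\<^sub>R space_grad \<phi> p) - g p)"
      using elim by blast
    also have "\<dots> = M * norm (space_grad \<phi> p) * \<bar>s\<bar>" by simp
    also have "\<dots> \<le> M * B3 * \<bar>s\<bar>" using M(1) B3(2)[of p] by (intro mult_right_mono mult_left_mono) auto
    finally show ?case using s(2) by (simp add: E_def abs_divide divide_le_eq)
  qed
  have Elim: "AE p in lebesgue_on Q. (\<lambda>n. E (s n) p) \<longlonglongrightarrow> grad (f (snd p)) (g p) \<bullet> space_grad \<phi> p"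
    if s: "s \<longlonglongrightarrow> 0" "\<And>n. s n \<noteq> 0" for s :: "nat \<Rightarrow> real"
    using AE_Q_time[OF M(2)]
  proof eventually_elim
    case (elim p)
    have "filterlim s (at 0) sequentially" using s by (auto simp: filterlim_at intro!: always_eventually)
    then show ?case unfolding E_def
      using C1_directional[of "f (snd p)" "g p" "space_grad \<phi> p"] elim filterlim_compose by blast
  qed
  define s1 where "s1 n = 1 / real (Suc n)" for n
  define s2 where "s2 n = - 1 / real (Suc n)" for n
  have s1: "s1 \<longlonglongrightarrow> 0" "0 < s1 n" "\<bar>s1 n\<bar> \<le> 1" for n
    using LIMSEQ_Suc[OF lim_1_over_n] by (simp_all add: s1_def[abs_def])
  have s2: "s2 \<longlonglongrightarrow> 0" "s2 n < 0" "\<bar>s2 n\<bar> \<le> 1" for n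
    using tendsto_minus[OF s1(1)] by (simp_all add: s1_def[abs_def] s2_def[abs_def])
  have fm: "finite_measure (lebesgue_on Q)"
    using Q_open Q_bounded by (intro finite_measure_lebesgue_on lmeasurable_open)
  have ic: "integrable (lebesgue_on Q) (\<lambda>_. M * B3)" using finite_measure.integrable_const[OF fm] .
  let ?G = "\<lambda>p. grad (f (snd p)) (g p) \<bullet> space_grad \<phi> p"
  \<comment> \<open>Measurability of \<open>grad (f t)\<close> along \<open>g\<close> is obtained
    here, from a pointwise limit of measurable difference quotients.\<close>
  define l where "l p = lim (\<lambda>n. E (s1 n) p)" for p
  have lm: "l \<in> borel_measurable (lebesgue_on Q)" unfolding l_def[abs_def]
    by (rule borel_measurable_lim_metric) (rule borel_measurable_integrable[OF iE[OF s1(3)]])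
  have ae1: "AE p in lebesgue_on Q. (\<lambda>n. E (s1 n) p) \<longlonglongrightarrow> ?G p" using s1(2) by (intro Elim s1(1)) (metis less_irrefl)
  have ael: "AE p in lebesgue_on Q. (\<lambda>n. E (s1 n) p) \<longlonglongrightarrow> l p"
    using ae1 by eventually_elim (simp add: l_def limI)
  have b1: "AE p in lebesgue_on Q. norm (E (s1 n) p) \<le> M * B3" for n
    using s1(2)[of n] by (intro Eb s1(3)) simp
  have b2: "AE p in lebesgue_on Q. norm (E (s2 n) p) \<le> M * B3" for n
    using s2(2)[of n] by (intro Eb s2(3)) simp
  have il: "integrable (lebesgue_on Q) l"
    by (rule integrable_dominated_convergence[OF lm borel_measurable_integrable[OF iE[OF s1(3)]] ic ael b1])
  have aeG: "AE p in lebesgue_on Q. l p = ?G p" using ae1 by eventually_elim (simp add: l_def limI)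
  note G = lebesgue_on_AE_cong[OF Q_lebesgue il aeG]
  show "integrable (lebesgue_on Q) ?G" by (rule G(1))
  have c1: "(\<lambda>n. LINT p|lebesgue_on Q. E (s1 n) p) \<longlonglongrightarrow> (LINT p|lebesgue_on Q. ?G p)"
    by (rule integral_dominated_convergence[OF borel_measurable_integrable[OF G(1)] borel_measurable_integrable[OF iE[OF s1(3)]] ic ae1 b1])
  have c2: "(\<lambda>n. LINT p|lebesgue_on Q. E (s2 n) p) \<longlonglongrightarrow> (LINT p|lebesgue_on Q. ?G p)"
  proof (rule integral_dominated_convergence[OF borel_measurable_integrable[OF G(1)] borel_measurable_integrable[OF iE[OF s2(3)]] ic _ b2])
    show "AE p in lebesgue_on Q. (\<lambda>n. E (s2 n) p) \<longlonglongrightarrow> ?G p" using s2(2) by (intro Elim s2(1)) (metis less_irrefl)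
  qed
  have "X \<le> (LINT p|lebesgue_on Q. E (s1 n) p)" for n
    unfolding LE[OF s1(3)] using ineq[of "s1 n"] s1(2)[of n] by (simp add: pos_le_divide_eq mult.commute)
  then have le1: "X \<le> (LINT p|lebesgue_on Q. ?G p)" by (intro LIMSEQ_le_const[OF c1]) blast
  have "(LINT p|lebesgue_on Q. E (s2 n) p) \<le> X" for n
    unfolding LE[OF s2(3)] using ineq[of "s2 n"] s2(2)[of n] by (simp add: neg_divide_le_eq mult.commute)
  then have le2: "(LINT p|lebesgue_on Q. ?G p) \<le> X" by (intro LIMSEQ_le_const2[OF c2]) blast
  show "(LINT p|lebesgue_on Q. U p * time_deriv \<phi> p) = (LINT p|lebesgue_on Q. ?G p)"
    using le1 le2 by (simp add: X_def)
qed

text \<open>Products of \<open>\<zeta>\<close> with test functions in time, put into the weak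
  equation, bound the weak derivative of the moment of \<open>U\<close> against
  \<open>\<zeta>\<close>; the Lipschitz criterion in dimension one does the rest. The radius
  \<open>B + 1\<close> leaves room for the values of \<open>g\<close>, whose norm is at most
  \<open>B\<close>.\<close>

lemma time_modulus:
  assumes M: "0 \<le> M" "AE t in lborel. t \<in> {0<..<\<tau>} \<longrightarrow> (\<forall>\<xi>\<in>ball 0 (B + 1). norm (grad (f t) \<xi>) \<le> M)"
    and \<zeta>: "\<zeta> \<in> test_functions \<Omega>" and S: "S \<in> sets borel" "bounded S"
    and D: "0 \<le> D" "\<And>x h. \<bar>frechet_derivative \<zeta> (at x) h\<bar> \<le> D * norm h" "\<And>x h. x \<notin> S \<Longrightarrow> frechet_derivative \<zeta> (at x) h = 0"
    and t: "t \<in> {0<..<\<tau>}" "s \<in> {0<..<\<tau>}"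
  shows "\<bar>(LINT x|lborel. \<zeta> x * U (x, t)) - (LINT x|lborel. \<zeta> x * U (x, s))\<bar> \<le> M * D * Sigma_Algebra.measure lborel S * \<bar>t - s\<bar>"
proof -
  have [measurable]: "\<zeta> \<in> borel_measurable borel" using \<zeta> by (rule test_functions_borel)
  have Sm[measurable]: "S \<in> sets borel" by (rule S(1))
  define m where "m t = (LINT x|lborel. \<zeta> x * U (x, t))" for t
  let ?\<mu> = "Sigma_Algebra.measure lborel S"
  have zi: "integrable lborel (\<lambda>x. B * \<bar>\<zeta> x\<bar>)" using test_functions_integrable[OF \<zeta>] by simp
  have zb: "norm (\<zeta> x * U (x, t)) \<le> B * \<bar>\<zeta> x\<bar>" for x t
    using mult_right_mono[OF U_bound[of "(x, t)"] abs_ge_zero[of "\<zeta> x"]] by (simp add: abs_mult mult.commute)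
  have mc: "continuous_on UNIV m"
  proof (subst continuous_on_sequentially, intro allI ballI impI)
    fix p q assume "q \<in> UNIV" "(\<forall>n. p n \<in> UNIV) \<and> p \<longlonglongrightarrow> (q :: real)"
    then have pq: "p \<longlonglongrightarrow> q" by simp
    have "(\<lambda>n. m (p n)) \<longlonglongrightarrow> m q"
      unfolding m_def
    proof (rule integral_dominated_convergence[OF _ _ zi])
      show "AE x in lborel. (\<lambda>n. \<zeta> x * U (x, p n)) \<longlonglongrightarrow> \<zeta> x * U (x, q)"
        using continuous_on_tendsto_compose[OF U_slice_cont[of UNIV] pq] by (intro AE_I2 tendsto_mult tendsto_const) auto
      show "AE x in lborel. norm (\<zeta> x * U (x, p n)) \<le> B * \<bar>\<zeta> x\<bar>" for n by (intro AE_I2 zb)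
    qed measurable
    then show "(m \<circ> p) \<longlonglongrightarrow> m q" by (simp add: o_def)
  qed
  have "\<bar>m t - m s\<bar> \<le> M * D * ?\<mu> * norm (t - s)"
  proof (rule lipschitz_if_weak_derivative_bounded[OF _ _ mc _ _ t])
    show "0 \<le> M * D * ?\<mu>" using M D by (intro mult_nonneg_nonneg measure_nonneg)
    fix \<eta> :: "real \<Rightarrow> real" and h :: real assume \<eta>: "\<eta> \<in> test_functions {0<..<\<tau>}"
    have [measurable]: "\<eta> \<in> borel_measurable borel" using \<eta> by (rule test_functions_borel)
    define \<phi> where "\<phi> = (\<lambda>p::'a \<times> real. \<zeta> (fst p) * \<eta> (snd p))"
    have \<phi>: "\<phi> \<in> test_functions Q" unfolding \<phi>_def by (rule test_functions_tensor(1)[OF \<zeta> \<eta>])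
    have sm: "smooth \<phi>" using \<phi> by (rule test_functions_smooth)
    have \<phi>t: "time_deriv \<phi> (x, t) = \<zeta> x * deriv \<eta> t" for x t
      unfolding time_deriv_eq(2)[OF sm] unfolding \<phi>_def
      by (subst test_functions_tensor(2)[OF \<zeta> \<eta>])
         (simp add: linear_0[OF has_derivative_linear[OF smooth_deriv(1)[OF test_functions_smooth[OF \<zeta>]]]])
    have \<phi>g: "space_grad \<phi> (x, t) \<bullet> k = frechet_derivative \<zeta> (at x) k * \<eta> t" for x t k
      unfolding space_grad_inner[OF sm] unfolding \<phi>_def by (subst test_functions_tensor(2)[OF \<zeta> \<eta>]) simp
    have \<phi>tm[measurable]: "time_deriv \<phi> \<in> borel_measurable borel" by (rule test_functions_borel[OF time_deriv_test[OF \<phi>]])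
    have fd: "frechet_derivative \<eta> (at t) h = deriv \<eta> t * h" for t
    proof -
      have "\<eta> differentiable (at t)" using smooth_deriv(1)[OF test_functions_smooth[OF \<eta>], of t] unfolding differentiable_def by blast
      then have "DERIV \<eta> t :> deriv \<eta> t" by (simp only: DERIV_deriv_iff_real_differentiable)
      then show ?thesis using frechet_derivative_at[of \<eta> "\<lambda>k. deriv \<eta> t * k" t] by (simp add: has_field_derivative_def)
    qed
    note we = weak_equation[OF \<phi>]
    obtain B2 where B2: "0 < B2" "\<And>p. \<bar>time_deriv \<phi> p\<bar> \<le> B2" using test_functions_bounded[OF time_deriv_test[OF \<phi>]] by blast
    have Um: "(\<lambda>p. U p * time_deriv \<phi> p) \<in> borel_measurable borel" by measurable
    have Uo: "U p * time_deriv \<phi> p = 0" if "p \<notin> Q" for p using test_functions_outside[OF time_deriv_test[OF \<phi>] that] by simp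
    have iU: "integrable lborel (\<lambda>p. U p * time_deriv \<phi> p)"
    proof (rule integrable_bounded_support[OF Um Q_bounded _ Uo])
      show "norm (U p * time_deriv \<phi> p) \<le> B * B2" for p
        unfolding real_norm_def abs_mult by (rule mult_mono[OF U_bound B2(2)]) (use B_nonneg in auto)
    qed
    have "(LINT t|lborel. m t * frechet_derivative \<eta> (at t) h) = (LINT t|lborel. h * (LINT x|lborel. U (x, t) * time_deriv \<phi> (x, t)))"
    proof (rule Bochner_Integration.integral_cong[OF refl])
      fix t
      have "(LINT x|lborel. U (x, t) * time_deriv \<phi> (x, t)) = (LINT x|lborel. deriv \<eta> t * (\<zeta> x * U (x, t)))"
        by (rule Bochner_Integration.integral_cong[OF refl]) (simp add: \<phi>t)
      then show "m t * frechet_derivative \<eta> (at t) h = h * (LINT x|lborel. U (x, t) * time_deriv \<phi> (x, t))"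
        unfolding fd m_def by simp
    qed
    also have "\<dots> = h * (LINT p|lborel. U p * time_deriv \<phi> p)"
      unfolding lborel_Fubini(1)[OF iU] by simp
    also have "(LINT p|lborel. U p * time_deriv \<phi> p) = (LINT p|lebesgue_on Q. U p * time_deriv \<phi> p)"
      by (rule LINT_lebesgue_on_zero_off[OF Q_borel Um Uo, symmetric])
    also have "\<dots> = (LINT p|lebesgue_on Q. grad (f (snd p)) (g p) \<bullet> space_grad \<phi> p)" by (rule we(2))
    finally have e1: "(LINT t|lborel. m t * frechet_derivative \<eta> (at t) h) = h * (LINT p|lebesgue_on Q. grad (f (snd p)) (g p) \<bullet> space_grad \<phi> p)" .
    \<comment> \<open>A majorant of the flux term: the gradient of \<open>f t\<close> is at most
      \<open>M\<close>, the derivative of \<open>\<zeta>\<close> is at most \<open>D\<close> and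
      vanishes off \<open>S\<close>. Integration in space yields \<open>M * D\<close> times the
      measure of \<open>S\<close>.\<close>
    define F where "F p = M * D * (indicator S (fst p) * \<bar>\<eta> (snd p)\<bar>)" for p :: "'a \<times> real"
    obtain B1 where B1: "0 < B1" "\<And>t. \<bar>\<eta> t\<bar> \<le> B1" using test_functions_bounded[OF \<eta>] by blast
    have Sf: "(\<lambda>p::'a \<times> real. indicator S (fst p) :: real) \<in> borel_measurable borel"
      by (rule measurable_compose[OF borel_measurable_fst_snd(1) borel_measurable_indicator[OF S(1)]])
    have \<eta>f: "(\<lambda>p::'a \<times> real. \<eta> (snd p)) \<in> borel_measurable borel"
      by (rule measurable_compose[OF borel_measurable_fst_snd(2)]) measurable
    have Fm: "F \<in> borel_measurable borel" unfolding F_def[abs_def] using Sf \<eta>f by measurable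
    have F0: "0 \<le> F p" for p unfolding F_def using M D by (intro mult_nonneg_nonneg) auto
    have Fb: "norm (F p) \<le> M * D * (1 * B1)" for p
      using F0[of p] unfolding real_norm_def F_def using M D B1
      by (simp only: abs_of_nonneg) (intro mult_left_mono mult_mono mult_nonneg_nonneg, auto split: split_indicator)
    have Fo: "F p = 0" if "p \<notin> S \<times> {0<..<\<tau>}" for p
      using that test_functions_outside[OF \<eta>, of "snd p"] by (cases p) (auto simp: F_def)
    have iF: "integrable lborel F"
      by (rule integrable_bounded_support[OF Fm _ Fb Fo]) (use S(2) in \<open>auto intro: bounded_Times\<close>)
    have Fb': "\<bar>F p\<bar> \<le> M * D * (1 * B1)" for p using Fb[of p] by simp
    note iFQ = bounded_on_Q[OF Fm Fb']
    have "\<bar>(LINT p|lebesgue_on Q. grad (f (snd p)) (g p) \<bullet> space_grad \<phi> p)\<bar> \<le> (LINT p|lebesgue_on Q. \<bar>grad (f (snd p)) (g p) \<bullet> space_grad \<phi> p\<bar>)"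
      by (rule integral_abs_bound)
    also have "\<dots> \<le> (LINT p|lebesgue_on Q. F p)"
    proof (rule integral_mono_AE[OF integrable_abs[OF we(1)] iFQ(2)])
      show "AE p in lebesgue_on Q. \<bar>grad (f (snd p)) (g p) \<bullet> space_grad \<phi> p\<bar> \<le> F p"
        using AE_Q_time[OF M(2)]
      proof eventually_elim
        case (elim p)
        obtain x t where p: "p = (x, t)" by force
        let ?k = "grad (f t) (g p)"
        have k: "norm ?k \<le> M" using elim g_bound[of p] by (auto simp: p)
        have "\<bar>frechet_derivative \<zeta> (at x) ?k\<bar> \<le> M * D * indicator S x"
        proof (cases "x \<in> S")
          case True
          have "\<bar>frechet_derivative \<zeta> (at x) ?k\<bar> \<le> D * norm ?k" by (rule D(2))
          also have "\<dots> \<le> D * M" by (rule mult_left_mono[OF k D(1)])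
          finally show ?thesis using True by (simp add: mult.commute)
        qed (simp add: D(3))
        then have "\<bar>frechet_derivative \<zeta> (at x) ?k\<bar> * \<bar>\<eta> t\<bar> \<le> M * D * indicator S x * \<bar>\<eta> t\<bar>" by (rule mult_right_mono) simp
        moreover have "grad (f (snd p)) (g p) \<bullet> space_grad \<phi> p = frechet_derivative \<zeta> (at x) ?k * \<eta> t"
          using \<phi>g[of x t ?k] by (simp add: p inner_commute)
        ultimately show ?case by (simp add: F_def p abs_mult)
      qed
    qed
    also have "\<dots> = (LINT p|lborel. indicator Q p * F p)" by (rule iFQ(3))
    also have "\<dots> \<le> (LINT p|lborel. F p)"
      by (rule integral_mono[OF iFQ(1) iF]) (use F0 in \<open>auto split: split_indicator\<close>)
    also have "\<dots> = (LINT t|lborel. LINT x|lborel. F (x, t))" by (rule lborel_Fubini(1)[OF iF])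
    also have "\<dots> = (LINT t|lborel. M * D * ?\<mu> * \<bar>\<eta> t\<bar>)"
    proof (rule Bochner_Integration.integral_cong[OF refl])
      fix t
      have "(LINT x|lborel. F (x, t)) = (LINT x|lborel. (M * D * \<bar>\<eta> t\<bar>) * indicator S x)"
        by (rule Bochner_Integration.integral_cong[OF refl]) (simp add: F_def)
      also have "\<dots> = M * D * \<bar>\<eta> t\<bar> * ?\<mu>" by simp
      finally show "(LINT x|lborel. F (x, t)) = M * D * ?\<mu> * \<bar>\<eta> t\<bar>" by simp
    qed
    also have "\<dots> = M * D * ?\<mu> * (LINT t|lborel. \<bar>\<eta> t\<bar>)" by (rule integral_mult_right_zero)
    finally have "\<bar>h\<bar> * \<bar>(LINT p|lebesgue_on Q. grad (f (snd p)) (g p) \<bullet> space_grad \<phi> p)\<bar> \<le> \<bar>h\<bar> * (M * D * ?\<mu> * (LINT t|lborel. \<bar>\<eta> t\<bar>))"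
      by (rule mult_left_mono) simp
    then show "\<bar>(LINT t|lborel. m t * frechet_derivative \<eta> (at t) h)\<bar> \<le> M * D * ?\<mu> * norm h * (LINT t|lborel. \<bar>\<eta> t\<bar>)"
      unfolding e1 abs_mult by (simp add: mult_ac)
  qed auto
  then show ?thesis by (simp add: m_def)
qed

end

subsection \<open>Hoelder continuity in time\<close>

text \<open>Scaling divides derivatives by \<open>r\<close>. At half the radius the argument of
  \<open>exp_bump\<close> is at least 3/4, so the bump is at least exp(-4/3) there, and doubling the
  radius multiplies the volume by \<open>2 ^ DIM('a)\<close>. Volume and integral are thus
  comparable, with constants independent of \<open>r\<close> and \<open>x0\<close>.\<close>

lemma rescaled_bump:
  fixes x0 :: "'a::euclidean_space"
  assumes D: "0 < D" "\<And>(x::'a) h. \<bar>frechet_derivative (bump 0 1) (at x) h\<bar> \<le> D * norm h" and r: "0 < r"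
  obtains \<zeta> where "\<And>V. cball x0 r \<subseteq> V \<Longrightarrow> \<zeta> \<in> test_functions V" "\<And>x. 0 \<le> \<zeta> x" "\<And>x. x \<notin> cball x0 r \<Longrightarrow> \<zeta> x = 0"
    "\<And>x h. \<bar>frechet_derivative \<zeta> (at x) h\<bar> \<le> D / r * norm h"
    "\<And>x h. x \<notin> cball x0 r \<Longrightarrow> frechet_derivative \<zeta> (at x) h = 0"
    "0 < (LINT x|lborel. \<zeta> x)"
    "Sigma_Algebra.measure lborel (cball x0 r) \<le> 2 ^ DIM('a) * exp (4/3) * (LINT x|lborel. \<zeta> x)"
proof -
  define \<beta> :: "'a \<Rightarrow> real" where "\<beta> = bump 0 1"
  define b where "b = - ((1 / r) *\<^sub>R x0)"
  define \<zeta> where "\<zeta> = (\<lambda>x. \<beta> ((1 / r) *\<^sub>R x + b))"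
  have arg: "(1 / r) *\<^sub>R x + b = (1 / r) *\<^sub>R (x - x0)" for x by (simp add: b_def scaleR_diff_right)
  have na: "norm ((1 / r) *\<^sub>R x + b) = dist x0 x / r" for x
    unfolding arg using r by (simp add: dist_norm norm_minus_commute)
  have sb: "smooth \<beta>" unfolding \<beta>_def by (rule smooth_bump)
  have sm: "smooth \<zeta>" unfolding \<zeta>_def by (rule smooth_affine[OF sb bounded_linear_scaleR_right])
  have out: "\<zeta> x = 0" if "x \<notin> cball x0 r" for x
  proof -
    have "1 \<le> dist x0 x / r" using that r by (simp add: pos_le_divide_eq)
    then have "(1 / r) *\<^sub>R x + b \<notin> ball 0 1" by (simp only: mem_ball dist_0_norm na not_less)
    then show ?thesis unfolding \<zeta>_def \<beta>_def by (simp only: bump_eq_0_iff[OF zero_less_one] simp_thms)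
  qed
  have test: "\<zeta> \<in> test_functions V" if "cball x0 r \<subseteq> V" for V
    by (rule test_functionsI[OF sm compact_cball that out])
  have fd: "frechet_derivative \<zeta> (at x) h = frechet_derivative \<beta> (at ((1 / r) *\<^sub>R x + b)) ((1 / r) *\<^sub>R h)" for x h
  proof -
    have "((\<lambda>x. (1 / r) *\<^sub>R x + b) has_derivative (\<lambda>h. (1 / r) *\<^sub>R h)) (at x)"
      by (auto intro!: derivative_eq_intros)
    from diff_chain_at[OF this smooth_deriv(1)[OF sb]]
    have "(\<zeta> has_derivative (\<lambda>h. frechet_derivative \<beta> (at ((1 / r) *\<^sub>R x + b)) ((1 / r) *\<^sub>R h))) (at x)"
      by (simp only: \<zeta>_def o_def)
    from frechet_derivative_at[OF this] show ?thesis by (simp only: fun_eq_iff)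
  qed
  have b1: "\<bar>frechet_derivative \<zeta> (at x) h\<bar> \<le> D / r * norm h" for x h
    using D(2)[of "(1 / r) *\<^sub>R x + b" "(1 / r) *\<^sub>R h"] r unfolding fd \<beta>_def by simp
  have b2: "frechet_derivative \<zeta> (at x) h = 0" if "x \<notin> cball x0 r" for x h
    using frechet_derivative_at[OF zero_off_closed_deriv[OF closed_cball out that]] by (simp add: fun_eq_iff)
  have pos: "0 \<le> \<zeta> x" for x unfolding \<zeta>_def \<beta>_def by (rule bump_nonneg)
  have lower: "exp (- (4/3)) * indicator (cball x0 (r / 2)) x \<le> \<zeta> x" for x
  proof (cases "x \<in> cball x0 (r / 2)")
    case True
    have "dist x0 x / r \<le> 1 / 2" using True r by (simp add: pos_divide_le_eq)
    then have "(dist x0 x / r)\<^sup>2 \<le> (1 / 2)\<^sup>2" using r by (intro power_mono) auto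
    then have t: "3 / 4 \<le> 1 - (dist x0 x / r)\<^sup>2" by (simp add: power2_eq_square)
    have "1 / (1 - (dist x0 x / r)\<^sup>2) \<le> 1 / (3 / 4)" by (rule divide_left_mono[OF t]) (use t in auto)
    moreover have "\<zeta> x = exp (- (1 / (1 - (dist x0 x / r)\<^sup>2)))"
      unfolding \<zeta>_def \<beta>_def bump_def diff_0_right na exp_bump_def using t by simp
    ultimately show ?thesis using True by simp
  qed (use pos in simp)
  have iz: "integrable lborel \<zeta>" by (rule test_functions_integrable[OF test[OF subset_UNIV]])
  have mc: "Sigma_Algebra.measure lborel (cball x0 s) = unit_ball_vol (DIM('a)) * s ^ DIM('a)" if "0 \<le> s" for s
    by (rule content_cball[OF that])
  let ?v = "Sigma_Algebra.measure lborel (cball x0 (r / 2))"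
  have "exp (- (4/3)) * ?v = (LINT x|lborel. exp (- (4/3)) * indicator (cball x0 (r / 2)) x)" by simp
  also have "\<dots> \<le> (LINT x|lborel. \<zeta> x)"
  proof (rule integral_mono[OF _ iz lower])
    have "emeasure lborel (cball x0 (r / 2)) < \<infinity>" by (rule emeasure_bounded_finite[OF bounded_cball])
    then show "integrable lborel (\<lambda>x. exp (- (4/3)) * indicator (cball x0 (r / 2)) x :: real)" by simp
  qed
  finally have J: "exp (- (4/3)) * ?v \<le> (LINT x|lborel. \<zeta> x)" .
  have "0 < ?v" using r by (simp add: mc)
  then have "0 < exp (- (4/3)) * ?v" by simp
  then have J0: "0 < (LINT x|lborel. \<zeta> x)" using J by linarith
  have "Sigma_Algebra.measure lborel (cball x0 r) = 2 ^ DIM('a) * ?v" using r by (simp add: mc power_divide)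
  also have "?v = exp (4/3) * (exp (- (4/3)) * ?v)" by (simp add: exp_minus)
  also have "2 ^ DIM('a) * \<dots> \<le> 2 ^ DIM('a) * (exp (4/3) * (LINT x|lborel. \<zeta> x))"
    by (intro mult_left_mono J) auto
  finally have J1: "Sigma_Algebra.measure lborel (cball x0 r) \<le> 2 ^ DIM('a) * exp (4/3) * (LINT x|lborel. \<zeta> x)"
    by (simp only: mult.assoc)
  show thesis by (rule that[OF test pos out b1 b2 J0 J1])
qed

context slab
begin

text \<open>The mean of \<open>U\<close> against the bump differs from the central value by at most
  \<open>L * r\<close> at each of the two times. The moment changes at a rate of
  \<open>D / r\<close> times the volume of the ball; dividing by the integral of the bump, to which
  that volume is comparable, leaves only the factor \<open>1 / r\<close>.\<close>

lemma interior_modulus: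
  assumes M: "0 \<le> M" "AE t in lborel. t \<in> {0<..<\<tau>} \<longrightarrow> (\<forall>\<xi>\<in>ball 0 (B + 1). norm (grad (f t) \<xi>) \<le> M)"
    and D: "0 < D" "\<And>(x::'a) h. \<bar>frechet_derivative (bump 0 1) (at x) h\<bar> \<le> D * norm h"
    and r: "0 < r" "cball x0 r \<subseteq> \<Omega>" and t: "t \<in> {0<..<\<tau>}" "s \<in> {0<..<\<tau>}"
  shows "\<bar>U (x0, t) - U (x0, s)\<bar> \<le> 2 * L * r + M * D * 2 ^ DIM('a) * exp (4/3) / r * \<bar>t - s\<bar>"
proof -
  obtain \<zeta> where \<zeta>: "\<And>V. cball x0 r \<subseteq> V \<Longrightarrow> \<zeta> \<in> test_functions V" "\<And>x. 0 \<le> \<zeta> x" "\<And>x. x \<notin> cball x0 r \<Longrightarrow> \<zeta> x = 0"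
    "\<And>x h. \<bar>frechet_derivative \<zeta> (at x) h\<bar> \<le> D / r * norm h"
    "\<And>x h. x \<notin> cball x0 r \<Longrightarrow> frechet_derivative \<zeta> (at x) h = 0"
    "0 < (LINT x|lborel. \<zeta> x)"
    "Sigma_Algebra.measure lborel (cball x0 r) \<le> 2 ^ DIM('a) * exp (4/3) * (LINT x|lborel. \<zeta> x)"
    by (rule rescaled_bump[OF D r(1)]) blast
  note z = \<zeta>(1)[OF r(2)]
  have iz: "integrable lborel \<zeta>" by (rule test_functions_integrable[OF z])
  have [measurable]: "\<zeta> \<in> borel_measurable borel" using z by (rule test_functions_borel)
  define J where "J = (LINT x|lborel. \<zeta> x)"
  define m where "m t = (LINT x|lborel. \<zeta> x * U (x, t))" for t
  have av: "\<bar>m t - J * U (x0, t)\<bar> \<le> L * r * J" for t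
  proof -
    have [measurable]: "(\<lambda>x. U (x, t)) \<in> borel_measurable borel"
      by (rule measurable_compose[OF _ U_borel]) (intro borel_measurable_continuous_onI continuous_intros)
    have i1: "integrable lborel (\<lambda>x. \<zeta> x * U (x, t))"
    proof (rule Bochner_Integration.integrable_bound[where f = "\<lambda>x. B * \<zeta> x"])
      show "integrable lborel (\<lambda>x. B * \<zeta> x)" using iz by simp
      show "AE x in lborel. norm (\<zeta> x * U (x, t)) \<le> norm (B * \<zeta> x)"
      proof (rule AE_I2)
        fix x show "norm (\<zeta> x * U (x, t)) \<le> norm (B * \<zeta> x)"
          using mult_right_mono[OF U_bound[of "(x, t)"] \<zeta>(2)[of x]] \<zeta>(2)[of x] B_nonneg by (simp add: abs_mult mult.commute)
      qed
    qed measurable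
    have i2: "integrable lborel (\<lambda>x. \<zeta> x * U (x0, t))" using iz by simp
    have "m t - J * U (x0, t) = (LINT x|lborel. \<zeta> x * U (x, t) - \<zeta> x * U (x0, t))"
      unfolding m_def J_def using Bochner_Integration.integral_diff[OF i1 i2] by simp
    also have "\<bar>\<dots>\<bar> \<le> (LINT x|lborel. \<bar>\<zeta> x * U (x, t) - \<zeta> x * U (x0, t)\<bar>)" by (rule integral_abs_bound)
    also have "\<dots> \<le> (LINT x|lborel. (L * r) * \<zeta> x)"
    proof (rule integral_mono)
      show "integrable lborel (\<lambda>x. \<bar>\<zeta> x * U (x, t) - \<zeta> x * U (x0, t)\<bar>)"
        by (intro integrable_abs Bochner_Integration.integrable_diff i1 i2)
      show "integrable lborel (\<lambda>x. L * r * \<zeta> x)" using iz by simp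
      fix x
      show "\<bar>\<zeta> x * U (x, t) - \<zeta> x * U (x0, t)\<bar> \<le> L * r * \<zeta> x"
      proof (cases "x \<in> cball x0 r")
        case True
        have "L * norm (x - x0) \<le> L * r" using True by (intro mult_left_mono L_nonneg) (simp add: dist_norm norm_minus_commute)
        then have "\<bar>U (x, t) - U (x0, t)\<bar> \<le> L * r" using U_lipschitz[of x t x0] by linarith
        then have "\<bar>U (x, t) - U (x0, t)\<bar> * \<zeta> x \<le> L * r * \<zeta> x" by (rule mult_right_mono[OF _ \<zeta>(2)])
        moreover have "\<bar>\<zeta> x * U (x, t) - \<zeta> x * U (x0, t)\<bar> = \<bar>U (x, t) - U (x0, t)\<bar> * \<zeta> x"
          using \<zeta>(2)[of x] by (simp add: right_diff_distrib[symmetric] abs_mult mult.commute)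
        ultimately show ?thesis by simp
      qed (simp add: \<zeta>(3))
    qed
    also have "\<dots> = L * r * J" by (simp add: J_def)
    finally show ?thesis .
  qed
  let ?c = "M * D * 2 ^ DIM('a) * exp (4/3) / r * \<bar>t - s\<bar>"
  have "\<bar>m t - m s\<bar> \<le> M * (D / r) * Sigma_Algebra.measure lborel (cball x0 r) * \<bar>t - s\<bar>"
    unfolding m_def by (rule time_modulus[OF M z _ bounded_cball _ \<zeta>(4,5) t]) (use D r in auto)
  also have "\<dots> \<le> M * (D / r) * (2 ^ DIM('a) * exp (4/3) * J) * \<bar>t - s\<bar>"
    using \<zeta>(7) M D r by (intro mult_right_mono mult_left_mono mult_nonneg_nonneg) (auto simp: J_def)
  also have "\<dots> = ?c * J" by simp
  finally have "\<bar>m t - m s\<bar> \<le> ?c * J" .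
  then have "\<bar>J * U (x0, t) - J * U (x0, s)\<bar> \<le> 2 * (L * r * J) + ?c * J"
    using av[of t] av[of s] by linarith
  also have "\<dots> = J * (2 * L * r + ?c)" by (simp add: algebra_simps)
  finally have "J * \<bar>U (x0, t) - U (x0, s)\<bar> \<le> J * (2 * L * r + ?c)"
    using \<zeta>(6) by (simp add: right_diff_distrib[symmetric] abs_mult J_def)
  then show ?thesis using \<zeta>(6) by (simp only: J_def[symmetric] mult_le_cancel_left_pos)
qed

lemma holder_in_time:
  assumes M: "0 \<le> M" "AE t in lborel. t \<in> {0<..<\<tau>} \<longrightarrow> (\<forall>\<xi>\<in>ball 0 (B + 1). norm (grad (f t) \<xi>) \<le> M)"
    and D: "0 < D" "\<And>(x::'a) h. \<bar>frechet_derivative (bump 0 1) (at x) h\<bar> \<le> D * norm h"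
    and x: "x \<in> closure \<Omega>" and t: "t \<in> {0..\<tau>}" "s \<in> {0..\<tau>}"
  shows "\<bar>U (x, t) - U (x, s)\<bar> \<le> (2 * L + M * D * 2 ^ DIM('a) * exp (4/3)) * sqrt \<bar>t - s\<bar>"
proof -
  let ?K = "M * D * 2 ^ DIM('a) * exp (4/3)"
  have K: "0 \<le> ?K" using M D by simp
  have inner: "\<bar>U (x, t) - U (x, s)\<bar> \<le> (2 * L + ?K) * sqrt \<bar>t - s\<bar>" if t: "t \<in> {0<..<\<tau>}" "s \<in> {0<..<\<tau>}" for t s
  proof (cases "t = s")
    case False
    define r where "r = sqrt \<bar>t - s\<bar>"
    have r: "0 < r" and rr: "\<bar>t - s\<bar> = r * r" using False by (auto simp: r_def)
    show ?thesis
    proof (cases "cball x r \<subseteq> \<Omega>")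
      case True
      have "\<bar>U (x, t) - U (x, s)\<bar> \<le> 2 * L * r + ?K / r * \<bar>t - s\<bar>"
        by (rule interior_modulus[OF M D r True t])
      also have "\<dots> = (2 * L + ?K) * r" using r by (simp add: rr algebra_simps)
      finally show ?thesis by (simp add: r_def)
    next
      case False
      \<comment> \<open>The ball is connected. If \<open>x\<close> lies in \<open>\<Omega>\<close>,
        the ball meets \<open>\<Omega>\<close> and is not contained in it, hence meets the frontier;
        otherwise \<open>x\<close> itself is a frontier point.\<close>
      have "\<exists>z\<in>frontier \<Omega>. dist x z \<le> r"
      proof (cases "x \<in> \<Omega>")
        case True
        then have "x \<in> cball x r \<inter> \<Omega>" using r by simp
        then have "cball x r \<inter> \<Omega> \<noteq> {}" by blast
        then have "cball x r \<inter> frontier \<Omega> \<noteq> {}"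
          using False by (intro connected_Int_frontier) (auto simp: convex_connected)
        then show ?thesis by auto
      next
        case False
        then have "x \<in> frontier \<Omega>" using x open_\<Omega> by (simp add: frontier_def interior_open)
        then show ?thesis using r by (intro bexI[of _ x]) auto
      qed
      then obtain z where z: "z \<in> frontier \<Omega>" "dist x z \<le> r" by blast
      have "L * norm (x - z) \<le> L * r" using z(2) by (intro mult_left_mono L_nonneg) (simp add: dist_norm)
      then have "\<bar>U (x, t) - U (z, t)\<bar> \<le> L * r" "\<bar>U (x, s) - U (z, s)\<bar> \<le> L * r"
        using U_lipschitz[of x t z] U_lipschitz[of x s z] by linarith+
      then have "\<bar>U (x, t) - U (x, s)\<bar> \<le> 2 * L * r" unfolding U_frontier[OF z(1)] by linarith
      also have "\<dots> \<le> (2 * L + ?K) * r" using K r by (intro mult_right_mono) auto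
      finally show ?thesis by (simp add: r_def)
    qed
  qed simp
  \<comment> \<open>The weak equation reaches only open times; continuity of \<open>U\<close>
    carries the bound to the end times.\<close>
  define F where "F p = \<bar>U (x, fst p) - U (x, snd p)\<bar> - (2 * L + ?K) * sqrt \<bar>fst p - snd p\<bar>" for p :: "real \<times> real"
  have cl: "closure ({0<..<\<tau>} \<times> {0<..<\<tau>}) = {0..\<tau>} \<times> {0..\<tau>}" using tau_pos by (simp add: closure_Times)
  have Uc: "continuous_on S (\<lambda>p. U (x, h p))" if "continuous_on S h" for S and h :: "real \<times> real \<Rightarrow> real"
    by (rule continuous_on_compose2[OF U_cont]) (auto intro!: continuous_intros that)
  have "F (t, s) \<le> 0"
  proof (rule continuous_le_on_closure[where S = "{0<..<\<tau>} \<times> {0<..<\<tau>}" and f = F])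
    show "continuous_on (closure ({0<..<\<tau>} \<times> {0<..<\<tau>})) F"
      unfolding F_def[abs_def] by (intro continuous_intros Uc)
    show "(t, s) \<in> closure ({0<..<\<tau>} \<times> {0<..<\<tau>})" unfolding cl using t by simp
    fix p assume "p \<in> {0<..<\<tau>} \<times> {0<..<\<tau>}"
    then show "F p \<le> 0" using inner[of "fst p" "snd p"] by (auto simp: F_def)
  qed
  then show ?thesis by (simp add: F_def)
qed

end

section \<open>From slabs of finite length to the full time interval\<close>

text \<open>Supplies the initial datum as a function that is continuous, and so Borel, on the whole
  space.\<close>

lemma W1inf_continuous_extension:
  assumes "convex \<Omega>" "\<Omega> \<noteq> {}" "w \<in> W1inf \<Omega>"
  obtains v where "continuous_on UNIV v" "\<And>x. x \<in> closure \<Omega> \<Longrightarrow> v x = w x"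
proof
  have c: "convex (closure \<Omega>)" "closed (closure \<Omega>)" "closure \<Omega> \<noteq> {}" using assms by (auto intro: convex_closure)
  have w: "continuous_on (closure \<Omega>) w" using assms(3) by (auto simp: W1inf_def intro: lipschitz_on_continuous_on)
  show "continuous_on UNIV (\<lambda>x. w (closest_point (closure \<Omega>) x))"
    by (rule continuous_on_compose2[OF w continuous_on_closest_point[OF c]]) (use closest_point_in_set[OF c(2,3)] in auto)
  show "w (closest_point (closure \<Omega>) x) = w x" if "x \<in> closure \<Omega>" for x by (simp add: closest_point_self[OF that])
qed

theorem theorem1p3:
  fixes \<Omega> :: "(real ^ 'n) set"
    and T :: ereal
    and f :: "real \<Rightarrow> real ^ 'n \<Rightarrow> real"
    and u0 :: "real ^ 'n \<Rightarrow> real"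
    and Q :: real
    and u :: "(real ^ 'n) \<times> real \<Rightarrow> real"
  assumes "open \<Omega>" and "bounded \<Omega>" and "convex \<Omega>"
    and "0 < T"
    and f_convex: "AE t in lebesgue_on (closed_time T). convex_on UNIV (f t)"
    and f_L1: "\<And>\<xi> \<tau>. 0 < \<tau> \<Longrightarrow> ereal \<tau> \<le> T \<Longrightarrow>
                 integrable (lebesgue_on {0<..<\<tau>}) (\<lambda>t. f t \<xi>)"
    and "u0 \<in> W1inf \<Omega>"
    and "0 < Q" and "bounded_slope \<Omega> u0 Q"
    and f_C1: "AE t in lebesgue_on (open_time T). C1 (f t)"
    and Df_bound: "\<And>L. 0 < L \<Longrightarrow> \<exists>M>0. \<forall>\<xi>\<in>ball 0 L.
                 (SUP t\<in>{t \<in> open_time T. C1 (f t)}. ereal (norm (grad (f t) \<xi>))) < ereal M"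
    and "variational_solution f \<Omega> T u0 u"
  shows "weak_solution f \<Omega> T u \<and> u \<in> C_0_1_half \<Omega> T"
proof (cases "\<Omega> = {}")
  \<comment> \<open>Nearest point projections need a nonempty set. Over the empty cylinder every
    integral is zero and every almost everywhere statement holds.\<close>
  case True
  then have "cylinder \<Omega> T = {}" by (simp add: cylinder_def)
  then show ?thesis
    by (simp add: weak_solution_def C_0_1_half_def LINT_lebesgue_on AE_lebesgue_on_iff)
next
  case ne: False
  have vsf: "variational_solution_finite f \<Omega> \<tau> u0 u" if "0 < \<tau>" "T = \<infinity> \<or> T = ereal \<tau>" for \<tau>
    using \<open>variational_solution f \<Omega> T u0 u\<close> that by (auto simp: variational_solution_def)
  have u: "u \<in> Kinf_bd \<Omega> T u0"
  proof (cases "T = \<infinity>")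
    case True
    then show ?thesis using \<open>variational_solution f \<Omega> T u0 u\<close> by (simp add: variational_solution_def)
  next
    case False
    then obtain \<tau> where "T = ereal \<tau>" using \<open>0 < T\<close> by (cases T) auto
    then show ?thesis using vsf[of \<tau>] \<open>0 < T\<close> by (simp add: variational_solution_finite_def Let_def)
  qed
  let ?Q = "cylinder \<Omega> T"
  obtain U L C g where L: "0 \<le> L" and U: "continuous_on UNIV U" "\<And>x y t. \<bar>U (x, t) - U (y, t)\<bar> \<le> L * norm (x - y)"
      "\<And>x t. x \<in> frontier \<Omega> \<Longrightarrow> U (x, t) = u0 x" "\<And>p. \<bar>U p\<bar> \<le> C"
    and uU: "AE p in lebesgue_on ?Q. u p = U p"
    and g: "g \<in> borel_measurable borel" "\<And>p. norm (g p) \<le> C" "has_weak_grad ?Q U g" "has_weak_grad ?Q u g"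
    by (rule slice_representative[OF \<open>open \<Omega>\<close> \<open>bounded \<Omega>\<close> \<open>convex \<Omega>\<close> ne \<open>0 < T\<close> u]) blast
  obtain v0 where v0: "continuous_on UNIV v0" "\<And>x. x \<in> closure \<Omega> \<Longrightarrow> v0 x = u0 x"
    using W1inf_continuous_extension[OF \<open>convex \<Omega>\<close> ne \<open>u0 \<in> W1inf \<Omega>\<close>] by blast
  have Qo: "open ?Q" unfolding cylinder_def using \<open>open \<Omega>\<close> open_open_time by (rule open_Times)
  have Ql: "?Q \<in> sets lebesgue" using Qo by (simp add: borel_open)
  have Tl: "open_time T \<in> sets lebesgue" using open_open_time[of T] by (simp add: borel_open)
  have sub: "{0<..<\<tau>} \<subseteq> open_time T" if "T = \<infinity> \<or> T = ereal \<tau>" for \<tau>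
    using that by (auto simp: open_time_def)
  have grad_bound: "\<exists>M>0. \<forall>t\<in>open_time T. C1 (f t) \<longrightarrow> (\<forall>\<xi>\<in>ball 0 R. norm (grad (f t) \<xi>) \<le> M)" if R: "0 < R" for R
  proof -
    obtain M where M: "0 < M" "\<forall>\<xi>\<in>ball 0 R. (SUP t\<in>{t \<in> open_time T. C1 (f t)}. ereal (norm (grad (f t) \<xi>))) < ereal M"
      using Df_bound[OF R] by blast
    have "norm (grad (f t) \<xi>) \<le> M" if "t \<in> open_time T" "C1 (f t)" "\<xi> \<in> ball 0 R" for t \<xi>
    proof -
      have "ereal (norm (grad (f t) \<xi>)) \<le> (SUP t\<in>{t \<in> open_time T. C1 (f t)}. ereal (norm (grad (f t) \<xi>)))"
        using that by (intro SUP_upper) auto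
      also have "\<dots> < ereal M" using M(2) that(3) by blast
      finally show ?thesis by simp
    qed
    then show ?thesis using M(1) by blast
  qed
  have C1T: "AE t in lborel. t \<in> open_time T \<longrightarrow> C1 (f t)" using f_C1 by (simp only: AE_lebesgue_on_iff[OF Tl])
  \<comment> \<open>One representative \<open>U\<close> with one set of constants serves all
    \<open>\<tau>\<close>; only the slab on which it is used varies.\<close>
  have slab: "slab \<Omega> \<tau> f u0 v0 u U g L C" if \<tau>: "0 < \<tau>" "T = \<infinity> \<or> T = ereal \<tau>" for \<tau>
  proof (rule slab.intro[OF \<open>open \<Omega>\<close> \<open>bounded \<Omega>\<close> \<tau>(1) L U g(1,2)])
    note s = sub[OF \<tau>(2)]
    have o: "open (\<Omega> \<times> {0<..<\<tau>})" using \<open>open \<Omega>\<close> by (intro open_Times) auto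
    have sQ: "\<Omega> \<times> {0<..<\<tau>} \<subseteq> ?Q" using s by (auto simp: cylinder_def)
    show "has_weak_grad (\<Omega> \<times> {0<..<\<tau>}) U g" "has_weak_grad (\<Omega> \<times> {0<..<\<tau>}) u g"
      by (rule has_weak_grad_subset[OF g(3) sQ Qo o] has_weak_grad_subset[OF g(4) sQ Qo o])+
    have "AE p in lborel. p \<in> ?Q \<longrightarrow> u p = U p" using uU by (simp only: AE_lebesgue_on_iff[OF Ql])
    then have "AE p in lborel. p \<in> \<Omega> \<times> {0<..<\<tau>} \<longrightarrow> u p = U p" by eventually_elim (use sQ in blast)
    then show "AE p in lebesgue_on (\<Omega> \<times> {0<..<\<tau>}). u p = U p"
      using o by (subst AE_lebesgue_on_iff) (auto simp: borel_open)
    show "integrable (lebesgue_on {0<..<\<tau>}) (\<lambda>t. f t \<xi>)" for \<xi> by (rule f_L1[OF \<tau>(1)]) (use \<tau>(2) in auto)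
    show "AE t in lborel. t \<in> {0<..<\<tau>} \<longrightarrow> C1 (f t)" using C1T by eventually_elim (use s in blast)
    show "\<exists>M>0. \<forall>t\<in>{0<..<\<tau>}. C1 (f t) \<longrightarrow> (\<forall>\<xi>\<in>ball 0 R. norm (grad (f t) \<xi>) \<le> M)" if "0 < R" for R
      using grad_bound[OF that] s by blast
    show "variational_solution_finite f \<Omega> \<tau> u0 u" by (rule vsf[OF \<tau>])
  qed (assumption | rule v0(1) | erule v0(2))+
  have "weak_solution f \<Omega> T u" unfolding weak_solution_def Let_def
  proof
    fix \<phi> assume \<phi>: "\<phi> \<in> test_functions ?Q"
    \<comment> \<open>The support of a test function is compact, so for infinite \<open>T\<close> it
      fits into a slab of finite length.\<close>
    obtain \<tau> where \<tau>: "0 < \<tau>" "T = \<infinity> \<or> T = ereal \<tau>" "\<phi> \<in> test_functions (\<Omega> \<times> {0<..<\<tau>})"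
    proof (cases "T = \<infinity>")
      case False
      then obtain \<tau> where "T = ereal \<tau>" using \<open>0 < T\<close> by (cases T) auto
      then show thesis using \<phi> \<open>0 < T\<close> by (intro that[of \<tau>]) (auto simp: cylinder_ereal)
    next
      case True
      let ?K = "closure {p. \<phi> p \<noteq> 0}"
      have K: "compact ?K" "?K \<subseteq> ?Q" using \<phi> by (auto simp: test_functions_def)
      obtain b where b: "0 < b" "\<And>p. p \<in> ?K \<Longrightarrow> norm p \<le> b" using compact_imp_bounded[OF K(1)] unfolding bounded_pos by blast
      have "?K \<subseteq> \<Omega> \<times> {0<..<b + 1}"
      proof
        fix p assume p: "p \<in> ?K"
        have "\<bar>snd p\<bar> \<le> norm p" using norm_snd_le[of "snd p" "fst p"] by simp
        then show "p \<in> \<Omega> \<times> {0<..<b + 1}" using b(2)[OF p] subsetD[OF K(2) p] by (auto simp: cylinder_def open_time_def)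
      qed
      then have "\<phi> \<in> test_functions (\<Omega> \<times> {0<..<b + 1})" using \<phi> by (auto simp: test_functions_def)
      then show thesis using b(1) True by (intro that[of "b + 1"]) auto
    qed
    interpret slab \<Omega> \<tau> f u0 v0 u U g L C by (rule slab[OF \<tau>(1,2)])
    let ?P = "\<Omega> \<times> {0<..<\<tau>}"
    let ?F = "\<lambda>p. u p * time_deriv \<phi> p - grad (f (snd p)) (weak_grad ?Q u p) \<bullet> space_grad \<phi> p"
    let ?G = "\<lambda>p. U p * time_deriv \<phi> p - grad (f (snd p)) (g p) \<bullet> space_grad \<phi> p"
    have sQ: "?P \<subseteq> ?Q" using sub[OF \<tau>(2)] by (auto simp: cylinder_def)
    note we = weak_equation[OF \<tau>(3)]
    have iG: "integrable (lebesgue_on ?P) ?G" by (rule Bochner_Integration.integrable_diff[OF we(3,1)])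
    \<comment> \<open>The gradient chosen on the whole cylinder agrees with \<open>g\<close> almost
      everywhere there, hence also on the slab, where the weak equation is phrased with
      \<open>g\<close>.\<close>
    have "AE p in lborel. p \<in> ?Q \<longrightarrow> weak_grad ?Q u p = g p"
      using weak_grad_AE(2)[OF Qo g(4)] by (simp only: AE_lebesgue_on_iff[OF Ql])
    moreover have "AE p in lborel. p \<in> ?P \<longrightarrow> u p = U p" using u_AE by (simp only: AE_lebesgue_on_iff[OF Q_lebesgue])
    ultimately have "AE p in lborel. p \<in> ?P \<longrightarrow> ?G p = ?F p" by eventually_elim (use sQ in auto)
    then have ae: "AE p in lebesgue_on ?P. ?G p = ?F p" by (simp only: AE_lebesgue_on_iff[OF Q_lebesgue])
    have "(LINT p|lebesgue_on ?Q. ?F p) = (LINT p|lebesgue_on ?P. ?F p)"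
    proof (rule LINT_lebesgue_on_support[OF Ql Q_lebesgue sQ, symmetric])
      fix p assume "p \<notin> ?P"
      then show "?F p = 0"
        using test_functions_outside[OF time_deriv_test[OF \<tau>(3)]] space_grad_outside[OF \<tau>(3)] by simp
    qed
    also have "\<dots> = (LINT p|lebesgue_on ?P. ?G p)" by (rule lebesgue_on_AE_cong(2)[OF Q_lebesgue iG ae])
    also have "\<dots> = 0" using Bochner_Integration.integral_diff[OF we(3,1)] we(2) by simp
    finally show "(LINT p|lebesgue_on ?Q. ?F p) = 0" .
  qed
  moreover have "u \<in> C_0_1_half \<Omega> T"
  proof -
    have C0: "0 \<le> C" using U(4)[of undefined] by linarith
    \<comment> \<open>\<open>M\<close> and, below, \<open>D\<close> are fixed before any
      \<open>\<tau>\<close>, so the constant of the time estimate is common to all slabs, also for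
      infinite \<open>T\<close>.\<close>
    obtain M where M: "0 < M" "\<forall>t\<in>open_time T. C1 (f t) \<longrightarrow> (\<forall>\<xi>\<in>ball 0 (C + 1). norm (grad (f t) \<xi>) \<le> M)"
      using grad_bound[of "C + 1"] C0 by auto
    have "(bump 0 1 :: real ^ 'n \<Rightarrow> real) \<in> test_functions UNIV" by (rule bump_test) auto
    from test_functions_frechet_bound[OF this] obtain D where D: "0 < D"
      "\<And>(x::real ^ 'n) h. \<bar>frechet_derivative (bump 0 1) (at x) h\<bar> \<le> D * norm h" by blast
    define H where "H = 2 * L + M * D * 2 ^ DIM(real ^ 'n) * exp (4/3)"
    have H0: "0 \<le> H" using L M(1) D(1) by (simp add: H_def)
    have time: "\<bar>U (x, t) - U (x, s)\<bar> \<le> H * sqrt \<bar>t - s\<bar>"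
      if x: "x \<in> closure \<Omega>" and ts: "t \<in> closed_time T" "s \<in> closed_time T" for x t s
    proof -
      obtain \<tau> where \<tau>: "0 < \<tau>" "T = \<infinity> \<or> T = ereal \<tau>" "t \<in> {0..\<tau>}" "s \<in> {0..\<tau>}"
      proof (cases "T = \<infinity>")
        case True
        then show thesis using ts by (intro that[of "max t s + 1"]) (auto simp: closed_time_def)
      next
        case False
        then obtain \<tau> where "T = ereal \<tau>" using \<open>0 < T\<close> by (cases T) auto
        then show thesis using ts \<open>0 < T\<close> by (intro that[of \<tau>]) (auto simp: closed_time_def)
      qed
      have "AE t in lborel. t \<in> {0<..<\<tau>} \<longrightarrow> (\<forall>\<xi>\<in>ball 0 (C + 1). norm (grad (f t) \<xi>) \<le> M)"
        using C1T by eventually_elim (use M(2) sub[OF \<tau>(2)] in blast)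
      from slab.holder_in_time[OF slab[OF \<tau>(1,2)] less_imp_le[OF M(1)] this D x \<tau>(3,4)]
      show ?thesis by (simp only: H_def)
    qed
    have cl: "closure ?Q \<subseteq> closure \<Omega> \<times> closed_time T"
      unfolding cylinder_def closure_Times
      by (intro Sigma_mono order_refl closure_minimal open_time_subset_closed closed_closed_time)
    have "\<bar>U (x, t) - U (y, s)\<bar> \<le> (L + H) * (norm (x - y) + sqrt \<bar>t - s\<bar>)"
      if "(x, t) \<in> closure ?Q" "(y, s) \<in> closure ?Q" for x t y s
    proof -
      have "\<bar>U (x, t) - U (y, s)\<bar> \<le> H * sqrt \<bar>t - s\<bar> + L * norm (x - y)"
        using time[of x t s] U(2)[of x s y] that cl by fastforce
      moreover have "0 \<le> L * sqrt \<bar>t - s\<bar>" "0 \<le> H * norm (x - y)" using L H0 by auto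
      ultimately show ?thesis by (simp add: algebra_simps)
    qed
    then show ?thesis unfolding C_0_1_half_def using uU by blast
  qed
  ultimately show ?thesis by blast
qed

end
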